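(* Let $f \in L^2(\mathbb{R}^n)$ and let $Q$ be a polynomial on $\mathbb{R}^n$. Then there exists a constant $C>0$ such that $K_a(f) \leq C\, K_a(Q\varphi_0)$ for all $0<a<1$ if and only if $f$ can be written as $f(x) = P(x) e^{-(Ax,x)}$ for some real symmetric positive definite $n\times n$ matrix $A$ and some polynomial $P$ with $\deg(P) \leq \deg(Q)$.
   Context: The Fourier transform is $\hat f(y) = (2\pi)^{-n/2}\int_{\mathbb{R}^n} f(x) e^{-i x\cdot y}\,dx$, extended to $L^2(\mathbb{R}^n)$ as usual. For $a>0$ and $f\in L^2(\mathbb{R}^n)$, $$K_a(f) = \int_{\mathbb{R}^n}\int_{\mathbb{R}^n} |f(x)|\,|\hat f(y)|\, e^{a|x\cdot y|}\,dx\,dy \in [0,\infty].$$ $\varphi_0(x) = e^{-\frac12|x|^2}$ is the Gaussian on $\mathbb{R}^n$, and $(\cdot,\cdot)$ is the Euclidean inner product. Polynomials have complex coefficients, and the zero polynomial has degree $-\infty$. Equality of $f$ with a function is almost everywhere. *)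

theory Defs
  imports "HOL-Analysis.Analysis" "HOL-Library.Poly_Mapping"
begin

section \<open>Polynomials with complex coefficients in the coordinates of \<open>real ^ 'n\<close>\<close>

text \<open>A polynomial is a finitely supported map from exponent vectors to coefficients.\<close>

type_synonym 'n cpoly = "('n \<Rightarrow>\<^sub>0 nat) \<Rightarrow>\<^sub>0 complex"

definition cpoly_eval :: "'n::finite cpoly \<Rightarrow> real ^ 'n \<Rightarrow> complex" where
  "cpoly_eval P x =
     (\<Sum>m\<in>Poly_Mapping.keys P.
        Poly_Mapping.lookup P m * (\<Prod>i\<in>UNIV. complex_of_real (x $ i) ^ Poly_Mapping.lookup m i))"

text \<open>Total degree. It is extended-real-valued: for the zero polynomial the supremum is taken
  over the empty set, which gives \<open>-\<infinity>\<close>.\<close>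

definition cpoly_degree :: "'n::finite cpoly \<Rightarrow> ereal" where
  "cpoly_degree P =
     (SUP m\<in>Poly_Mapping.keys P. ereal (real (\<Sum>i\<in>UNIV. Poly_Mapping.lookup m i)))"

section \<open>Square-integrable functions and the Fourier transform\<close>

definition in_L1 :: "(real ^ 'n::finite \<Rightarrow> complex) \<Rightarrow> bool" where
  "in_L1 f \<longleftrightarrow> integrable lebesgue f"

definition in_L2 :: "(real ^ 'n::finite \<Rightarrow> complex) \<Rightarrow> bool" where
  "in_L2 f \<longleftrightarrow>
     f \<in> borel_measurable lebesgue \<and> integrable lebesgue (\<lambda>x. (cmod (f x))\<^sup>2)"

text \<open>Convergence in the \<open>L\<^sup>2\<close> norm; the extended integral takes the value \<open>\<infinity>\<close> whenever
  the difference is not square-integrable.\<close>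

definition L2_tendsto ::
  "(nat \<Rightarrow> real ^ 'n::finite \<Rightarrow> complex) \<Rightarrow> (real ^ 'n \<Rightarrow> complex) \<Rightarrow> bool" where
  "L2_tendsto u g \<longleftrightarrow>
     (\<lambda>k. \<integral>\<^sup>+x. ennreal ((cmod (u k x - g x))\<^sup>2) \<partial>lebesgue) \<longlonglongrightarrow> 0"

definition fourier_integral :: "(real ^ 'n::finite \<Rightarrow> complex) \<Rightarrow> real ^ 'n \<Rightarrow> complex" where
  "fourier_integral f y =
     complex_of_real ((2 * pi) powr (- (real CARD('n) / 2))) *
       (LINT x|lebesgue. f x * exp (- (\<i> * complex_of_real (x \<bullet> y))))"

text \<open>The extension to \<open>L\<^sup>2\<close> by density: \<open>g\<close> is a Fourier transform of \<open>f\<close> if it is the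
  \<open>L\<^sup>2\<close> limit of the Fourier integrals of some sequence in \<open>L\<^sup>1 \<inter> L\<^sup>2\<close> that converges to
  \<open>f\<close> in \<open>L\<^sup>2\<close>. By Plancherel's theorem such a \<open>g\<close> exists for every \<open>f\<close> in \<open>L\<^sup>2\<close> and is
  unique up to a null set, so the choice below only picks a representative.\<close>

definition is_fourier_L2 ::
  "(real ^ 'n::finite \<Rightarrow> complex) \<Rightarrow> (real ^ 'n \<Rightarrow> complex) \<Rightarrow> bool" where
  "is_fourier_L2 f g \<longleftrightarrow>
     in_L2 g \<and>
     (\<exists>u. (\<forall>k. in_L1 (u k) \<and> in_L2 (u k)) \<and> L2_tendsto u f \<and>
          L2_tendsto (\<lambda>k. fourier_integral (u k)) g)"

definition fourier_L2 :: "(real ^ 'n::finite \<Rightarrow> complex) \<Rightarrow> real ^ 'n \<Rightarrow> complex" where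
  "fourier_L2 f = (SOME g. is_fourier_L2 f g)"

section \<open>The functional \<open>K\<^sub>a\<close>, the Gaussian, positive definite matrices\<close>

definition K :: "real \<Rightarrow> (real ^ 'n::finite \<Rightarrow> complex) \<Rightarrow> ennreal" where
  "K a f =
     (\<integral>\<^sup>+x. (\<integral>\<^sup>+y. ennreal (cmod (f x) * cmod (fourier_L2 f y) * exp (a * \<bar>x \<bullet> y\<bar>))
        \<partial>lebesgue) \<partial>lebesgue)"

definition gaussian :: "real ^ 'n::finite \<Rightarrow> complex" where
  "gaussian x = complex_of_real (exp (- (1 / 2) * (norm x)\<^sup>2))"

definition sym_pos_def :: "real ^ 'n ^ 'n::finite \<Rightarrow> bool" where
  "sym_pos_def A \<longleftrightarrow> transpose A = A \<and> (\<forall>x. x \<noteq> 0 \<longrightarrow> (A *v x) \<bullet> x > 0)"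

end

theory Submission
imports Defs "HOL-Probability.Distributions" "HOL-Complex_Analysis.Complex_Analysis"
"HOL-Computational_Algebra.Fundamental_Theorem_Algebra"
begin

text \<open>
Write \<open>s = 1 / sqrt (1 - a)\<close>. For \<open>g = P exp (- q)\<close> with a positive definite form \<open>q\<close>, the transform of \<open>g\<close> is again a
polynomial of the same degree times the Gaussian of the dual form, and along the direction in which \<open>\<bar>x \<bullet> y\<bar>\<close>
is largest the Gaussians cancel the factor \<open>exp \<bar>x \<bullet> y\<bar>\<close> exactly. Hence \<open>K a g\<close> is comparable to
\<open>s ^ (n + 2 deg P)\<close> (\<open>KK_pgauss_upper\<close>, \<open>KK_pgauss_lower\<close>). This settles one implication, and it reduces the
other one to showing that a function with \<open>K a f \<le> C s ^ N\<close> is a polynomial times a Gaussian, since the degrees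
are then compared through the two bounds.

For that implication, let \<open>\<phi>\<close> be the transform of \<open>f\<close> damped by \<open>exp (- \<bar>y\<bar>\<^sup>2 / 2)\<close>, and let \<open>g\<close> be the inverse transform of
\<open>\<phi>\<close>, so that \<open>g\<close> is the convolution of \<open>f\<close> with a Gaussian and extends to an entire function of order two. Choosing
\<open>a = 1 - 1 / (2 R\<^sup>2)\<close> turns the hypothesis into polynomial growth of the integral over \<open>\<bar>x\<bar> \<le> R\<close> of \<open>\<bar>g x\<bar>\<close> times the
natural majorant of \<open>g (i x)\<close> (\<open>local_growth_bound\<close>), and by Tonelli the same holds on almost every line through
the origin (\<open>ray_growth_bound\<close>). On such a line the restriction \<open>h\<close> is entire, and a Phragmen-Lindelof argument in
the four quadrants shows that \<open>h z * h (i z)\<close> is a polynomial (\<open>product_polynomial\<close>); so \<open>h\<close> has finitely many zeros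
and is a polynomial times \<open>exp (- c z\<^sup>2)\<close> (\<open>hadamard_factorization\<close>).

It remains to see that \<open>c\<close> depends on the direction as a quadratic form. The number \<open>- 2 c\<close> is a quotient \<open>T / E\<close> of
Taylor coefficients of \<open>h' z * h (i z)\<close> and \<open>h z * h (i z)\<close>, which are polynomials in the direction. On complex lines
of directions the bound on \<open>c\<close> that comes from the order of growth forces this rational function to be a polynomial
of degree two (\<open>poly_quadratic_quotient\<close>, \<open>gaussian_rigidity\<close>). Thus \<open>g\<close> is a polynomial times \<open>exp (- q)\<close>. Integrability
makes \<open>q\<close> positive definite (\<open>pgauss_positive_definite\<close>), and Fourier inversion, undoing the damping, transfers the
form from \<open>g\<close> to \<open>\<phi>\<close>, to the transform of \<open>f\<close>, and to \<open>f\<close> (\<open>KK_bound_imp_pgauss\<close>).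
\<close>

abbreviation (input) cplx :: "real \<Rightarrow> complex" where "cplx \<equiv> complex_of_real"

section \<open>Parametric integrals\<close>

text \<open>Domination on discs gives, through the Cauchy estimate for difference quotients, differentiation under the integral sign.\<close>
lemma holomorphic_integral_param:
fixes F :: "'a => complex => complex"
assumes meas: "!!z. (%x. F x z) \<in> borel_measurable M"
and hol: "!!x. F x holomorphic_on UNIV"
and dom: "!!R::real. \<exists>B. integrable M B \<and> (\<forall>x z. norm z <= R --> norm (F x z) <= B x)"
shows "(%z. LINT x|M. F x z) holomorphic_on UNIV"
proof -
have "\<exists>D. ((%z. LINT x|M. F x z) has_field_derivative D) (at z)" for z
proof -
obtain B where B: "integrable M B" "!!x w. norm w <= norm z + 2 ==> norm (F x w) <= B x"
 using dom[of "norm z + 2"] by blast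
have int: "integrable M (%x. F x w)" if "norm w <= norm z + 2" for w
 by (rule Bochner_Integration.integrable_bound[OF B(1) meas]) (use B(2)[OF that] in \<open>auto intro!: AE_I2 intro: order_trans[OF _ abs_ge_self]\<close>)
have der: "norm (deriv (F x) w) <= B x" if "norm (w - z) <= 1" for x w
proof -
 have "norm ((deriv ^^ 1) (F x) w) <= fact 1 * B x / 1 ^ 1"
 proof (rule Cauchy_inequality)
 fix v :: complex assume "norm (w - v) = 1"
 hence "norm v <= norm z + 2"
 using that norm_triangle_ineq2[of v z] norm_triangle_ineq[of "v - w" "w - z"]
 by (simp add: norm_minus_commute)
 thus "norm (F x v) <= B x" by (rule B(2))
 qed (use hol in \<open>auto intro: holomorphic_on_subset holomorphic_on_imp_continuous_on\<close>)
 thus ?thesis by simp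
qed
have quot: "norm ((F x (z + h) - F x z) / h) <= B x" if "norm h <= 1" for x h
proof -
 have "norm (F x (z + h) - F x z) <= B x * norm ((z + h) - z)"
 proof (rule field_differentiable_bound[where S = "cball z 1" and f' = "deriv (F x)"])
 fix w assume "w \<in> cball z 1"
 show "(F x has_field_derivative deriv (F x) w) (at w within cball z 1)"
 using hol[of x] by (meson UNIV_I open_UNIV holomorphic_derivI)
 show "norm (deriv (F x) w) <= B x"
 using der[of w x] \<open>w \<in> cball z 1\<close> by (simp add: dist_norm norm_minus_commute)
 qed (use that in \<open>auto simp: dist_norm\<close>)
 moreover have "0 <= B x"
 using B(2)[of z x] by (auto intro: order_trans[OF norm_ge_zero])
 ultimately show ?thesis
 by (cases "h = 0") (auto simp: norm_divide divide_le_eq)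
qed
have "((%h. ((LINT x|M. F x (z + h)) - (LINT x|M. F x z)) / h) \<longlongrightarrow> (LINT x|M. deriv (F x) z)) (at 0)"
proof (subst tendsto_at_iff_sequentially, safe)
 fix X :: "nat => complex" assume X: "\<forall>i. X i \<in> UNIV - {0}" "X \<longlonglongrightarrow> 0"
 have "\<forall>\<^sub>F i in sequentially. dist (X i) 0 < 1"
 using X(2) by (rule tendstoD) simp
 then obtain N where N: "!!i. i >= N ==> norm (X i) <= 1"
 by (fastforce simp: eventually_sequentially)
 have X0: "X i ~= 0" for i using X(1) by auto
 have lim: "(%i. (F x (z + X i) - F x z) / X i) \<longlonglongrightarrow> deriv (F x) z" for x
 proof -
 have "((%h. (F x (z + h) - F x z) / h) \<longlongrightarrow> deriv (F x) z) (at 0)"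
 using hol[of x] unfolding DERIV_def[symmetric] by (meson UNIV_I open_UNIV holomorphic_derivI)
 thus ?thesis using X by (auto simp: tendsto_at_iff_sequentially o_def)
 qed
 have "(%i. LINT x|M. (F x (z + X (i + N)) - F x z) / X (i + N)) \<longlonglongrightarrow> (LINT x|M. deriv (F x) z)"
 proof (rule integral_dominated_convergence[where w = B])
 show "(%x. deriv (F x) z) \<in> borel_measurable M"
 by (rule borel_measurable_LIMSEQ_metric[OF _ lim]) (use meas in auto)
 show "AE x in M. (%i. (F x (z + X (i + N)) - F x z) / X (i + N)) \<longlonglongrightarrow> deriv (F x) z"
 by (intro AE_I2 LIMSEQ_ignore_initial_segment[OF lim])
 show "AE x in M. norm ((F x (z + X (i + N)) - F x z) / X (i + N)) <= B x" for i
 using quot N by auto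
 qed (use meas B(1) in auto)
 also have "(%i. LINT x|M. (F x (z + X (i + N)) - F x z) / X (i + N)) =
 (%i. ((LINT x|M. F x (z + X (i + N))) - (LINT x|M. F x z)) / X (i + N))"
 proof
 fix i
 have "norm (z + X (i + N)) <= norm z + 2"
 using N[of "i + N"] norm_triangle_ineq[of z "X (i + N)"] by simp
 thus "(LINT x|M. (F x (z + X (i + N)) - F x z) / X (i + N)) =
 ((LINT x|M. F x (z + X (i + N))) - (LINT x|M. F x z)) / X (i + N)"
 using int[of z] int[of "z + X (i + N)"] by simp
 qed
 finally show "((%h. ((LINT x|M. F x (z + h)) - (LINT x|M. F x z)) / h) \<circ> X) \<longlonglongrightarrow> (LINT x|M. deriv (F x) z)"
 unfolding o_def by (rule LIMSEQ_offset)
qed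
thus ?thesis unfolding DERIV_def by blast
qed
thus ?thesis
by (metis DERIV_imp_deriv holomorphic_on_open open_UNIV)
qed

text \<open>Laplace-type integrals against functions with all exponential moments are entire, with the moments as Taylor coefficients.\<close>
lemma exp_integral_sums:
fixes \<phi> l :: "'a => complex"
assumes [measurable]: "\<phi> \<in> borel_measurable M" "l \<in> borel_measurable M"
and int: "!!R::real. integrable M (%x. norm (\<phi> x) * exp (R * norm (l x)))"
shows "(%k. (LINT x|M. \<phi> x * l x ^ k / fact k) * z ^ k) sums (LINT x|M. \<phi> x * exp (z * l x))"
and "integrable M (%x. \<phi> x * l x ^ k)"
and "integrable M (%x. \<phi> x * exp (z * l x))"
proof -
have pow_le: "r ^ k / fact k <= exp r" if "r >= 0" for r :: real and k :: nat
using sum_le_suminf[OF summable_exp_generic[of r], of "{k}"] that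
by (simp add: exp_def field_simps)
have int1: "integrable M (%x. \<phi> x * l x ^ k)" for k
proof (rule Bochner_Integration.integrable_bound)
show "integrable M (%x. fact k * (norm (\<phi> x) * exp (1 * norm (l x))))"
 using int[of 1] by simp
show "AE x in M. norm (\<phi> x * l x ^ k) <= norm (fact k * (norm (\<phi> x) * exp (1 * norm (l x))))"
proof (rule AE_I2)
 fix x
 have "norm (l x) ^ k <= fact k * exp (norm (l x))"
 using pow_le[of "norm (l x)" k] by (simp add: field_simps)
 from mult_left_mono[OF this norm_ge_zero[of "\<phi> x"]]
 show "norm (\<phi> x * l x ^ k) <= norm (fact k * (norm (\<phi> x) * exp (1 * norm (l x))))"
 by (simp add: norm_mult norm_power mult.left_commute)
qed
qed auto
show "integrable M (%x. \<phi> x * l x ^ k)" by (rule int1)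
show "integrable M (%x. \<phi> x * exp (z * l x))"
proof (rule Bochner_Integration.integrable_bound[OF int[of "norm z"]])
show "AE x in M. norm (\<phi> x * exp (z * l x)) <= norm (norm (\<phi> x) * exp (norm z * norm (l x)))"
 using norm_exp[of "z * l _"] by (auto simp: norm_mult intro!: mult_left_mono)
qed auto
have "(%n. LINT x|M. \<phi> x * (\<Sum>k<n. (z * l x) ^ k / fact k)) \<longlonglongrightarrow> (LINT x|M. \<phi> x * exp (z * l x))"
proof (rule integral_dominated_convergence[OF _ _ int[of "norm z"]])
show "AE x in M. (%n. \<phi> x * (\<Sum>k<n. (z * l x) ^ k / fact k)) \<longlonglongrightarrow> \<phi> x * exp (z * l x)"
 using exp_converges[of "z * l _"]
 by (auto intro!: tendsto_mult tendsto_const simp: sums_def scaleR_conv_of_real field_simps)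
show "AE x in M. norm (\<phi> x * (\<Sum>k<n. (z * l x) ^ k / fact k)) <= norm (\<phi> x) * exp (norm z * norm (l x))" for n
proof (rule AE_I2)
 fix x
 have "norm (\<Sum>k<n. (z * l x) ^ k / fact k) <= (\<Sum>k<n. (norm z * norm (l x)) ^ k / fact k)"
 by (rule sum_norm_le) (simp add: norm_divide norm_power norm_mult)
 also have "... <= exp (norm z * norm (l x))"
 using sum_le_suminf[OF summable_exp_generic[of "norm z * norm (l x)"], of "{..<n}"]
 by (simp add: exp_def field_simps)
 finally show "norm (\<phi> x * (\<Sum>k<n. (z * l x) ^ k / fact k)) <= norm (\<phi> x) * exp (norm z * norm (l x))"
 by (simp add: norm_mult mult_left_mono)
qed
qed auto
moreover have "(LINT x|M. \<phi> x * (\<Sum>k<n. (z * l x) ^ k / fact k)) = (\<Sum>k<n. (LINT x|M. \<phi> x * l x ^ k / fact k) * z ^ k)" for n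
proof -
have "(LINT x|M. \<phi> x * (\<Sum>k<n. (z * l x) ^ k / fact k)) = (LINT x|M. (\<Sum>k<n. (\<phi> x * l x ^ k / fact k) * z ^ k))"
 by (intro Bochner_Integration.integral_cong) (auto simp: sum_distrib_left power_mult_distrib field_simps)
also have "... = (\<Sum>k<n. (LINT x|M. \<phi> x * l x ^ k / fact k) * z ^ k)"
 by (subst Bochner_Integration.integral_sum) (use int1 in auto)
finally show ?thesis .
qed
ultimately show "(%k. (LINT x|M. \<phi> x * l x ^ k / fact k) * z ^ k) sums (LINT x|M. \<phi> x * exp (z * l x))"
by (simp add: sums_def)
qed

lemma exp_integral_bounds:
fixes r :: real assumes "r >= 0"
shows "(1 + r) ^ M <= fact M * exp (1 + r)"
proof -
have "(1 + r) ^ M / fact M <= exp (1 + r)"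
using sum_le_suminf[OF summable_exp_generic[of "1 + r"], of "{M}"] assms
by (simp add: exp_def field_simps)
thus ?thesis by (simp add: field_simps)
qed

lemma integrable_gaussian:
assumes "c > 0"
shows "integrable lborel (%x::'a::euclidean_space. exp (- c * (norm x)\<^sup>2))"
proof (rule integrableI_nonneg)
have "(\<integral>\<^sup>+(x::'a). ennreal (exp (- c * (norm x)\<^sup>2)) \<partial>lborel)
= (\<integral>\<^sup>+(x::'a). (\<Prod>b\<in>Basis. ennreal (exp (- c * (x \<bullet> b)\<^sup>2))) \<partial>lborel)"
by (intro nn_integral_cong)
 (simp add: prod_ennreal exp_sum[symmetric] norm_eq_sqrt_inner euclidean_inner[of x x for x]
 power2_eq_square sum_distrib_left sum_negf sum_nonneg)
also have "... = (\<Prod>b\<in>(Basis::'a set). (\<integral>\<^sup>+x. ennreal (exp (- c * x\<^sup>2)) \<partial>lborel))"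
by (rule nn_integral_lborel_prod[where f = "%b x. ennreal (exp (- c * x\<^sup>2))"]) auto
also have "... < \<infinity>"
proof -
have "integrable lborel (%x::real. exp (- c * x\<^sup>2))"
proof -
 have "integrable lborel (%x. sqrt (pi / c) * normal_density 0 (sqrt (1 / (2 * c))) x)"
 using assms by (intro integrable_mult_right integrable_normal_density) auto
 thus ?thesis using assms by (simp add: normal_density_def real_sqrt_divide field_simps real_sqrt_mult)
qed
hence "(\<integral>\<^sup>+(x::real). ennreal (exp (- c * x\<^sup>2)) \<partial>lborel) < \<infinity>"
 by (simp add: integrable_iff_bounded)
thus ?thesis by (simp add: less_top[symmetric] power_eq_top_ennreal)
qed
finally show "(\<integral>\<^sup>+(x::'a). ennreal (exp (- c * (norm x)\<^sup>2)) \<partial>lborel) < \<infinity>" .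
qed auto

lemma integrable_poly_gaussian:
assumes "c > 0"
shows "integrable lborel (%x::'a::euclidean_space. (1 + norm x) ^ M * exp (b * norm x - c * (norm x)\<^sup>2))"
proof (rule Bochner_Integration.integrable_bound)
define d where "d = (b + 1)\<^sup>2 / (2 * c)"
show "integrable lborel (%x::'a. (fact M * exp (1 + d)) * exp (- (c / 2) * (norm x)\<^sup>2))"
using integrable_gaussian[of "c / 2"] assms by (intro integrable_mult_right) auto
show "AE x::'a in lborel. norm ((1 + norm x) ^ M * exp (b * norm x - c * (norm x)\<^sup>2))
<= norm ((fact M * exp (1 + d)) * exp (- (c / 2) * (norm x)\<^sup>2))"
proof (rule AE_I2)
fix x :: 'a
have "0 <= (c * norm x - (b + 1))\<^sup>2" by simp
hence "(b + 1) * norm x <= (c / 2) * (norm x)\<^sup>2 + d"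
 unfolding d_def using assms by (simp add: field_simps power2_eq_square)
hence "(1 + norm x) + (b * norm x - c * (norm x)\<^sup>2) <= (1 + d) + (- (c / 2) * (norm x)\<^sup>2)"
 by (simp add: field_simps)
hence "exp (1 + norm x) * exp (b * norm x - c * (norm x)\<^sup>2) <= exp (1 + d) * exp (- (c / 2) * (norm x)\<^sup>2)"
 by (simp add: exp_add[symmetric])
moreover have "(1 + norm x) ^ M * exp (b * norm x - c * (norm x)\<^sup>2) <= (fact M * exp (1 + norm x)) * exp (b * norm x - c * (norm x)\<^sup>2)"
 by (intro mult_right_mono exp_integral_bounds) auto
ultimately have "(1 + norm x) ^ M * exp (b * norm x - c * (norm x)\<^sup>2) <= fact M * (exp (1 + d) * exp (- (c / 2) * (norm x)\<^sup>2))"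
 by (smt (verit) mult.assoc mult_left_mono fact_ge_zero)
thus "norm ((1 + norm x) ^ M * exp (b * norm x - c * (norm x)\<^sup>2))
<= norm ((fact M * exp (1 + d)) * exp (- (c / 2) * (norm x)\<^sup>2))"
 by (simp add: abs_mult)
qed
qed auto

section \<open>Polynomials, quadratic forms and the transform on integrable functions\<close>

no_notation fps_nth (infixl "$" 75)

definition expo_degree :: "('n::finite \<Rightarrow>\<^sub>0 nat) => nat" where
"expo_degree m = (\<Sum>i\<in>UNIV. Poly_Mapping.lookup m i)"

text \<open>The polynomial at a complex point, homogenised to degree \<open>M\<close> by the variable \<open>\<tau>\<close>. Taking \<open>\<tau> = 1\<close> gives the values of the polynomial, and \<open>\<tau> = 0\<close> its form of degree \<open>M\<close>; this lets the leading form appear as a limit \<open>\<tau> \<rightarrow> 0\<close>.\<close>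
definition heval :: "nat => 'n::finite cpoly => complex => complex ^ 'n => complex" where
"heval M P \<tau> z = (\<Sum>m\<in>Poly_Mapping.keys P. Poly_Mapping.lookup P m * \<tau> ^ (M - expo_degree m) *
(\<Prod>i\<in>UNIV. (z $ i) ^ Poly_Mapping.lookup m i))"

definition cvec :: "real ^ 'n::finite => complex ^ 'n" where
"cvec x = (\<chi> i. cplx (x $ i))"

definition deg_le :: "'n::finite cpoly => nat => bool" where
"deg_le P M \<longleftrightarrow> (\<forall>m\<in>Poly_Mapping.keys P. expo_degree m <= M)"

lemma cpoly_eval_heval: "cpoly_eval P x = heval M P 1 (cvec x)"
by (simp add: cpoly_eval_def heval_def cvec_def)

lemma cvec_nth [simp]: "cvec x $ i = cplx (x $ i)"
by (simp add: cvec_def)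

lemma deg_le_exists: "\<exists>M. deg_le P M"
proof -
have "expo_degree m <= (\<Sum>m\<in>Poly_Mapping.keys P. expo_degree m)" if "m \<in> Poly_Mapping.keys P" for m
using that by (intro member_le_sum) auto
thus ?thesis unfolding deg_le_def by blast
qed

lemma heval_scale:
assumes "deg_le P M" "s ~= 0"
shows "heval M P 1 (\<chi> i. s * z $ i) = s ^ M * heval M P (1 / s) z"
unfolding heval_def sum_distrib_left
proof (rule sum.cong)
fix m assume "m \<in> Poly_Mapping.keys P"
hence "expo_degree m <= M" using assms by (auto simp: deg_le_def)
moreover have "(\<Prod>i\<in>UNIV. ((\<chi> i. s * z $ i) $ i) ^ Poly_Mapping.lookup m i)
= s ^ expo_degree m * (\<Prod>i\<in>UNIV. (z $ i) ^ Poly_Mapping.lookup m i)"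
by (simp add: power_mult_distrib prod.distrib expo_degree_def power_sum)
ultimately show "Poly_Mapping.lookup P m * 1 ^ (M - expo_degree m) * (\<Prod>i\<in>UNIV. ((\<chi> i. s * z $ i) $ i) ^ Poly_Mapping.lookup m i)
= s ^ M * (Poly_Mapping.lookup P m * (1 / s) ^ (M - expo_degree m) * (\<Prod>i\<in>UNIV. (z $ i) ^ Poly_Mapping.lookup m i))"
using assms(2) by (simp add: power_diff power_divide)
qed auto

lemma heval_bound:
assumes "deg_le P M"
obtains C where "C > 0"
"!!\<tau> z r. norm \<tau> <= 1 ==> r >= 0 ==> (!!i. norm (z $ i) <= r) ==> norm (heval M P \<tau> z) <= C * (1 + r) ^ M"
proof
let ?C = "1 + (\<Sum>m\<in>Poly_Mapping.keys P. norm (Poly_Mapping.lookup P m))"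
show "?C > 0" by (smt (verit) norm_ge_zero sum_nonneg)
fix \<tau> :: complex and z :: "complex ^ 'a" and r :: real
assume \<tau>: "norm \<tau> <= 1" and r: "r >= 0" and z: "!!i. norm (z $ i) <= r"
have "norm (heval M P \<tau> z) <= (\<Sum>m\<in>Poly_Mapping.keys P. norm (Poly_Mapping.lookup P m) * (1 + r) ^ M)"
unfolding heval_def
proof (rule sum_norm_le)
fix m assume m: "m \<in> Poly_Mapping.keys P"
have "(\<Prod>i\<in>UNIV. norm (z $ i) ^ Poly_Mapping.lookup m i) <= (\<Prod>i\<in>UNIV. (1 + r) ^ Poly_Mapping.lookup m i)"
 using z r by (intro prod_mono conjI power_mono) (auto simp: add_increasing)
also have "... = (1 + r) ^ expo_degree m"
 by (simp add: expo_degree_def power_sum)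
also have "... <= (1 + r) ^ M"
 using m assms r by (intro power_increasing) (auto simp: deg_le_def)
finally have "norm \<tau> ^ (M - expo_degree m) * (\<Prod>i\<in>UNIV. norm (z $ i) ^ Poly_Mapping.lookup m i) <= 1 * (1 + r) ^ M"
 using \<tau> by (intro mult_mono power_le_one) (auto intro!: prod_nonneg)
thus "norm (Poly_Mapping.lookup P m * \<tau> ^ (M - expo_degree m) * (\<Prod>i\<in>UNIV. (z $ i) ^ Poly_Mapping.lookup m i))
 <= norm (Poly_Mapping.lookup P m) * (1 + r) ^ M"
 by (simp add: norm_mult norm_power prod_norm[symmetric] mult.assoc mult_left_mono)
qed
also have "... <= ?C * (1 + r) ^ M"
using r by (simp add: sum_distrib_right[symmetric] field_simps)
finally show "norm (heval M P \<tau> z) <= ?C * (1 + r) ^ M" .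
qed

lemma continuous_on_heval [continuous_intros]:
assumes "continuous_on S f" "continuous_on S g"
shows "continuous_on S (%x. heval M P (f x) (g x))"
unfolding heval_def using assms by (intro continuous_intros)

lemma holomorphic_on_heval:
assumes "!!i. (%x. g x $ i) holomorphic_on S"
shows "(%x. heval M P 1 (g x)) holomorphic_on S"
unfolding heval_def using assms by (intro holomorphic_intros)

lemma heval_measurable [measurable]:
assumes "!!i. (%x. g x $ i) \<in> borel_measurable N"
shows "(%x. heval M P \<tau> (g x)) \<in> borel_measurable N"
unfolding heval_def using assms by measurable

lemma cpoly_eval_measurable [measurable]: "cpoly_eval P \<in> borel_measurable borel"
proof -
have "(%x. cpoly_eval P x) \<in> borel_measurable borel"
unfolding cpoly_eval_def by measurable
thus ?thesis by simp
qed

lemma cpoly_eval_continuous: "continuous_on S (cpoly_eval P)"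
proof -
have "continuous_on S (%x. cpoly_eval P x)"
unfolding cpoly_eval_def by (intro continuous_intros)
thus ?thesis by simp
qed

lemma sym_inner:
assumes "transpose A = (A :: real ^ 'n ^ 'n::finite)"
shows "(A *v x) \<bullet> y = x \<bullet> (A *v y)"
by (metis assms dot_lmul_matrix vector_transpose_matrix)

lemma quad_add:
assumes "transpose A = (A :: real ^ 'n ^ 'n::finite)"
shows "(A *v (x + t *\<^sub>R v)) \<bullet> (x + t *\<^sub>R v) = (A *v x) \<bullet> x + 2 * t * ((A *v x) \<bullet> v) + t\<^sup>2 * ((A *v v) \<bullet> v)"
using sym_inner[OF assms, of x v]
by (simp add: matrix_vector_right_distrib matrix_vector_mult_scaleR inner_add_left inner_add_right
 power2_eq_square algebra_simps inner_commute)

lemma sym_pos_def_lower: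
assumes "sym_pos_def (A :: real ^ 'n ^ 'n::finite)"
obtains c where "c > 0" "!!x. c * (norm x)\<^sup>2 <= (A *v x) \<bullet> x"
proof -
have cont: "continuous_on (sphere (0 :: real ^ 'n) 1) (%x. (A *v x) \<bullet> x)"
by (intro continuous_intros linear_continuous_on_compose[OF continuous_on_id]) auto
have "sphere (0 :: real ^ 'n) 1 ~= {}" by (simp add: sphere_eq_empty)
then obtain u where u: "u \<in> sphere (0 :: real ^ 'n) 1" "!!x. x \<in> sphere 0 1 ==> (A *v u) \<bullet> u <= (A *v x) \<bullet> x"
using continuous_attains_inf[OF compact_sphere _ cont] by blast
have "(A *v u) \<bullet> u > 0" using u(1) assms unfolding sym_pos_def_def
by (metis mem_sphere_0 norm_zero zero_neq_one)
moreover have "(A *v u) \<bullet> u * (norm x)\<^sup>2 <= (A *v x) \<bullet> x" for x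
proof (cases "x = 0")
case False
have "(A *v u) \<bullet> u <= (A *v (x /\<^sub>R norm x)) \<bullet> (x /\<^sub>R norm x)"
 using False by (intro u) simp
also have "... = ((A *v x) \<bullet> x) / (norm x)\<^sup>2"
 by (simp add: matrix_vector_mult_scaleR power2_eq_square divide_inverse)
finally show ?thesis using False by (simp add: field_simps)
qed simp
ultimately show ?thesis using that by blast
qed

definition quad :: "real ^ 'n ^ 'n::finite => real ^ 'n => real" where
"quad A x = (A *v x) \<bullet> x"

lemma quad_measurable [measurable]: "quad A \<in> borel_measurable borel"
unfolding quad_def
by (intro borel_measurable_continuous_onI continuous_intros linear_continuous_on_compose[OF continuous_on_id]) auto

text \<open>The unnormalised transform, chosen so that the formulas below carry no powers of \<open>2 * pi\<close>.\<close>
definition FT :: "(real ^ 'n::finite => complex) => real ^ 'n => complex" where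
"FT u y = (LINT x|lborel. u x * exp (- (\<i> * cplx (x \<bullet> y))))"

lemma lborel_integral_translate:
fixes f :: "'a::euclidean_space => 'b::{banach, second_countable_topology}"
assumes [measurable]: "f \<in> borel_measurable borel"
shows "(LINT x|lborel. f (x + a)) = (LINT x|lborel. f x)"
proof -
have "(LINT x|lborel. f x) = (LINT x|distr lborel borel ((+) a). f x)"
by (simp add: lborel_distr_plus)
also have "... = (LINT x|lborel. f (a + x))"
by (rule integral_distr) auto
finally show ?thesis by (simp add: add.commute)
qed

lemma lborel_nn_integral_translate:
fixes f :: "'a::euclidean_space => ennreal"
assumes [measurable]: "f \<in> borel_measurable borel"
shows "(\<integral>\<^sup>+x. f (x + a) \<partial>lborel) = (\<integral>\<^sup>+x. f x \<partial>lborel)"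
proof -
have "(\<integral>\<^sup>+x. f x \<partial>lborel) = (\<integral>\<^sup>+x. f x \<partial>distr lborel borel ((+) a))"
by (simp add: lborel_distr_plus)
also have "... = (\<integral>\<^sup>+x. f (a + x) \<partial>lborel)"
by (rule nn_integral_distr) auto
finally show ?thesis by (simp add: add.commute)
qed

text \<open>Completing the square asks for a shift of the contour by an imaginary vector. The shifted integral is entire in the complex multiple of the shift and, by translation invariance, constant for real multiples, hence constant.\<close>
lemma FT_poly_gaussian:
fixes A :: "real ^ 'n ^ 'n::finite"
assumes A: "sym_pos_def A"
shows "FT (%x. cpoly_eval P x * exp (- quad A x)) (2 *\<^sub>R (A *v v))
= exp (- quad A v) * (LINT x|lborel. heval M P 1 (\<chi> i. x $ i - \<i> * v $ i) * exp (- quad A x))"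
proof -
have sym: "transpose A = A" using A by (simp add: sym_pos_def_def)
obtain c where c: "c > 0" "!!x. c * (norm x)\<^sup>2 <= (A *v x) \<bullet> x"
using sym_pos_def_lower[OF A] by blast
obtain M' where M': "deg_le P M'" using deg_le_exists by blast
obtain C where C: "C > 0" "!!\<tau> z r. norm \<tau> <= 1 ==> r >= 0 ==> (!!i. norm (z $ i) <= r) ==> norm (heval M' P \<tau> z) <= C * (1 + r) ^ M'"
using heval_bound[OF M'] by blast
have hM: "heval M P 1 z = heval M' P 1 z" for z by (simp add: heval_def)
define F where "F x \<zeta> = heval M P 1 (\<chi> i. x $ i + (\<zeta> - \<i>) * v $ i) *
exp (- (cplx ((A *v x) \<bullet> x) + 2 * \<zeta> * cplx ((A *v x) \<bullet> v) + \<zeta>\<^sup>2 * cplx ((A *v v) \<bullet> v)))"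
for x :: "real ^ 'n" and \<zeta> :: complex
define \<Psi> where "\<Psi> \<zeta> = (LINT x|lborel. F x \<zeta>)" for \<zeta>
have [measurable]: "(%x. A *v x) \<in> borel_measurable borel"
by (intro borel_measurable_continuous_onI linear_continuous_on_compose[OF continuous_on_id]) auto
have Fmeas [measurable]: "(%x. F x \<zeta>) \<in> borel_measurable borel" for \<zeta>
proof -
have "(%x. heval M P 1 (\<chi> i. cplx (x $ i) + (\<zeta> - \<i>) * cplx (v $ i))) \<in> borel_measurable borel"
 by (rule heval_measurable, unfold vec_lambda_beta, measurable)
thus ?thesis unfolding F_def by measurable
qed
have "\<Psi> holomorphic_on UNIV"
unfolding \<Psi>_def
proof (rule holomorphic_integral_param)
show "F x holomorphic_on UNIV" for x
 unfolding F_def by (intro holomorphic_intros holomorphic_on_heval) (auto intro!: holomorphic_intros)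
fix R :: real
define R' where "R' = max 0 R"
define K1 where "K1 = C * (1 + (R' + 1) * norm v) ^ M' * exp (R'\<^sup>2 * \<bar>(A *v v) \<bullet> v\<bar>)"
define b where "b = 2 * R' * norm (A *v v)"
have R': "R' >= 0" "R <= R'" by (auto simp: R'_def)
show "\<exists>B. integrable lborel B \<and> (\<forall>x z. cmod z <= R --> cmod (F x z) <= B x)"
proof (intro exI conjI allI impI)
 show "integrable lborel (%x::real^'n. K1 * ((1 + norm x) ^ M' * exp (b * norm x - c * (norm x)\<^sup>2)))"
 by (intro integrable_mult_right integrable_poly_gaussian c)
 fix x :: "real ^ 'n" and z assume "cmod z <= R"
 hence z: "cmod z <= R'" using R' by simp
 have "cmod ((\<chi> i. cplx (x $ i) + (z - \<i>) * cplx (v $ i)) $ i) <= norm x + (R' + 1) * norm v" for i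
 proof -
 have "cmod (z - \<i>) <= R' + 1" using z norm_triangle_ineq4[of z \<i>] by simp
 moreover have "\<bar>v $ i\<bar> <= norm v" "\<bar>x $ i\<bar> <= norm x" by (auto simp: component_le_norm_cart)
 ultimately have "cmod ((z - \<i>) * cplx (v $ i)) <= (R' + 1) * norm v"
 unfolding norm_mult using R' by (intro mult_mono) auto
 thus ?thesis using norm_triangle_ineq[of "cplx (x $ i)" "(z - \<i>) * cplx (v $ i)"]
 \<open>\<bar>x $ i\<bar> <= norm x\<close> by simp
 qed
 hence "cmod (heval M P 1 (\<chi> i. x $ i + (z - \<i>) * v $ i)) <= C * (1 + (norm x + (R' + 1) * norm v)) ^ M'"
 unfolding hM using R' by (intro C) auto
 also have "... <= C * ((1 + norm x) * (1 + (R' + 1) * norm v)) ^ M'"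
 using C(1) R' by (intro mult_left_mono power_mono) (auto simp: algebra_simps)
 finally have 1: "cmod (heval M P 1 (\<chi> i. x $ i + (z - \<i>) * v $ i)) <= C * (1 + (R' + 1) * norm v) ^ M' * (1 + norm x) ^ M'"
 by (simp add: power_mult_distrib mult_ac)
 have "\<bar>Re (2 * z * cplx ((A *v x) \<bullet> v))\<bar> <= b * norm x"
 proof -
 have "\<bar>Re (2 * z * cplx ((A *v x) \<bullet> v))\<bar> <= cmod (2 * z * cplx ((A *v x) \<bullet> v))"
 by (rule abs_Re_le_cmod)
 also have "... = 2 * cmod z * \<bar>x \<bullet> (A *v v)\<bar>"
 by (simp add: norm_mult sym_inner[OF sym])
 also have "... <= 2 * R' * (norm x * norm (A *v v))"
 using z R' Cauchy_Schwarz_ineq2[of x "A *v v"] by (intro mult_mono) auto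
 finally show ?thesis by (simp add: b_def mult_ac)
 qed
 moreover have "\<bar>Re (z\<^sup>2 * cplx ((A *v v) \<bullet> v))\<bar> <= R'\<^sup>2 * \<bar>(A *v v) \<bullet> v\<bar>"
 proof -
 have "\<bar>Re (z\<^sup>2 * cplx ((A *v v) \<bullet> v))\<bar> <= cmod (z\<^sup>2 * cplx ((A *v v) \<bullet> v))"
 by (rule abs_Re_le_cmod)
 also have "... = (cmod z)\<^sup>2 * \<bar>(A *v v) \<bullet> v\<bar>" by (simp add: norm_mult norm_power)
 also have "... <= R'\<^sup>2 * \<bar>(A *v v) \<bullet> v\<bar>"
 using z by (intro mult_right_mono power_mono) auto
 finally show ?thesis .
 qed
 ultimately have "cmod (exp (- (cplx ((A *v x) \<bullet> x) + 2 * z * cplx ((A *v x) \<bullet> v) + z\<^sup>2 * cplx ((A *v v) \<bullet> v))))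
 <= exp (R'\<^sup>2 * \<bar>(A *v v) \<bullet> v\<bar> + (b * norm x - c * (norm x)\<^sup>2))"
 unfolding norm_exp_eq_Re using c(2)[of x] by (simp add: abs_le_iff)
 hence "cmod (F x z) <= (C * (1 + (R' + 1) * norm v) ^ M' * (1 + norm x) ^ M') * exp (R'\<^sup>2 * \<bar>(A *v v) \<bullet> v\<bar> + (b * norm x - c * (norm x)\<^sup>2))"
 unfolding F_def norm_mult using 1 by (intro mult_mono) (use C(1) R' in auto)
 thus "cmod (F x z) <= K1 * ((1 + norm x) ^ M' * exp (b * norm x - c * (norm x)\<^sup>2))"
 by (simp add: K1_def exp_add mult_ac)
qed
qed auto
hence hol: "(%\<zeta>. \<Psi> \<zeta> - \<Psi> 0) holomorphic_on UNIV" by (intro holomorphic_intros)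
have real: "\<Psi> (cplx t) = \<Psi> 0" for t
proof -
have "F x (cplx t) = F (x + t *\<^sub>R v) 0" for x
 using quad_add[OF sym, of x t v] by (simp add: F_def algebra_simps)
thus ?thesis unfolding \<Psi>_def by (simp add: lborel_integral_translate[of "%x. F x 0"])
qed
have "\<Psi> \<i> - \<Psi> 0 = 0"
proof (rule analytic_continuation[OF hol open_UNIV connected_UNIV, of "range cplx" 0])
show "(0::complex) islimpt range cplx"
proof (rule islimptI)
 fix T :: "complex set" assume "0 \<in> T" "open T"
 then obtain e where "e > 0" "ball 0 e \<subseteq> T" by (meson open_contains_ball)
 have "cplx (e / 2) \<in> T"
 using \<open>e > 0\<close> by (intro subsetD[OF \<open>ball 0 e \<subseteq> T\<close>]) simp
 thus "\<exists>y\<in>range cplx. y \<in> T \<and> y ~= 0"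
 using \<open>e > 0\<close> by (intro bexI[of _ "cplx (e / 2)"] conjI rangeI) simp_all
qed
qed (use real in auto)
hence "\<Psi> \<i> = \<Psi> 0" by simp
moreover have "\<Psi> \<i> = exp (quad A v) * FT (%x. cpoly_eval P x * exp (- quad A x)) (2 *\<^sub>R (A *v v))"
proof -
have "F x \<i> = exp (quad A v) * ((cpoly_eval P x * exp (- quad A x)) * exp (- (\<i> * cplx (x \<bullet> (2 *\<^sub>R (A *v v))))))" for x
proof -
 have "F x \<i> = cpoly_eval P x * exp (- (cplx (quad A x) + 2 * \<i> * cplx (x \<bullet> (A *v v)) - cplx (quad A v)))"
 by (simp add: F_def cpoly_eval_heval[of P x M] quad_def sym_inner[OF sym] cvec_def)
 also have "- (cplx (quad A x) + 2 * \<i> * cplx (x \<bullet> (A *v v)) - cplx (quad A v))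
 = cplx (quad A v) + (cplx (- quad A x) + (- (\<i> * cplx (x \<bullet> (2 *\<^sub>R (A *v v))))))"
 by simp
 finally show ?thesis by (simp only: exp_add exp_of_real mult_ac)
qed
thus ?thesis unfolding \<Psi>_def FT_def by simp
qed
moreover have "\<Psi> 0 = (LINT x|lborel. heval M P 1 (\<chi> i. x $ i - \<i> * v $ i) * exp (- quad A x))"
unfolding \<Psi>_def F_def by (simp add: quad_def exp_of_real[symmetric])
ultimately show ?thesis
by (simp add: exp_minus field_simps)
qed

section \<open>Fourier inversion\<close>

text \<open>The boxes generate the Borel sets and are stable under intersection.\<close>
lemma AE_zero_if_box_integrals_zero:
fixes w :: "'a::euclidean_space => 'b::{banach, second_countable_topology}"
assumes [measurable]: "w \<in> borel_measurable borel"
and int: "!!a b. integrable lborel (%x. indicator (box a b) x *\<^sub>R w x)"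
and zero: "!!a b. (LINT x|lborel. indicator (box a b) x *\<^sub>R w x) = 0"
shows "AE x in lborel. w x = 0"
proof -
define Q where "Q N = box (- (real N *\<^sub>R One)) (real N *\<^sub>R One :: 'a)" for N
have Qint: "integrable lborel (%x. indicator (Q N) x *\<^sub>R w x)" for N
unfolding Q_def by (rule int)
have *: "(LINT x|lborel. indicator (A \<inter> Q N) x *\<^sub>R w x) = 0" if "A \<in> sets borel" for A N
proof -
have intA: "integrable lborel (%x. indicator (A \<inter> Q N) x *\<^sub>R w x)" if [measurable]: "A \<in> sets borel" for A
proof (rule Bochner_Integration.integrable_bound[OF Qint[of N]])
 have [measurable]: "Q N \<in> sets borel" by (simp add: Q_def)
 show "(%x. indicator (A \<inter> Q N) x *\<^sub>R w x) \<in> borel_measurable lborel" by measurable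
qed (auto simp: indicator_def)
have borel: "sets borel = sigma_sets UNIV (range (%(a, b). box a b :: 'a set))"
 by (subst borel_eq_box) simp
have "Int_stable (range (%(a, b). box a b :: 'a set))"
 by (auto simp: Int_stable_def box_Int_box)
moreover have "range (%(a, b). box a b :: 'a set) \<subseteq> Pow UNIV" by auto
moreover have "A \<in> sigma_sets UNIV (range (%(a, b). box a b :: 'a set))" using that borel by simp
ultimately show ?thesis
proof (induction rule: sigma_sets_induct_disjoint[consumes 3])
 case (basic A)
 then obtain a b where "A = box a b" by auto
 then have "\<exists>c d. A \<inter> Q N = box c d"
 unfolding Q_def by (simp only: box_Int_box) blast
 then obtain c d where "A \<inter> Q N = box c d" by blast
 thus ?case using zero by simp
next
 case empty
 show ?case by simp
next
 case (compl A)
 have A: "A \<in> sets borel" using compl borel by simp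
 have "indicator ((UNIV - A) \<inter> Q N) x *\<^sub>R w x = indicator (Q N) x *\<^sub>R w x - indicator (A \<inter> Q N) x *\<^sub>R w x" for x
 by (cases "x \<in> A"; cases "x \<in> Q N") simp_all
 hence "(LINT x|lborel. indicator ((UNIV - A) \<inter> Q N) x *\<^sub>R w x)
 = (LINT x|lborel. indicator (Q N) x *\<^sub>R w x) - (LINT x|lborel. indicator (A \<inter> Q N) x *\<^sub>R w x)"
 using intA[OF A] Qint[of N] by simp
 thus ?case using compl zero by (simp add: Q_def)
next
 case (union F)
 have F: "F i \<in> sets borel" for i using union borel by auto
 have "(%k. LINT x|lborel. indicator ((\<Union>i<k. F i) \<inter> Q N) x *\<^sub>R w x) \<longlonglongrightarrow> (LINT x|lborel. indicator ((\<Union>i. F i) \<inter> Q N) x *\<^sub>R w x)"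
 proof (rule integral_dominated_convergence[where w = "%x. norm (indicator (Q N) x *\<^sub>R w x)"])
 have [measurable]: "Q N \<in> sets borel" by (simp add: Q_def)
 have [measurable]: "(\<Union>i. F i) \<in> sets borel" "(\<Union>i<k. F i) \<in> sets borel" for k using F by auto
 show "(%x. indicator ((\<Union>i. F i) \<inter> Q N) x *\<^sub>R w x) \<in> borel_measurable lborel"
 "(%x. indicator ((\<Union>i<k. F i) \<inter> Q N) x *\<^sub>R w x) \<in> borel_measurable lborel" for k by measurable
 show "AE x in lborel. (%k. indicator ((\<Union>i<k. F i) \<inter> Q N) x *\<^sub>R w x) \<longlonglongrightarrow> indicator ((\<Union>i. F i) \<inter> Q N) x *\<^sub>R w x"
 proof (rule AE_I2)
 fix x
 show "(%k. indicator ((\<Union>i<k. F i) \<inter> Q N) x *\<^sub>R w x) \<longlonglongrightarrow> indicator ((\<Union>i. F i) \<inter> Q N) x *\<^sub>R w x"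
 proof (cases "\<exists>i. x \<in> F i")
  case True
  then obtain i where i: "x \<in> F i" by blast
  have "\<forall>\<^sub>F k in sequentially. indicator ((\<Union>i. F i) \<inter> Q N) x *\<^sub>R w x = indicator ((\<Union>i<k. F i) \<inter> Q N) x *\<^sub>R w x"
  using i by (auto simp: eventually_sequentially indicator_def intro!: exI[of _ "Suc i"])
  thus ?thesis by (rule Lim_transform_eventually[OF tendsto_const])
 qed (auto simp: indicator_def)
 qed
 show "integrable lborel (%x. norm (indicator (Q N) x *\<^sub>R w x))"
 by (rule integrable_norm[OF Qint])
 qed (auto simp: indicator_def)
 moreover have "(LINT x|lborel. indicator ((\<Union>i<k. F i) \<inter> Q N) x *\<^sub>R w x) = 0" for k
 proof -
 have "indicator ((\<Union>i<k. F i) \<inter> Q N) x *\<^sub>R w x = (\<Sum>i<k. indicator (F i \<inter> Q N) x *\<^sub>R w x)" for x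
 proof (cases "\<exists>i<k. x \<in> F i")
 case True
 then obtain i where i: "i < k" "x \<in> F i" by blast
 have "x \<notin> F j" if "j ~= i" for j
  using union(1) i(2) that by (auto simp: disjoint_family_on_def)
 hence "(\<Sum>j<k. indicator (F j \<inter> Q N) x *\<^sub>R w x) = (\<Sum>j<k. if j = i then indicator (Q N) x *\<^sub>R w x else 0)"
  using i by (intro sum.cong) (auto simp: indicator_def)
 thus ?thesis using i by (auto simp: indicator_def)
 next
 case False
 hence "(\<Sum>j<k. indicator (F j \<inter> Q N) x *\<^sub>R w x) = 0"
  by (intro sum.neutral) auto
 thus ?thesis using False by (auto simp: indicator_def)
 qed
 hence "(LINT x|lborel. indicator ((\<Union>i<k. F i) \<inter> Q N) x *\<^sub>R w x) = (LINT x|lborel. (\<Sum>i<k. indicator (F i \<inter> Q N) x *\<^sub>R w x))"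
 by (simp only:)
 also have "... = (\<Sum>i<k. LINT x|lborel. indicator (F i \<inter> Q N) x *\<^sub>R w x)"
 by (rule Bochner_Integration.integral_sum[OF intA[OF F]])
 finally have "(LINT x|lborel. indicator ((\<Union>i<k. F i) \<inter> Q N) x *\<^sub>R w x) = (\<Sum>i<k. LINT x|lborel. indicator (F i \<inter> Q N) x *\<^sub>R w x)" .
 thus ?thesis using union by simp
 qed
 ultimately have "(%k::nat. 0) \<longlonglongrightarrow> (LINT x|lborel. indicator ((\<Union>i. F i) \<inter> Q N) x *\<^sub>R w x)"
 by simp
 thus ?case by (simp only: LIMSEQ_const_iff)
qed
qed
have AEQ: "AE x in lborel. indicator (Q N) x *\<^sub>R w x = 0" for N
proof (rule sigma_finite_measure.density_zero[OF sigma_finite_lborel Qint])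
fix A :: "'a set" assume A: "A \<in> sets lborel"
have eq: "indicator A x *\<^sub>R indicator (Q N) x *\<^sub>R w x = indicator (A \<inter> Q N) x *\<^sub>R w x" for x
 by (cases "x \<in> A"; cases "x \<in> Q N") simp_all
show "(LINT x:A|lborel. indicator (Q N) x *\<^sub>R w x) = 0"
 unfolding set_lebesgue_integral_def eq using *[of A N] A by simp
qed
have "AE x in lborel. \<forall>N. indicator (Q N) x *\<^sub>R w x = 0"
by (rule AE_all_countable[THEN iffD2, OF allI[OF AEQ]])
thus ?thesis
proof eventually_elim
case (elim x)
have "x \<in> (\<Union>N. Q N)" unfolding Q_def UN_box_eq_UNIV by (rule UNIV_I)
thus ?case using elim by (auto simp: indicator_def)
qed
qed

lemma integrable_pair_bound:
fixes F :: "'a::euclidean_space => 'b::euclidean_space => complex"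
assumes [measurable]: "(%(x, y). F x y) \<in> borel_measurable (borel \<Otimes>\<^sub>M borel)"
and f: "integrable lborel (f :: _ => real)" and g: "integrable lborel (g :: _ => real)"
and bd: "!!x y. norm (F x y) <= f x * g y"
shows "integrable (lborel \<Otimes>\<^sub>M lborel) (%(x, y). F x y)"
and "(LINT y|lborel. LINT x|lborel. F x y) = (LINT x|lborel. LINT y|lborel. F x y)"
proof -
have [measurable]: "f \<in> borel_measurable borel" "g \<in> borel_measurable borel" using f g by auto
have meas: "(%(x, y). F x y) \<in> borel_measurable (lborel \<Otimes>\<^sub>M lborel)" by measurable
have in2: "integrable lborel (%y. F x y)" for x
proof (rule Bochner_Integration.integrable_bound)
show "integrable lborel (%y. f x * g y)" using g by simp
show "AE y in lborel. norm (F x y) <= norm (f x * g y)"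
 using bd by (auto intro!: AE_I2 intro: order_trans[OF _ abs_ge_self])
qed measurable
show pair: "integrable (lborel \<Otimes>\<^sub>M lborel) (%(x, y). F x y)"
proof (rule lborel_pair.Fubini_integrable[OF meas])
show "integrable lborel (%x. LINT y|lborel. norm (case (x, y) of (x, y) => F x y))"
proof (rule Bochner_Integration.integrable_bound)
 show "integrable lborel (%x. f x * (LINT y|lborel. g y))" using f by simp
 show "AE x in lborel. norm (LINT y|lborel. norm (case (x, y) of (x, y) => F x y)) <= norm (f x * (LINT y|lborel. g y))"
 proof (rule AE_I2)
 fix x
 have "(LINT y|lborel. norm (F x y)) <= (LINT y|lborel. f x * g y)"
 using in2[of x] g bd by (intro integral_mono) auto
 moreover have "0 <= (LINT y|lborel. norm (F x y))" by simp
 ultimately show "norm (LINT y|lborel. norm (case (x, y) of (x, y) => F x y)) <= norm (f x * (LINT y|lborel. g y))"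
 by simp
 qed
qed measurable
qed (use in2 in auto)
show "(LINT y|lborel. LINT x|lborel. F x y) = (LINT x|lborel. LINT y|lborel. F x y)"
by (rule lborel_pair.Fubini_integral[OF pair])
qed

lemma lborel_integral_affine:
fixes f :: "'a::euclidean_space => 'b::{banach, second_countable_topology}"
assumes [measurable]: "f \<in> borel_measurable borel" and "c ~= 0"
shows "(LINT x|lborel. f x) = \<bar>c\<bar> ^ DIM('a) *\<^sub>R (LINT x|lborel. f (t + c *\<^sub>R x))"
proof -
have "(LINT x|lborel. f x) = (LINT x|density (distr lborel borel (%x. t + c *\<^sub>R x)) (%_. ennreal (\<bar>c\<bar> ^ DIM('a))). f x)"
using lborel_affine[OF assms(2), of t] by (simp only: ennreal_power abs_ge_zero)
also have "... = (LINT x|distr lborel borel (%x. t + c *\<^sub>R x). \<bar>c\<bar> ^ DIM('a) *\<^sub>R f x)"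
by (rule integral_density) auto
also have "... = (LINT x|lborel. \<bar>c\<bar> ^ DIM('a) *\<^sub>R f (t + c *\<^sub>R x))"
by (rule integral_distr) auto
finally show ?thesis by (simp only: integral_scaleR_right)
qed

lemma lborel_nn_integral_affine:
fixes f :: "'a::euclidean_space => ennreal"
assumes [measurable]: "f \<in> borel_measurable borel" and "c ~= 0"
shows "(\<integral>\<^sup>+x. f x \<partial>lborel) = ennreal (\<bar>c\<bar> ^ DIM('a)) * (\<integral>\<^sup>+x. f (t + c *\<^sub>R x) \<partial>lborel)"
proof -
have "(\<integral>\<^sup>+x. f x \<partial>lborel) = (\<integral>\<^sup>+x. f x \<partial>density (distr lborel borel (%x. t + c *\<^sub>R x)) (%_. ennreal (\<bar>c\<bar> ^ DIM('a))))"
using lborel_affine[OF assms(2), of t] by (simp only: ennreal_power abs_ge_zero)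
also have "... = (\<integral>\<^sup>+x. ennreal (\<bar>c\<bar> ^ DIM('a)) * f x \<partial>distr lborel borel (%x. t + c *\<^sub>R x))"
by (rule nn_integral_density) auto
also have "... = (\<integral>\<^sup>+x. ennreal (\<bar>c\<bar> ^ DIM('a)) * f (t + c *\<^sub>R x) \<partial>lborel)"
by (rule nn_integral_distr) auto
also have "... = ennreal (\<bar>c\<bar> ^ DIM('a)) * (\<integral>\<^sup>+x. f (t + c *\<^sub>R x) \<partial>lborel)"
by (rule nn_integral_cmult) simp
finally show ?thesis .
qed

definition gauss_mass :: "'n::finite itself => real" where
"gauss_mass _ = (LINT x::real^'n|lborel. exp (- ((norm x)\<^sup>2 / 2)))"

lemma gauss_integrable: "integrable lborel (%x::'a::euclidean_space. exp (- ((norm x)\<^sup>2 / 2)))"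
using integrable_gaussian[of "1/2"] by simp

lemma gauss_mass_pos: "gauss_mass TYPE('n::finite) > 0"
proof -
have "(LINT x::real^'n|lborel. exp (- ((norm x)\<^sup>2 / 2))) ~= 0"
proof
assume "(LINT x::real^'n|lborel. exp (- ((norm x)\<^sup>2 / 2))) = 0"
hence "AE x::real^'n in lborel. exp (- ((norm x)\<^sup>2 / 2)) = 0"
 by (subst (asm) integral_nonneg_eq_0_iff_AE[OF gauss_integrable]) auto
hence "AE x::real^'n in lborel. False" by simp
then obtain N :: "(real^'n) set" where N: "N \<in> null_sets lborel" "UNIV \<subseteq> N"
 by (auto simp: eventually_ae_filter)
hence "N = UNIV" by blast
with N(1) show False by (simp add: null_sets_def)
qed
moreover have "(LINT x::real^'n|lborel. exp (- ((norm x)\<^sup>2 / 2))) >= 0" by simp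
ultimately show ?thesis unfolding gauss_mass_def by linarith
qed

lemma fourier_gaussian:
fixes x :: "real ^ 'n::finite"
assumes s: "\<sigma> > 0"
shows "(LINT y|lborel. exp (\<i> * cplx (x \<bullet> y)) * cplx (exp (- (\<sigma>\<^sup>2 * (norm y)\<^sup>2 / 2))))
= cplx (gauss_mass TYPE('n) / \<sigma> ^ CARD('n) * exp (- ((norm x)\<^sup>2 / (2 * \<sigma>\<^sup>2))))"
proof -
define A where "A = (mat (\<sigma>\<^sup>2 / 2) :: real ^ 'n ^ 'n)"
have Av: "A *v v = (\<sigma>\<^sup>2 / 2) *\<^sub>R v" for v
by (simp add: A_def vec_eq_iff matrix_vector_mult_def mat_def if_distrib[of "%x. x * _"] cong: if_cong)
have "sym_pos_def A"
proof -
have "transpose A = A" by (simp add: A_def transpose_mat)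
thus ?thesis using s by (auto simp: sym_pos_def_def Av)
qed
have quadA: "quad A v = \<sigma>\<^sup>2 * (norm v)\<^sup>2 / 2" for v
by (simp add: quad_def Av power2_norm_eq_inner)
define P where "P = (Poly_Mapping.single 0 1 :: 'n cpoly)"
have P: "heval M P \<tau> z = \<tau> ^ M" for M \<tau> z
by (simp add: heval_def P_def expo_degree_def)
define v where "v = (- (1 / \<sigma>\<^sup>2)) *\<^sub>R x"
have v: "2 *\<^sub>R (A *v v) = - x" using s by (simp add: Av v_def)
have qv: "quad A v = (norm x)\<^sup>2 / (2 * \<sigma>\<^sup>2)"
using s by (simp add: quadA v_def power2_eq_square field_simps)
have "(LINT y|lborel. exp (\<i> * cplx (x \<bullet> y)) * cplx (exp (- (\<sigma>\<^sup>2 * (norm y)\<^sup>2 / 2))))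
= FT (%x. cpoly_eval P x * exp (- quad A x)) (2 *\<^sub>R (A *v v))"
unfolding v FT_def by (simp add: cpoly_eval_heval[of P _ 0] P quadA inner_commute mult.commute)
also have "... = exp (- quad A v) * (LINT x|lborel. heval 0 P 1 (\<chi> i. x $ i - \<i> * v $ i) * exp (- quad A x))"
by (rule FT_poly_gaussian) fact
also have "... = exp (- ((norm x)\<^sup>2 / (2 * \<sigma>\<^sup>2))) * (LINT x::real^'n|lborel. cplx (exp (- (\<sigma>\<^sup>2 * (norm x)\<^sup>2 / 2))))"
unfolding P power_0 qv unfolding quadA by simp
also have "(LINT x::real^'n|lborel. cplx (exp (- (\<sigma>\<^sup>2 * (norm x)\<^sup>2 / 2)))) = cplx (gauss_mass TYPE('n) / \<sigma> ^ CARD('n))"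
proof -
have "gauss_mass TYPE('n) = \<bar>\<sigma>\<bar> ^ DIM(real^'n) *\<^sub>R (LINT x::real^'n|lborel. exp (- ((norm (0 + \<sigma> *\<^sub>R x))\<^sup>2 / 2)))"
 unfolding gauss_mass_def using s by (intro lborel_integral_affine) auto
hence "gauss_mass TYPE('n) = \<sigma> ^ CARD('n) * (LINT x::real^'n|lborel. exp (- (\<sigma>\<^sup>2 * (norm x)\<^sup>2 / 2)))"
 using s by (simp add: power_mult_distrib)
thus ?thesis using s by (simp add: field_simps)
qed
finally show ?thesis by (simp add: mult.commute)
qed

lemma FT_cong_AE:
assumes "AE x in lborel. u x = v x" "u \<in> borel_measurable borel" "v \<in> borel_measurable borel"
shows "FT u y = FT v y"
unfolding FT_def using assms by (intro integral_cong_AE) (auto elim: eventually_mono)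

lemma FT_bound: "norm (FT u y) <= (LINT x|lborel. norm (u x))"
unfolding FT_def by (rule order_trans[OF integral_norm_bound]) (simp add: norm_mult)

lemma FT_measurable [measurable]:
assumes [measurable]: "u \<in> borel_measurable borel"
shows "FT u \<in> borel_measurable borel"
unfolding FT_def[abs_def] by measurable

lemma norm_exp_i [simp]: "norm (exp (\<i> * cplx t)) = 1" "norm (exp (- (\<i> * cplx t))) = 1"
by (simp_all add: norm_exp_eq_Re)

text \<open>Fubini and the transform of the Gaussian: damping the transform convolves the function with a Gaussian.\<close>
lemma fourier_gaussian_weighted:
fixes u :: "real ^ 'n::finite => complex"
assumes u: "integrable lborel u" and s: "\<sigma> > 0"
shows "(LINT y|lborel. FT u y * exp (\<i> * cplx (x \<bullet> y)) * exp (- (\<sigma>\<^sup>2 * (norm y)\<^sup>2 / 2)))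
 = (LINT t|lborel. u t * cplx (gauss_mass TYPE('n) / \<sigma> ^ CARD('n) * exp (- ((norm (x - t))\<^sup>2 / (2 * \<sigma>\<^sup>2)))))"
proof -
have [measurable]: "u \<in> borel_measurable borel" using u by auto
define F where "F t y = u t * (exp (\<i> * cplx ((x - t) \<bullet> y)) * exp (- (\<sigma>\<^sup>2 * (norm y)\<^sup>2 / 2)))" for t y
have "(LINT y|lborel. LINT t|lborel. F t y) = (LINT t|lborel. LINT y|lborel. F t y)"
proof (rule integrable_pair_bound(2))
show "(%(t, y). F t y) \<in> borel_measurable (borel \<Otimes>\<^sub>M borel)" unfolding F_def by measurable
show "integrable lborel (%t. norm (u t))" using u by simp
show "integrable lborel (%y::real^'n. exp (- (\<sigma>\<^sup>2 * (norm y)\<^sup>2 / 2)))"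
 using integrable_gaussian[of "\<sigma>\<^sup>2 / 2", where 'a="real^'n"] s by simp
show "norm (F t y) <= norm (u t) * exp (- (\<sigma>\<^sup>2 * (norm y)\<^sup>2 / 2))" for t y
 unfolding F_def norm_mult norm_exp_i by simp
qed
moreover have "(LINT t|lborel. F t y) = FT u y * exp (\<i> * cplx (x \<bullet> y)) * exp (- (\<sigma>\<^sup>2 * (norm y)\<^sup>2 / 2))" for y
proof -
have "F t y = (u t * exp (- (\<i> * cplx (t \<bullet> y)))) * (exp (\<i> * cplx (x \<bullet> y)) * exp (- (\<sigma>\<^sup>2 * (norm y)\<^sup>2 / 2)))" for t
 unfolding F_def by (simp add: inner_diff_left right_diff_distrib exp_diff exp_minus field_simps)
thus ?thesis by (simp only: FT_def integral_mult_left_zero mult.assoc[of "integral\<^sup>L _ _"])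
qed
moreover have "(LINT y|lborel. F t y) = u t * cplx (gauss_mass TYPE('n) / \<sigma> ^ CARD('n) * exp (- ((norm (x - t))\<^sup>2 / (2 * \<sigma>\<^sup>2))))" for t
unfolding F_def integral_mult_right_zero fourier_gaussian[OF s] ..
ultimately show ?thesis by simp
qed

text \<open>The identity with a Gaussian weight is tested on boxes; both sides converge as the weight becomes flat, and integrals over boxes determine a function.\<close>
theorem fourier_inversion:
fixes u :: "real ^ 'n::finite => complex"
assumes u: "integrable lborel u" and Fu: "integrable lborel (FT u)"
shows "AE x in lborel. cplx ((gauss_mass TYPE('n))\<^sup>2) * u x = FT (FT u) (- x)"
proof -
have [measurable]: "u \<in> borel_measurable borel" using u by auto
let ?\<kappa> = "gauss_mass TYPE('n)"
define L where "L \<sigma> x = (LINT y|lborel. FT u y * exp (\<i> * cplx (x \<bullet> y)) * cplx (exp (- (\<sigma>\<^sup>2 * (norm y)\<^sup>2 / 2))))"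
for \<sigma> :: real and x :: "real^'n"
have LFT: "FT (FT u) (- x) = L 0 x" for x
unfolding L_def FT_def[of "FT u"] by (simp add: inner_commute)
have [measurable]: "L \<sigma> \<in> borel_measurable borel" for \<sigma>
unfolding L_def[abs_def] by measurable
have Lbd: "norm (L \<sigma> x) <= (LINT y|lborel. norm (FT u y))" for \<sigma> x
unfolding L_def
proof (rule order_trans[OF integral_norm_bound], rule integral_mono_AE')
show "AE y in lborel. norm (FT u y * exp (\<i> * cplx (x \<bullet> y)) * cplx (exp (- (\<sigma>\<^sup>2 * (norm y)\<^sup>2 / 2)))) <= norm (FT u y)"
 by (auto simp: norm_mult mult_left_le)
qed (use Fu in auto)
define s where "s k = 1 / real (Suc k)" for k
have s: "s k > 0" for k by (simp add: s_def)
have s0: "s \<longlonglongrightarrow> 0" unfolding s_def by (rule LIMSEQ_Suc[OF lim_1_over_n])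
have Llim: "(%k. L (s k) x) \<longlonglongrightarrow> L 0 x" for x
unfolding L_def
proof (rule integral_dominated_convergence[where w = "%y. norm (FT u y)"])
show "AE y in lborel. (%k. FT u y * exp (\<i> * cplx (x \<bullet> y)) * cplx (exp (- ((s k)\<^sup>2 * (norm y)\<^sup>2 / 2))))
 \<longlonglongrightarrow> FT u y * exp (\<i> * cplx (x \<bullet> y)) * cplx (exp (- (0\<^sup>2 * (norm y)\<^sup>2 / 2)))"
 by (intro AE_I2 tendsto_intros s0) auto
show "AE y in lborel. norm (FT u y * exp (\<i> * cplx (x \<bullet> y)) * cplx (exp (- ((s k)\<^sup>2 * (norm y)\<^sup>2 / 2)))) <= norm (FT u y)" for k
 by (auto simp: norm_mult mult_left_le)
qed (use Fu in auto)
define D where "D x = cplx (?\<kappa>\<^sup>2) * u x - L 0 x" for x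
have indint: "integrable lborel (%x::real^'n. indicator (box a b) x :: real)" for a b
by (simp add: emeasure_lborel_box_eq less_top[symmetric])
have Lint: "integrable lborel (%x. indicator (box a b) x *\<^sub>R L \<sigma> x)" for a b \<sigma>
proof (rule Bochner_Integration.integrable_bound)
show "integrable lborel (%x::real^'n. indicator (box a b) x * (LINT y|lborel. norm (FT u y)))"
 using indint[of a b] by simp
show "AE x in lborel. norm (indicator (box a b) x *\<^sub>R L \<sigma> x) <= norm (indicator (box a b) x * (LINT y|lborel. norm (FT u y)))"
 using Lbd by (auto simp: indicator_def intro!: AE_I2 intro: order_trans[OF _ abs_ge_self])
qed measurable
have uint: "integrable lborel (%x. indicator (box a b) x *\<^sub>R u x)" for a b
by (rule Bochner_Integration.integrable_bound[OF u]) (auto simp: indicator_def)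
have main: "(LINT x|lborel. indicator (box a b) x *\<^sub>R L 0 x) = cplx (?\<kappa>\<^sup>2) * (LINT x|lborel. indicator (box a b) x *\<^sub>R u x)" for a b
proof -
let ?B = "box a b"
define J where "J \<sigma> t = (LINT w::real^'n|lborel. indicator ?B (t + \<sigma> *\<^sub>R w) * exp (- ((norm w)\<^sup>2 / 2)))" for \<sigma> t
have [measurable]: "J \<sigma> \<in> borel_measurable borel" for \<sigma>
 unfolding J_def[abs_def] by measurable
have J0: "0 <= J \<sigma> t" "J \<sigma> t <= ?\<kappa>" for \<sigma> t
proof -
 show "0 <= J \<sigma> t" unfolding J_def by (intro integral_nonneg_AE) auto
 show "J \<sigma> t <= ?\<kappa>" unfolding J_def gauss_mass_def
 proof (rule integral_mono)
 show "integrable lborel (%w::real^'n. indicator ?B (t + \<sigma> *\<^sub>R w) * exp (- ((norm w)\<^sup>2 / 2)))"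
 by (rule Bochner_Integration.integrable_bound[OF gauss_integrable]) (auto simp: indicator_def)
 qed (auto simp: gauss_integrable indicator_def)
qed
have eq: "(LINT x|lborel. indicator ?B x *\<^sub>R L \<sigma> x) = (LINT t|lborel. u t * cplx (?\<kappa> * J \<sigma> t))" if \<sigma>: "\<sigma> > 0" for \<sigma>
proof -
 define G where "G t x = cplx (indicator ?B x) * (u t * cplx (?\<kappa> / \<sigma> ^ CARD('n) * exp (- ((norm (x - t))\<^sup>2 / (2 * \<sigma>\<^sup>2)))))" for t x
 have "(LINT x|lborel. LINT t|lborel. G t x) = (LINT t|lborel. LINT x|lborel. G t x)"
 proof (rule integrable_pair_bound(2))
 show "(%(t, x). G t x) \<in> borel_measurable (borel \<Otimes>\<^sub>M borel)" unfolding G_def by measurable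
 show "integrable lborel (%t. norm (u t) * (?\<kappa> / \<sigma> ^ CARD('n)))" using u by simp
 show "integrable lborel (%x::real^'n. indicator ?B x :: real)" by (rule indint)
 show "norm (G t x) <= norm (u t) * (?\<kappa> / \<sigma> ^ CARD('n)) * indicator ?B x" for t x
 proof -
 have "?\<kappa> / \<sigma> ^ CARD('n) * exp (- ((norm (x - t))\<^sup>2 / (2 * \<sigma>\<^sup>2))) <= ?\<kappa> / \<sigma> ^ CARD('n) * 1"
  using gauss_mass_pos[where 'n='n] \<sigma> by (intro mult_left_mono) auto
 from mult_left_mono[OF this norm_ge_zero[of "u t"]] show ?thesis
  unfolding G_def norm_mult norm_of_real using gauss_mass_pos[where 'n='n] \<sigma>
  by (auto simp: indicator_def abs_mult)
 qed
 qed
 moreover have "(LINT t|lborel. G t x) = indicator ?B x *\<^sub>R L \<sigma> x" for x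
 unfolding G_def L_def fourier_gaussian_weighted[OF u \<sigma>] by (simp add: scaleR_conv_of_real)
 moreover have "(LINT x|lborel. G t x) = u t * cplx (?\<kappa> * J \<sigma> t)" for t
 proof -
 have "(LINT x|lborel. G t x) = (u t * cplx (?\<kappa> / \<sigma> ^ CARD('n))) * cplx (LINT x|lborel. indicator ?B x * exp (- ((norm (x - t))\<^sup>2 / (2 * \<sigma>\<^sup>2))))"
 unfolding integral_complex_of_real[symmetric] integral_mult_right_zero[symmetric] G_def
 by (intro Bochner_Integration.integral_cong) auto
 also have "(LINT x|lborel. indicator ?B x * exp (- ((norm (x - t))\<^sup>2 / (2 * \<sigma>\<^sup>2))))
 = \<bar>\<sigma>\<bar> ^ DIM(real^'n) *\<^sub>R (LINT w::real^'n|lborel. indicator ?B (t + \<sigma> *\<^sub>R w) * exp (- ((norm ((t + \<sigma> *\<^sub>R w) - t))\<^sup>2 / (2 * \<sigma>\<^sup>2))))"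
 using \<sigma> by (intro lborel_integral_affine) auto
 also have "... = \<sigma> ^ CARD('n) * J \<sigma> t"
 using \<sigma> by (simp add: J_def power_mult_distrib)
 finally show ?thesis using \<sigma> by simp
 qed
 ultimately show ?thesis by simp
qed
have lim1: "(%k. LINT x|lborel. indicator ?B x *\<^sub>R L (s k) x) \<longlonglongrightarrow> (LINT x|lborel. indicator ?B x *\<^sub>R L 0 x)"
proof (rule integral_dominated_convergence[where w = "%x::real^'n. indicator (box a b) x * (LINT y|lborel. norm (FT u y))"])
 show "AE x in lborel. (%k. indicator ?B x *\<^sub>R L (s k) x) \<longlonglongrightarrow> indicator ?B x *\<^sub>R L 0 x"
 by (intro AE_I2 tendsto_intros Llim)
 show "AE x in lborel. norm (indicator (box a b) x *\<^sub>R L (s k) x) <= indicator (box a b) x * (LINT y|lborel. norm (FT u y))" for k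
 using Lbd by (auto simp: indicator_def)
qed (use indint[of a b] in auto)
have lim2: "(%k. LINT t|lborel. u t * cplx (?\<kappa> * J (s k) t)) \<longlonglongrightarrow> (LINT t|lborel. u t * cplx (?\<kappa> * (indicator ?B t * ?\<kappa>)))"
proof (rule integral_dominated_convergence[where w = "%t. norm (u t) * (?\<kappa> * ?\<kappa>)"])
 have "AE t in lborel. t \<notin> frontier ?B"
 proof -
 have "negligible (frontier ?B)" by (intro negligible_convex_frontier convex_box)
 hence "frontier ?B \<in> null_sets lebesgue" by (simp add: negligible_iff_null_sets)
 hence "frontier ?B \<in> null_sets lborel"
 by (subst (asm) null_sets_completion_iff) (auto simp: frontier_def)
 thus ?thesis by (rule AE_not_in)
 qed
 thus "AE t in lborel. (%k. u t * cplx (?\<kappa> * J (s k) t)) \<longlonglongrightarrow> u t * cplx (?\<kappa> * (indicator ?B t * ?\<kappa>))"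
 proof eventually_elim
 case (elim t)
 have "(%k. J (s k) t) \<longlonglongrightarrow> (LINT w::real^'n|lborel. indicator ?B t * exp (- ((norm w)\<^sup>2 / 2)))"
 unfolding J_def
 proof (rule integral_dominated_convergence[OF _ _ gauss_integrable])
 show "AE w::real^'n in lborel. (%k. indicator ?B (t + s k *\<^sub>R w) * exp (- ((norm w)\<^sup>2 / 2))) \<longlonglongrightarrow> indicator ?B t * exp (- ((norm w)\<^sup>2 / 2))"
 proof (rule AE_I2)
  fix w :: "real^'n"
  have "(%k. t + s k *\<^sub>R w) \<longlonglongrightarrow> t + 0 *\<^sub>R w" by (intro tendsto_intros s0)
  hence tt: "(%k. t + s k *\<^sub>R w) \<longlonglongrightarrow> t" by simp
  have "\<forall>\<^sub>F k in sequentially. (t + s k *\<^sub>R w \<in> ?B) = (t \<in> ?B)"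
  proof (cases "t \<in> ?B")
  case True
  thus ?thesis using topological_tendstoD[OF tt open_box] by simp
  next
  case False
  hence "t \<in> - closure ?B" using elim using interior_open[OF open_box, of a b] by (auto simp: frontier_def)
  from topological_tendstoD[OF tt _ this]
  have "\<forall>\<^sub>F k in sequentially. t + s k *\<^sub>R w \<in> - closure ?B" by auto
  thus ?thesis by eventually_elim (use False closure_subset in auto)
  qed
  hence "\<forall>\<^sub>F k in sequentially. indicator ?B t * exp (- ((norm w)\<^sup>2 / 2)) = (indicator ?B (t + s k *\<^sub>R w) * exp (- ((norm w)\<^sup>2 / 2)) :: real)"
  by eventually_elim (auto simp: indicator_def)
  thus "(%k. indicator ?B (t + s k *\<^sub>R w) * exp (- ((norm w)\<^sup>2 / 2)) :: real) \<longlonglongrightarrow> indicator ?B t * exp (- ((norm w)\<^sup>2 / 2))"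
  by (rule Lim_transform_eventually[OF tendsto_const])
 qed
 qed (auto simp: indicator_def)
 hence "(%k. J (s k) t) \<longlonglongrightarrow> indicator ?B t * ?\<kappa>" by (simp add: gauss_mass_def)
 thus ?case by (intro tendsto_intros)
 qed
 show "AE t in lborel. norm (u t * cplx (?\<kappa> * J (s k) t)) <= norm (u t) * (?\<kappa> * ?\<kappa>)" for k
 using J0 gauss_mass_pos[where 'n='n] by (auto simp: norm_mult intro!: mult_left_mono)
qed (use u in auto)
have "(%k. LINT x|lborel. indicator ?B x *\<^sub>R L (s k) x) = (%k. LINT t|lborel. u t * cplx (?\<kappa> * J (s k) t))"
 using eq[OF s] by simp
hence "(LINT x|lborel. indicator ?B x *\<^sub>R L 0 x) = (LINT t|lborel. u t * cplx (?\<kappa> * (indicator ?B t * ?\<kappa>)))"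
 using LIMSEQ_unique[OF lim1] lim2 by simp
also have "... = (LINT t|lborel. cplx (?\<kappa>\<^sup>2) * (indicator ?B t *\<^sub>R u t))"
 by (intro Bochner_Integration.integral_cong) (auto simp: indicator_def power2_eq_square)
also have "... = cplx (?\<kappa>\<^sup>2) * (LINT t|lborel. indicator ?B t *\<^sub>R u t)"
 by (rule integral_mult_right_zero)
finally show ?thesis .
qed
have Dsplit: "indicator (box a b) x *\<^sub>R D x = cplx (?\<kappa>\<^sup>2) * (indicator (box a b) x *\<^sub>R u x) - indicator (box a b) x *\<^sub>R L 0 x" for a b x
by (simp add: D_def indicator_def)
have "AE x in lborel. D x = 0"
proof (rule AE_zero_if_box_integrals_zero)
show "D \<in> borel_measurable borel" unfolding D_def[abs_def] by measurable
show "integrable lborel (%x. indicator (box a b) x *\<^sub>R D x)" for a b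
 unfolding Dsplit using uint Lint by (intro Bochner_Integration.integrable_diff integrable_mult_right)
show "(LINT x|lborel. indicator (box a b) x *\<^sub>R D x) = 0" for a b
 unfolding Dsplit
 by (subst Bochner_Integration.integral_diff[OF integrable_mult_right[OF uint] Lint])
 (simp only: integral_mult_right_zero main diff_self)
qed
thus ?thesis unfolding D_def LFT by (auto elim: eventually_mono)
qed

section \<open>Gaussian convolution and the square norm of the transform\<close>

lemma entire_zero_on_reals:
assumes hol: "f holomorphic_on UNIV" and zero: "!!t::real. f (cplx t) = 0"
shows "f z = 0"
proof (rule analytic_continuation[OF hol open_UNIV connected_UNIV, of "range cplx" 0])
show "(0::complex) islimpt range cplx"
proof (rule islimptI)
fix T :: "complex set" assume "0 \<in> T" "open T"
then obtain e where "e > 0" "ball 0 e \<subseteq> T" by (meson open_contains_ball)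
have "cplx (e / 2) \<in> T"
 using \<open>e > 0\<close> by (intro subsetD[OF \<open>ball 0 e \<subseteq> T\<close>]) simp
thus "\<exists>y\<in>range cplx. y \<in> T \<and> y ~= 0"
 using \<open>e > 0\<close> by (intro bexI[of _ "cplx (e / 2)"] conjI rangeI) simp_all
qed
qed (use zero in auto)

lemma nn_integral_le_limit:
assumes [measurable]: "!!k. f k \<in> borel_measurable M"
and lim: "AE x in M. (%k. f k x) \<longlonglongrightarrow> (g x :: ennreal)"
and le: "!!k. k >= N ==> (\<integral>\<^sup>+x. f k x \<partial>M) <= c"
shows "(\<integral>\<^sup>+x. g x \<partial>M) <= c"
proof -
have "(\<integral>\<^sup>+x. g x \<partial>M) = (\<integral>\<^sup>+x. liminf (%k. f k x) \<partial>M)"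
using lim by (intro nn_integral_cong_AE) (auto elim!: eventually_mono simp: lim_imp_Liminf)
also have "... <= liminf (%k. \<integral>\<^sup>+x. f k x \<partial>M)"
by (rule nn_integral_liminf) simp
also have "... <= limsup (%k. \<integral>\<^sup>+x. f k x \<partial>M)"
by (rule Liminf_le_Limsup) simp
also have "... <= c"
using le by (intro Limsup_bounded) (auto simp: eventually_sequentially)
finally show ?thesis .
qed

lemma gauss_nn_integral:
assumes "\<sigma> > 0"
shows "(\<integral>\<^sup>+w. ennreal (gauss_mass TYPE('n) / \<sigma> ^ CARD('n) * exp (- ((norm (w :: real^'n::finite))\<^sup>2 / (2 * \<sigma>\<^sup>2)))) \<partial>lborel)
= ennreal ((gauss_mass TYPE('n))\<^sup>2)"
proof -
let ?\<kappa> = "gauss_mass TYPE('n)"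
have "(\<integral>\<^sup>+w. ennreal (?\<kappa> / \<sigma> ^ CARD('n) * exp (- ((norm (w :: real^'n))\<^sup>2 / (2 * \<sigma>\<^sup>2)))) \<partial>lborel)
= ennreal (\<bar>\<sigma>\<bar> ^ DIM(real^'n)) * (\<integral>\<^sup>+w. ennreal (?\<kappa> / \<sigma> ^ CARD('n) * exp (- ((norm (0 + \<sigma> *\<^sub>R w :: real^'n))\<^sup>2 / (2 * \<sigma>\<^sup>2)))) \<partial>lborel)"
using assms by (intro lborel_nn_integral_affine) auto
also have "... = ennreal (\<sigma> ^ CARD('n)) * (\<integral>\<^sup>+w. ennreal (?\<kappa> / \<sigma> ^ CARD('n)) * ennreal (exp (- ((norm (w :: real^'n))\<^sup>2 / 2))) \<partial>lborel)"
using assms gauss_mass_pos[where 'n='n]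
by (auto simp: power_mult_distrib ennreal_mult[symmetric] intro!: arg_cong2[where f = "(*)"] nn_integral_cong)
also have "... = ennreal (\<sigma> ^ CARD('n)) * (ennreal (?\<kappa> / \<sigma> ^ CARD('n)) * ennreal ?\<kappa>)"
by (subst nn_integral_cmult) (auto simp: gauss_mass_def nn_integral_eq_integral[OF gauss_integrable])
also have "... = ennreal (?\<kappa>\<^sup>2)"
using assms gauss_mass_pos[where 'n='n] by (simp add: ennreal_mult[symmetric] power2_eq_square)
finally show ?thesis .
qed

text \<open>Half of the Plancherel theorem suffices: the weighted identity and the inequality between means bound the weighted square norm, and Fatou removes the weight.\<close>
lemma FT_L2_bound:
fixes u :: "real ^ 'n::finite => complex"
assumes u: "integrable lborel u"
shows "(\<integral>\<^sup>+y. ennreal ((norm (FT u y))\<^sup>2) \<partial>lborel)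
<= ennreal ((gauss_mass TYPE('n))\<^sup>2) * (\<integral>\<^sup>+x. ennreal ((norm (u x))\<^sup>2) \<partial>lborel)"
proof -
let ?\<kappa> = "gauss_mass TYPE('n)"
let ?N = "\<integral>\<^sup>+x. ennreal ((norm (u x))\<^sup>2) \<partial>lborel"
have [measurable]: "u \<in> borel_measurable borel" using u by auto
have [measurable]: "cnj \<in> borel_measurable borel"
by (intro borel_measurable_continuous_onI continuous_intros)
define U where "U = (LINT x|lborel. norm (u x))"
have reg: "(\<integral>\<^sup>+y. ennreal ((norm (FT u y))\<^sup>2 * exp (- (\<sigma>\<^sup>2 * (norm y)\<^sup>2 / 2))) \<partial>lborel) <= ennreal (?\<kappa>\<^sup>2) * ?N"
if \<sigma>: "\<sigma> > 0" for \<sigma>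
proof -
let ?\<gamma> = "%y::real^'n. exp (- (\<sigma>\<^sup>2 * (norm y)\<^sup>2 / 2))"
define k where "k w = ?\<kappa> / \<sigma> ^ CARD('n) * exp (- ((norm w)\<^sup>2 / (2 * \<sigma>\<^sup>2)))" for w :: "real^'n"
have k0: "k w >= 0" for w using \<sigma> gauss_mass_pos[where 'n='n] by (simp add: k_def)
have [measurable]: "k \<in> borel_measurable borel" unfolding k_def[abs_def] by measurable
have kint: "(\<integral>\<^sup>+w. ennreal (k w) \<partial>lborel) = ennreal (?\<kappa>\<^sup>2)"
 unfolding k_def by (rule gauss_nn_integral[OF \<sigma>])
have k_sym: "k (x - t) = k (t - x)" for x t by (simp add: k_def norm_minus_commute)
have ktrans: "(\<integral>\<^sup>+t. ennreal (k (t - x)) \<partial>lborel) = ennreal (?\<kappa>\<^sup>2)" for x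
 using lborel_nn_integral_translate[of "%w. ennreal (k w)" "- x"] kint by simp
have gint: "integrable lborel ?\<gamma>"
 using integrable_gaussian[of "\<sigma>\<^sup>2 / 2", where 'a="real^'n"] \<sigma> by simp
define G where "G x y = cnj (u x) * (FT u y * exp (\<i> * cplx (x \<bullet> y)) * cplx (?\<gamma> y))" for x y
have 1: "(LINT y|lborel. LINT x|lborel. G x y) = (LINT x|lborel. LINT y|lborel. G x y)"
proof (rule integrable_pair_bound(2))
 show "(%(x, y). G x y) \<in> borel_measurable (borel \<Otimes>\<^sub>M borel)" unfolding G_def by measurable
 show "integrable lborel (%x. norm (u x))" using u by simp
 show "integrable lborel (%y. U * ?\<gamma> y)" using gint by simp
 show "norm (G x y) <= norm (u x) * (U * ?\<gamma> y)" for x y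
 unfolding G_def norm_mult norm_exp_i using FT_bound[of u y]
 by (auto simp: U_def intro!: mult_left_mono mult_right_mono)
qed
have 2: "(LINT x|lborel. G x y) = cplx ((norm (FT u y))\<^sup>2 * ?\<gamma> y)" for y
proof -
 have "cnj (FT u y) = (LINT x|lborel. cnj (u x) * exp (\<i> * cplx (x \<bullet> y)))"
 unfolding FT_def
 by (subst integral_bounded_linear'[OF bounded_linear_cnj bounded_linear_cnj, symmetric], simp,
  rule Bochner_Integration.integral_cong) (simp_all add: exp_cnj)
 moreover have "(LINT x|lborel. G x y) = (LINT x|lborel. (cnj (u x) * exp (\<i> * cplx (x \<bullet> y))) * (FT u y * cplx (?\<gamma> y)))"
 unfolding G_def by (intro Bochner_Integration.integral_cong) (auto simp: mult_ac)
 ultimately have "(LINT x|lborel. G x y) = cnj (FT u y) * (FT u y * cplx (?\<gamma> y))"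
 by (simp only: integral_mult_left_zero)
 thus ?thesis unfolding of_real_mult complex_norm_square by (simp only: mult_ac)
qed
have 3: "(LINT y|lborel. G x y) = cnj (u x) * (LINT t|lborel. u t * cplx (k (x - t)))" for x
 unfolding G_def k_def integral_mult_right_zero fourier_gaussian_weighted[OF u \<sigma>, of x] ..
have int: "integrable lborel (%y. (norm (FT u y))\<^sup>2 * ?\<gamma> y)"
proof (rule Bochner_Integration.integrable_bound)
 show "integrable lborel (%y. U\<^sup>2 * ?\<gamma> y)" using gint by simp
 show "AE y in lborel. norm ((norm (FT u y))\<^sup>2 * ?\<gamma> y) <= norm (U\<^sup>2 * ?\<gamma> y)"
 using FT_bound[of u] by (auto simp: U_def abs_mult intro!: AE_I2 mult_right_mono power_mono)
qed measurable
have "(\<integral>\<^sup>+y. ennreal ((norm (FT u y))\<^sup>2 * ?\<gamma> y) \<partial>lborel) = ennreal (LINT y|lborel. (norm (FT u y))\<^sup>2 * ?\<gamma> y)"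
 by (rule nn_integral_eq_integral[OF int]) simp
also have "(LINT y|lborel. (norm (FT u y))\<^sup>2 * ?\<gamma> y) = norm (cplx (LINT y|lborel. (norm (FT u y))\<^sup>2 * ?\<gamma> y))"
 unfolding norm_of_real by (rule abs_of_nonneg[symmetric]) simp
also have "cplx (LINT y|lborel. (norm (FT u y))\<^sup>2 * ?\<gamma> y) = (LINT x|lborel. cnj (u x) * (LINT t|lborel. u t * cplx (k (x - t))))"
 using 1 unfolding 2 3 integral_complex_of_real .
also have "ennreal (norm ...) <= (\<integral>\<^sup>+x. ennreal (norm (u x)) * (\<integral>\<^sup>+t. ennreal (norm (u t) * k (x - t)) \<partial>lborel) \<partial>lborel)"
proof -
 have bd: "ennreal (norm (integral\<^sup>L lborel h)) <= (\<integral>\<^sup>+x. ennreal (norm (h x)) \<partial>lborel)" for h :: "real^'n => complex"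
 by (cases "integrable lborel h") (auto simp: not_integrable_integral_eq intro: integral_norm_bound_ennreal)
 have "ennreal (norm (LINT x|lborel. cnj (u x) * (LINT t|lborel. u t * cplx (k (x - t)))))
 <= (\<integral>\<^sup>+x. ennreal (norm (cnj (u x) * (LINT t|lborel. u t * cplx (k (x - t))))) \<partial>lborel)"
 by (rule bd)
 also have "... <= (\<integral>\<^sup>+x. ennreal (norm (u x)) * (\<integral>\<^sup>+t. ennreal (norm (u t) * k (x - t)) \<partial>lborel) \<partial>lborel)"
 proof (rule nn_integral_mono)
 fix x
 have "ennreal (norm (LINT t|lborel. u t * cplx (k (x - t)))) <= (\<integral>\<^sup>+t. ennreal (norm (u t * cplx (k (x - t)))) \<partial>lborel)"
 by (rule bd)
 also have "... = (\<integral>\<^sup>+t. ennreal (norm (u t) * k (x - t)) \<partial>lborel)"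
 using k0 by (simp add: norm_mult)
 finally show "ennreal (norm (cnj (u x) * (LINT t|lborel. u t * cplx (k (x - t))))) <= ennreal (norm (u x)) * (\<integral>\<^sup>+t. ennreal (norm (u t) * k (x - t)) \<partial>lborel)"
 by (simp add: norm_mult ennreal_mult mult_left_mono)
 qed
 finally show ?thesis .
qed
also have "... = (\<integral>\<^sup>+x. \<integral>\<^sup>+t. ennreal (norm (u x) * norm (u t) * k (x - t)) \<partial>lborel \<partial>lborel)"
 using k0 by (simp add: nn_integral_cmult[symmetric] ennreal_mult[symmetric] mult.assoc)
also have "... <= (\<integral>\<^sup>+x. \<integral>\<^sup>+t. ennreal ((norm (u x))\<^sup>2 / 2) * ennreal (k (t - x)) + ennreal ((norm (u t))\<^sup>2 / 2) * ennreal (k (x - t)) \<partial>lborel \<partial>lborel)"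
proof (intro nn_integral_mono)
 fix x t
 have "norm (u x) * norm (u t) <= (norm (u x))\<^sup>2 / 2 + (norm (u t))\<^sup>2 / 2"
 using sum_squares_bound[of "norm (u x)" "norm (u t)"] by simp
 from mult_right_mono[OF this k0[of "x - t"]]
 show "ennreal (norm (u x) * norm (u t) * k (x - t)) <= ennreal ((norm (u x))\<^sup>2 / 2) * ennreal (k (t - x)) + ennreal ((norm (u t))\<^sup>2 / 2) * ennreal (k (x - t))"
 using k0 k_sym[of x t] by (simp add: ennreal_mult[symmetric] ennreal_plus[symmetric] distrib_right del: ennreal_plus)
qed
also have "... = (\<integral>\<^sup>+x. \<integral>\<^sup>+t. ennreal ((norm (u x))\<^sup>2 / 2) * ennreal (k (t - x)) \<partial>lborel \<partial>lborel) + (\<integral>\<^sup>+x. \<integral>\<^sup>+t. ennreal ((norm (u t))\<^sup>2 / 2) * ennreal (k (x - t)) \<partial>lborel \<partial>lborel)"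
 by (simp add: nn_integral_add)
also have "... = (\<integral>\<^sup>+t. ennreal ((norm (u t))\<^sup>2 / 2) * ennreal (?\<kappa>\<^sup>2) \<partial>lborel) + (\<integral>\<^sup>+t. ennreal ((norm (u t))\<^sup>2 / 2) * ennreal (?\<kappa>\<^sup>2) \<partial>lborel)"
proof -
 have "(\<integral>\<^sup>+x. \<integral>\<^sup>+t. ennreal ((norm (u t))\<^sup>2 / 2) * ennreal (k (x - t)) \<partial>lborel \<partial>lborel) = (\<integral>\<^sup>+t. \<integral>\<^sup>+x. ennreal ((norm (u t))\<^sup>2 / 2) * ennreal (k (x - t)) \<partial>lborel \<partial>lborel)"
 by (rule lborel_pair.Fubini') measurable
 also have "... = (\<integral>\<^sup>+t. ennreal ((norm (u t))\<^sup>2 / 2) * ennreal (?\<kappa>\<^sup>2) \<partial>lborel)"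
 by (simp add: nn_integral_cmult ktrans)
 finally have I2: "(\<integral>\<^sup>+x. \<integral>\<^sup>+t. ennreal ((norm (u t))\<^sup>2 / 2) * ennreal (k (x - t)) \<partial>lborel \<partial>lborel) = (\<integral>\<^sup>+t. ennreal ((norm (u t))\<^sup>2 / 2) * ennreal (?\<kappa>\<^sup>2) \<partial>lborel)" .
 have I1: "(\<integral>\<^sup>+x. \<integral>\<^sup>+t. ennreal ((norm (u x))\<^sup>2 / 2) * ennreal (k (t - x)) \<partial>lborel \<partial>lborel) = (\<integral>\<^sup>+t. ennreal ((norm (u t))\<^sup>2 / 2) * ennreal (?\<kappa>\<^sup>2) \<partial>lborel)"
 by (simp add: nn_integral_cmult ktrans)
 show ?thesis unfolding I1 I2 ..
qed
also have "...
 = (\<integral>\<^sup>+t. ennreal (?\<kappa>\<^sup>2) * ennreal ((norm (u t))\<^sup>2) \<partial>lborel)"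
 by (subst nn_integral_add[symmetric]) (auto intro!: nn_integral_cong simp: ennreal_mult[symmetric] ennreal_plus[symmetric] simp del: ennreal_plus)
also have "... = ennreal (?\<kappa>\<^sup>2) * ?N" by (rule nn_integral_cmult) simp
finally show ?thesis .
qed
define s where "s k = 1 / real (Suc k)" for k
have s: "s k > 0" for k by (simp add: s_def)
have s0: "s \<longlonglongrightarrow> 0" unfolding s_def by (rule LIMSEQ_Suc[OF lim_1_over_n])
show ?thesis
proof (rule nn_integral_le_limit[where f = "%k y. ennreal ((norm (FT u y))\<^sup>2 * exp (- ((s k)\<^sup>2 * (norm y)\<^sup>2 / 2)))"])
show "AE y in lborel. (%k. ennreal ((norm (FT u y))\<^sup>2 * exp (- ((s k)\<^sup>2 * (norm y)\<^sup>2 / 2)))) \<longlonglongrightarrow> ennreal ((norm (FT u y))\<^sup>2)"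
proof (intro AE_I2 tendsto_ennrealI)
 fix y
 have "(%k. (norm (FT u y))\<^sup>2 * exp (- ((s k)\<^sup>2 * (norm y)\<^sup>2 / 2))) \<longlonglongrightarrow> (norm (FT u y))\<^sup>2 * exp (- (0\<^sup>2 * (norm y)\<^sup>2 / 2))"
 by (intro tendsto_intros s0) auto
 thus "(%k. (norm (FT u y))\<^sup>2 * exp (- ((s k)\<^sup>2 * (norm y)\<^sup>2 / 2))) \<longlonglongrightarrow> (norm (FT u y))\<^sup>2" by simp
qed
show "(\<integral>\<^sup>+y. ennreal ((norm (FT u y))\<^sup>2 * exp (- ((s k)\<^sup>2 * (norm y)\<^sup>2 / 2))) \<partial>lborel) <= ennreal (?\<kappa>\<^sup>2) * ?N" for k
 by (rule reg[OF s])
qed measurable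
qed

text \<open>A vanishing convolution means that \<open>f\<close> times the Gaussian has an entire Laplace transform that vanishes on the reals, so its Fourier transform vanishes and inversion applies.\<close>
lemma gaussian_convolution_zero:
fixes f :: "real ^ 'n::finite => complex"
assumes [measurable]: "f \<in> borel_measurable borel"
and int: "!!b. integrable lborel (%t. norm (f t) * exp (b * norm t - (norm t)\<^sup>2 / 2))"
and zero: "!!x. (LINT t|lborel. f t * exp (- ((norm (x - t))\<^sup>2 / 2))) = 0"
shows "AE t in lborel. f t = 0"
proof -
let ?\<kappa> = "gauss_mass TYPE('n)"
define w where "w t = f t * exp (- ((norm t)\<^sup>2 / 2))" for t
have [measurable]: "w \<in> borel_measurable borel" unfolding w_def[abs_def] by measurable
have wint: "integrable lborel w"
by (rule Bochner_Integration.integrable_bound[OF int[of 0]]) (auto simp: w_def norm_mult)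
have FT0: "FT w y = 0" for y
proof -
define \<Phi> where "\<Phi> z = (LINT t|lborel. w t * exp (z * cplx (y \<bullet> t)))" for z
have "\<Phi> holomorphic_on UNIV" unfolding \<Phi>_def
proof (rule holomorphic_integral_param)
 fix R :: real
 show "\<exists>B. integrable lborel B \<and> (\<forall>t z. cmod z <= R --> cmod (w t * exp (z * cplx (y \<bullet> t))) <= B t)"
 proof (intro exI conjI allI impI)
 show "integrable lborel (%t. norm (f t) * exp ((R * norm y) * norm t - (norm t)\<^sup>2 / 2))" by (rule int)
 fix t z assume z: "cmod z <= R"
 have "cmod (exp (z * cplx (y \<bullet> t))) <= exp (cmod (z * cplx (y \<bullet> t)))"
 by (rule norm_exp)
 also have "... <= exp (R * norm y * norm t)"
 proof -
 have "cmod z * \<bar>y \<bullet> t\<bar> <= R * (norm y * norm t)"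
  using z Cauchy_Schwarz_ineq2[of y t] by (intro mult_mono) (auto intro: order_trans[OF norm_ge_zero])
 thus ?thesis by (simp add: norm_mult mult.assoc)
 qed
 finally have "cmod (exp (z * cplx (y \<bullet> t))) <= exp (R * norm y * norm t)" .
 hence "cmod (w t * exp (z * cplx (y \<bullet> t))) <= cmod (w t) * exp (R * norm y * norm t)"
 unfolding norm_mult by (rule mult_left_mono) simp
 also have "cmod (w t) = norm (f t) * exp (- ((norm t)\<^sup>2 / 2))" by (simp add: w_def norm_mult)
 also have "norm (f t) * exp (- ((norm t)\<^sup>2 / 2)) * exp (R * norm y * norm t) = norm (f t) * exp ((R * norm y) * norm t - (norm t)\<^sup>2 / 2)"
 by (simp add: mult.assoc exp_add[symmetric])
 finally show "cmod (w t * exp (z * cplx (y \<bullet> t))) <= norm (f t) * exp ((R * norm y) * norm t - (norm t)\<^sup>2 / 2)" .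
 qed
qed (auto intro!: holomorphic_intros)
moreover have "\<Phi> (cplx r) = 0" for r
proof -
 have "f t * exp (- ((norm (r *\<^sub>R y - t))\<^sup>2 / 2)) = exp (- (r\<^sup>2 * (norm y)\<^sup>2 / 2)) * (w t * exp (cplx r * cplx (y \<bullet> t)))" for t
 proof -
 have "(norm (r *\<^sub>R y - t))\<^sup>2 = r\<^sup>2 * (norm y)\<^sup>2 - 2 * r * (y \<bullet> t) + (norm t)\<^sup>2"
 unfolding power2_norm_eq_inner
 by (simp add: inner_diff_left inner_diff_right inner_commute power2_eq_square algebra_simps)
 hence *: "- ((norm (r *\<^sub>R y - t))\<^sup>2 / 2) = - (r\<^sup>2 * (norm y)\<^sup>2 / 2) + (- ((norm t)\<^sup>2 / 2) + r * (y \<bullet> t))"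
 by (simp add: field_simps)
 show ?thesis unfolding * exp_add w_def by (simp add: exp_of_real[symmetric])
 qed
 hence "exp (- (r\<^sup>2 * (norm y)\<^sup>2 / 2)) * \<Phi> (cplx r) = 0"
 using zero[of "r *\<^sub>R y"] by (simp add: \<Phi>_def)
 thus ?thesis by simp
qed
ultimately have "\<Phi> (- \<i>) = 0" by (rule entire_zero_on_reals)
thus ?thesis by (simp add: \<Phi>_def FT_def inner_commute)
qed
have "AE t in lborel. cplx (?\<kappa>\<^sup>2) * w t = FT (FT w) (- t)"
by (rule fourier_inversion[OF wint]) (simp add: FT0[abs_def])
thus ?thesis
proof eventually_elim
case (elim t)
have "FT (FT w) (- t) = 0" by (simp add: FT_def[of "FT w"] FT0)
thus ?case using elim gauss_mass_pos[where 'n='n] by (simp add: w_def)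
qed
qed

section \<open>The transform on square-integrable functions\<close>

lemma lebesgue_borel_representative:
fixes f :: "real ^ 'n::finite => complex"
assumes "f \<in> borel_measurable lebesgue"
obtains g where "g \<in> borel_measurable borel" "AE x in lborel. f x = g x"
proof -
have "(%x. Re (f x)) \<in> borel_measurable (completion lborel)"
using assms by measurable
from completion_ex_borel_measurable_real[OF this] obtain a
where a: "a \<in> borel_measurable lborel" "AE x in lborel. Re (f x) = a x" by (rule bexE)
have "(%x. Im (f x)) \<in> borel_measurable (completion lborel)"
using assms by measurable
from completion_ex_borel_measurable_real[OF this] obtain b
where b: "b \<in> borel_measurable lborel" "AE x in lborel. Im (f x) = b x" by (rule bexE)
have [measurable]: "a \<in> borel_measurable borel" "b \<in> borel_measurable borel" using a b by auto
have "(%x. Complex (a x) (b x)) \<in> borel_measurable borel"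
unfolding Complex_eq by measurable
moreover have "AE x in lborel. f x = Complex (a x) (b x)"
using a(2) b(2) by eventually_elim (simp add: complex_eq_iff)
ultimately show ?thesis using that by blast
qed

lemma AE_lebesgue_iff: "(AE x in lebesgue. P x) \<longleftrightarrow> (AE x in lborel. P x)"
by (rule AE_completion_iff)

lemma lebesgue_measurable_cong_AE:
fixes f g :: "real ^ 'n::finite => complex"
assumes "g \<in> borel_measurable borel" "AE x in lborel. f x = g x"
shows "f \<in> borel_measurable lebesgue"
proof -
have "g \<in> borel_measurable lebesgue"
using assms(1) by (intro measurable_completion) auto
thus ?thesis
by (rule borel_measurable_AE) (use assms(2) in \<open>auto simp: AE_lebesgue_iff elim: eventually_mono\<close>)
qed

definition fourier_const :: "'n::finite itself => complex" where
"fourier_const _ = cplx ((2 * pi) powr (- (real CARD('n) / 2)))"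

lemma fourier_const_nz [simp]: "fourier_const TYPE('n::finite) ~= 0"
by (simp add: fourier_const_def)

lemma integrable_lebesgue_cong:
fixes f g :: "real ^ 'n::finite => complex"
assumes g: "g \<in> borel_measurable borel" and ae: "AE x in lborel. f x = g x"
shows "integrable lebesgue f \<longleftrightarrow> integrable lborel g"
and "integral\<^sup>L lebesgue f = integral\<^sup>L lborel g"
proof -
have f: "f \<in> borel_measurable lebesgue" by (rule lebesgue_measurable_cong_AE[OF assms])
have g': "g \<in> borel_measurable lebesgue" using g by (intro measurable_completion) auto
have ae': "AE x in lebesgue. f x = g x" using ae by (simp add: AE_lebesgue_iff)
show "integrable lebesgue f \<longleftrightarrow> integrable lborel g"
using integrable_cong_AE[OF f g' ae'] g by (simp add: integrable_completion)
show "integral\<^sup>L lebesgue f = integral\<^sup>L lborel g"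
using integral_cong_AE[OF f g' ae'] g by (simp add: integral_completion)
qed

lemma fourier_integral_FT:
fixes f g :: "real ^ 'n::finite => complex"
assumes g [measurable]: "g \<in> borel_measurable borel" and ae: "AE x in lborel. f x = g x"
shows "fourier_integral f y = fourier_const TYPE('n) * FT g y"
proof -
have "(LINT x|lebesgue. f x * exp (- (\<i> * cplx (x \<bullet> y)))) = (LINT x|lborel. g x * exp (- (\<i> * cplx (x \<bullet> y))))"
by (rule integrable_lebesgue_cong(2)) (use ae in \<open>auto elim: eventually_mono\<close>)
thus ?thesis by (simp add: fourier_integral_def fourier_const_def FT_def)
qed

lemma nn_integral_lebesgue_eq:
"(\<integral>\<^sup>+x. F x \<partial>lebesgue) = (\<integral>\<^sup>+x. F x \<partial>lborel)"
by (rule nn_integral_completion)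

lemma in_L1_iff:
assumes "g \<in> borel_measurable borel" "AE x in lborel. f x = g x"
shows "in_L1 f \<longleftrightarrow> integrable lborel g"
unfolding in_L1_def by (rule integrable_lebesgue_cong(1)[OF assms])

lemma in_L2_iff_nn:
fixes f :: "real ^ 'n::finite => complex"
shows "in_L2 f \<longleftrightarrow> f \<in> borel_measurable lebesgue \<and> (\<integral>\<^sup>+x. ennreal ((norm (f x))\<^sup>2) \<partial>lebesgue) < \<infinity>"
unfolding in_L2_def by (auto simp: integrable_iff_bounded)

lemma in_L2_iff:
fixes f :: "real ^ 'n::finite => complex"
assumes g: "g \<in> borel_measurable borel" and ae: "AE x in lborel. f x = g x"
shows "in_L2 f \<longleftrightarrow> (\<integral>\<^sup>+x. ennreal ((norm (g x))\<^sup>2) \<partial>lborel) < \<infinity>"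
proof -
have "(\<integral>\<^sup>+x. ennreal ((norm (f x))\<^sup>2) \<partial>lborel) = (\<integral>\<^sup>+x. ennreal ((norm (g x))\<^sup>2) \<partial>lborel)"
using ae by (intro nn_integral_cong_AE) (auto elim: eventually_mono)
thus ?thesis
unfolding in_L2_iff_nn nn_integral_lebesgue_eq using lebesgue_measurable_cong_AE[OF assms] by simp
qed

lemma fourier_integral_measurable:
fixes u :: "real ^ 'n::finite => complex"
assumes "in_L1 u"
shows "fourier_integral u \<in> borel_measurable borel"
proof -
have "u \<in> borel_measurable lebesgue" using assms by (auto simp: in_L1_def)
then obtain g where [measurable]: "g \<in> borel_measurable borel" and ae: "AE x in lborel. u x = g x"
by (rule lebesgue_borel_representative)
have "fourier_integral u = (%y. fourier_const TYPE('n) * FT g y)"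
using fourier_integral_FT[OF _ ae] by auto
thus ?thesis by simp
qed

definition L2_const :: "'n::finite itself => real" where
"L2_const _ = (norm (fourier_const TYPE('n)))\<^sup>2 * (gauss_mass TYPE('n))\<^sup>2"

lemma fourier_integral_L2_bound:
fixes u :: "real ^ 'n::finite => complex"
assumes u: "in_L1 u"
shows "(\<integral>\<^sup>+y. ennreal ((norm (fourier_integral u y))\<^sup>2) \<partial>lebesgue)
<= ennreal (L2_const TYPE('n)) * (\<integral>\<^sup>+x. ennreal ((norm (u x))\<^sup>2) \<partial>lebesgue)"
proof -
have "u \<in> borel_measurable lebesgue" using assms by (auto simp: in_L1_def)
then obtain g where [measurable]: "g \<in> borel_measurable borel" and ae: "AE x in lborel. u x = g x"
by (rule lebesgue_borel_representative)
have g: "integrable lborel g" using u in_L1_iff[OF _ ae] by simp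
have "(\<integral>\<^sup>+y. ennreal ((norm (fourier_integral u y))\<^sup>2) \<partial>lebesgue)
= (\<integral>\<^sup>+y. ennreal ((norm (fourier_const TYPE('n)))\<^sup>2) * ennreal ((norm (FT g y))\<^sup>2) \<partial>lborel)"
unfolding nn_integral_lebesgue_eq using fourier_integral_FT[OF _ ae]
by (simp add: norm_mult power_mult_distrib ennreal_mult)
also have "... = ennreal ((norm (fourier_const TYPE('n)))\<^sup>2) * (\<integral>\<^sup>+y. ennreal ((norm (FT g y))\<^sup>2) \<partial>lborel)"
by (rule nn_integral_cmult) simp
also have "... <= ennreal ((norm (fourier_const TYPE('n)))\<^sup>2) * (ennreal ((gauss_mass TYPE('n))\<^sup>2) * (\<integral>\<^sup>+x. ennreal ((norm (g x))\<^sup>2) \<partial>lborel))"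
by (intro mult_left_mono FT_L2_bound g) auto
also have "(\<integral>\<^sup>+x. ennreal ((norm (g x))\<^sup>2) \<partial>lborel) = (\<integral>\<^sup>+x. ennreal ((norm (u x))\<^sup>2) \<partial>lebesgue)"
unfolding nn_integral_lebesgue_eq using ae by (intro nn_integral_cong_AE) (auto elim: eventually_mono)
finally show ?thesis by (simp add: L2_const_def ennreal_mult mult.assoc)
qed

lemma fourier_integral_diff:
assumes "in_L1 u" "in_L1 v"
shows "fourier_integral (%x. u x - v x) y = fourier_integral u y - fourier_integral v y"
proof -
have mod: "integrable lebesgue (%x. w x * exp (- (\<i> * cplx (x \<bullet> y))))" if "in_L1 w" for w
proof (rule Bochner_Integration.integrable_bound)
show "integrable lebesgue w" using that by (simp add: in_L1_def)
have "(%x. exp (- (\<i> * cplx (x \<bullet> y)))) \<in> borel_measurable lebesgue"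
 by (intro measurable_completion) measurable
thus "(%x. w x * exp (- (\<i> * cplx (x \<bullet> y)))) \<in> borel_measurable lebesgue"
 using that by (auto simp: in_L1_def)
qed (auto simp: norm_mult)
show ?thesis
unfolding fourier_integral_def left_diff_distrib
by (simp add: Bochner_Integration.integral_diff[OF mod[OF assms(1)] mod[OF assms(2)]] right_diff_distrib)
qed

lemma in_L1_diff: "in_L1 u ==> in_L1 v ==> in_L1 (%x. u x - v x)"
unfolding in_L1_def by (rule Bochner_Integration.integrable_diff)

abbreviation L2_dist2 :: "(real ^ 'n::finite => complex) => (real ^ 'n => complex) => ennreal" where
"L2_dist2 u v \<equiv> (\<integral>\<^sup>+x. ennreal ((norm (u x - v x))\<^sup>2) \<partial>lebesgue)"

lemma L2_dist2_triangle:
fixes u v w :: "real ^ 'n::finite => complex"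
assumes [measurable]: "u \<in> borel_measurable lebesgue" "v \<in> borel_measurable lebesgue" "w \<in> borel_measurable lebesgue"
shows "L2_dist2 u w <= 2 * L2_dist2 u v + 2 * L2_dist2 v w"
proof -
have "L2_dist2 u w <= (\<integral>\<^sup>+x. 2 * ennreal ((norm (u x - v x))\<^sup>2) + 2 * ennreal ((norm (v x - w x))\<^sup>2) \<partial>lebesgue)"
proof (rule nn_integral_mono)
fix x
let ?a = "norm (u x - v x)" and ?b = "norm (v x - w x)"
have "norm (u x - w x) <= ?a + ?b"
 using norm_triangle_ineq[of "u x - v x" "v x - w x"] by simp
hence "(norm (u x - w x))\<^sup>2 <= (?a + ?b)\<^sup>2" by (intro power_mono) auto
also have "... <= 2 * ?a\<^sup>2 + 2 * ?b\<^sup>2"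
 using sum_squares_bound[of ?a ?b] by (simp add: power2_sum)
finally have "ennreal ((norm (u x - w x))\<^sup>2) <= ennreal (2 * ?a\<^sup>2 + 2 * ?b\<^sup>2)" by (rule ennreal_leI)
thus "ennreal ((norm (u x - w x))\<^sup>2) <= 2 * ennreal (?a\<^sup>2) + 2 * ennreal (?b\<^sup>2)"
 by (simp add: ennreal_mult)
qed
also have "... = 2 * L2_dist2 u v + 2 * L2_dist2 v w"
by (subst nn_integral_add) (auto simp: nn_integral_cmult)
finally show ?thesis .
qed

lemma L2_dist2_fourier:
fixes u v :: "real ^ 'n::finite => complex"
assumes "in_L1 u" "in_L1 v"
shows "L2_dist2 (fourier_integral u) (fourier_integral v) <= ennreal (L2_const TYPE('n)) * L2_dist2 u v"
using fourier_integral_L2_bound[OF in_L1_diff[OF assms]] unfolding fourier_integral_diff[OF assms] .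

lemma fourier_integral_lebesgue_measurable:
"in_L1 u ==> fourier_integral u \<in> borel_measurable lebesgue"
by (intro measurable_completion) (simp add: fourier_integral_measurable)

lemma in_L2_fourier_integral:
fixes u :: "real ^ 'n::finite => complex"
assumes "in_L1 u" "in_L2 u"
shows "in_L2 (fourier_integral u)"
proof -
have "ennreal (L2_const TYPE('n)) * (\<integral>\<^sup>+x. ennreal ((norm (u x))\<^sup>2) \<partial>lebesgue) < \<infinity>"
using assms(2) by (auto simp: in_L2_iff_nn ennreal_mult_less_top)
thus ?thesis
using fourier_integral_L2_bound[OF assms(1)] fourier_integral_lebesgue_measurable[OF assms(1)]
by (auto simp: in_L2_iff_nn intro: le_less_trans)
qed

lemma truncation_approx:
fixes f :: "real ^ 'n::finite => complex"
assumes f: "in_L2 f"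
defines "u \<equiv> %k x. indicator (ball 0 (real k)) x * f x"
shows "in_L1 (u k)" "in_L2 (u k)" "(%k. L2_dist2 (u k) f) \<longlonglongrightarrow> 0"
proof -
have fm [measurable]: "f \<in> borel_measurable lebesgue" and fi: "integrable lebesgue (%x. (norm (f x))\<^sup>2)"
using f by (auto simp: in_L2_def)
have um [measurable]: "u k \<in> borel_measurable lebesgue" for k
proof -
have "(%x::real^'n. indicator (ball 0 (real k)) x :: complex) \<in> borel_measurable lebesgue"
 by (intro measurable_completion borel_measurable_indicator) simp
thus ?thesis unfolding u_def using fm by (rule borel_measurable_times)
qed
have bint: "integrable lebesgue (%x::real^'n. indicator (ball 0 (real k)) x :: real)"
by (rule integrable_real_indicator) (use emeasure_lborel_ball_finite[of "0::real^'n" "real k"] in simp_all)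
show "in_L1 (u k)"
unfolding in_L1_def
proof (rule Bochner_Integration.integrable_bound)
show "integrable lebesgue (%x::real^'n. indicator (ball 0 (real k)) x + (norm (f x))\<^sup>2 :: real)"
 using bint fi by (rule Bochner_Integration.integrable_add)
show "AE x in lebesgue. norm (u k x) <= norm (indicator (ball 0 (real k)) x + (norm (f x))\<^sup>2)"
proof (rule AE_I2)
 fix x :: "real ^ 'n"
 have "2 * norm (f x) <= 1 + (norm (f x))\<^sup>2"
 using sum_squares_bound[of 1 "norm (f x)"] by simp
 hence "norm (f x) <= 1 + (norm (f x))\<^sup>2" using norm_ge_zero[of "f x"] by linarith
 thus "norm (u k x) <= norm (indicator (ball 0 (real k)) x + (norm (f x))\<^sup>2)"
 by (simp add: u_def indicator_def norm_mult)
qed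
qed (rule um)
have "integrable lebesgue (%x. (norm (u k x))\<^sup>2)"
proof (rule Bochner_Integration.integrable_bound[OF fi])
show "(%x. (norm (u k x))\<^sup>2) \<in> borel_measurable lebesgue"
 by (intro borel_measurable_power measurable_compose[OF um borel_measurable_norm])
show "AE x in lebesgue. norm ((norm (u k x))\<^sup>2) <= norm ((norm (f x))\<^sup>2)"
 by (rule AE_I2) (simp add: u_def indicator_def)
qed
thus "in_L2 (u k)" using um by (simp add: in_L2_def)
have "(%k. L2_dist2 (u k) f) \<longlonglongrightarrow> (\<integral>\<^sup>+(x::real^'n). 0 \<partial>lebesgue)"
proof (rule nn_integral_dominated_convergence[where w = "%x. ennreal ((norm (f x))\<^sup>2)"])
show "AE x in lebesgue. ennreal ((norm (u j x - f x))\<^sup>2) <= ennreal ((norm (f x))\<^sup>2)" for j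
 by (rule AE_I2) (simp add: u_def indicator_def)
show "(\<integral>\<^sup>+x. ennreal ((norm (f x))\<^sup>2) \<partial>lebesgue) < \<infinity>" using f by (simp add: in_L2_iff_nn)
show "AE x in lebesgue. (%k. ennreal ((norm (u k x - f x))\<^sup>2)) \<longlonglongrightarrow> 0"
proof (rule AE_I2)
 fix x :: "real ^ 'n"
 obtain N where "norm x < real N" using reals_Archimedean2 by blast
 hence "\<forall>\<^sub>F k in sequentially. 0 = ennreal ((norm (u k x - f x))\<^sup>2)"
 by (auto simp: eventually_sequentially u_def indicator_def intro!: exI[of _ N])
 thus "(%k. ennreal ((norm (u k x - f x))\<^sup>2)) \<longlonglongrightarrow> 0"
 by (rule Lim_transform_eventually[OF tendsto_const])
qed
qed measurable
thus "(%k. L2_dist2 (u k) f) \<longlonglongrightarrow> 0" by simp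
qed

text \<open>A rapidly Cauchy sequence converges almost everywhere, and Fatou identifies its pointwise limit with the limit in the mean.\<close>
lemma fast_L2_Cauchy_limit:
fixes v :: "nat => real ^ 'n::finite => complex"
assumes vm: "!!j. v j \<in> borel_measurable lebesgue"
and B: "B >= 0" and bd: "!!i j. j <= i ==> L2_dist2 (v i) (v j) <= ennreal (B / 4 ^ j)"
shows "\<exists>w. w \<in> borel_measurable lebesgue \<and> (\<forall>j. L2_dist2 w (v j) <= ennreal (B / 4 ^ j))"
proof -
note [measurable] = vm
define d where "d j x = norm (v (Suc j) x - v j x)" for j x
have [measurable]: "d j \<in> borel_measurable lebesgue" for j unfolding d_def[abs_def] by measurable
have "(\<integral>\<^sup>+x. suminf (%j. ennreal (2 ^ j * (d j x)\<^sup>2)) \<partial>lebesgue) = suminf (%j. \<integral>\<^sup>+x. ennreal (2 ^ j * (d j x)\<^sup>2) \<partial>lebesgue)"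
by (rule nn_integral_suminf) measurable
also have "... <= suminf (%j. ennreal (B * (1 / 2) ^ j))"
proof (rule suminf_le)
fix j
have "(\<integral>\<^sup>+x. ennreal (2 ^ j * (d j x)\<^sup>2) \<partial>lebesgue) = ennreal (2 ^ j) * L2_dist2 (v (Suc j)) (v j)"
 by (simp add: ennreal_mult nn_integral_cmult d_def)
also have "... <= ennreal (2 ^ j) * ennreal (B / 4 ^ j)"
 by (intro mult_left_mono bd) auto
also have "... = ennreal (B * (1 / 2) ^ j)"
proof -
 have "(4::real) ^ j = 2 ^ j * 2 ^ j" by (simp add: power_mult_distrib[symmetric])
 thus ?thesis using B by (simp add: ennreal_mult[symmetric] power_one_over field_simps)
qed
finally show "(\<integral>\<^sup>+x. ennreal (2 ^ j * (d j x)\<^sup>2) \<partial>lebesgue) <= ennreal (B * (1 / 2) ^ j)" .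
qed auto
also have "... < \<infinity>"
proof -
have "summable (%j. B * (1 / 2 :: real) ^ j)" by (intro summable_mult summable_geometric) simp
thus ?thesis using B by (simp add: suminf_ennreal2 less_top[symmetric])
qed
finally have fin: "(\<integral>\<^sup>+x. suminf (%j. ennreal (2 ^ j * (d j x)\<^sup>2)) \<partial>lebesgue) < \<infinity>" .
have "AE x in lebesgue. suminf (%j. ennreal (2 ^ j * (d j x)\<^sup>2)) ~= \<infinity>"
by (rule nn_integral_PInf_AE) (use fin in auto)
hence conv: "AE x in lebesgue. convergent (%j. v j x)"
proof eventually_elim
case (elim x)
have s2: "summable (%j. 2 ^ j * (d j x)\<^sup>2)"
 by (rule summable_suminf_not_top) (use elim in \<open>auto simp: top_ennreal_def[symmetric]\<close>)
have "summable (%j. (1 / 2 :: real) ^ j + 2 ^ j * (d j x)\<^sup>2)"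
 by (intro summable_add s2 summable_geometric) simp
hence "summable (%j. v (Suc j) x - v j x)"
proof (rule summable_comparison_test')
 fix j :: nat
 have "2 ^ j * d j x <= 1 + (2 ^ j * d j x)\<^sup>2"
 proof -
 have "0 <= 2 ^ j * d j x" by (simp add: d_def)
 thus ?thesis using sum_squares_bound[of 1 "2 ^ j * d j x"] by (simp add: power_mult_distrib)
 qed
 hence "d j x <= (1 + (2 ^ j * d j x)\<^sup>2) / 2 ^ j" by (simp add: field_simps)
 also have "... = (1 / 2) ^ j + 2 ^ j * (d j x)\<^sup>2"
 by (simp add: power_mult_distrib power2_eq_square field_simps power_one_over)
 finally show "norm (v (Suc j) x - v j x) <= (1 / 2) ^ j + 2 ^ j * (d j x)\<^sup>2" by (simp add: d_def)
qed
hence "convergent (%n. \<Sum>j<n. v (Suc j) x - v j x)" by (simp add: summable_iff_convergent)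
hence "convergent (%n. v n x - v 0 x)" by (simp only: sum_lessThan_telescope[of "%n. v n x"])
hence "convergent (%n. (v n x - v 0 x) + v 0 x)" by (intro convergent_add convergent_const)
thus ?case by simp
qed
define w where "w x = lim (%j. v j x)" for x
have wm: "w \<in> borel_measurable lebesgue" unfolding w_def[abs_def] by (rule borel_measurable_lim_metric) (rule vm)
have lim: "AE x in lebesgue. (%i. v i x) \<longlonglongrightarrow> w x"
using conv by eventually_elim (simp add: w_def convergent_LIMSEQ_iff)
have "L2_dist2 w (v j) <= ennreal (B / 4 ^ j)" for j
proof (rule nn_integral_le_limit[where f = "%i x. ennreal ((norm (v i x - v j x))\<^sup>2)"])
show "AE x in lebesgue. (%i. ennreal ((norm (v i x - v j x))\<^sup>2)) \<longlonglongrightarrow> ennreal ((norm (w x - v j x))\<^sup>2)"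
 using lim by eventually_elim (intro tendsto_ennrealI tendsto_intros)
show "L2_dist2 (v i) (v j) <= ennreal (B / 4 ^ j)" if "i >= j" for i by (rule bd[OF that])
qed measurable
thus ?thesis using wm by blast
qed

text \<open>The truncations to balls approximate the function, and the bound on the square norm makes their transforms a Cauchy sequence.\<close>
theorem fourier_L2_exists:
fixes f :: "real ^ 'n::finite => complex"
assumes f: "in_L2 f"
shows "\<exists>g. is_fourier_L2 f g"
proof -
have fm: "f \<in> borel_measurable lebesgue" using f by (simp add: in_L2_def)
define u where "u k x = indicator (ball 0 (real k)) x * f x" for k :: nat and x
have u: "in_L1 (u k)" "in_L2 (u k)" "(%k. L2_dist2 (u k) f) \<longlonglongrightarrow> 0" for k
unfolding u_def[abs_def] using truncation_approx[OF f] by auto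
have um: "u k \<in> borel_measurable lebesgue" for k using u(2)[of k] by (simp add: in_L2_def)
let ?B = "L2_const TYPE('n)"
have B0: "?B >= 0" by (simp add: L2_const_def)
have "\<exists>k. L2_dist2 (u k) f < ennreal (1 / 4 ^ j)" for j :: nat
proof -
have "\<forall>\<^sub>F k in sequentially. L2_dist2 (u k) f < ennreal (1 / 4 ^ j)"
 using u(3) by (rule order_tendstoD) simp
thus ?thesis by (auto simp: eventually_sequentially)
qed
then obtain r where r: "!!j. L2_dist2 (u (r j)) f < ennreal (1 / 4 ^ j)" by metis
define v where "v j = fourier_integral (u (r j))" for j
have vm: "v j \<in> borel_measurable lebesgue" for j
unfolding v_def by (rule fourier_integral_lebesgue_measurable[OF u(1)])
have vbd: "L2_dist2 (v i) (v j) <= ennreal (?B * 4 / 4 ^ j)" if "j <= i" for i j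
proof -
have "L2_dist2 (u (r i)) (u (r j)) <= 2 * L2_dist2 (u (r i)) f + 2 * L2_dist2 f (u (r j))"
 by (rule L2_dist2_triangle) (use um fm in auto)
also have "... <= 2 * ennreal (1 / 4 ^ i) + 2 * ennreal (1 / 4 ^ j)"
 using r[of i] r[of j] by (intro add_mono mult_left_mono) (auto simp: norm_minus_commute)
also have "... <= 2 * ennreal (1 / 4 ^ j) + 2 * ennreal (1 / 4 ^ j)"
 using that by (intro add_mono mult_left_mono ennreal_leI) (auto simp: field_simps intro!: power_increasing)
also have "... = ennreal (4 / 4 ^ j)"
 by (simp add: ennreal_plus[symmetric] ennreal_mult'[symmetric] ennreal_numeral[symmetric] del: ennreal_plus ennreal_numeral)
finally have "ennreal ?B * L2_dist2 (u (r i)) (u (r j)) <= ennreal ?B * ennreal (4 / 4 ^ j)"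
 by (rule mult_left_mono) simp
thus ?thesis
 using L2_dist2_fourier[OF u(1)[of "r i"] u(1)[of "r j"]] B0
 by (simp add: v_def ennreal_mult'[symmetric])
qed
obtain w where w: "w \<in> borel_measurable lebesgue" "!!j. L2_dist2 w (v j) <= ennreal (?B * 4 / 4 ^ j)"
using fast_L2_Cauchy_limit[OF vm _ vbd] B0 by fastforce
have null: "(%j. ennreal (c / 4 ^ j)) \<longlonglongrightarrow> 0" for c :: real
proof -
have "(%j. c * (1 / 4 :: real) ^ j) \<longlonglongrightarrow> c * 0" by (intro tendsto_intros LIMSEQ_realpow_zero) auto
hence "(%j. ennreal (c / 4 ^ j)) \<longlonglongrightarrow> ennreal 0" by (intro tendsto_ennrealI) (simp add: power_one_over field_simps)
thus ?thesis by simp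
qed
have "in_L2 w"
proof -
have "(\<integral>\<^sup>+x. ennreal ((norm (w x - 0))\<^sup>2) \<partial>lebesgue) <= 2 * L2_dist2 w (v 0) + 2 * L2_dist2 (v 0) (%_. 0)"
 using L2_dist2_triangle[OF w(1) vm[of 0], of "%_. 0"] by simp
also have "... < \<infinity>"
proof -
 have "in_L2 (v 0)" unfolding v_def by (intro in_L2_fourier_integral u)
 hence "L2_dist2 (v 0) (%_. 0) < \<infinity>" by (simp add: in_L2_iff_nn)
 moreover have "L2_dist2 w (v 0) < \<infinity>" using w(2)[of 0] by (rule le_less_trans) simp
 ultimately show ?thesis by (simp add: ennreal_mult_less_top)
qed
finally show ?thesis using w(1) by (simp add: in_L2_iff_nn)
qed
moreover have "L2_tendsto (%j. u (r j)) f"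
unfolding L2_tendsto_def
by (rule tendsto_sandwich[OF _ _ tendsto_const null[of 1]]) (use r in \<open>auto intro!: always_eventually less_imp_le\<close>)
moreover have "L2_tendsto (%j. fourier_integral (u (r j))) w"
unfolding L2_tendsto_def v_def[symmetric]
by (rule tendsto_sandwich[OF _ _ tendsto_const null[of "?B * 4"]]) (use w(2) in \<open>auto simp: norm_minus_commute\<close>)
moreover have "\<forall>j. in_L1 (u (r j)) \<and> in_L2 (u (r j))" using u by simp
ultimately show ?thesis unfolding is_fourier_L2_def
by (intro exI[of _ w] conjI exI[of _ "%j. u (r j)"])
qed

lemma is_fourier_fourier_L2: "in_L2 f ==> is_fourier_L2 f (fourier_L2 f)"
unfolding fourier_L2_def using fourier_L2_exists by (rule someI_ex)

lemma is_fourier_L2_unique: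
fixes f :: "real ^ 'n::finite => complex"
assumes f: "f \<in> borel_measurable lebesgue" and g: "is_fourier_L2 f g" and g': "is_fourier_L2 f g'"
shows "AE x in lebesgue. g x = g' x"
proof -
obtain u where u: "!!k. in_L1 (u k)" "!!k. in_L2 (u k)" "L2_tendsto u f" "L2_tendsto (%k. fourier_integral (u k)) g"
using g by (auto simp: is_fourier_L2_def)
obtain u' where u': "!!k. in_L1 (u' k)" "!!k. in_L2 (u' k)" "L2_tendsto u' f" "L2_tendsto (%k. fourier_integral (u' k)) g'"
using g' by (auto simp: is_fourier_L2_def)
have gm: "g \<in> borel_measurable lebesgue" "g' \<in> borel_measurable lebesgue"
using g g' by (auto simp: is_fourier_L2_def in_L2_def)
have um: "u k \<in> borel_measurable lebesgue" "u' k \<in> borel_measurable lebesgue" for k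
using u(2) u'(2) by (auto simp: in_L2_def)
have vm: "fourier_integral (u k) \<in> borel_measurable lebesgue" "fourier_integral (u' k) \<in> borel_measurable lebesgue" for k
using u(1) u'(1) fourier_integral_lebesgue_measurable by auto
let ?B = "ennreal (L2_const TYPE('n))"
define e where "e k = 2 * L2_dist2 (fourier_integral (u k)) g + 2 * (2 * (?B * (2 * L2_dist2 (u k) f + 2 * L2_dist2 (u' k) f)) + 2 * L2_dist2 (fourier_integral (u' k)) g')" for k
have bd: "L2_dist2 g g' <= e k" for k
proof -
have "L2_dist2 g g' <= 2 * L2_dist2 g (fourier_integral (u k)) + 2 * L2_dist2 (fourier_integral (u k)) g'"
 by (rule L2_dist2_triangle) (use gm vm in auto)
also have "... <= 2 * L2_dist2 g (fourier_integral (u k)) + 2 * (2 * L2_dist2 (fourier_integral (u k)) (fourier_integral (u' k)) + 2 * L2_dist2 (fourier_integral (u' k)) g')"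
 by (intro add_mono mult_left_mono L2_dist2_triangle) (use gm vm in auto)
also have "... <= 2 * L2_dist2 g (fourier_integral (u k)) + 2 * (2 * (?B * L2_dist2 (u k) (u' k)) + 2 * L2_dist2 (fourier_integral (u' k)) g')"
 by (intro add_mono mult_left_mono L2_dist2_fourier order_refl u u') auto
also have "... <= 2 * L2_dist2 g (fourier_integral (u k)) + 2 * (2 * (?B * (2 * L2_dist2 (u k) f + 2 * L2_dist2 f (u' k))) + 2 * L2_dist2 (fourier_integral (u' k)) g')"
 by (intro add_mono mult_left_mono L2_dist2_triangle order_refl um f) auto
finally show ?thesis unfolding e_def by (simp add: norm_minus_commute)
qed
have "e \<longlonglongrightarrow> 2 * 0 + 2 * (2 * (?B * (2 * 0 + 2 * 0)) + 2 * 0)"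
unfolding e_def using u(3,4) u'(3,4) unfolding L2_tendsto_def
by (intro tendsto_add ennreal_tendsto_cmult) auto
hence "e \<longlonglongrightarrow> 0" by simp
hence "L2_dist2 g g' <= 0"
by (rule tendsto_lowerbound) (use bd in auto)
hence "AE x in lebesgue. ennreal ((norm (g x - g' x))\<^sup>2) = 0"
using gm by (subst (asm) le_zero_eq, subst (asm) nn_integral_0_iff_AE) auto
thus ?thesis by eventually_elim simp
qed

lemma fourier_L2_eq_integral:
assumes "in_L1 f" "in_L2 f"
shows "AE y in lebesgue. fourier_L2 f y = fourier_integral f y"
proof (rule is_fourier_L2_unique)
show "f \<in> borel_measurable lebesgue" using assms(2) by (simp add: in_L2_def)
show "is_fourier_L2 f (fourier_L2 f)" by (rule is_fourier_fourier_L2[OF assms(2)])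
show "is_fourier_L2 f (fourier_integral f)"
unfolding is_fourier_L2_def
using assms in_L2_fourier_integral[OF assms] by (auto intro!: exI[of _ "%_. f"] simp: L2_tendsto_def)
qed

section \<open>The functional for integrable representatives\<close>

lemma L2_pairing_tendsto_zero:
fixes h :: "nat => 'a => complex"
assumes [measurable]: "!!k. h k \<in> borel_measurable M" "w \<in> borel_measurable M"
and h0: "(%k. \<integral>\<^sup>+x. ennreal ((norm (h k x))\<^sup>2) \<partial>M) \<longlonglongrightarrow> 0"
and w: "(\<integral>\<^sup>+x. ennreal ((norm (w x))\<^sup>2) \<partial>M) < \<infinity>"
shows "(%k. LINT x|M. h k x * w x) \<longlonglongrightarrow> (0::complex)"
proof -
let ?W = "\<integral>\<^sup>+x. ennreal ((norm (w x))\<^sup>2) \<partial>M"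
let ?A = "%k. \<integral>\<^sup>+x. ennreal ((norm (h k x))\<^sup>2) \<partial>M"
have le: "ennreal ((norm (LINT x|M. h k x * w x))\<^sup>2) <= ?W * ?A k" for k
proof -
have "ennreal (norm (LINT x|M. h k x * w x)) <= (\<integral>\<^sup>+x. ennreal (norm (h k x * w x)) \<partial>M)"
 by (cases "integrable M (%x. h k x * w x)") (auto simp: not_integrable_integral_eq intro: integral_norm_bound_ennreal)
also have "... = (\<integral>\<^sup>+x. ennreal (norm (h k x)) * ennreal (norm (w x)) \<partial>M)"
 by (simp add: norm_mult ennreal_mult)
finally have "(ennreal (norm (LINT x|M. h k x * w x)))\<^sup>2 <= (\<integral>\<^sup>+x. ennreal (norm (h k x)) * ennreal (norm (w x)) \<partial>M)\<^sup>2"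
 by (rule power_mono) simp
also have "... <= (\<integral>\<^sup>+x. (ennreal (norm (h k x)))\<^sup>2 \<partial>M) * (\<integral>\<^sup>+x. (ennreal (norm (w x)))\<^sup>2 \<partial>M)"
 by (rule Cauchy_Schwarz_nn_integral) measurable
finally show ?thesis by (simp add: ennreal_power mult.commute)
qed
have "(%k. ?W * ?A k) \<longlonglongrightarrow> ?W * 0"
by (rule ennreal_tendsto_cmult) (use w h0 in auto)
hence lim: "(%k. ?W * ?A k) \<longlonglongrightarrow> 0" by simp
have "(%k. ennreal ((norm (LINT x|M. h k x * w x))\<^sup>2)) \<longlonglongrightarrow> 0"
by (rule tendsto_sandwich[OF _ _ tendsto_const lim]) (use le in auto)
hence "(%k. (norm (LINT x|M. h k x * w x))\<^sup>2) \<longlonglongrightarrow> 0"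
by (subst (asm) ennreal_tendsto_0_iff) auto
from tendsto_real_sqrt[OF this] have "(%k. norm (LINT x|M. h k x * w x)) \<longlonglongrightarrow> 0" by simp
thus ?thesis by (rule tendsto_norm_zero_cancel)
qed

text \<open>Approximants have transforms tending to zero. Pairing them with Gaussian-weighted exponentials shows that the convolution of the function with a Gaussian vanishes.\<close>
lemma fourier_L2_zero_imp_zero:
fixes f :: "real ^ 'n::finite => complex"
assumes f: "in_L2 f" and zero: "AE y in lborel. fourier_L2 f y = 0"
shows "AE x in lborel. f x = 0"
proof -
let ?\<kappa> = "gauss_mass TYPE('n)"
have "f \<in> borel_measurable lebesgue" using f by (simp add: in_L2_def)
then obtain f0 where [measurable]: "f0 \<in> borel_measurable borel" and ae: "AE x in lborel. f x = f0 x"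
by (rule lebesgue_borel_representative)
have f0: "(\<integral>\<^sup>+x. ennreal ((norm (f0 x))\<^sup>2) \<partial>lborel) < \<infinity>" using f in_L2_iff[OF _ ae] by simp
obtain u where u: "!!k. in_L1 (u k)" "!!k. in_L2 (u k)" "L2_tendsto u f" "L2_tendsto (%k. fourier_integral (u k)) (fourier_L2 f)"
using is_fourier_fourier_L2[OF f] by (auto simp: is_fourier_L2_def)
have "\<exists>v. v \<in> borel_measurable borel \<and> (AE x in lborel. u k x = v x)" for k
using u(2)[of k] lebesgue_borel_representative[of "u k"] unfolding in_L2_def by metis
then obtain v where vm [measurable]: "!!k. v k \<in> borel_measurable borel" and vae: "!!k. AE x in lborel. u k x = v k x"
by metis
have vint: "integrable lborel (v k)" for k using u(1) in_L1_iff[OF vm vae] by simp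
have lim1: "(%k. \<integral>\<^sup>+x. ennreal ((norm (v k x - f0 x))\<^sup>2) \<partial>lborel) \<longlonglongrightarrow> 0"
proof -
have "(\<integral>\<^sup>+x. ennreal ((norm (v k x - f0 x))\<^sup>2) \<partial>lborel) = L2_dist2 (u k) f" for k
 unfolding nn_integral_lebesgue_eq
proof (rule nn_integral_cong_AE)
 show "AE x in lborel. ennreal ((norm (v k x - f0 x))\<^sup>2) = ennreal ((norm (u k x - f x))\<^sup>2)"
 using vae[of k] ae by eventually_elim simp
qed
thus ?thesis using u(3) by (simp add: L2_tendsto_def)
qed
have lim2: "(%k. \<integral>\<^sup>+y. ennreal ((norm (fourier_const TYPE('n) * FT (v k) y))\<^sup>2) \<partial>lborel) \<longlonglongrightarrow> 0"
proof -
have "(\<integral>\<^sup>+y. ennreal ((norm (fourier_const TYPE('n) * FT (v k) y))\<^sup>2) \<partial>lborel) = L2_dist2 (fourier_integral (u k)) (fourier_L2 f)" for k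
 unfolding nn_integral_lebesgue_eq
proof (rule nn_integral_cong_AE)
 show "AE y in lborel. ennreal ((norm (fourier_const TYPE('n) * FT (v k) y))\<^sup>2) = ennreal ((norm (fourier_integral (u k) y - fourier_L2 f y))\<^sup>2)"
 using zero by eventually_elim (simp add: fourier_integral_FT[OF vm vae])
qed
thus ?thesis using u(4) by (simp add: L2_tendsto_def)
qed
have gauss2: "(\<integral>\<^sup>+t. ennreal ((norm (cplx (exp (- ((norm (x - t))\<^sup>2 / 2)))))\<^sup>2) \<partial>lborel) < \<infinity>" for x :: "real^'n"
proof -
have "(\<integral>\<^sup>+t. ennreal ((norm (cplx (exp (- ((norm (x - t))\<^sup>2 / 2)))))\<^sup>2) \<partial>lborel)
 = (\<integral>\<^sup>+t. ennreal (exp (- 1 * (norm (t + - x))\<^sup>2)) \<partial>lborel)"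
 by (intro nn_integral_cong) (simp add: norm_minus_commute exp_double[symmetric])
also have "... = (\<integral>\<^sup>+(t::real^'n). ennreal (exp (- 1 * (norm t)\<^sup>2)) \<partial>lborel)"
 by (rule lborel_nn_integral_translate) measurable
also have "... < \<infinity>"
 using integrable_gaussian[of 1, where 'a="real^'n"] by (simp add: integrable_iff_bounded)
finally show ?thesis .
qed
have conv0: "(LINT t|lborel. f0 t * exp (- ((norm (x - t))\<^sup>2 / 2))) = 0" for x
proof -
let ?g = "%t. cplx (exp (- ((norm (x - t))\<^sup>2 / 2)))"
have fgi: "integrable lborel (%t. f0 t * ?g t)"
proof (rule Bochner_Integration.integrable_bound)
 show "integrable lborel (%t. (norm (f0 t))\<^sup>2 + (norm (?g t))\<^sup>2)"
 using f0 gauss2[of x] by (intro Bochner_Integration.integrable_add) (simp_all add: integrable_iff_bounded)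
 show "AE t in lborel. norm (f0 t * ?g t) <= norm ((norm (f0 t))\<^sup>2 + (norm (?g t))\<^sup>2)"
 proof (rule AE_I2)
 fix t
 have "norm (f0 t) * norm (?g t) <= (norm (f0 t))\<^sup>2 + (norm (?g t))\<^sup>2"
 using sum_squares_bound[of "norm (f0 t)" "norm (?g t)"] mult_nonneg_nonneg[OF norm_ge_zero norm_ge_zero, of "f0 t" "?g t"]
 by linarith
 thus "norm (f0 t * ?g t) <= norm ((norm (f0 t))\<^sup>2 + (norm (?g t))\<^sup>2)"
 by (simp only: norm_mult real_norm_def)
 qed
qed measurable
have vgi: "integrable lborel (%t. v k t * ?g t)" for k
 by (rule Bochner_Integration.integrable_bound[OF vint[of k]]) (auto simp: norm_mult mult_left_le)
have "(%k. LINT y|lborel. (fourier_const TYPE('n) * FT (v k) y) * (exp (\<i> * cplx (x \<bullet> y)) * cplx (exp (- ((norm (0 - y))\<^sup>2 / 2))))) \<longlonglongrightarrow> 0"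
 by (rule L2_pairing_tendsto_zero[OF _ _ lim2]) (use gauss2[of 0] in \<open>auto simp: norm_mult\<close>)
moreover have "(LINT y|lborel. (fourier_const TYPE('n) * FT (v k) y) * (exp (\<i> * cplx (x \<bullet> y)) * cplx (exp (- ((norm (0 - y))\<^sup>2 / 2)))))
 = (fourier_const TYPE('n) * ?\<kappa>) * (LINT t|lborel. v k t * ?g t)" for k
proof -
 have "(LINT y|lborel. (fourier_const TYPE('n) * FT (v k) y) * (exp (\<i> * cplx (x \<bullet> y)) * cplx (exp (- ((norm (0 - y))\<^sup>2 / 2)))))
 = fourier_const TYPE('n) * (LINT y|lborel. FT (v k) y * exp (\<i> * cplx (x \<bullet> y)) * cplx (exp (- (1\<^sup>2 * (norm y)\<^sup>2 / 2))))"
 by (subst integral_mult_right_zero[symmetric]) (simp add: mult.assoc)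
 also have "... = fourier_const TYPE('n) * (LINT t|lborel. ?\<kappa> * (v k t * ?g t))"
 by (subst fourier_gaussian_weighted[OF vint]) (simp_all add: mult_ac)
 finally show ?thesis by (simp add: mult.assoc)
qed
ultimately have "(%k. (fourier_const TYPE('n) * ?\<kappa>) * (LINT t|lborel. v k t * ?g t)) \<longlonglongrightarrow> 0" by simp
hence "(%k. (1 / (fourier_const TYPE('n) * ?\<kappa>)) * ((fourier_const TYPE('n) * ?\<kappa>) * (LINT t|lborel. v k t * ?g t))) \<longlonglongrightarrow> (1 / (fourier_const TYPE('n) * ?\<kappa>)) * 0"
 by (intro tendsto_mult tendsto_const)
hence A: "(%k. LINT t|lborel. v k t * ?g t) \<longlonglongrightarrow> 0"
 using gauss_mass_pos[where 'n='n] by simp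
have "(%k. LINT t|lborel. (v k t - f0 t) * ?g t) \<longlonglongrightarrow> 0"
 by (rule L2_pairing_tendsto_zero[OF _ _ lim1 gauss2]) auto
hence "(%k. (LINT t|lborel. v k t * ?g t) - (LINT t|lborel. f0 t * ?g t)) \<longlonglongrightarrow> 0"
 unfolding left_diff_distrib using Bochner_Integration.integral_diff[OF vgi fgi] by simp
from tendsto_diff[OF A this] have "(%k::nat. LINT t|lborel. f0 t * ?g t) \<longlonglongrightarrow> 0" by simp
thus ?thesis by (simp only: LIMSEQ_const_iff)
qed
have "AE t in lborel. f0 t = 0"
proof (rule gaussian_convolution_zero)
fix b :: real
show "integrable lborel (%t. norm (f0 t) * exp (b * norm t - (norm t)\<^sup>2 / 2))"
proof (rule Bochner_Integration.integrable_bound)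
 show "integrable lborel (%t. (norm (f0 t))\<^sup>2 + (1 + norm t) ^ 0 * exp ((2 * b) * norm t - 1 * (norm t)\<^sup>2))"
 using f0 by (intro Bochner_Integration.integrable_add integrable_poly_gaussian) (simp_all add: integrable_iff_bounded)
 show "AE t in lborel. norm (norm (f0 t) * exp (b * norm t - (norm t)\<^sup>2 / 2)) <= norm ((norm (f0 t))\<^sup>2 + (1 + norm t) ^ 0 * exp ((2 * b) * norm t - 1 * (norm t)\<^sup>2))"
 proof (rule AE_I2)
 fix t :: "real^'n"
 define e where "e = exp (b * norm t - (norm t)\<^sup>2 / 2)"
 have e2: "exp ((2 * b) * norm t - 1 * (norm t)\<^sup>2) = e\<^sup>2"
 unfolding e_def by (simp add: exp_double[symmetric] right_diff_distrib)
 have "e > 0" by (simp add: e_def)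
 hence "0 <= norm (f0 t) * e" by simp
 hence "norm (f0 t) * e <= (norm (f0 t))\<^sup>2 + e\<^sup>2"
 using sum_squares_bound[of "norm (f0 t)" e] by linarith
 thus "norm (norm (f0 t) * exp (b * norm t - (norm t)\<^sup>2 / 2)) <= norm ((norm (f0 t))\<^sup>2 + (1 + norm t) ^ 0 * exp ((2 * b) * norm t - 1 * (norm t)\<^sup>2))"
 unfolding e2 e_def[symmetric] using \<open>e > 0\<close> by simp
 qed
qed measurable
qed (use conv0 in auto)
with ae show ?thesis by eventually_elim simp
qed

text \<open>The functional on a pair of Borel functions, where the second one need not be a chosen transform of the first.\<close>
definition KK :: "real => (real ^ 'n::finite => complex) => (real ^ 'n => complex) => ennreal" where
"KK a f g = (\<integral>\<^sup>+x. (\<integral>\<^sup>+y. ennreal (norm (f x) * norm (g y) * exp (a * \<bar>x \<bullet> y\<bar>)) \<partial>lborel) \<partial>lborel)"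

lemma K_eq_KK:
assumes f: "AE x in lborel. f x = f0 x" and g: "AE y in lborel. fourier_L2 f y = g0 y"
shows "K a f = KK a f0 g0"
unfolding K_def KK_def nn_integral_lebesgue_eq
proof (rule nn_integral_cong_AE)
show "AE x in lborel. (\<integral>\<^sup>+y. ennreal (norm (f x) * norm (fourier_L2 f y) * exp (a * \<bar>x \<bullet> y\<bar>)) \<partial>lborel)
= (\<integral>\<^sup>+y. ennreal (norm (f0 x) * norm (g0 y) * exp (a * \<bar>x \<bullet> y\<bar>)) \<partial>lborel)"
using f
proof eventually_elim
case (elim x)
show ?case
proof (rule nn_integral_cong_AE)
 show "AE y in lborel. ennreal (norm (f x) * norm (fourier_L2 f y) * exp (a * \<bar>x \<bullet> y\<bar>)) = ennreal (norm (f0 x) * norm (g0 y) * exp (a * \<bar>x \<bullet> y\<bar>))"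
 using g by eventually_elim (simp add: elim)
qed
qed
qed

lemma K_eq_KK_FT:
fixes f :: "real ^ 'n::finite => complex"
assumes f [measurable]: "f \<in> borel_measurable borel" and i: "integrable lborel f"
and i2: "(\<integral>\<^sup>+x. ennreal ((norm (f x))\<^sup>2) \<partial>lborel) < \<infinity>" and ae: "AE x in lborel. f' x = f x"
shows "K a f' = KK a f (%y. fourier_const TYPE('n) * FT f y)"
"AE y in lborel. fourier_L2 f' y = fourier_const TYPE('n) * FT f y"
proof -
have 1: "in_L1 f'" using in_L1_iff[OF f ae] i by simp
have 2: "in_L2 f'" using in_L2_iff[OF f ae] i2 by simp
have "AE y in lebesgue. fourier_L2 f' y = fourier_integral f' y" by (rule fourier_L2_eq_integral[OF 1 2])
thus 3: "AE y in lborel. fourier_L2 f' y = fourier_const TYPE('n) * FT f y"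
unfolding AE_lebesgue_iff fourier_integral_FT[OF f ae] .
show "K a f' = KK a f (%y. fourier_const TYPE('n) * FT f y)"
by (rule K_eq_KK[OF ae 3])
qed

text \<open>For real exponents outside finitely many hyperplanes the monomials have distinct orders of growth along the curve whose coordinates grow with these exponents, so they cannot cancel.\<close>
lemma monomial_sum_nonvanishing:
fixes c :: "('n::finite \<Rightarrow>\<^sub>0 nat) => complex"
assumes S: "finite S" "S ~= {}" and c: "!!m. m \<in> S ==> c m ~= 0"
shows "\<exists>x::real^'n. (\<Sum>m\<in>S. c m * (\<Prod>i\<in>UNIV. cplx (x $ i) ^ Poly_Mapping.lookup m i)) ~= 0"
proof (rule ccontr)
assume "\<not> ?thesis"
hence zero: "(\<Sum>m\<in>S. c m * (\<Prod>i\<in>UNIV. cplx (x $ i) ^ Poly_Mapping.lookup m i)) = 0" for x :: "real^'n" by blast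
define v where "v m = (\<chi> i. real (Poly_Mapping.lookup m i) :: real^'n)" for m :: "'n \<Rightarrow>\<^sub>0 nat"
have v_inj: "v m = v m' ==> m = m'" for m m'
by (simp add: v_def vec_eq_iff poly_mapping_eq_iff fun_eq_iff)
have "negligible (\<Union>(m, m') \<in> {(m, m') \<in> S \<times> S. m ~= m'}. {\<alpha>. (v m - v m') \<bullet> \<alpha> = 0})"
proof (rule negligible_Union)
show "finite ((%(m, m'). {\<alpha>. (v m - v m') \<bullet> \<alpha> = 0}) ` {(m, m') \<in> S \<times> S. m ~= m'})"
 by (rule finite_imageI, rule finite_subset[of _ "S \<times> S"]) (use S in auto)
fix t assume "t \<in> (%(m, m'). {\<alpha>. (v m - v m') \<bullet> \<alpha> = 0}) ` {(m, m') \<in> S \<times> S. m ~= m'}"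
then obtain m m' where m: "m ~= m'" "t = {\<alpha>. (v m - v m') \<bullet> \<alpha> = 0}" by auto
have "v m - v m' ~= 0" using v_inj m(1) by auto
thus "negligible t" unfolding m(2) by (intro negligible_hyperplane) simp
qed
hence "(\<Union>(m, m') \<in> {(m, m') \<in> S \<times> S. m ~= m'}. {\<alpha>. (v m - v m') \<bullet> \<alpha> = 0}) ~= UNIV"
using non_negligible_UNIV by auto
then obtain \<alpha> where "\<alpha> \<notin> (\<Union>(m, m') \<in> {(m, m') \<in> S \<times> S. m ~= m'}. {\<alpha>. (v m - v m') \<bullet> \<alpha> = 0})" by blast
hence \<alpha>: "v m \<bullet> \<alpha> ~= v m' \<bullet> \<alpha>" if "m \<in> S" "m' \<in> S" "m ~= m'" for m m'
using that by (auto simp: inner_diff_left)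
define mx where "mx = Max ((%m. v m \<bullet> \<alpha>) ` S)"
have "mx \<in> (%m. v m \<bullet> \<alpha>) ` S" unfolding mx_def using S by (intro Max_in) auto
then obtain m0 where m0: "m0 \<in> S" "mx = v m0 \<bullet> \<alpha>" by blast
have le: "v m \<bullet> \<alpha> < v m0 \<bullet> \<alpha>" if "m \<in> S" "m ~= m0" for m
using Max_ge[of "(%m. v m \<bullet> \<alpha>) ` S" "v m \<bullet> \<alpha>"] S that \<alpha>[OF that(1) m0(1) that(2)] m0(2) mx_def by fastforce
have E: "(\<Sum>m\<in>S. c m * cplx (exp (real k * (v m \<bullet> \<alpha> - v m0 \<bullet> \<alpha>)))) = 0" for k :: nat
proof -
have "(\<Prod>i\<in>UNIV. cplx (exp (real k * \<alpha> $ i)) ^ Poly_Mapping.lookup m i) = cplx (exp (real k * (v m \<bullet> \<alpha>)))" for m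
 by (simp add: v_def inner_vec_def exp_of_nat_mult[symmetric] exp_sum[symmetric] sum_distrib_left mult_ac
 flip: of_real_power of_real_prod)
hence "(\<Sum>m\<in>S. c m * cplx (exp (real k * (v m \<bullet> \<alpha>)))) = 0"
 using zero[of "\<chi> i. exp (real k * \<alpha> $ i)"] by simp
hence "(\<Sum>m\<in>S. c m * cplx (exp (real k * (v m \<bullet> \<alpha>)))) * cplx (exp (- real k * (v m0 \<bullet> \<alpha>))) = 0" by simp
thus ?thesis
 by (simp add: sum_distrib_right mult.assoc exp_add[symmetric] right_diff_distrib flip: of_real_mult)
qed
have "(%k. \<Sum>m\<in>S. c m * cplx (exp (real k * (v m \<bullet> \<alpha> - v m0 \<bullet> \<alpha>)))) \<longlonglongrightarrow> (\<Sum>m\<in>S. c m * (if m = m0 then 1 else 0))"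
proof (intro tendsto_sum tendsto_mult tendsto_const)
fix m assume m: "m \<in> S"
show "(%k. cplx (exp (real k * (v m \<bullet> \<alpha> - v m0 \<bullet> \<alpha>)))) \<longlonglongrightarrow> (if m = m0 then 1 else 0)"
proof (cases "m = m0")
 case False
 define q where "q = exp (v m \<bullet> \<alpha> - v m0 \<bullet> \<alpha>)"
 have "0 < q" "q < 1" using le[OF m False] by (auto simp: q_def)
 hence "(%k. cplx (q ^ k)) \<longlonglongrightarrow> cplx 0"
 by (intro tendsto_of_real LIMSEQ_realpow_zero) auto
 moreover have "q ^ k = exp (real k * (v m \<bullet> \<alpha> - v m0 \<bullet> \<alpha>))" for k
 by (simp add: q_def exp_of_nat_mult)
 ultimately show ?thesis using False by simp
qed simp
qed
hence "(%k::nat. 0::complex) \<longlonglongrightarrow> (\<Sum>m\<in>S. c m * (if m = m0 then 1 else 0))" unfolding E .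
moreover have "(\<Sum>m\<in>S. c m * (if m = m0 then 1 else 0)) = c m0"
using m0(1) S(1) by (simp add: if_distrib[of "%x. _ * x"] sum.delta cong: if_cong)
ultimately have "c m0 = 0" by (simp add: LIMSEQ_const_iff)
thus False using c[OF m0(1)] by simp
qed

text \<open>Polynomial functions by their values: closure properties become statements about functions, and no arithmetic on coefficient maps is needed.\<close>
definition polyfun :: "nat => (real ^ 'n::finite => complex) => bool" where
"polyfun d F \<longleftrightarrow> (\<exists>P. deg_le P d \<and> (\<forall>x. F x = cpoly_eval P x))"

lemma polyfun_mono: "polyfun d F ==> d <= d' ==> polyfun d' F"
unfolding polyfun_def deg_le_def by fastforce

lemma cpoly_eval_superset:
assumes "finite S" "Poly_Mapping.keys P \<subseteq> S"
shows "cpoly_eval P x = (\<Sum>m\<in>S. Poly_Mapping.lookup P m * (\<Prod>i\<in>UNIV. cplx (x $ i) ^ Poly_Mapping.lookup m i))"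
unfolding cpoly_eval_def using assms by (intro sum.mono_neutral_left) (auto simp: in_keys_iff)

lemma polyfun_monomial:
fixes m :: "'n::finite \<Rightarrow>\<^sub>0 nat"
assumes "expo_degree m <= d"
shows "polyfun d (%x. a * (\<Prod>i\<in>UNIV. cplx (x $ i) ^ Poly_Mapping.lookup m i))"
proof -
have "cpoly_eval (Poly_Mapping.single m a) x = a * (\<Prod>i\<in>UNIV. cplx (x $ i) ^ Poly_Mapping.lookup m i)" for x
by (subst cpoly_eval_superset[of "{m}"]) auto
moreover have "deg_le (Poly_Mapping.single m a) d" using assms by (auto simp: deg_le_def)
ultimately show ?thesis unfolding polyfun_def by metis
qed

lemma polyfun_add:
assumes "polyfun d F" "polyfun d G"
shows "polyfun d (%x. F x + G x)"
proof -
obtain P Q where P: "deg_le P d" "!!x. F x = cpoly_eval P x" and Q: "deg_le Q d" "!!x. G x = cpoly_eval Q x"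
using assms unfolding polyfun_def by blast
let ?S = "Poly_Mapping.keys P \<union> Poly_Mapping.keys Q"
have keys: "Poly_Mapping.keys (P + Q) \<subseteq> ?S" by (rule Poly_Mapping.keys_add)
have "cpoly_eval (P + Q) x = F x + G x" for x
unfolding P Q using keys
by (subst (1 2 3) cpoly_eval_superset[of ?S]) (auto simp: lookup_add distrib_right sum.distrib)
moreover have "deg_le (P + Q) d" using P(1) Q(1) keys unfolding deg_le_def by blast
ultimately show ?thesis unfolding polyfun_def by metis
qed

lemma polyfun_const: "polyfun d (%x. a)"
using polyfun_monomial[of "0 :: 'a \<Rightarrow>\<^sub>0 nat" d a] by (simp add: expo_degree_def)

lemma polyfun_sum: "(!!j. j \<in> J ==> polyfun d (F j)) ==> polyfun d (%x. \<Sum>j\<in>J. F j x)"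
by (induction J rule: infinite_finite_induct) (auto intro: polyfun_add polyfun_const)

lemma polyfun_mult:
assumes "polyfun d F" "polyfun e G"
shows "polyfun (d + e) (%x. F x * G x)"
proof -
obtain P Q where P: "deg_le P d" "!!x. F x = cpoly_eval P x" and Q: "deg_le Q e" "!!x. G x = cpoly_eval Q x"
using assms unfolding polyfun_def by blast
have eq: "F x * G x = (\<Sum>m\<in>Poly_Mapping.keys P. \<Sum>m'\<in>Poly_Mapping.keys Q. (Poly_Mapping.lookup P m * Poly_Mapping.lookup Q m') *
 (\<Prod>i\<in>UNIV. cplx (x $ i) ^ Poly_Mapping.lookup (m + m') i))" for x
unfolding P Q cpoly_eval_def sum_product
by (intro sum.cong refl) (simp add: lookup_add power_add prod.distrib mult_ac)
have deg: "expo_degree (m + m') = expo_degree m + expo_degree m'" for m m' :: "'a \<Rightarrow>\<^sub>0 nat"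
by (simp add: expo_degree_def lookup_add sum.distrib)
show ?thesis unfolding eq
by (intro polyfun_sum polyfun_monomial) (use P(1) Q(1) in \<open>auto simp: deg_le_def deg intro!: add_mono\<close>)
qed

lemma polyfun_cmult: "polyfun d F ==> polyfun d (%x. a * F x)"
using polyfun_mult[OF polyfun_const[of 0 a], of d F] by simp

lemma polyfun_coord: "polyfun 1 (%x. cplx (x $ i))"
proof -
have *: "Poly_Mapping.lookup (Poly_Mapping.single i (1::nat)) j = (if j = i then 1 else 0)" for j
by (simp add: lookup_single when_def)
have "(\<Prod>j\<in>UNIV. cplx (x $ j) ^ Poly_Mapping.lookup (Poly_Mapping.single i (1::nat)) j) = cplx (x $ i)" for x
unfolding * by (simp add: if_distrib[of "%k. _ ^ k"] prod.delta cong: if_cong)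
moreover have "expo_degree (Poly_Mapping.single i (1::nat)) = 1"
unfolding expo_degree_def * by simp
ultimately show ?thesis using polyfun_monomial[of "Poly_Mapping.single i (1::nat)" 1 1] by simp
qed

lemma polyfun_power: "polyfun d F ==> polyfun (k * d) (%x. F x ^ k)"
by (induction k) (auto intro: polyfun_const polyfun_mult)

lemma polyfun_prod:
"(!!j. j \<in> J ==> polyfun (d j) (F j)) ==> polyfun (\<Sum>j\<in>J. d j) (%x. \<Prod>j\<in>J. F j x)"
by (induction J rule: infinite_finite_induct) (auto intro: polyfun_const polyfun_mult)

lemma polyfun_linear: "polyfun 1 (%x. cplx ((B *v x) $ i))"
unfolding matrix_vector_mult_def vec_lambda_beta of_real_sum of_real_mult
by (intro polyfun_sum polyfun_cmult polyfun_coord)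

lemma polyfun_compose_linear:
assumes "polyfun d F"
shows "polyfun d (%x. F (B *v x))"
proof -
obtain P where P: "deg_le P d" "!!x. F x = cpoly_eval P x" using assms unfolding polyfun_def by blast
show ?thesis unfolding P cpoly_eval_def
proof (intro polyfun_sum polyfun_cmult)
fix m assume m: "m \<in> Poly_Mapping.keys P"
have "polyfun (\<Sum>i\<in>UNIV. Poly_Mapping.lookup m i * 1) (%x. \<Prod>i\<in>UNIV. cplx ((B *v x) $ i) ^ Poly_Mapping.lookup m i)"
 by (intro polyfun_prod polyfun_power polyfun_linear)
thus "polyfun d (%x. \<Prod>i\<in>UNIV. cplx ((B *v x) $ i) ^ Poly_Mapping.lookup m i)"
 by (rule polyfun_mono) (use m P(1) in \<open>simp add: deg_le_def expo_degree_def\<close>)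
qed
qed

section \<open>Polynomials times Gaussians\<close>

definition pgauss :: "'n::finite cpoly => real ^ 'n ^ 'n => real ^ 'n => complex" where
"pgauss P A x = cpoly_eval P x * cplx (exp (- quad A x))"

lemma pgauss_measurable [measurable]: "pgauss P A \<in> borel_measurable borel"
unfolding pgauss_def[abs_def] by measurable

lemma matrix_norm_bound:
obtains \<beta> where "\<beta> > 0" "!!x. norm (B *v x) <= \<beta> * norm (x :: real ^ 'n::finite)"
proof -
have "bounded_linear ((*v) B)" by (rule matrix_vector_mul_bounded_linear)
then obtain K where "K > 0" "!!x. norm (B *v x) <= norm x * K" using bounded_linear.pos_bounded by blast
thus ?thesis using that[of K] by (simp add: mult.commute)
qed

lemma quad_abs_bound:
obtains \<beta> where "\<beta> > 0" "!!x. \<bar>quad A x\<bar> <= \<beta> * (norm (x :: real ^ 'n::finite))\<^sup>2"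
proof -
obtain \<beta> where \<beta>: "\<beta> > 0" "!!x. norm (A *v x) <= \<beta> * norm x" using matrix_norm_bound by blast
have "\<bar>quad A x\<bar> <= \<beta> * (norm x)\<^sup>2" for x
proof -
have "\<bar>quad A x\<bar> <= norm (A *v x) * norm x" unfolding quad_def by (rule Cauchy_Schwarz_ineq2)
also have "... <= \<beta> * norm x * norm x" by (intro mult_right_mono \<beta>) auto
finally show ?thesis by (simp add: power2_eq_square mult.assoc)
qed
thus ?thesis using that \<beta>(1) by blast
qed

lemma quad_scaleR: "quad A (c *\<^sub>R x) = c\<^sup>2 * quad A x"
by (simp add: quad_def matrix_vector_mult_scaleR power2_eq_square)

lemma cpoly_eval_bound:
assumes "deg_le P M"
obtains C where "C > 0" "!!x. norm (cpoly_eval P x) <= C * (1 + norm x) ^ M"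
proof -
obtain C where C: "C > 0" "!!\<tau> z r. norm \<tau> <= 1 ==> r >= 0 ==> (!!i. norm (z $ i) <= r) ==> norm (heval M P \<tau> z) <= C * (1 + r) ^ M"
using heval_bound[OF assms] by blast
have "norm (cpoly_eval P x) <= C * (1 + norm x) ^ M" for x
unfolding cpoly_eval_heval[of P x M] by (rule C(2)) (auto simp: component_le_norm_cart)
thus ?thesis using that C(1) by blast
qed

lemma pgauss_bound:
assumes "sym_pos_def A" "deg_le P M"
obtains C c where "C > 0" "c > 0" "!!x. norm (pgauss P A x) <= C * ((1 + norm x) ^ M * exp (0 * norm x - c * (norm x)\<^sup>2))"
proof -
obtain C where C: "C > 0" "!!x. norm (cpoly_eval P x) <= C * (1 + norm x) ^ M"
using cpoly_eval_bound[OF assms(2)] by blast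
obtain c where c: "c > 0" "!!x. c * (norm x)\<^sup>2 <= quad A x"
using sym_pos_def_lower[OF assms(1)] unfolding quad_def by blast
have "norm (pgauss P A x) <= C * ((1 + norm x) ^ M * exp (0 * norm x - c * (norm x)\<^sup>2))" for x
proof -
have "norm (cpoly_eval P x) * exp (- quad A x) <= (C * (1 + norm x) ^ M) * exp (0 * norm x - c * (norm x)\<^sup>2)"
 by (intro mult_mono C) (use c(2)[of x] C(1) in auto)
thus ?thesis by (simp add: pgauss_def norm_mult mult.assoc)
qed
thus ?thesis using that C(1) c(1) by blast
qed

lemma pgauss_integrable:
assumes "sym_pos_def A"
shows "integrable lborel (pgauss P A)" "(\<integral>\<^sup>+x. ennreal ((norm (pgauss P A x))\<^sup>2) \<partial>lborel) < \<infinity>"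
proof -
obtain M where M: "deg_le P M" using deg_le_exists by blast
obtain C c where C: "C > 0" "c > 0" "!!x. norm (pgauss P A x) <= C * ((1 + norm x) ^ M * exp (0 * norm x - c * (norm x)\<^sup>2))"
using pgauss_bound[OF assms M] by blast
show "integrable lborel (pgauss P A)"
proof (rule Bochner_Integration.integrable_bound)
show "integrable lborel (%x::real^'a. C * ((1 + norm x) ^ M * exp (0 * norm x - c * (norm x)\<^sup>2)))"
 by (intro integrable_mult_right integrable_poly_gaussian C)
show "AE x in lborel. norm (pgauss P A x) <= norm (C * ((1 + norm x) ^ M * exp (0 * norm x - c * (norm x)\<^sup>2)))"
 using C(3) by (intro AE_I2) (auto intro: order_trans[OF _ abs_ge_self])
qed measurable
have "(\<integral>\<^sup>+x. ennreal ((norm (pgauss P A x))\<^sup>2) \<partial>lborel) <= (\<integral>\<^sup>+(x::real^'a). ennreal (C\<^sup>2 * ((1 + norm x) ^ (2 * M) * exp (0 * norm x - (2 * c) * (norm x)\<^sup>2))) \<partial>lborel)"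
proof (intro nn_integral_mono ennreal_leI)
fix x :: "real^'a"
have "(norm (pgauss P A x))\<^sup>2 <= (C * ((1 + norm x) ^ M * exp (0 * norm x - c * (norm x)\<^sup>2)))\<^sup>2"
 by (intro power_mono C) auto
also have "... = C\<^sup>2 * ((1 + norm x) ^ (2 * M) * exp (0 * norm x - (2 * c) * (norm x)\<^sup>2))"
 by (simp add: power_mult_distrib power_mult[symmetric] mult.commute[of M] exp_double[symmetric])
finally show "(norm (pgauss P A x))\<^sup>2 <= C\<^sup>2 * ((1 + norm x) ^ (2 * M) * exp (0 * norm x - (2 * c) * (norm x)\<^sup>2))" .
qed
also have "... < \<infinity>"
proof -
have "integrable lborel (%x::real^'a. C\<^sup>2 * ((1 + norm x) ^ (2 * M) * exp (0 * norm x - (2 * c) * (norm x)\<^sup>2)))"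
 using C(2) by (intro integrable_mult_right integrable_poly_gaussian) simp
thus ?thesis by (subst nn_integral_eq_integral) auto
qed
finally show "(\<integral>\<^sup>+x. ennreal ((norm (pgauss P A x))\<^sup>2) \<partial>lborel) < \<infinity>" .
qed

lemma sym_pos_def_inverse:
assumes A: "sym_pos_def (A :: real ^ 'n ^ 'n::finite)"
obtains B where "sym_pos_def B" "!!y. A *v (B *v y) = y"
proof -
have sym: "transpose A = A" and pos: "!!x. x ~= 0 ==> (A *v x) \<bullet> x > 0"
using A by (auto simp: sym_pos_def_def)
have "\<forall>x. A *v x = 0 --> x = 0" using pos by fastforce
then obtain B where "B ** A = mat 1" using matrix_left_invertible_ker[of A] by blast
hence "A ** B = mat 1" by (simp add: matrix_left_right_inverse)
hence AB: "A *v (B *v y) = y" for y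
by (metis matrix_vector_mul_assoc matrix_vector_mul_lid)
have Bsym: "(B *v x) \<bullet> y = x \<bullet> (B *v y)" for x y
using sym_inner[OF sym, of "B *v x" "B *v y"] by (simp add: AB inner_commute)
have "(transpose B *v x - B *v x) \<bullet> y = 0" for x y
using Bsym[of x y] by (simp add: inner_diff_left dot_lmul_matrix flip: vector_transpose_matrix)
hence "transpose B *v x = B *v x" for x by (metis inner_eq_zero_iff right_minus_eq)
hence "transpose B = B" by (simp add: matrix_eq)
moreover have "(B *v y) \<bullet> y > 0" if "y ~= 0" for y
proof -
have "B *v y ~= 0" using AB[of y] that by auto
from pos[OF this] show ?thesis by (simp add: AB inner_commute)
qed
ultimately show ?thesis using that AB by (auto simp: sym_pos_def_def)
qed

text \<open>The Gaussian mean of the polynomial about an imaginary point; it is the polynomial factor of the transform.\<close>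
definition shifted_mean :: "nat => 'n::finite cpoly => real ^ 'n ^ 'n => real ^ 'n => complex" where
"shifted_mean M P A v = (LINT x|lborel. heval M P 1 (\<chi> i. x $ i - \<i> * v $ i) * exp (- quad A x))"

lemma FT_pgauss: "sym_pos_def A ==> FT (pgauss P A) (2 *\<^sub>R (A *v v)) = exp (- quad A v) * shifted_mean M P A v"
using FT_poly_gaussian[of A P v M] by (simp add: pgauss_def[abs_def] shifted_mean_def)

lemma integrable_monomial_gauss:
assumes "sym_pos_def A"
shows "integrable lborel (%x. (\<Prod>i\<in>UNIV. cplx (x $ i) ^ k i) * cplx (exp (- quad A x)))"
proof -
define P where "P = Poly_Mapping.single (Abs_poly_mapping k) (1::complex)"
have k: "Poly_Mapping.lookup (Abs_poly_mapping k) = k" by (simp add: Abs_poly_mapping_inverse)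
have "pgauss P A = (%x. (\<Prod>i\<in>UNIV. cplx (x $ i) ^ k i) * cplx (exp (- quad A x)))"
unfolding pgauss_def by (rule ext, subst cpoly_eval_superset[of "{Abs_poly_mapping k}"]) (auto simp: P_def k)
thus ?thesis using pgauss_integrable(1)[OF assms, of P] by simp
qed

lemma shifted_mean_polyfun:
assumes A: "sym_pos_def A" and P: "deg_le P M"
shows "polyfun M (shifted_mean M P A)"
proof -
define q where "q m \<kappa> v = (\<Prod>i\<in>UNIV. (of_nat (Poly_Mapping.lookup m i choose \<kappa> i) * (- \<i>) ^ (Poly_Mapping.lookup m i - \<kappa> i)) * cplx (v $ i) ^ (Poly_Mapping.lookup m i - \<kappa> i))"
for m :: "'a \<Rightarrow>\<^sub>0 nat" and \<kappa> and v :: "real^'a"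
define mom where "mom \<kappa> = (LINT x|lborel. (\<Prod>i\<in>UNIV. cplx (x $ i) ^ \<kappa> i) * cplx (exp (- quad A x)))" for \<kappa> :: "'a => nat"
let ?K = "%m. PiE UNIV (%i. {..Poly_Mapping.lookup m i})"
have finK: "finite (?K m)" for m :: "'a \<Rightarrow>\<^sub>0 nat" by (intro finite_PiE) auto
have exp: "heval M P 1 (\<chi> i. x $ i - \<i> * v $ i) = (\<Sum>m\<in>Poly_Mapping.keys P. \<Sum>\<kappa>\<in>?K m. (Poly_Mapping.lookup P m * q m \<kappa> v) * (\<Prod>i\<in>UNIV. cplx (x $ i) ^ \<kappa> i))"
for x v :: "real^'a"
unfolding heval_def
proof (rule sum.cong)
fix m assume "m \<in> Poly_Mapping.keys P"
have "(\<Prod>i\<in>UNIV. ((\<chi> i. cplx (x $ i) - \<i> * cplx (v $ i)) $ i) ^ Poly_Mapping.lookup m i)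
 = (\<Prod>i\<in>UNIV. \<Sum>k\<le>Poly_Mapping.lookup m i. of_nat (Poly_Mapping.lookup m i choose k) * cplx (x $ i) ^ k * (- \<i> * cplx (v $ i)) ^ (Poly_Mapping.lookup m i - k))"
 by (rule prod.cong) (simp_all add: binomial_ring[symmetric])
also have "... = (\<Sum>\<kappa>\<in>?K m. \<Prod>i\<in>UNIV. of_nat (Poly_Mapping.lookup m i choose \<kappa> i) * cplx (x $ i) ^ \<kappa> i * (- \<i> * cplx (v $ i)) ^ (Poly_Mapping.lookup m i - \<kappa> i))"
 by (rule prod_sum_PiE) auto
also have "... = (\<Sum>\<kappa>\<in>?K m. q m \<kappa> v * (\<Prod>i\<in>UNIV. cplx (x $ i) ^ \<kappa> i))"
 by (intro sum.cong refl) (simp only: q_def prod.distrib[symmetric] power_mult_distrib mult_ac)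
finally show "Poly_Mapping.lookup P m * 1 ^ (M - expo_degree m) * (\<Prod>i\<in>UNIV. ((\<chi> i. cplx (x $ i) - \<i> * cplx (v $ i)) $ i) ^ Poly_Mapping.lookup m i)
 = (\<Sum>\<kappa>\<in>?K m. (Poly_Mapping.lookup P m * q m \<kappa> v) * (\<Prod>i\<in>UNIV. cplx (x $ i) ^ \<kappa> i))"
 by (simp add: sum_distrib_left mult.assoc)
qed simp
have eq: "shifted_mean M P A v = (\<Sum>m\<in>Poly_Mapping.keys P. \<Sum>\<kappa>\<in>?K m. (Poly_Mapping.lookup P m * mom \<kappa>) * q m \<kappa> v)" for v
proof -
have "shifted_mean M P A v = (LINT x|lborel. (\<Sum>m\<in>Poly_Mapping.keys P. \<Sum>\<kappa>\<in>?K m. (Poly_Mapping.lookup P m * q m \<kappa> v) * ((\<Prod>i\<in>UNIV. cplx (x $ i) ^ \<kappa> i) * cplx (exp (- quad A x)))))"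
 unfolding shifted_mean_def exp sum_distrib_right by (simp only: mult.assoc)
also have "... = (\<Sum>m\<in>Poly_Mapping.keys P. \<Sum>\<kappa>\<in>?K m. (Poly_Mapping.lookup P m * q m \<kappa> v) * mom \<kappa>)"
 unfolding mom_def
 by (subst Bochner_Integration.integral_sum, (intro Bochner_Integration.integrable_sum integrable_mult_right integrable_monomial_gauss A),
 rule sum.cong[OF refl], subst Bochner_Integration.integral_sum, (intro integrable_mult_right integrable_monomial_gauss A),
 simp only: integral_mult_right_zero)
finally show ?thesis by (simp add: mult_ac)
qed
have "polyfun M (%v. \<Sum>m\<in>Poly_Mapping.keys P. \<Sum>\<kappa>\<in>?K m. (Poly_Mapping.lookup P m * mom \<kappa>) * q m \<kappa> v)"
proof (intro polyfun_sum polyfun_cmult)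
fix m \<kappa> assume m: "m \<in> Poly_Mapping.keys P"
have "polyfun (\<Sum>i\<in>UNIV. (Poly_Mapping.lookup m i - \<kappa> i) * 1) (%v. q m \<kappa> v)"
 unfolding q_def by (intro polyfun_prod polyfun_cmult polyfun_power polyfun_coord)
moreover have "(\<Sum>i\<in>UNIV. (Poly_Mapping.lookup m i - \<kappa> i) * 1) <= M"
proof -
 have "(\<Sum>i\<in>UNIV. (Poly_Mapping.lookup m i - \<kappa> i) * 1) <= expo_degree m"
 unfolding expo_degree_def by (intro sum_mono) auto
 thus ?thesis using m P by (auto simp: deg_le_def)
qed
ultimately show "polyfun M (q m \<kappa>)" by (rule polyfun_mono)
qed
moreover have "shifted_mean M P A = (%v. \<Sum>m\<in>Poly_Mapping.keys P. \<Sum>\<kappa>\<in>?K m. (Poly_Mapping.lookup P m * mom \<kappa>) * q m \<kappa> v)"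
using eq by (rule ext)
ultimately show ?thesis by simp
qed

text \<open>The polynomial factor is a Gaussian mean of shifts of the original polynomial, which does not raise the degree.\<close>
lemma FT_pgauss_is_pgauss:
assumes A: "sym_pos_def A" and P: "deg_le P M"
obtains P' B where "sym_pos_def B" "deg_le P' M" "!!y. A *v (B *v y) = (1/4) *\<^sub>R y" "!!y. FT (pgauss P A) y = pgauss P' B y"
proof -
obtain B where B: "sym_pos_def B" "!!y. A *v (B *v y) = y" using sym_pos_def_inverse[OF A] by blast
define B' where "B' = (1/4) *\<^sub>R B"
have B'v: "B' *v y = (1/4) *\<^sub>R (B *v y)" for y by (simp add: B'_def scaleR_matrix_vector_assoc[symmetric])
have "transpose B' = B'" using B(1) by (simp add: B'_def transpose_scalar sym_pos_def_def)
hence "sym_pos_def B'" using B(1) by (auto simp: sym_pos_def_def B'v)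
have "polyfun M (%y. shifted_mean M P A (((1/2) *\<^sub>R B) *v y))"
by (intro polyfun_compose_linear shifted_mean_polyfun assms)
then obtain P' where P': "deg_le P' M" "!!y. shifted_mean M P A (((1/2) *\<^sub>R B) *v y) = cpoly_eval P' y"
unfolding polyfun_def by blast
have "FT (pgauss P A) y = pgauss P' B' y" for y
proof -
define v where "v = (1/2) *\<^sub>R (B *v y)"
have v: "((1/2) *\<^sub>R B) *v y = v" by (simp add: v_def scaleR_matrix_vector_assoc[symmetric])
have y: "2 *\<^sub>R (A *v v) = y" by (simp add: v_def matrix_vector_mult_scaleR B(2))
have q: "quad A v = quad B' y"
 by (simp add: quad_def v_def matrix_vector_mult_scaleR B(2) B'v inner_commute)
show ?thesis using FT_pgauss[OF A, of P v M] unfolding y q P'(2)[of y, unfolded v]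
 by (simp add: pgauss_def mult.commute)
qed
moreover have "A *v (B' *v y) = (1/4) *\<^sub>R y" for y by (simp add: B'v matrix_vector_mult_scaleR B(2))
ultimately show ?thesis using that \<open>sym_pos_def B'\<close> P'(1) by blast
qed

lemma KK_mono: "a <= a' ==> KK a f g <= KK a' f g"
unfolding KK_def by (intro nn_integral_mono ennreal_leI mult_left_mono) (auto intro!: mult_right_mono)

lemma KK_swap:
assumes [measurable]: "f \<in> borel_measurable borel" "g \<in> borel_measurable borel"
shows "KK a f g = (\<integral>\<^sup>+y. \<integral>\<^sup>+x. ennreal (norm (f x) * norm (g y) * exp (a * \<bar>x \<bullet> y\<bar>)) \<partial>lborel \<partial>lborel)"
unfolding KK_def by (rule lborel_pair.Fubini') measurable

section \<open>Sharp growth of the functional for polynomials times Gaussians\<close>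

text \<open>The length scale, in units of the standard Gaussian, on which the damping \<open>exp (- (1 - a) \<bar>x\<bar>\<^sup>2)\<close> acts.\<close>
definition blowup :: "real => real" where
"blowup a = 1 / sqrt (1 - a)"

lemma blowup_props:
assumes "0 < a" "a < 1"
shows "blowup a >= 1" "(1 - a) * (blowup a)\<^sup>2 = 1"
using assms by (auto simp: blowup_def power_divide)

lemma quad_diff_identity:
assumes "transpose A = (A :: real ^ 'n ^ 'n::finite)"
shows "quad A (x - v) = quad A x + quad A v - 2 * ((A *v v) \<bullet> x)"
using quad_add[OF assms, of x "- 1" v] sym_inner[OF assms, of x v]
by (simp add: quad_def inner_commute)

text \<open>The exponent splits into a square, which is integrated out around the dual point and costs no power of the scale, and a Gaussian of width \<open>blowup a\<close>. The latter contributes the dimension, and each of the two polynomial factors contributes its degree.\<close>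
lemma KK_pgauss_upper:
fixes A :: "real ^ 'n ^ 'n::finite"
assumes A: "sym_pos_def A" and P: "deg_le P M"
obtains C where "C > 0" "!!a. 0 < a ==> a < 1 ==>
KK a (pgauss P A) (%y. \<alpha> * FT (pgauss P A) y) <= ennreal (C * blowup a ^ (CARD('n) + 2 * M))"
proof -
have sym: "transpose A = A" using A by (simp add: sym_pos_def_def)
obtain B P' where B: "sym_pos_def B" and P': "deg_le P' M" and AB: "!!y. A *v (B *v y) = (1/4) *\<^sub>R y"
and FTB: "!!y. FT (pgauss P A) y = pgauss P' B y"
by (rule FT_pgauss_is_pgauss[OF A P], rule that)
obtain c where c: "c > 0" "!!x. c * (norm x)\<^sup>2 <= quad A x"
using sym_pos_def_lower[OF A] unfolding quad_def by blast
obtain c3 where c3: "c3 > 0" "!!x. c3 * (norm x)\<^sup>2 <= quad B x"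
using sym_pos_def_lower[OF B] unfolding quad_def by blast
obtain C1 where C1: "C1 > 0" "!!x. norm (cpoly_eval P x) <= C1 * (1 + norm x) ^ M"
using cpoly_eval_bound[OF P] by blast
obtain C2 where C2: "C2 > 0" "!!x. norm (cpoly_eval P' x) <= C2 * (1 + norm x) ^ M"
using cpoly_eval_bound[OF P'] by blast
define v where "v y = 2 *\<^sub>R (B *v y)" for y
have Av: "2 *\<^sub>R (A *v (v y)) = y" for y by (simp add: v_def matrix_vector_mult_scaleR AB)
have qv: "quad A (v y) = quad B y" for y
by (simp add: quad_def v_def matrix_vector_mult_scaleR AB inner_commute)
obtain \<beta> where \<beta>: "\<beta> > 0" "!!y. norm (B *v y) <= \<beta> * norm y" using matrix_norm_bound by blast
have vb: "1 + norm (v y) <= (1 + 2 * \<beta>) * (1 + norm y)" for y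
proof -
have "norm (v y) <= 2 * \<beta> * norm y" using \<beta>(2)[of y] by (simp add: v_def)
moreover have "(1 + 2 * \<beta>) * (1 + norm y) = 1 + norm y + 2 * \<beta> + 2 * \<beta> * norm y" by (simp add: algebra_simps)
ultimately show ?thesis using \<beta>(1) norm_ge_zero[of y] by linarith
qed
have [measurable]: "v \<in> borel_measurable borel"
unfolding v_def[abs_def]
by (intro borel_measurable_continuous_onI continuous_intros linear_continuous_on_compose[OF continuous_on_id]) auto
define D where "D = (\<integral>\<^sup>+(w::real^'n). ennreal ((1 + norm w) ^ M * exp (0 * norm w - (c / 2) * (norm w)\<^sup>2)) \<partial>lborel)"
define D3 where "D3 = (\<integral>\<^sup>+(w::real^'n). ennreal ((1 + norm w) ^ (2 * M) * exp (0 * norm w - c3 * (norm w)\<^sup>2)) \<partial>lborel)"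
have fin: "D < \<infinity>" "D3 < \<infinity>"
proof -
have "integrable lborel (%w::real^'n. (1 + norm w) ^ M * exp (0 * norm w - (c / 2) * (norm w)\<^sup>2))"
 using c by (intro integrable_poly_gaussian) simp
thus "D < \<infinity>" unfolding D_def by (subst nn_integral_eq_integral) auto
have "integrable lborel (%w::real^'n. (1 + norm w) ^ (2 * M) * exp (0 * norm w - c3 * (norm w)\<^sup>2))"
 using c3 by (intro integrable_poly_gaussian) simp
thus "D3 < \<infinity>" unfolding D3_def by (subst nn_integral_eq_integral) auto
qed
have Dtrans: "(\<integral>\<^sup>+x. ennreal ((1 + norm x) ^ M * exp (- (c / 2) * (norm (x - w))\<^sup>2)) \<partial>lborel) <= ennreal ((1 + norm w) ^ M) * D" for w :: "real^'n"
proof -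
have "(\<integral>\<^sup>+x. ennreal ((1 + norm x) ^ M * exp (- (c / 2) * (norm (x - w))\<^sup>2)) \<partial>lborel)
 = (\<integral>\<^sup>+x. ennreal ((1 + norm (x + w)) ^ M * exp (- (c / 2) * (norm ((x + w) - w))\<^sup>2)) \<partial>lborel)"
 by (rule lborel_nn_integral_translate[symmetric]) measurable
also have "... <= (\<integral>\<^sup>+(x::real^'n). ennreal ((1 + norm w) ^ M) * ennreal ((1 + norm x) ^ M * exp (0 * norm x - (c / 2) * (norm x)\<^sup>2)) \<partial>lborel)"
proof (rule nn_integral_mono)
 fix x :: "real^'n"
 have "1 + norm (x + w) <= (1 + norm w) * (1 + norm x)"
 proof -
 have "(1 + norm w) * (1 + norm x) = 1 + norm w + norm x + norm w * norm x" by (simp add: algebra_simps)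
 moreover have "0 <= norm w * norm x" by simp
 ultimately show ?thesis using norm_triangle_ineq[of x w] by linarith
 qed
 hence "(1 + norm (x + w)) ^ M <= (1 + norm w) ^ M * (1 + norm x) ^ M"
 unfolding power_mult_distrib[symmetric] by (intro power_mono) auto
 hence "(1 + norm (x + w)) ^ M * exp (- (c / 2) * (norm x)\<^sup>2) <= (1 + norm w) ^ M * (1 + norm x) ^ M * exp (- (c / 2) * (norm x)\<^sup>2)"
 by (rule mult_right_mono) simp
 hence "ennreal ((1 + norm (x + w)) ^ M * exp (- (c / 2) * (norm ((x + w) - w))\<^sup>2)) <= ennreal ((1 + norm w) ^ M * ((1 + norm x) ^ M * exp (0 * norm x - (c / 2) * (norm x)\<^sup>2)))"
 by (intro ennreal_leI) (simp add: mult.assoc)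
 thus "ennreal ((1 + norm (x + w)) ^ M * exp (- (c / 2) * (norm ((x + w) - w))\<^sup>2)) <= ennreal ((1 + norm w) ^ M) * ennreal ((1 + norm x) ^ M * exp (0 * norm x - (c / 2) * (norm x)\<^sup>2))"
 by (simp add: ennreal_mult)
qed
also have "... = ennreal ((1 + norm w) ^ M) * D"
 unfolding D_def by (rule nn_integral_cmult) measurable
finally show ?thesis .
qed
define E where "E = C1 * (norm \<alpha> * C2)"
have E0: "E >= 0" using C1(1) C2(1) by (simp add: E_def)
define G where "G = 2 * (1 + 2 * \<beta>) ^ M"
have G0: "G >= 0" using \<beta>(1) by (simp add: G_def)
have half: "KK a (pgauss P A) (%y. \<alpha> * FT (pgauss P A) y) <= ennreal (E * G * blowup a ^ (CARD('n) + 2 * M)) * (D * D3)"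
if a: "1/2 <= a" "a < 1" for a
proof -
let ?I = "%x y. norm (pgauss P A x) * norm (\<alpha> * FT (pgauss P A) y) * exp (a * \<bar>x \<bullet> y\<bar>)"
have I: "?I x y <= (E * (1 + norm y) ^ M * exp (- (1 - a) * c3 * (norm y)\<^sup>2)) *
 ((1 + norm x) ^ M * exp (- (c / 2) * (norm (x - v y))\<^sup>2) + (1 + norm x) ^ M * exp (- (c / 2) * (norm (x - (- v y)))\<^sup>2))" for x y
proof -
 have xy: "x \<bullet> y = 2 * ((A *v v y) \<bullet> x)" using Av[of y] by (metis inner_commute inner_scaleR_left)
 have q1: "quad A (x - v y) = quad A x + quad B y - x \<bullet> y"
 unfolding quad_diff_identity[OF sym] xy qv ..
 have q2: "quad A (x - (- v y)) = quad A x + quad B y + x \<bullet> y"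
 unfolding quad_diff_identity[OF sym] xy qv[symmetric] using quad_scaleR[of A "-1" "v y"] matrix_vector_mult_scaleR[of A "-1" "v y"] by simp
 have gen: "- quad A x - quad B y + a * t <= - (1 - a) * c3 * (norm y)\<^sup>2 + (- (c / 2) * (norm u)\<^sup>2)"
 if "quad A u = quad A x + quad B y - t" for t u
 proof -
 have "(1 - a) * quad A x >= 0" using a c(2)[of x] c(1) by (smt (verit) mult_nonneg_nonneg zero_le_power2)
 moreover have "(1 - a) * (c3 * (norm y)\<^sup>2) <= (1 - a) * quad B y" using a by (intro mult_left_mono c3) auto
 moreover have "(1/2) * (c * (norm u)\<^sup>2) <= a * quad A u"
 using a c(2)[of u] c(1) by (intro mult_mono) auto
 moreover have "a * quad A u = a * quad A x + a * quad B y - a * t" unfolding that by (simp add: algebra_simps)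
 ultimately show ?thesis by (simp add: algebra_simps)
 qed
 have "- quad A x - quad B y + a * \<bar>x \<bullet> y\<bar> <= - (1 - a) * c3 * (norm y)\<^sup>2 + (- (c / 2) * (norm (x - v y))\<^sup>2) \<or>
  - quad A x - quad B y + a * \<bar>x \<bullet> y\<bar> <= - (1 - a) * c3 * (norm y)\<^sup>2 + (- (c / 2) * (norm (x - (- v y)))\<^sup>2)"
 proof (cases "x \<bullet> y >= 0")
 case True
 thus ?thesis using gen[of "x - v y" "x \<bullet> y"] q1 by simp
 next
 case False
 thus ?thesis using gen[of "x - (- v y)" "- (x \<bullet> y)"] q2 by simp
 qed
 hence e1: "exp (- quad A x - quad B y + a * \<bar>x \<bullet> y\<bar>) <= exp (- (1 - a) * c3 * (norm y)\<^sup>2) * (exp (- (c / 2) * (norm (x - v y))\<^sup>2) + exp (- (c / 2) * (norm (x - (- v y)))\<^sup>2))"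
 proof
 assume "- quad A x - quad B y + a * \<bar>x \<bullet> y\<bar> <= - (1 - a) * c3 * (norm y)\<^sup>2 + (- (c / 2) * (norm (x - v y))\<^sup>2)"
 hence "exp (- quad A x - quad B y + a * \<bar>x \<bullet> y\<bar>) <= exp (- (1 - a) * c3 * (norm y)\<^sup>2) * exp (- (c / 2) * (norm (x - v y))\<^sup>2)"
 unfolding exp_add[symmetric] by simp
 thus ?thesis by (rule order_trans) (intro mult_left_mono, auto)
 next
 assume "- quad A x - quad B y + a * \<bar>x \<bullet> y\<bar> <= - (1 - a) * c3 * (norm y)\<^sup>2 + (- (c / 2) * (norm (x - (- v y)))\<^sup>2)"
 hence "exp (- quad A x - quad B y + a * \<bar>x \<bullet> y\<bar>) <= exp (- (1 - a) * c3 * (norm y)\<^sup>2) * exp (- (c / 2) * (norm (x - (- v y)))\<^sup>2)"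
 unfolding exp_add[symmetric] by simp
 thus ?thesis by (rule order_trans) (intro mult_left_mono, auto)
 qed
 have e2: "norm (cpoly_eval P x) * (norm \<alpha> * norm (cpoly_eval P' y)) <= (C1 * (1 + norm x) ^ M) * (norm \<alpha> * (C2 * (1 + norm y) ^ M))"
 using C1 C2 by (intro mult_mono) auto
 have "(norm (cpoly_eval P x) * (norm \<alpha> * norm (cpoly_eval P' y))) * exp (- quad A x - quad B y + a * \<bar>x \<bullet> y\<bar>)
 <= ((C1 * (1 + norm x) ^ M) * (norm \<alpha> * (C2 * (1 + norm y) ^ M))) * (exp (- (1 - a) * c3 * (norm y)\<^sup>2) * (exp (- (c / 2) * (norm (x - v y))\<^sup>2) + exp (- (c / 2) * (norm (x - (- v y)))\<^sup>2)))"
 by (rule mult_mono[OF e2 e1]) (use C1(1) C2(1) in auto)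
 moreover have "?I x y = (norm (cpoly_eval P x) * (norm \<alpha> * norm (cpoly_eval P' y))) * exp (- quad A x - quad B y + a * \<bar>x \<bullet> y\<bar>)"
 unfolding FTB pgauss_def norm_mult norm_of_real by (simp add: exp_add exp_diff exp_minus field_simps)
 ultimately show ?thesis by (simp add: E_def algebra_simps)
qed
have "KK a (pgauss P A) (%y. \<alpha> * FT (pgauss P A) y) = (\<integral>\<^sup>+y. \<integral>\<^sup>+x. ennreal (?I x y) \<partial>lborel \<partial>lborel)"
 by (rule KK_swap) measurable
also have "... <= (\<integral>\<^sup>+(y::real^'n). ennreal (E * G * ((1 + norm y) ^ (2 * M) * exp (- (1 - a) * c3 * (norm y)\<^sup>2))) * D \<partial>lborel)"
proof (rule nn_integral_mono)
 fix y :: "real^'n"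
 let ?w = "E * (1 + norm y) ^ M * exp (- (1 - a) * c3 * (norm y)\<^sup>2)"
 have w0: "?w >= 0" using E0 by simp
 have "(\<integral>\<^sup>+x. ennreal (?I x y) \<partial>lborel) <= (\<integral>\<^sup>+x. ennreal ?w * (ennreal ((1 + norm x) ^ M * exp (- (c / 2) * (norm (x - v y))\<^sup>2)) + ennreal ((1 + norm x) ^ M * exp (- (c / 2) * (norm (x - (- v y)))\<^sup>2))) \<partial>lborel)"
 proof (rule nn_integral_mono)
 fix x
 have "ennreal (?I x y) <= ennreal (?w * ((1 + norm x) ^ M * exp (- (c / 2) * (norm (x - v y))\<^sup>2) + (1 + norm x) ^ M * exp (- (c / 2) * (norm (x - (- v y)))\<^sup>2)))"
 by (rule ennreal_leI[OF I])
 also have "... = ennreal ?w * (ennreal ((1 + norm x) ^ M * exp (- (c / 2) * (norm (x - v y))\<^sup>2)) + ennreal ((1 + norm x) ^ M * exp (- (c / 2) * (norm (x - (- v y)))\<^sup>2)))"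
 by (subst ennreal_mult[OF w0], simp, subst ennreal_plus) auto
 finally show "ennreal (?I x y) <= ..." .
 qed
 also have "... = ennreal ?w * ((\<integral>\<^sup>+x. ennreal ((1 + norm x) ^ M * exp (- (c / 2) * (norm (x - v y))\<^sup>2)) \<partial>lborel) + (\<integral>\<^sup>+x. ennreal ((1 + norm x) ^ M * exp (- (c / 2) * (norm (x - (- v y)))\<^sup>2)) \<partial>lborel))"
 by (subst nn_integral_cmult, measurable, subst nn_integral_add, measurable)
 also have "... <= ennreal ?w * (ennreal ((1 + norm (v y)) ^ M) * D + ennreal ((1 + norm (- v y)) ^ M) * D)"
 by (intro mult_left_mono add_mono Dtrans) auto
 also have "... = ennreal (?w * (2 * (1 + norm (v y)) ^ M)) * D"
 by (subst ennreal_mult[OF w0], simp, subst ennreal_mult, simp, simp)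
 (simp add: mult.assoc mult_2 distrib_left distrib_right)
 also have "... <= ennreal (E * G * ((1 + norm y) ^ (2 * M) * exp (- (1 - a) * c3 * (norm y)\<^sup>2))) * D"
 proof (intro mult_right_mono ennreal_leI)
 have "(1 + norm (v y)) ^ M <= (1 + 2 * \<beta>) ^ M * (1 + norm y) ^ M"
 unfolding power_mult_distrib[symmetric] by (intro power_mono vb) auto
 hence "?w * (2 * (1 + norm (v y)) ^ M) <= ?w * (2 * ((1 + 2 * \<beta>) ^ M * (1 + norm y) ^ M))"
 using w0 by (intro mult_left_mono) auto
 also have "... = E * G * ((1 + norm y) ^ (2 * M) * exp (- (1 - a) * c3 * (norm y)\<^sup>2))"
 proof -
 have "(1 + norm y) ^ (2 * M) = (1 + norm y) ^ M * (1 + norm y) ^ M" by (simp add: mult_2 power_add)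
 thus ?thesis unfolding G_def by (simp only: mult_ac)
 qed
 finally show "?w * (2 * (1 + norm (v y)) ^ M) <= E * G * ((1 + norm y) ^ (2 * M) * exp (- (1 - a) * c3 * (norm y)\<^sup>2))" .
 qed simp
 finally show "(\<integral>\<^sup>+x. ennreal (?I x y) \<partial>lborel) <= ennreal (E * G * ((1 + norm y) ^ (2 * M) * exp (- (1 - a) * c3 * (norm y)\<^sup>2))) * D" .
qed
also have "... = (\<integral>\<^sup>+(y::real^'n). ennreal (E * G) * ennreal ((1 + norm y) ^ (2 * M) * exp (- (1 - a) * c3 * (norm y)\<^sup>2)) \<partial>lborel) * D"
 using E0 G0 by (subst nn_integral_multc, measurable) (simp add: ennreal_mult)
also have "... = ennreal (E * G) * (\<integral>\<^sup>+(y::real^'n). ennreal ((1 + norm y) ^ (2 * M) * exp (- (1 - a) * c3 * (norm y)\<^sup>2)) \<partial>lborel) * D"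
 by (subst nn_integral_cmult, measurable)
also have "... <= ennreal (E * G) * (ennreal (blowup a ^ (CARD('n) + 2 * M)) * D3) * D"
proof (intro mult_right_mono mult_left_mono)
 let ?s = "blowup a"
 have s: "?s >= 1" "(1 - a) * ?s\<^sup>2 = 1" using blowup_props[of a] a by auto
 have "(\<integral>\<^sup>+(y::real^'n). ennreal ((1 + norm y) ^ (2 * M) * exp (- (1 - a) * c3 * (norm y)\<^sup>2)) \<partial>lborel)
 = ennreal (\<bar>?s\<bar> ^ DIM(real^'n)) * (\<integral>\<^sup>+(y::real^'n). ennreal ((1 + norm (0 + ?s *\<^sub>R y)) ^ (2 * M) * exp (- (1 - a) * c3 * (norm (0 + ?s *\<^sub>R y))\<^sup>2)) \<partial>lborel)"
 using s by (intro lborel_nn_integral_affine) auto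
 also have "... <= ennreal (\<bar>?s\<bar> ^ DIM(real^'n)) * (\<integral>\<^sup>+(y::real^'n). ennreal (?s ^ (2 * M)) * ennreal ((1 + norm y) ^ (2 * M) * exp (0 * norm y - c3 * (norm y)\<^sup>2)) \<partial>lborel)"
 proof (intro mult_left_mono nn_integral_mono)
 fix y :: "real^'n"
 have "(1 - a) * c3 * (norm (0 + ?s *\<^sub>R y))\<^sup>2 = ((1 - a) * ?s\<^sup>2) * (c3 * (norm y)\<^sup>2)"
 by (simp add: power_mult_distrib)
 hence k: "(1 - a) * c3 * (norm (0 + ?s *\<^sub>R y))\<^sup>2 = c3 * (norm y)\<^sup>2"
 unfolding s(2) by (simp only: mult_1)
 have e: "exp (- (1 - a) * c3 * (norm (0 + ?s *\<^sub>R y))\<^sup>2) = exp (0 * norm y - c3 * (norm y)\<^sup>2)"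
 unfolding mult_minus_left k by simp
 have "1 + norm (0 + ?s *\<^sub>R y) <= ?s * (1 + norm y)" using s(1) by (simp add: algebra_simps)
 hence "(1 + norm (0 + ?s *\<^sub>R y)) ^ (2 * M) <= ?s ^ (2 * M) * (1 + norm y) ^ (2 * M)"
 unfolding power_mult_distrib[symmetric] by (intro power_mono) auto
 hence "(1 + norm (0 + ?s *\<^sub>R y)) ^ (2 * M) * exp (- (1 - a) * c3 * (norm (0 + ?s *\<^sub>R y))\<^sup>2)
 <= ?s ^ (2 * M) * ((1 + norm y) ^ (2 * M) * exp (0 * norm y - c3 * (norm y)\<^sup>2))"
 unfolding e mult.assoc[symmetric] by (rule mult_right_mono) simp
 from ennreal_leI[OF this]
 show "ennreal ((1 + norm (0 + ?s *\<^sub>R y)) ^ (2 * M) * exp (- (1 - a) * c3 * (norm (0 + ?s *\<^sub>R y))\<^sup>2))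
 <= ennreal (?s ^ (2 * M)) * ennreal ((1 + norm y) ^ (2 * M) * exp (0 * norm y - c3 * (norm y)\<^sup>2))"
 using s(1) by (simp add: ennreal_mult)
 qed simp
 also have "... = ennreal (?s ^ (CARD('n) + 2 * M)) * D3"
 unfolding D3_def using s(1)
 by (subst nn_integral_cmult, measurable) (simp add: power_add ennreal_mult mult.assoc)
 finally show "(\<integral>\<^sup>+(y::real^'n). ennreal ((1 + norm y) ^ (2 * M) * exp (- (1 - a) * c3 * (norm y)\<^sup>2)) \<partial>lborel) <= ennreal (?s ^ (CARD('n) + 2 * M)) * D3" .
qed auto
also have "... = ennreal (E * G * blowup a ^ (CARD('n) + 2 * M)) * (D * D3)"
 using E0 G0 blowup_props[of a] a by (subst ennreal_mult) (auto simp: mult_ac)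
finally show ?thesis .
qed
obtain d where d: "d >= 0" "D * D3 = ennreal d"
using fin by (metis ennreal_cases ennreal_mult_less_top infinity_ennreal_def less_irrefl)
define N where "N = CARD('n) + 2 * M"
define C where "C = E * G * d * (blowup (1/2)) ^ N + 1"
have b2: "blowup (1/2) >= 1" using blowup_props[of "1/2"] by simp
have EGd: "E * G * d >= 0" using E0 G0 d by simp
have "C > 0" using EGd b2 by (simp add: C_def add_nonneg_pos)
moreover have "KK a (pgauss P A) (%y. \<alpha> * FT (pgauss P A) y) <= ennreal (C * blowup a ^ N)" if a: "0 < a" "a < 1" for a
proof -
have ba: "blowup a >= 1" using blowup_props[of a] a by simp
have half': "KK a (pgauss P A) (%y. \<alpha> * FT (pgauss P A) y) <= ennreal (E * G * d * blowup a ^ N)" if "1/2 <= a" "a < 1" for a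
proof -
 have "blowup a >= 0" using blowup_props[of a] that by simp
 hence "E * G * blowup a ^ N >= 0" using E0 G0 by simp
 hence "ennreal (E * G * blowup a ^ N) * (D * D3) = ennreal (E * G * blowup a ^ N * d)"
 unfolding d(2) using d(1) by (simp only: ennreal_mult)
 also have "E * G * blowup a ^ N * d = E * G * d * blowup a ^ N" by (simp only: mult_ac)
 finally show ?thesis using half[OF that] unfolding N_def by simp
qed
show ?thesis
proof (cases "1/2 <= a")
 case True
 have "E * G * d * blowup a ^ N <= C * blowup a ^ N"
 proof (rule mult_right_mono)
 have "1 <= blowup (1/2) ^ N" using b2 by (rule one_le_power)
 from mult_left_mono[OF this EGd] show "E * G * d <= C" by (simp add: C_def)
 qed (use ba in simp)
 thus ?thesis using half'[OF True a(2)] by (meson ennreal_leI order_trans)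
next
 case False
 have "KK a (pgauss P A) (%y. \<alpha> * FT (pgauss P A) y) <= KK (1/2) (pgauss P A) (%y. \<alpha> * FT (pgauss P A) y)"
 using False by (intro KK_mono) simp
 also have "... <= ennreal (E * G * d * blowup (1/2) ^ N)" by (rule half') auto
 also have "... <= ennreal (C * blowup a ^ N)"
 proof (rule ennreal_leI)
 have "E * G * d * blowup (1/2) ^ N <= C * 1" by (simp add: C_def)
 also have "... <= C * blowup a ^ N" using \<open>C > 0\<close> ba by (intro mult_left_mono) auto
 finally show "E * G * d * blowup (1/2) ^ N <= C * blowup a ^ N" .
 qed
 finally show ?thesis .
qed
qed
ultimately show ?thesis using that unfolding N_def by blast
qed

text \<open>The leading form of a nonzero polynomial is a nonzero polynomial function.\<close>
lemma leading_form_nonzero: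
assumes m: "m \<in> Poly_Mapping.keys P" "expo_degree m = M" and P: "deg_le P M"
obtains x :: "real ^ 'n::finite" where "heval M P 0 (cvec x) ~= 0"
proof -
define S where "S = {m \<in> Poly_Mapping.keys P. expo_degree m = M}"
have S: "finite S" "S ~= {}" using m by (auto simp: S_def)
obtain x :: "real^'n" where x: "(\<Sum>m\<in>S. Poly_Mapping.lookup P m * (\<Prod>i\<in>UNIV. cplx (x $ i) ^ Poly_Mapping.lookup m i)) ~= 0"
using monomial_sum_nonvanishing[OF S, of "Poly_Mapping.lookup P"] by (auto simp: S_def in_keys_iff)
have "heval M P 0 (cvec x) = (\<Sum>m\<in>S. Poly_Mapping.lookup P m * (\<Prod>i\<in>UNIV. cplx (x $ i) ^ Poly_Mapping.lookup m i))"
unfolding heval_def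
proof (rule sum.mono_neutral_cong_right)
show "\<forall>i\<in>Poly_Mapping.keys P - S. Poly_Mapping.lookup P i * 0 ^ (M - expo_degree i) * (\<Prod>ia\<in>UNIV. (cvec x $ ia) ^ Poly_Mapping.lookup i ia) = 0"
 using P by (auto simp: S_def deg_le_def)
qed (auto simp: S_def)
with x have "heval M P 0 (cvec x) ~= 0" by simp
thus ?thesis by (rule that)
qed

lemma continuous_nonzero_ball:
fixes f :: "real \<times> 'a::euclidean_space => complex"
assumes "continuous (at (0, x0)) f" "f (0, x0) ~= 0"
obtains \<delta> \<eta> where "\<delta> > 0" "\<eta> > 0" "!!t x. \<bar>t\<bar> < \<delta> ==> norm (x - x0) < \<delta> ==> norm (f (t, x)) >= \<eta>"
proof -
let ?e = "norm (f (0, x0)) / 2"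
have "?e > 0" using assms(2) by simp
then obtain d where d: "d > 0" "!!z. dist z (0, x0) < d ==> dist (f z) (f (0, x0)) < ?e"
using assms(1) unfolding continuous_at_eps_delta by blast
have "norm (f (t, x)) >= ?e" if "\<bar>t\<bar> < d / 2" "norm (x - x0) < d / 2" for t x
proof -
have "dist (t, x) (0, x0) <= \<bar>t\<bar> + norm (x - x0)"
 unfolding dist_Pair_Pair by (simp add: dist_norm sqrt_sum_squares_le_sum_abs[of t "norm (x - x0)", simplified])
hence "dist (f (t, x)) (f (0, x0)) < ?e" using that by (intro d) simp
thus ?thesis using norm_triangle_ineq2[of "f (0, x0)" "f (t, x)"] by (simp add: dist_norm norm_minus_commute)
qed
thus ?thesis using that[of "d / 2" ?e] d(1) \<open>?e > 0\<close> by simp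
qed

text \<open>It suffices to integrate over pairs in which one variable lies in the dilation by \<open>blowup a\<close> of a small ball where the leading form does not vanish, and the other one stays close to its dual point; there the exponential factors compensate each other.\<close>
lemma KK_pgauss_lower:
fixes A :: "real ^ 'n ^ 'n::finite"
assumes A: "sym_pos_def A" and P: "deg_le P M" and m: "m \<in> Poly_Mapping.keys P" "expo_degree m = M" and \<alpha>: "\<alpha> ~= 0"
obtains c where "c > 0" "!!a. 0 < a ==> a < 1 ==>
ennreal (c * blowup a ^ (CARD('n) + 2 * M)) <= KK a (pgauss P A) (%y. \<alpha> * FT (pgauss P A) y)"
proof -
have sym: "transpose A = A" using A by (simp add: sym_pos_def_def)
obtain B where B: "sym_pos_def B" and AB: "!!y. A *v (B *v y) = y"
by (rule sym_pos_def_inverse[OF A]) blast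
obtain c1 where c1: "c1 > 0" "!!x. c1 * (norm x)\<^sup>2 <= quad A x"
using sym_pos_def_lower[OF A] unfolding quad_def by blast
obtain C where C: "C > 0" "!!\<tau> z r. norm \<tau> <= 1 ==> r >= 0 ==> (!!i. norm (z $ i) <= r) ==> norm (heval M P \<tau> z) <= C * (1 + r) ^ M"
using heval_bound[OF P] by blast
obtain x0 :: "real^'n" where x0: "heval M P 0 (cvec x0) ~= 0"
by (rule leading_form_nonzero[OF m P])
define H where "H = (%(t::real, X::real^'n). heval M P (cplx t) (cvec X))"
have ccvec: "continuous_on S (%z. cvec (g z))" if "continuous_on S g" for S :: "'z::topological_space set" and g :: "'z => real^'n"
unfolding cvec_def using that by (intro continuous_intros)
have "continuous_on UNIV H"
unfolding H_def case_prod_beta by (intro continuous_intros ccvec)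
hence "continuous (at (0, x0)) H" by (simp add: continuous_on_eq_continuous_at)
moreover have "H (0, x0) ~= 0" using x0 by (simp add: H_def)
ultimately obtain \<delta>1 \<eta>1 where \<delta>1: "\<delta>1 > 0" "\<eta>1 > 0" "!!t x. \<bar>t\<bar> < \<delta>1 ==> norm (x - x0) < \<delta>1 ==> norm (H (t, x)) >= \<eta>1"
by (rule continuous_nonzero_ball) blast
define \<Theta> where "\<Theta> = (%(t::real, X::real^'n). LINT x|lborel. heval M P (cplx t) (\<chi> i. cplx t * cplx (x $ i) - \<i> * cplx (X $ i)) * cplx (exp (- quad A x)))"
have "continuous (at (0, x0)) \<Theta>"
proof (rule continuous_at_sequentiallyI)
fix u :: "nat => real \<times> (real^'n)" assume u: "u \<longlonglongrightarrow> (0, x0)"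
have u1: "(%k. fst (u k)) \<longlonglongrightarrow> 0" and u2: "(%k. snd (u k)) \<longlonglongrightarrow> x0"
 using tendsto_fst[OF u] tendsto_snd[OF u] by simp_all
have "\<forall>\<^sub>F k in sequentially. dist (u k) (0, x0) < 1" using u by (rule tendstoD) simp
then obtain N where N: "!!k. k >= N ==> dist (u k) (0, x0) < 1" by (auto simp: eventually_sequentially)
have N1: "\<bar>fst (u k)\<bar> <= 1" "norm (snd (u k)) <= norm x0 + 1" if "k >= N" for k
proof -
 show "\<bar>fst (u k)\<bar> <= 1" using N[OF that] dist_fst_le[of "u k" "(0, x0)"] by (simp add: dist_norm)
 have "norm (snd (u k) - x0) <= 1" using N[OF that] dist_snd_le[of "u k" "(0, x0)"] by (simp add: dist_norm)
 thus "norm (snd (u k)) <= norm x0 + 1" using norm_triangle_sub[of "snd (u k)" x0] by simp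
qed
let ?F = "%t (X::real^'n) (x::real^'n). heval M P (cplx t) (\<chi> i. cplx t * cplx (x $ i) - \<i> * cplx (X $ i)) * cplx (exp (- quad A x))"
have Fm: "?F t X \<in> borel_measurable borel" for t X
proof -
 have "(%x. heval M P (cplx t) (\<chi> i. cplx t * cplx (x $ i) - \<i> * cplx (X $ i))) \<in> borel_measurable borel"
 by (rule heval_measurable, unfold vec_lambda_beta, measurable)
 thus ?thesis by measurable
qed
have "(%k. LINT x|lborel. ?F (fst (u (k + N))) (snd (u (k + N))) x) \<longlonglongrightarrow> (LINT x|lborel. ?F 0 x0 x)"
proof (rule integral_dominated_convergence[where w = "%x. C * (2 + norm x0) ^ M * ((1 + norm x) ^ M * exp (0 * norm x - c1 * (norm x)\<^sup>2))"])
 show "integrable lborel (%x::real^'n. C * (2 + norm x0) ^ M * ((1 + norm x) ^ M * exp (0 * norm x - c1 * (norm x)\<^sup>2)))"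
 by (intro integrable_mult_right integrable_poly_gaussian c1)
 show "AE x in lborel. (%k. ?F (fst (u (k + N))) (snd (u (k + N))) x) \<longlonglongrightarrow> ?F 0 x0 x"
 proof (rule AE_I2)
 fix x :: "real^'n"
 have cont: "continuous_on UNIV (%z. ?F (fst z) (snd z) x)"
 by (intro continuous_intros)
 have "(%k. u (k + N)) \<longlonglongrightarrow> (0, x0)" by (rule LIMSEQ_ignore_initial_segment[OF u])
 from continuous_on_tendsto_compose[OF cont this]
 show "(%k. ?F (fst (u (k + N))) (snd (u (k + N))) x) \<longlonglongrightarrow> ?F 0 x0 x" by simp
 qed
 show "AE x in lborel. norm (?F (fst (u (k + N))) (snd (u (k + N))) x) <= C * (2 + norm x0) ^ M * ((1 + norm x) ^ M * exp (0 * norm x - c1 * (norm x)\<^sup>2))" for k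
 proof (rule AE_I2)
 fix x :: "real^'n"
 let ?t = "fst (u (k + N))" and ?X = "snd (u (k + N))"
 have t: "\<bar>?t\<bar> <= 1" and X: "norm ?X <= norm x0 + 1" using N1[of "k + N"] by auto
 have "norm (heval M P (cplx ?t) (\<chi> i. cplx ?t * cplx (x $ i) - \<i> * cplx (?X $ i))) <= C * (1 + (norm x + (norm x0 + 1))) ^ M"
 proof (rule C(2))
 fix i
 have "norm (cplx ?t * cplx (x $ i) - \<i> * cplx (?X $ i)) <= \<bar>?t\<bar> * \<bar>x $ i\<bar> + \<bar>?X $ i\<bar>"
  by (rule order_trans[OF norm_triangle_ineq4]) (simp add: norm_mult)
 also have "... <= 1 * norm x + (norm x0 + 1)"
  using t X component_le_norm_cart[of x i] component_le_norm_cart[of ?X i] by (intro add_mono mult_mono) auto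
 finally show "norm ((\<chi> i. cplx ?t * cplx (x $ i) - \<i> * cplx (?X $ i)) $ i) <= norm x + (norm x0 + 1)" by simp
 qed (use t in auto)
 also have "... <= C * ((2 + norm x0) * (1 + norm x)) ^ M"
 using C(1) by (intro mult_left_mono power_mono) (auto simp: algebra_simps)
 finally have "norm (heval M P (cplx ?t) (\<chi> i. cplx ?t * cplx (x $ i) - \<i> * cplx (?X $ i))) <= C * (2 + norm x0) ^ M * (1 + norm x) ^ M"
 by (simp add: power_mult_distrib mult.assoc)
 moreover have "exp (- quad A x) <= exp (0 * norm x - c1 * (norm x)\<^sup>2)" using c1(2)[of x] by simp
 ultimately have "norm (heval M P (cplx ?t) (\<chi> i. cplx ?t * cplx (x $ i) - \<i> * cplx (?X $ i))) * exp (- quad A x) <= (C * (2 + norm x0) ^ M * (1 + norm x) ^ M) * exp (0 * norm x - c1 * (norm x)\<^sup>2)"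
 using C(1) by (intro mult_mono) auto
 thus "norm (?F ?t ?X x) <= C * (2 + norm x0) ^ M * ((1 + norm x) ^ M * exp (0 * norm x - c1 * (norm x)\<^sup>2))"
 by (simp add: norm_mult mult.assoc)
 qed
qed (use Fm in simp_all)
hence "(%k. \<Theta> (u (k + N))) \<longlonglongrightarrow> \<Theta> (0, x0)" unfolding \<Theta>_def case_prod_beta by simp
thus "(%k. \<Theta> (u k)) \<longlonglongrightarrow> \<Theta> (0, x0)" by (rule LIMSEQ_offset)
qed
moreover have "\<Theta> (0, x0) ~= 0"
proof -
have "heval M P 0 (\<chi> i. - \<i> * cplx (x0 $ i)) = (- \<i>) ^ M * heval M P 0 (cvec x0)"
 unfolding heval_def sum_distrib_left
proof (rule sum.cong)
 fix k assume k: "k \<in> Poly_Mapping.keys P"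
 have "(\<Prod>i\<in>UNIV. ((\<chi> i. - \<i> * cplx (x0 $ i)) $ i) ^ Poly_Mapping.lookup k i) = (- \<i>) ^ expo_degree k * (\<Prod>i\<in>UNIV. (cvec x0 $ i) ^ Poly_Mapping.lookup k i)"
 by (simp only: vec_lambda_beta cvec_nth power_mult_distrib prod.distrib expo_degree_def power_sum)
 thus "Poly_Mapping.lookup P k * 0 ^ (M - expo_degree k) * (\<Prod>i\<in>UNIV. ((\<chi> i. - \<i> * cplx (x0 $ i)) $ i) ^ Poly_Mapping.lookup k i)
 = (- \<i>) ^ M * (Poly_Mapping.lookup P k * 0 ^ (M - expo_degree k) * (\<Prod>i\<in>UNIV. (cvec x0 $ i) ^ Poly_Mapping.lookup k i))"
 using k P by (cases "expo_degree k = M") (auto simp: deg_le_def)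
qed simp
moreover have "\<Theta> (0, x0) = heval M P 0 (\<chi> i. - \<i> * cplx (x0 $ i)) * cplx (LINT x|lborel. exp (- quad A x))"
 by (simp add: \<Theta>_def integral_complex_of_real)
moreover have "(LINT x|lborel. exp (- quad A x)) ~= 0"
proof
 have ei: "integrable lborel (%x. exp (- quad A x))"
 proof (rule Bochner_Integration.integrable_bound[OF integrable_gaussian[OF c1(1)]])
 show "AE x in lborel. norm (exp (- quad A x)) <= norm (exp (- c1 * (norm x)\<^sup>2))"
 using c1(2) by (intro AE_I2) simp
 qed measurable
 assume "(LINT x|lborel. exp (- quad A x)) = 0"
 hence "AE x in lborel. exp (- quad A x) = 0"
 by (subst (asm) integral_nonneg_eq_0_iff_AE[OF ei]) auto
 hence "AE x::real^'n in lborel. False" by simp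
 then obtain N :: "(real^'n) set" where N: "N \<in> null_sets lborel" "UNIV \<subseteq> N"
 by (auto simp: eventually_ae_filter)
 hence "N = UNIV" by blast
 with N(1) show False by (simp add: null_sets_def)
qed
ultimately show ?thesis using x0 by simp
qed
ultimately obtain \<delta>2 \<eta>2 where \<delta>2: "\<delta>2 > 0" "\<eta>2 > 0" "!!t x. \<bar>t\<bar> < \<delta>2 ==> norm (x - x0) < \<delta>2 ==> norm (\<Theta> (t, x)) >= \<eta>2"
by (rule continuous_nonzero_ball) blast
define \<delta> where "\<delta> = min \<delta>1 \<delta>2"
have \<delta>: "\<delta> > 0" "\<delta> <= \<delta>1" "\<delta> <= \<delta>2" using \<delta>1(1) \<delta>2(1) by (auto simp: \<delta>_def)
define s0 where "s0 = max 1 (4 / \<delta>)"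
have s0: "s0 >= 1" "4 / \<delta> <= s0" by (auto simp: s0_def)
obtain \<beta>B where \<beta>B: "\<beta>B > 0" "!!y. norm (B *v y) <= \<beta>B * norm y" using matrix_norm_bound by blast
obtain \<beta> where \<beta>: "\<beta> > 0" "!!x. \<bar>quad A x\<bar> <= \<beta> * (norm x)\<^sup>2" using quad_abs_bound by blast
define v where "v y = (1/2) *\<^sub>R (B *v y)" for y
have Av: "2 *\<^sub>R (A *v (v y)) = y" for y by (simp add: v_def matrix_vector_mult_scaleR AB)
define y0 where "y0 = 2 *\<^sub>R (A *v x0)"
define \<rho> where "\<rho> = \<delta> / (2 * \<beta>B)"
have \<rho>: "\<rho> > 0" using \<delta> \<beta>B by (simp add: \<rho>_def)
have Ainj: "x = x'" if "A *v x = A *v x'" for x x'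
proof (rule ccontr)
assume "x ~= x'"
hence "(A *v (x - x')) \<bullet> (x - x') > 0" using A by (simp add: sym_pos_def_def)
thus False using that by (simp add: matrix_vector_mult_diff_distrib)
qed
have vy0: "v y0 = x0"
by (rule Ainj) (use Av[of y0] in \<open>simp add: y0_def\<close>)
have vnear: "norm ((1 / s) *\<^sub>R v y - x0) < \<delta> / 2" if "s > 0" "y \<in> ball (s *\<^sub>R y0) (s * \<rho>)" for s y
proof -
have "(1 / s) *\<^sub>R v y - x0 = (1/2) *\<^sub>R (B *v ((1 / s) *\<^sub>R (y - s *\<^sub>R y0)))"
 using that(1) unfolding vy0[symmetric]
 by (simp add: v_def matrix_vector_mult_scaleR matrix_vector_mult_diff_distrib scaleR_diff_right)
also have "norm ... <= (1/2) * (\<beta>B * norm ((1 / s) *\<^sub>R (y - s *\<^sub>R y0)))"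
 using \<beta>B(2)[of "(1 / s) *\<^sub>R (y - s *\<^sub>R y0)"] by simp
also have "... <= \<beta>B * (norm (y - s *\<^sub>R y0) / s)"
proof -
 have eq: "norm ((1 / s) *\<^sub>R (y - s *\<^sub>R y0)) = norm (y - s *\<^sub>R y0) / s" using that(1) by simp
 have "0 <= \<beta>B * (norm (y - s *\<^sub>R y0) / s)" using that(1) \<beta>B(1) by simp
 thus ?thesis unfolding eq by linarith
qed
also have "... < \<beta>B * \<rho>"
 using that \<beta>B(1) by (simp add: dist_norm norm_minus_commute field_simps)
also have "... = \<delta> / 2" using \<beta>B(1) by (simp add: \<rho>_def)
finally show ?thesis .
qed
define \<Lambda> where "\<Lambda> = 2 * \<beta> * (norm x0 + \<delta>)\<^sup>2"
have \<Lambda>0: "\<Lambda> >= 0" using \<beta>(1) by (simp add: \<Lambda>_def)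
define c2 where "c2 = \<eta>1 * (norm \<alpha> * \<eta>2) * exp (- (s0\<^sup>2 * \<Lambda>) - \<beta>)"
have c2: "c2 > 0" using \<delta>1(2) \<delta>2(2) \<alpha> by (simp add: c2_def)
have lower: "c2 * s ^ (2 * M) <= norm (pgauss P A x) * norm (\<alpha> * FT (pgauss P A) y) * exp (a * \<bar>x \<bullet> y\<bar>)"
if a: "0 < a" "a < 1" and s: "s >= s0" "(1 - a) * s\<^sup>2 <= s0\<^sup>2" and y: "y \<in> ball (s *\<^sub>R y0) (s * \<rho>)" and x: "x \<in> ball (v y) 1" for a s x y
proof -
have s1: "s >= 1" "s > 0" using s s0 by auto
have sd: "1 / s < \<delta> / 2"
proof -
 have "4 / \<delta> <= s" using s s0 by simp
 thus ?thesis using \<delta>(1) s1 by (simp add: field_simps)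
qed
have near1: "norm ((1 / s) *\<^sub>R v y - x0) < \<delta> / 2" by (rule vnear[OF s1(2) y])
have near2: "norm ((1 / s) *\<^sub>R x - x0) < \<delta>"
proof -
 have "norm ((1 / s) *\<^sub>R (x - v y)) < \<delta> / 2"
 proof -
 have "norm ((1 / s) *\<^sub>R (x - v y)) <= 1 / s * 1"
 using x s1 by (simp add: dist_norm norm_minus_commute divide_right_mono)
 thus ?thesis using sd by linarith
 qed
 moreover have "(1 / s) *\<^sub>R x - x0 = (1 / s) *\<^sub>R (x - v y) + ((1 / s) *\<^sub>R v y - x0)" by (simp add: scaleR_diff_right)
 ultimately show ?thesis using near1 norm_triangle_ineq[of "(1 / s) *\<^sub>R (x - v y)" "(1 / s) *\<^sub>R v y - x0"] by (simp only:)
qed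
have Px: "norm (cpoly_eval P x) >= s ^ M * \<eta>1"
proof -
 have "cvec x = (\<chi> i. cplx s * cvec ((1 / s) *\<^sub>R x) $ i)"
 using s1 by (simp add: vec_eq_iff)
 hence "cpoly_eval P x = cplx s ^ M * heval M P (1 / cplx s) (cvec ((1 / s) *\<^sub>R x))"
 unfolding cpoly_eval_heval[of P x M] using heval_scale[OF P, of "cplx s" "cvec ((1 / s) *\<^sub>R x)"] s1 by simp
 hence "norm (cpoly_eval P x) = s ^ M * norm (H (1 / s, (1 / s) *\<^sub>R x))"
 using s1 by (simp add: H_def norm_mult norm_power)
 moreover have "norm (H (1 / s, (1 / s) *\<^sub>R x)) >= \<eta>1"
 using near2 \<delta> sd s1 by (intro \<delta>1(3)) auto
 ultimately show ?thesis using s1 by (simp add: mult_left_mono)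
qed
have Wy: "norm (shifted_mean M P A (v y)) >= s ^ M * \<eta>2"
proof -
 have "heval M P 1 (\<chi> i. cplx (w $ i) - \<i> * cplx (v y $ i))
 = cplx s ^ M * heval M P (cplx (1 / s)) (\<chi> i. cplx (1 / s) * cplx (w $ i) - \<i> * cplx (((1 / s) *\<^sub>R v y) $ i))" for w :: "real^'n"
 proof -
 have "(\<chi> i. cplx (w $ i) - \<i> * cplx (v y $ i)) = (\<chi> i. cplx s * ((\<chi> i. cplx (1 / s) * cplx (w $ i) - \<i> * cplx (((1 / s) *\<^sub>R v y) $ i)) $ i))"
 using s1 by (simp add: vec_eq_iff right_diff_distrib)
 thus ?thesis using heval_scale[OF P, of "cplx s" "\<chi> i. cplx (1 / s) * cplx (w $ i) - \<i> * cplx (((1 / s) *\<^sub>R v y) $ i)"] s1 by simp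
 qed
 hence "shifted_mean M P A (v y) = cplx s ^ M * \<Theta> (1 / s, (1 / s) *\<^sub>R v y)"
 unfolding shifted_mean_def \<Theta>_def by (simp only: prod.case mult.assoc integral_mult_right_zero)
 hence "norm (shifted_mean M P A (v y)) = s ^ M * norm (\<Theta> (1 / s, (1 / s) *\<^sub>R v y))"
 using s1 by (simp add: norm_mult norm_power)
 moreover have "norm (\<Theta> (1 / s, (1 / s) *\<^sub>R v y)) >= \<eta>2"
 using near1 \<delta> sd s1 by (intro \<delta>2(3)) auto
 ultimately show ?thesis using s1 by (simp add: mult_left_mono)
qed
have FTy: "norm (FT (pgauss P A) y) = exp (- quad A (v y)) * norm (shifted_mean M P A (v y))"
 using FT_pgauss[OF A, of P "v y" M] unfolding Av by (simp add: norm_mult)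
have qb: "quad A z <= s\<^sup>2 * (\<Lambda> / 2)" if "norm ((1 / s) *\<^sub>R z - x0) < \<delta>" for z
proof -
 have "norm ((1 / s) *\<^sub>R z) <= norm x0 + \<delta>" using that norm_triangle_sub[of "(1 / s) *\<^sub>R z" x0] by simp
 hence "(norm ((1 / s) *\<^sub>R z))\<^sup>2 <= (norm x0 + \<delta>)\<^sup>2" by (intro power_mono) auto
 hence "\<beta> * (norm ((1 / s) *\<^sub>R z))\<^sup>2 <= \<Lambda> / 2" using \<beta>(1) by (simp add: \<Lambda>_def)
 hence "quad A ((1 / s) *\<^sub>R z) <= \<Lambda> / 2" using \<beta>(2)[of "(1 / s) *\<^sub>R z"] by linarith
 hence "s\<^sup>2 * quad A ((1 / s) *\<^sub>R z) <= s\<^sup>2 * (\<Lambda> / 2)" by (intro mult_left_mono) auto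
 thus ?thesis using s1 by (simp add: quad_scaleR power_divide)
qed
have "quad A x + quad A (v y) <= s\<^sup>2 * \<Lambda>"
 using qb[OF near2] qb[of "v y"] near1 \<delta>(1) by simp
hence "(1 - a) * (quad A x + quad A (v y)) <= (1 - a) * (s\<^sup>2 * \<Lambda>)"
 using a by (intro mult_left_mono) auto
also have "... <= s0\<^sup>2 * \<Lambda>" using mult_right_mono[OF s(2) \<Lambda>0] by (simp add: mult.assoc)
finally have e1: "(1 - a) * (quad A x + quad A (v y)) <= s0\<^sup>2 * \<Lambda>" .
have "quad A (x - v y) <= \<beta> * 1"
proof -
 have "norm (x - v y) <= 1" using x by (simp add: dist_norm norm_minus_commute)
 hence "(norm (x - v y))\<^sup>2 <= 1" by (simp add: power_le_one)
 hence "\<beta> * (norm (x - v y))\<^sup>2 <= \<beta> * 1" using \<beta>(1) by (intro mult_left_mono) auto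
 thus ?thesis using \<beta>(2)[of "x - v y"] by linarith
qed
hence e2: "a * quad A (x - v y) <= \<beta>"
 using a \<beta>(1) mult_mono[of a 1 "quad A (x - v y)" \<beta>] c1(2)[of "x - v y"] c1(1)
 by (smt (verit) mult_nonneg_nonneg zero_le_power2)
have e3: "a * (x \<bullet> y) = a * (quad A x + quad A (v y)) - a * quad A (x - v y)"
proof -
 have "x \<bullet> y = 2 * ((A *v v y) \<bullet> x)" using Av[of y] by (metis inner_commute inner_scaleR_left)
 thus ?thesis unfolding quad_diff_identity[OF sym] by (simp add: algebra_simps)
qed
have "- (s0\<^sup>2 * \<Lambda>) - \<beta> <= - quad A x - quad A (v y) + a * (x \<bullet> y)"
 using e1 e2 unfolding e3 by (simp add: algebra_simps)
also have "... <= - quad A x - quad A (v y) + a * \<bar>x \<bullet> y\<bar>" using a by simp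
finally have ex: "exp (- (s0\<^sup>2 * \<Lambda>) - \<beta>) <= exp (- quad A x - quad A (v y) + a * \<bar>x \<bullet> y\<bar>)" by simp
have "c2 * s ^ (2 * M) = ((s ^ M * \<eta>1) * (norm \<alpha> * (s ^ M * \<eta>2))) * exp (- (s0\<^sup>2 * \<Lambda>) - \<beta>)"
proof -
 have "s ^ (2 * M) = s ^ M * s ^ M" by (simp add: mult_2 power_add)
 thus ?thesis unfolding c2_def by (simp only: mult_ac)
qed
also have "... <= (norm (cpoly_eval P x) * (norm \<alpha> * norm (shifted_mean M P A (v y)))) * exp (- quad A x - quad A (v y) + a * \<bar>x \<bullet> y\<bar>)"
 using s1 \<delta>1(2) \<delta>2(2) by (intro mult_mono Px Wy ex order_refl) (auto intro!: mult_nonneg_nonneg)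
also have "... = norm (pgauss P A x) * norm (\<alpha> * FT (pgauss P A) y) * exp (a * \<bar>x \<bullet> y\<bar>)"
 unfolding norm_mult FTy pgauss_def norm_of_real by (simp add: exp_add exp_diff exp_minus field_simps)
finally show ?thesis .
qed
define V where "V = unit_ball_vol (real CARD('n))"
have V: "V > 0" by (simp add: V_def)
have [measurable]: "v \<in> borel_measurable borel"
unfolding v_def[abs_def]
by (intro borel_measurable_continuous_onI continuous_intros linear_continuous_on_compose[OF continuous_on_id]) auto
define c where "c = c2 * V * (\<rho> ^ CARD('n) * V)"
have "c > 0" using c2 V \<rho> by (simp add: c_def)
moreover have "ennreal (c * blowup a ^ (CARD('n) + 2 * M)) <= KK a (pgauss P A) (%y. \<alpha> * FT (pgauss P A) y)"
if a: "0 < a" "a < 1" for a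
proof -
define s where "s = max s0 (blowup a)"
have b: "blowup a >= 1" "(1 - a) * (blowup a)\<^sup>2 = 1" using blowup_props[of a] a by auto
have s: "s >= s0" "s >= blowup a" "s > 0" using s0 by (auto simp: s_def)
have s2: "(1 - a) * s\<^sup>2 <= s0\<^sup>2"
proof (cases "s0 <= blowup a")
 case True
 thus ?thesis using b(2) s0(1) by (simp add: s_def max_def one_le_power)
next
 case False
 thus ?thesis using a by (simp add: s_def max_def mult_left_le_one_le)
qed
let ?I = "%x y. norm (pgauss P A x) * norm (\<alpha> * FT (pgauss P A) y) * exp (a * \<bar>x \<bullet> y\<bar>)"
have "ennreal (c * blowup a ^ (CARD('n) + 2 * M)) <= ennreal (c * s ^ (CARD('n) + 2 * M))"
 using \<open>c > 0\<close> s(2) b(1) by (intro ennreal_leI mult_left_mono power_mono) auto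
also have "... = (\<integral>\<^sup>+y. ennreal (c2 * s ^ (2 * M) * V) * indicator (ball (s *\<^sub>R y0) (s * \<rho>)) y \<partial>lborel)"
 using s \<rho> c2 V
 by (subst nn_integral_cmult_indicator)
 (auto simp: emeasure_ball V_def c_def ennreal_mult[symmetric] power_mult_distrib power_add mult_ac)
also have "... <= (\<integral>\<^sup>+y. \<integral>\<^sup>+x. ennreal (?I x y) \<partial>lborel \<partial>lborel)"
proof (rule nn_integral_mono)
 fix y :: "real^'n"
 show "ennreal (c2 * s ^ (2 * M) * V) * indicator (ball (s *\<^sub>R y0) (s * \<rho>)) y <= (\<integral>\<^sup>+x. ennreal (?I x y) \<partial>lborel)"
 proof (cases "y \<in> ball (s *\<^sub>R y0) (s * \<rho>)")
 case True
 have "ennreal (c2 * s ^ (2 * M) * V) = (\<integral>\<^sup>+x. ennreal (c2 * s ^ (2 * M)) * indicator (ball (v y) 1) x \<partial>lborel)"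
 using s c2 V by (subst nn_integral_cmult_indicator) (auto simp: emeasure_ball V_def ennreal_mult)
 also have "... <= (\<integral>\<^sup>+x. ennreal (?I x y) \<partial>lborel)"
 proof (rule nn_integral_mono)
 fix x
 show "ennreal (c2 * s ^ (2 * M)) * indicator (ball (v y) 1) x <= ennreal (?I x y)"
  using lower[OF a s(1) s2 True, of x] by (cases "x \<in> ball (v y) 1") (auto intro: ennreal_leI)
 qed
 finally show ?thesis using True by simp
 qed simp
qed
also have "... = KK a (pgauss P A) (%y. \<alpha> * FT (pgauss P A) y)"
 by (rule KK_swap[symmetric]) measurable
finally show ?thesis .
qed
ultimately show ?thesis using that by blast
qed

section \<open>Entire functions of order two: the product with the rotated function\<close>

lemma double_exp_decay:
assumes A: "A >= 0" and B: "B >= 0" and c: "c > 0" and \<rho>: "\<rho> > 2" and \<eta>: "\<eta> > 0"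
shows "\<exists>T0. \<forall>T\<ge>T0. A * exp (B * exp (2 * T)) * exp (- c * exp (\<rho> * T)) <= (\<eta>::real)"
proof (intro exI allI impI)
define Q where "Q = A / \<eta>"
define T0 where "T0 = max 0 ((B + Q) / (c * (\<rho> - 2)))"
fix T assume T: "T >= T0"
have Q: "Q >= 0" using A \<eta> by (simp add: Q_def)
have T1: "T >= 0" "(B + Q) / (c * (\<rho> - 2)) <= T" using T by (auto simp: T0_def)
have "B + Q <= c * ((\<rho> - 2) * T)"
using T1(2) c \<rho> by (simp add: field_simps)
also have "... <= c * exp ((\<rho> - 2) * T)"
proof (rule mult_left_mono)
show "(\<rho> - 2) * T <= exp ((\<rho> - 2) * T)" using exp_ge_add_one_self[of "(\<rho> - 2) * T"] by linarith
qed (use c in simp)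
finally have 1: "B + Q <= c * exp ((\<rho> - 2) * T)" .
have "exp (\<rho> * T) = exp (2 * T) * exp ((\<rho> - 2) * T)" by (simp add: exp_add[symmetric] algebra_simps)
hence "B * exp (2 * T) - c * exp (\<rho> * T) = - (exp (2 * T) * (c * exp ((\<rho> - 2) * T) - B))"
by (simp add: algebra_simps)
also have "... <= - (1 * Q)"
using T1(1) Q 1 by (intro le_imp_neg_le mult_mono) auto
finally have 2: "B * exp (2 * T) - c * exp (\<rho> * T) <= - Q" by simp
have "A * exp (B * exp (2 * T)) * exp (- c * exp (\<rho> * T)) = A * exp (B * exp (2 * T) - c * exp (\<rho> * T))"
by (simp add: exp_diff exp_minus field_simps)
also have "... <= A * exp (- Q)" using A 2 by (intro mult_left_mono) auto
also have "... <= \<eta>"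
proof -
have "A = Q * \<eta>" using \<eta> by (simp add: Q_def)
also have "... <= exp Q * \<eta>"
proof (rule mult_right_mono)
 show "Q <= exp Q" using exp_ge_add_one_self[of Q] by linarith
qed (use \<eta> in simp)
finally show ?thesis by (simp add: exp_minus field_simps)
qed
finally show "A * exp (B * exp (2 * T)) * exp (- c * exp (\<rho> * T)) <= \<eta>" .
qed

text \<open>The auxiliary factor decays doubly exponentially in the logarithm of the variable, so it dominates growth of order two in a sector whose opening is less than a right angle; then it is removed by a limit.\<close>
lemma phragmen_lindelof_sector:
fixes F :: "complex => complex"
assumes ab: "a < b" "b - a < pi / 2"
and hol: "F holomorphic_on U" and U: "open U" "0 \<in> U" "!!w. a <= Im w ==> Im w <= b ==> exp w \<in> U"
and AB: "A >= 0" "B >= 0" and F0: "norm (F 0) <= M"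
and growth: "!!w. a <= Im w ==> Im w <= b ==> norm (F (exp w)) <= A * exp (B * exp (2 * Re w))"
and bdry: "!!w. Im w = a \<or> Im w = b ==> norm (F (exp w)) <= M"
and w0: "a <= Im w0" "Im w0 <= b"
shows "norm (F (exp w0)) <= M"
proof -
define \<mu> where "\<mu> = (a + b) / 2"
define \<rho> where "\<rho> = (2 + pi / (b - a)) / 2"
have pib: "pi / (b - a) > 2" using ab by (simp add: field_simps)
have mid: "2 < (2 + X) / 2" "(2 + X) / 2 < X" if "2 < X" for X :: real using that by auto
have "\<rho> > 2" unfolding \<rho>_def by (rule mid(1)[OF pib])
moreover have "\<rho> < pi / (b - a)" unfolding \<rho>_def by (rule mid(2)[OF pib])
ultimately have \<rho>: "\<rho> > 2" "\<rho> < pi / (b - a)" by blast+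
define \<delta> where "\<delta> = cos (\<rho> * ((b - a) / 2))"
have ang: "\<rho> * ((b - a) / 2) < pi / 2" "\<rho> * ((b - a) / 2) > 0" using \<rho> ab by (auto simp: field_simps)
have \<delta>: "\<delta> > 0" unfolding \<delta>_def using ang by (intro cos_gt_zero) auto
have cosge: "cos (\<rho> * (t - \<mu>)) >= \<delta>" if "a <= t" "t <= b" for t
proof -
have "\<bar>t - \<mu>\<bar> <= (b - a) / 2" using that unfolding \<mu>_def by (simp add: abs_le_iff field_simps)
hence "\<bar>\<rho> * (t - \<mu>)\<bar> <= \<rho> * ((b - a) / 2)" using \<rho> by (simp add: abs_mult)
hence "cos (\<rho> * ((b - a) / 2)) <= cos \<bar>\<rho> * (t - \<mu>)\<bar>"
 using ang by (intro cos_monotone_0_pi_le) auto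
thus ?thesis by (simp add: \<delta>_def)
qed
have main: "norm (F (exp w0)) * exp (- \<epsilon> * exp (\<rho> * Re w0)) <= M + \<eta>" if \<epsilon>: "\<epsilon> > 0" and \<eta>: "\<eta> > 0" for \<epsilon> \<eta>
proof -
define H where "H w = F (exp w) * exp (- cplx \<epsilon> * exp (cplx \<rho> * (w - \<i> * cplx \<mu>)))" for w
have ReE: "Re (exp (cplx \<rho> * (w - \<i> * cplx \<mu>))) = exp (\<rho> * Re w) * cos (\<rho> * (Im w - \<mu>))" for w
 by (simp add: Re_exp)
have normH: "norm (H w) = norm (F (exp w)) * exp (- \<epsilon> * (exp (\<rho> * Re w) * cos (\<rho> * (Im w - \<mu>))))" for w
 unfolding H_def norm_mult norm_exp_eq_Re using ReE[of w] by simp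
have normH_le: "norm (H w) <= norm (F (exp w)) * exp (- \<epsilon> * \<delta> * exp (\<rho> * Re w))" if "a <= Im w" "Im w <= b" for w
proof -
 have "\<delta> * exp (\<rho> * Re w) <= exp (\<rho> * Re w) * cos (\<rho> * (Im w - \<mu>))"
 using cosge[OF that] by simp
 hence "\<epsilon> * (\<delta> * exp (\<rho> * Re w)) <= \<epsilon> * (exp (\<rho> * Re w) * cos (\<rho> * (Im w - \<mu>)))"
 using \<epsilon> by (intro mult_left_mono) auto
 thus ?thesis unfolding normH by (intro mult_left_mono) (auto simp: mult.assoc)
qed
have normH_le1: "norm (H w) <= norm (F (exp w))" if "a <= Im w" "Im w <= b" for w
proof -
 have "exp (- \<epsilon> * \<delta> * exp (\<rho> * Re w)) <= 1" using \<epsilon> \<delta> by simp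
 from mult_left_mono[OF this norm_ge_zero[of "F (exp w)"]] show ?thesis using normH_le[OF that] by simp
qed
obtain d where d: "d > 0" "!!z. norm z < d ==> norm (F z - F 0) < \<eta>"
proof -
 have "continuous (at 0) F"
 using holomorphic_on_imp_continuous_on[OF hol] U by (simp add: continuous_on_eq_continuous_at)
 thus ?thesis using \<eta> that unfolding continuous_at_eps_delta dist_norm by (metis diff_zero)
qed
obtain T0 where T0: "!!T. T >= T0 ==> A * exp (B * exp (2 * T)) * exp (- (\<epsilon> * \<delta>) * exp (\<rho> * T)) <= \<eta>"
 using double_exp_decay[OF AB, of "\<epsilon> * \<delta>" \<rho> \<eta>] \<epsilon> \<delta> \<rho> \<eta> by auto
define T where "T = Max {1, T0, \<bar>Re w0\<bar>, 1 - ln d}"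
have T: "T >= 1" "T >= T0" "\<bar>Re w0\<bar> <= T" "1 - ln d <= T" by (auto simp: T_def)
have M0: "0 <= M" using F0 norm_ge_zero order_trans by blast
define S where "S = cbox (Complex (- T) a) (Complex T b)"
have memS: "w \<in> S \<longleftrightarrow> - T <= Re w \<and> Re w <= T \<and> a <= Im w \<and> Im w <= b" for w
 by (auto simp: S_def in_cbox_complex_iff)
have intS: "interior S = box (Complex (- T) a) (Complex T b)" by (simp add: S_def interior_cbox)
have "norm (H w0) <= M + \<eta>"
proof (rule maximum_modulus_frontier[where S = S and f = H and \<xi> = w0])
 have "H holomorphic_on S"
 proof -
 have "(%w. F (exp w)) holomorphic_on S"
 by (rule holomorphic_on_compose_gen[unfolded o_def, OF _ hol]) (use U memS in \<open>auto intro!: holomorphic_intros\<close>)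
 thus ?thesis unfolding H_def by (intro holomorphic_intros)
 qed
 thus "H holomorphic_on interior S" "continuous_on (closure S) H"
 using interior_subset[of S] by (auto intro: holomorphic_on_subset holomorphic_on_imp_continuous_on simp: S_def)
 show "bounded S" by (simp add: S_def bounded_cbox)
 show "w0 \<in> S" using T w0 by (auto simp: memS)
 fix w assume "w \<in> frontier S"
 hence wS: "w \<in> S" and "w \<notin> interior S" by (auto simp: frontier_def S_def)
 hence edge: "Re w = - T \<or> Re w = T \<or> Im w = a \<or> Im w = b"
 unfolding intS in_box_complex_iff memS by auto
 have strip: "a <= Im w" "Im w <= b" using wS by (auto simp: memS)
 consider "Im w = a \<or> Im w = b" | "Re w = - T" | "Re w = T" using edge by blast
 thus "norm (H w) <= M + \<eta>"
 proof cases
 case 1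
 thus ?thesis using bdry[OF 1] normH_le1[OF strip] \<eta> by linarith
 next
 case 2
 have "norm (exp w) < d"
 proof -
 have "- T < ln d" using T(4) by linarith
 thus ?thesis using d(1) by (simp add: 2 norm_exp_eq_Re) (metis exp_less_mono exp_ln)
 qed
 from d(2)[OF this] have "norm (F (exp w)) < norm (F 0) + \<eta>"
 using norm_triangle_sub[of "F (exp w)" "F 0"] by linarith
 thus ?thesis using normH_le1[OF strip] F0 by linarith
 next
 case 3
 have "norm (H w) <= A * exp (B * exp (2 * Re w)) * exp (- \<epsilon> * \<delta> * exp (\<rho> * Re w))"
 using normH_le[OF strip] growth[OF strip] by (rule order_trans[OF _ mult_right_mono]) simp
 also have "... <= \<eta>" using T0[OF T(2)] 3 by simp
 finally show ?thesis using M0 by linarith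
 qed
qed
moreover have "norm (F (exp w0)) * exp (- \<epsilon> * exp (\<rho> * Re w0)) <= norm (H w0)"
proof -
 have "\<epsilon> * (exp (\<rho> * Re w0) * cos (\<rho> * (Im w0 - \<mu>))) <= \<epsilon> * (exp (\<rho> * Re w0) * 1)"
 using \<epsilon> by (intro mult_left_mono) auto
 thus ?thesis unfolding normH by (intro mult_left_mono) auto
qed
ultimately show ?thesis by linarith
qed
have "norm (F (exp w0)) * exp (- \<epsilon> * exp (\<rho> * Re w0)) <= M" if "\<epsilon> > 0" for \<epsilon>
by (rule field_le_epsilon, rule main[OF that])
hence ev: "\<forall>\<^sub>F \<epsilon> in at_right 0. norm (F (exp w0)) * exp (- \<epsilon> * exp (\<rho> * Re w0)) <= M"
by (auto simp: eventually_at_right_field intro: exI[of _ 1])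
have "((%\<epsilon>. norm (F (exp w0)) * exp (- \<epsilon> * exp (\<rho> * Re w0))) \<longlongrightarrow> norm (F (exp w0)) * exp (- 0 * exp (\<rho> * Re w0))) (at_right 0)"
by (intro tendsto_intros)
from tendsto_upperbound[OF this ev] show ?thesis by simp
qed

lemma ray_integral_FTC:
assumes \<Phi>: "!!z. (\<Phi> has_field_derivative E z) (at z)" and E: "continuous_on UNIV E" and \<Phi>0: "\<Phi> 0 = 0" and r: "r >= 0"
shows "\<Phi> (cplx r * e) = (LINT s|lborel. indicator {0..r} s *\<^sub>R (e * E (cplx s * e)))"
and "integrable lborel (%s. indicator {0..r} s *\<^sub>R (e * E (cplx s * e)))"
proof -
have der: "((%s. \<Phi> (cplx s * e)) has_vector_derivative e * E (cplx s * e)) (at s within {0..r})" for s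
proof -
have "((%s. cplx s * e) has_vector_derivative e) (at s within {0..r})"
 by (auto intro!: derivative_eq_intros)
from field_vector_diff_chain_within[OF this, of \<Phi> "E (cplx s * e)"] \<Phi>
show ?thesis by (simp add: o_def has_field_derivative_at_within)
qed
have cont: "continuous_on {0..r} (%s. e * E (cplx s * e))"
by (intro continuous_intros continuous_on_compose2[OF E]) auto
show "\<Phi> (cplx r * e) = (LINT s|lborel. indicator {0..r} s *\<^sub>R (e * E (cplx s * e)))"
using integral_FTC_Icc[OF r der cont] \<Phi>0 by simp
show "integrable lborel (%s. indicator {0..r} s *\<^sub>R (e * E (cplx s * e)))"
using has_bochner_integral_FTC_Icc[OF r der cont] by (auto simp: has_bochner_integral_iff)
qed

lemma ray_integral_bound:
assumes \<Phi>: "!!z. (\<Phi> has_field_derivative E z) (at z)" and E: "continuous_on UNIV E" and \<Phi>0: "\<Phi> 0 = 0" and r: "r >= 0"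
and e: "norm e = 1"
and k: "!!s. 0 <= s ==> s <= r ==> norm (E (cplx s * e)) <= k s"
and Kb: "(\<integral>\<^sup>+s. ennreal (k s) * indicator {0..r} s \<partial>lborel) <= ennreal b" "b >= 0"
shows "norm (\<Phi> (cplx r * e)) <= b"
proof -
have "ennreal (norm (\<Phi> (cplx r * e))) <= (\<integral>\<^sup>+s. ennreal (norm (indicator {0..r} s *\<^sub>R (e * E (cplx s * e)))) \<partial>lborel)"
unfolding ray_integral_FTC(1)[OF \<Phi> E \<Phi>0 r]
by (rule integral_norm_bound_ennreal[OF ray_integral_FTC(2)[OF \<Phi> E \<Phi>0 r]])
also have "... <= (\<integral>\<^sup>+s. ennreal (k s) * indicator {0..r} s \<partial>lborel)"
proof (rule nn_integral_mono)
fix s :: real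
show "ennreal (norm (indicator {0..r} s *\<^sub>R (e * E (cplx s * e)))) <= ennreal (k s) * indicator {0..r} s"
 using k[of s] e by (auto simp: indicator_def norm_mult intro!: ennreal_leI)
qed
also note Kb(1)
finally show ?thesis using Kb(2) by simp
qed

text \<open>On a boundary ray one factor is controlled by its values on the axis and the other by the majorant \<open>G\<close>, so the integral hypotheses bound the primitive \<open>\<Phi>\<close> of the product. Rotating slightly makes the opening smaller than a right angle, for which order two is subcritical.\<close>
lemma quadrant_bound:
fixes h1 h2 :: "complex => complex" and G :: "real => real"
assumes hol: "h1 holomorphic_on UNIV" "h2 holomorphic_on UNIV"
and AB: "A >= 0" "B >= 0"
and gr: "!!z. norm (h1 z) <= A * exp (B * (norm z)\<^sup>2)" "!!z. norm (h2 z) <= A * exp (B * (norm z)\<^sup>2)"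
and G: "!!z. norm (h1 z) <= G \<bar>Im z\<bar>" "!!z. norm (h2 z) <= G \<bar>Im z\<bar>"
and mono: "!!s t. 0 <= s ==> s <= t ==> G s <= G t"
and C: "C >= 0"
and int: "!!R. R >= 0 ==> (\<integral>\<^sup>+s. ennreal (norm (h1 (cplx s)) * G s) * indicator {0..R} s \<partial>lborel) <= ennreal (C * (1 + R) ^ L)"
 "!!R. R >= 0 ==> (\<integral>\<^sup>+s. ennreal (norm (h2 (cplx (- s))) * G s) * indicator {0..R} s \<partial>lborel) <= ennreal (C * (1 + R) ^ L)"
and \<Phi>: "!!z. (\<Phi> has_field_derivative h1 z * h2 (\<i> * z)) (at z)" "\<Phi> 0 = 0"
and w: "0 < Im w" "Im w <= pi / 2"
shows "norm (\<Phi> (exp w)) <= C * 2 ^ L * (1 + norm (exp w)) ^ L"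
proof -
have cont: "continuous_on S h1" "continuous_on S h2" for S
using hol by (auto intro: holomorphic_on_imp_continuous_on holomorphic_on_subset)
have G0: "G s >= 0" if "s >= 0" for s
using G(1)[of "\<i> * cplx s"] that by (simp add: order_trans[OF norm_ge_zero])
define E where "E \<alpha> u = h1 (exp (- (\<i> * cplx \<alpha>)) * u) * h2 (\<i> * u)" for \<alpha> u
have holE: "E \<alpha> holomorphic_on UNIV" for \<alpha>
proof -
have "(%u. h1 (exp (- (\<i> * cplx \<alpha>)) * u)) holomorphic_on UNIV"
 by (rule holomorphic_on_compose_gen[unfolded o_def, OF _ hol(1)]) (auto intro!: holomorphic_intros)
moreover have "(%u. h2 (\<i> * u)) holomorphic_on UNIV"
 by (rule holomorphic_on_compose_gen[unfolded o_def, OF _ hol(2)]) (auto intro!: holomorphic_intros)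
ultimately show ?thesis unfolding E_def by (rule holomorphic_on_mult)
qed
have contE: "continuous_on UNIV (E \<alpha>)" for \<alpha> by (rule holomorphic_on_imp_continuous_on[OF holE])
have Ebd: "norm (E \<alpha> u) <= A\<^sup>2 * exp (2 * B * (norm u)\<^sup>2)" for \<alpha> u
proof -
have "norm (E \<alpha> u) <= (A * exp (B * (norm u)\<^sup>2)) * (A * exp (B * (norm u)\<^sup>2))"
 unfolding E_def norm_mult
 using gr(1)[of "exp (- (\<i> * cplx \<alpha>)) * u"] gr(2)[of "\<i> * u"] AB
 by (intro mult_mono) (auto simp: norm_mult)
thus ?thesis by (simp add: power2_eq_square mult_ac exp_add[symmetric])
qed
have "\<exists>\<Psi>. (\<forall>z. (\<Psi> has_field_derivative E \<alpha> z) (at z)) \<and> \<Psi> 0 = 0" for \<alpha>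
proof -
obtain g where g: "!!x. x \<in> UNIV ==> (g has_field_derivative E \<alpha> x) (at x within UNIV)"
 using holomorphic_convex_primitive'[OF convex_UNIV open_UNIV holE[of \<alpha>]] by blast
have "((%z. g z - g 0) has_field_derivative E \<alpha> z) (at z)" for z
 using g[of z] by (auto intro!: derivative_eq_intros)
thus ?thesis by (intro exI[of _ "%z. g z - g 0"]) simp
qed
then obtain \<Psi> where \<Psi>: "!!\<alpha> z. (\<Psi> \<alpha> has_field_derivative E \<alpha> z) (at z)" "!!\<alpha>. \<Psi> \<alpha> 0 = 0" by metis
have sector: "norm (\<Psi> \<alpha> (exp w)) <= C * 2 ^ L * (1 + norm (exp w)) ^ L"
if \<alpha>: "0 < \<alpha>" "\<alpha> <= Im w" "\<alpha> < pi / 2" for \<alpha>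
proof -
define F where "F z = \<Psi> \<alpha> z / (1 + z) ^ L" for z
define U where "U = {z::complex. Re z > - 1}"
have polar: "exp w = cplx (exp (Re w)) * exp (\<i> * cplx (Im w))" for w
 by (metis complex_eq exp_add exp_of_real)
have Re0: "Re (exp w) >= 0" if "\<alpha> <= Im w" "Im w <= pi / 2" for w
 using that \<alpha> by (auto simp: Re_exp intro!: mult_nonneg_nonneg cos_ge_zero)
have n1: "norm (1 + z) >= 1" "norm (1 + z) >= (1 + norm z) / 2" if "Re z >= 0" for z
proof -
 have "1 + Re z <= norm (1 + z)" using complex_Re_le_cmod[of "1 + z"] by simp
 thus 1: "norm (1 + z) >= 1" using that by simp
 have "norm z <= norm (1 + z)"
 unfolding cmod_def using that by (intro real_sqrt_le_mono) (simp add: power2_eq_square algebra_simps)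
 thus "norm (1 + z) >= (1 + norm z) / 2" using 1 by simp
qed
have Psi_gr: "norm (\<Psi> \<alpha> (cplx r * e)) <= A\<^sup>2 * exp ((2 * B + 1) * r\<^sup>2)" if "r >= 0" "norm e = 1" for r e
proof (rule ray_integral_bound[OF \<Psi>(1) contE \<Psi>(2) that])
 show "norm (E \<alpha> (cplx s * e)) <= A\<^sup>2 * exp (2 * B * r\<^sup>2)" if "0 <= s" "s <= r" for s
 proof -
 have "s\<^sup>2 <= r\<^sup>2" using that by (intro power_mono)
 hence "A\<^sup>2 * exp (2 * B * s\<^sup>2) <= A\<^sup>2 * exp (2 * B * r\<^sup>2)" using AB by (intro mult_left_mono) (auto intro: mult_left_mono)
 thus ?thesis using Ebd[of \<alpha> "cplx s * e"] \<open>norm e = 1\<close> by (simp add: norm_mult)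
 qed
 have "r * exp (2 * B * r\<^sup>2) <= exp (r\<^sup>2) * exp (2 * B * r\<^sup>2)"
 proof (intro mult_right_mono)
 have "r <= 1 + r\<^sup>2" using sum_squares_bound[of 1 r] \<open>r >= 0\<close> by simp
 thus "r <= exp (r\<^sup>2)" using exp_ge_add_one_self[of "r\<^sup>2"] by linarith
 qed simp
 hence "A\<^sup>2 * (r * exp (2 * B * r\<^sup>2)) <= A\<^sup>2 * exp ((2 * B + 1) * r\<^sup>2)"
 by (intro mult_left_mono) (auto simp: exp_add[symmetric] algebra_simps)
 moreover have "(\<integral>\<^sup>+s. ennreal (A\<^sup>2 * exp (2 * B * r\<^sup>2)) * indicator {0..r} s \<partial>lborel) = ennreal (A\<^sup>2 * (r * exp (2 * B * r\<^sup>2)))"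
 using \<open>r >= 0\<close> by (subst nn_integral_cmult_indicator) (auto simp: ennreal_mult[symmetric] mult_ac)
 ultimately show "(\<integral>\<^sup>+s. ennreal (A\<^sup>2 * exp (2 * B * r\<^sup>2)) * indicator {0..r} s \<partial>lborel) <= ennreal (A\<^sup>2 * exp ((2 * B + 1) * r\<^sup>2))"
 by (simp add: ennreal_leI)
qed simp
have ray1: "norm (\<Psi> \<alpha> (cplx r * exp (\<i> * cplx \<alpha>))) <= C * (1 + r) ^ L" if "r >= 0" for r
proof (rule ray_integral_bound[OF \<Psi>(1) contE \<Psi>(2) that _ _ int(1)[OF that]])
 fix s assume s: "0 <= s" "s <= r"
 have eq1: "exp (- (\<i> * cplx \<alpha>)) * (cplx s * exp (\<i> * cplx \<alpha>)) = cplx s"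
 by (simp add: exp_minus field_simps)
 have b1: "norm (h2 (\<i> * (cplx s * exp (\<i> * cplx \<alpha>)))) <= G s"
 proof -
 have "\<bar>Im (\<i> * (cplx s * exp (\<i> * cplx \<alpha>)))\<bar> = s * cos \<alpha>"
 using s \<alpha> by (simp add: Re_exp abs_mult cos_ge_zero)
 moreover have "0 <= s * cos \<alpha>" using s \<alpha> by (intro mult_nonneg_nonneg cos_ge_zero) auto
 moreover have "s * cos \<alpha> <= s * 1" by (rule mult_left_mono[OF cos_le_one s(1)])
 ultimately show ?thesis using G(2)[of "\<i> * (cplx s * exp (\<i> * cplx \<alpha>))"] mono[of "s * cos \<alpha>" s] by simp
 qed
 show "norm (E \<alpha> (cplx s * exp (\<i> * cplx \<alpha>))) <= norm (h1 (cplx s)) * G s"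
 unfolding E_def norm_mult eq1 using b1 by (rule mult_left_mono) simp
qed (use C that in auto)
have ray2: "norm (\<Psi> \<alpha> (cplx r * \<i>)) <= C * (1 + r) ^ L" if "r >= 0" for r
proof (rule ray_integral_bound[OF \<Psi>(1) contE \<Psi>(2) that _ _ int(2)[OF that]])
 fix s assume s: "0 <= s" "s <= r"
 have eq2: "\<i> * (cplx s * \<i>) = cplx (- s)" by (simp add: complex_eq_iff)
 have b2: "norm (h1 (exp (- (\<i> * cplx \<alpha>)) * (cplx s * \<i>))) <= G s"
 proof -
 have "\<bar>Im (exp (- (\<i> * cplx \<alpha>)) * (cplx s * \<i>))\<bar> = s * cos \<alpha>"
 using s \<alpha> by (simp add: Re_exp Im_exp abs_mult cos_ge_zero)
 moreover have "0 <= s * cos \<alpha>" using s \<alpha> by (intro mult_nonneg_nonneg cos_ge_zero) auto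
 moreover have "s * cos \<alpha> <= s * 1" by (rule mult_left_mono[OF cos_le_one s(1)])
 ultimately show ?thesis using G(1)[of "exp (- (\<i> * cplx \<alpha>)) * (cplx s * \<i>)"] mono[of "s * cos \<alpha>" s] by simp
 qed
 show "norm (E \<alpha> (cplx s * \<i>)) <= norm (h2 (cplx (- s))) * G s"
 using mult_right_mono[OF b2 norm_ge_zero[of "h2 (cplx (- s))"]]
 unfolding E_def norm_mult eq2 by (simp only: mult.commute)
qed (use C that in auto)
have Fle: "norm (F z) <= C * 2 ^ L" if "Re z >= 0" "norm (\<Psi> \<alpha> z) <= C * (1 + norm z) ^ L" for z
proof -
 have "((1 + norm z) / 2) ^ L <= norm (1 + z) ^ L" by (intro power_mono n1 that) auto
 hence "(1 + norm z) ^ L <= 2 ^ L * norm (1 + z) ^ L" by (simp add: power_divide field_simps)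
 hence "C * (1 + norm z) ^ L <= C * (2 ^ L * norm (1 + z) ^ L)" using C by (rule mult_left_mono)
 hence "norm (\<Psi> \<alpha> z) <= C * 2 ^ L * norm (1 + z) ^ L" using that(2) by (simp add: mult.assoc)
 moreover have "norm (1 + z) > 0" using n1(1)[OF that(1)] by linarith
 ultimately show ?thesis by (simp add: F_def norm_divide norm_power divide_le_eq)
qed
have "norm (F (exp w)) <= C * 2 ^ L"
proof (rule phragmen_lindelof_sector[where a = \<alpha> and b = "pi / 2" and U = U and A = "A\<^sup>2" and B = "2 * B + 1"])
 show "F holomorphic_on U"
 proof -
 have "\<Psi> \<alpha> holomorphic_on U"
 using \<Psi>(1) by (meson holomorphic_on_open has_field_derivative_at_within holomorphic_on_def field_differentiable_def)
 moreover have "(1 + z) ^ L ~= 0" if "z \<in> U" for z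
 proof -
 have "Re (1 + z) > 0" using that by (simp add: U_def)
 hence "1 + z ~= 0" by force
 thus ?thesis by simp
 qed
 ultimately show ?thesis unfolding F_def by (intro holomorphic_intros) auto
 qed
 show "open U" unfolding U_def by (rule open_halfspace_Re_gt)
 show "0 \<in> U" by (simp add: U_def)
 show "norm (F 0) <= C * 2 ^ L" using \<Psi>(2) C by (simp add: F_def)
 fix v :: complex
 show "exp v \<in> U" if "\<alpha> <= Im v" "Im v <= pi / 2" using Re0[OF that] by (simp add: U_def)
 show "norm (F (exp v)) <= A\<^sup>2 * exp ((2 * B + 1) * exp (2 * Re v))" if "\<alpha> <= Im v" "Im v <= pi / 2"
 proof -
 have "norm (1 + exp v) ^ L >= 1" using n1(1)[OF Re0[OF that]] by (rule one_le_power)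
 hence "norm (F (exp v)) <= norm (\<Psi> \<alpha> (exp v))"
 unfolding F_def norm_divide norm_power by (intro divide_left_mono[of 1, simplified]) auto
 also have "... <= A\<^sup>2 * exp ((2 * B + 1) * (exp (Re v))\<^sup>2)"
 unfolding polar[of v] by (rule Psi_gr) auto
 finally show ?thesis by (simp add: exp_double)
 qed
 show "norm (F (exp v)) <= C * 2 ^ L" if "Im v = \<alpha> \<or> Im v = pi / 2"
 proof (rule Fle)
 show "Re (exp v) >= 0" using that \<alpha> by (intro Re0) auto
 have ei: "exp (\<i> * cplx (pi / 2)) = \<i>" unfolding cis_conv_exp[symmetric] by simp
 show "norm (\<Psi> \<alpha> (exp v)) <= C * (1 + norm (exp v)) ^ L"
 using that
 proof
 assume i: "Im v = \<alpha>"
 show ?thesis using ray1[of "exp (Re v)"] unfolding polar[of v] i by (simp add: norm_mult)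
 next
 assume i: "Im v = pi / 2"
 show ?thesis using ray2[of "exp (Re v)"] unfolding polar[of v] i ei by (simp add: norm_mult)
 qed
 qed
qed (use \<alpha> w AB in auto)
moreover have "norm (F (exp w)) = norm (\<Psi> \<alpha> (exp w)) / norm (1 + exp w) ^ L" by (simp add: F_def norm_divide norm_power)
moreover have pos: "norm (1 + exp w) > 0" using n1(1)[OF Re0[OF \<alpha>(2) w(2)]] by linarith
ultimately have "norm (\<Psi> \<alpha> (exp w)) <= C * 2 ^ L * norm (1 + exp w) ^ L" by (simp add: divide_le_eq)
also have "... <= C * 2 ^ L * (1 + norm (exp w)) ^ L"
 using C norm_triangle_ineq[of 1 "exp w"] by (intro mult_left_mono power_mono) auto
finally show ?thesis .
qed
have E0: "E 0 u = h1 u * h2 (\<i> * u)" for u by (simp add: E_def)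
have Psi0: "\<Psi> 0 z = \<Phi> z" for z
proof -
have "((%z. \<Psi> 0 z - \<Phi> z) has_field_derivative 0) (at z within UNIV)" for z
 using \<Psi>(1)[of 0 z] \<Phi>(1)[of z] unfolding E0 by (auto intro!: derivative_eq_intros)
from has_field_derivative_zero_constant[OF convex_UNIV this]
obtain c where "!!z. \<Psi> 0 z - \<Phi> z = c" by auto
hence "\<Psi> 0 z - \<Phi> z = \<Psi> 0 0 - \<Phi> 0" by simp
thus ?thesis using \<Psi>(2) \<Phi>(2) by simp
qed
define \<alpha> where "\<alpha> k = Im w / real (k + 2)" for k :: nat
have \<alpha>: "0 < \<alpha> k" "\<alpha> k <= Im w" "\<alpha> k < pi / 2" for k
proof -
show "0 < \<alpha> k" using w by (simp add: \<alpha>_def)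
have "\<alpha> k <= Im w / 2" unfolding \<alpha>_def using w by (intro divide_left_mono) auto
thus "\<alpha> k <= Im w" "\<alpha> k < pi / 2" using w pi_gt_zero by linarith+
qed
have \<alpha>0: "\<alpha> \<longlonglongrightarrow> 0"
proof -
have "(%k. Im w * (1 / real (k + 2))) \<longlonglongrightarrow> Im w * 0"
 by (intro tendsto_mult tendsto_const) (rule LIMSEQ_ignore_initial_segment[OF lim_1_over_n])
thus ?thesis by (simp add: \<alpha>_def[abs_def])
qed
have "(%k. \<Psi> (\<alpha> k) (exp w)) \<longlonglongrightarrow> \<Psi> 0 (exp w)"
proof -
define r where "r = exp (Re w)"
define e where "e = exp (\<i> * cplx (Im w))"
have rw: "exp w = cplx r * e" unfolding r_def e_def by (metis complex_eq exp_add exp_of_real)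
have re: "r >= 0" "norm e = 1" by (auto simp: r_def e_def)
have "(%k. LINT s|lborel. indicator {0..r} s *\<^sub>R (e * E (\<alpha> k) (cplx s * e))) \<longlonglongrightarrow> (LINT s|lborel. indicator {0..r} s *\<^sub>R (e * E 0 (cplx s * e)))"
proof (rule integral_dominated_convergence[where w = "%s. indicator {0..r} s *\<^sub>R (A\<^sup>2 * exp (2 * B * r\<^sup>2))"])
 show "integrable lborel (%s::real. indicator {0..r} s *\<^sub>R (A\<^sup>2 * exp (2 * B * r\<^sup>2)))"
 by (intro integrable_scaleR_left integrable_real_indicator) (auto simp: emeasure_lborel_Icc_eq)
 show "(%s. indicator {0..r} s *\<^sub>R (e * E a (cplx s * e))) \<in> borel_measurable lborel" for a
 using ray_integral_FTC(2)[OF \<Psi>(1) contE \<Psi>(2) re(1)] by (rule borel_measurable_integrable)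
 thus "(%s. indicator {0..r} s *\<^sub>R (e * E a (cplx s * e))) \<in> borel_measurable lborel" for a .
 show "AE s in lborel. (%k. indicator {0..r} s *\<^sub>R (e * E (\<alpha> k) (cplx s * e))) \<longlonglongrightarrow> indicator {0..r} s *\<^sub>R (e * E 0 (cplx s * e))"
 proof (intro AE_I2 tendsto_scaleR tendsto_mult tendsto_const)
 fix s :: real
 have "(%k. exp (- (\<i> * cplx (\<alpha> k))) * (cplx s * e)) \<longlonglongrightarrow> exp (- (\<i> * cplx 0)) * (cplx s * e)"
 by (intro tendsto_intros \<alpha>0)
 from continuous_on_tendsto_compose[OF cont(1)[of UNIV] this]
 show "(%k. E (\<alpha> k) (cplx s * e)) \<longlonglongrightarrow> E 0 (cplx s * e)"
 unfolding E_def by (intro tendsto_mult tendsto_const) auto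
 qed
 show "AE s in lborel. norm (indicator {0..r} s *\<^sub>R (e * E (\<alpha> k) (cplx s * e))) <= indicator {0..r} s *\<^sub>R (A\<^sup>2 * exp (2 * B * r\<^sup>2))" for k
 proof (rule AE_I2)
 fix s :: real
 show "norm (indicator {0..r} s *\<^sub>R (e * E (\<alpha> k) (cplx s * e))) <= indicator {0..r} s *\<^sub>R (A\<^sup>2 * exp (2 * B * r\<^sup>2))"
 proof (cases "s \<in> {0..r}")
 case True
 hence "s\<^sup>2 <= r\<^sup>2" by (intro power_mono) auto
 hence "A\<^sup>2 * exp (2 * B * s\<^sup>2) <= A\<^sup>2 * exp (2 * B * r\<^sup>2)" using AB by (intro mult_left_mono) (auto intro: mult_left_mono)
 thus ?thesis using Ebd[of "\<alpha> k" "cplx s * e"] True re by (simp add: norm_mult)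
 qed simp
 qed
qed
thus ?thesis unfolding rw ray_integral_FTC(1)[OF \<Psi>(1) contE \<Psi>(2) re(1), symmetric] .
qed
hence "(%k. norm (\<Psi> (\<alpha> k) (exp w))) \<longlonglongrightarrow> norm (\<Phi> (exp w))" unfolding Psi0 by (rule tendsto_norm)
thus ?thesis by (rule tendsto_upperbound) (use sector[OF \<alpha>] in auto)
qed

text \<open>The primitive of the product grows polynomially in all four quadrants, hence is a polynomial by Liouville's theorem.\<close>
theorem product_polynomial:
fixes h :: "complex => complex" and G :: "real => real"
assumes hol: "h holomorphic_on UNIV"
and AB: "A >= 0" "B >= 0"
and gr: "!!z. norm (h z) <= A * exp (B * (norm z)\<^sup>2)"
and G: "!!z. norm (h z) <= G \<bar>Im z\<bar>"
and mono: "!!s t. 0 <= s ==> s <= t ==> G s <= G t"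
and C: "C >= 0"
and int: "!!R. R >= 0 ==> (\<integral>\<^sup>+s. ennreal (norm (h (cplx s)) * G s) * indicator {0..R} s \<partial>lborel) <= ennreal (C * (1 + R) ^ L)"
 "!!R. R >= 0 ==> (\<integral>\<^sup>+s. ennreal (norm (h (cplx (- s))) * G s) * indicator {0..R} s \<partial>lborel) <= ennreal (C * (1 + R) ^ L)"
obtains p where "degree p <= L" "!!z. h z * h (\<i> * z) = poly p z"
proof -
have holm: "(%z. h (c * z)) holomorphic_on UNIV" for c
by (rule holomorphic_on_compose_gen[unfolded o_def, OF _ hol]) (auto intro!: holomorphic_intros)
have hm: "(%z. h (- z)) holomorphic_on UNIV" using holm[of "- 1"] by simp
have "(%z. h z * h (\<i> * z)) holomorphic_on UNIV" by (intro holomorphic_on_mult hol holm)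
then obtain g where g: "!!x. x \<in> UNIV ==> (g has_field_derivative h x * h (\<i> * x)) (at x within UNIV)"
using holomorphic_convex_primitive'[OF convex_UNIV open_UNIV] by blast
define \<Phi> where "\<Phi> z = g z - g 0" for z
have \<Phi>: "(\<Phi> has_field_derivative h z * h (\<i> * z)) (at z)" for z
unfolding \<Phi>_def using g[of z] by (auto intro!: derivative_eq_intros)
have \<Phi>0: "\<Phi> 0 = 0" by (simp add: \<Phi>_def)
have rot: "((%z. \<Phi> (c * z) / c) has_field_derivative h (c * z) * h (\<i> * (c * z))) (at z)" if "c ~= 0" for c z
proof -
have "((%z. \<Phi> (c * z)) has_field_derivative (h (c * z) * h (\<i> * (c * z))) * c) (at z)"
 by (rule DERIV_chain2[OF \<Phi>]) (auto intro!: derivative_eq_intros)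
from DERIV_cdivide[OF this, of c] show ?thesis using that by simp
qed
let ?K = "C * 2 ^ L"
have Gm: "norm (h (- z)) <= G \<bar>Im z\<bar>" for z using G[of "- z"] by simp
have grm: "norm (h (- z)) <= A * exp (B * (norm z)\<^sup>2)" for z using gr[of "- z"] by simp
have intm: "(\<integral>\<^sup>+s. ennreal (norm (h (- cplx s)) * G s) * indicator {0..R} s \<partial>lborel) <= ennreal (C * (1 + R) ^ L)" if "R >= 0" for R
using int(2)[OF that] by simp
have intmm: "(\<integral>\<^sup>+s. ennreal (norm (h (- cplx (- s))) * G s) * indicator {0..R} s \<partial>lborel) <= ennreal (C * (1 + R) ^ L)" if "R >= 0" for R
using int(1)[OF that] by simp
have q1: "norm (\<Phi> (exp w)) <= ?K * (1 + norm (exp w)) ^ L" if "0 < Im w" "Im w <= pi / 2" for w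
by (rule quadrant_bound[OF hol hol AB gr gr G G mono C int \<Phi> \<Phi>0 that])
have q2: "norm (\<Phi> (\<i> * exp w) / \<i>) <= ?K * (1 + norm (exp w)) ^ L" if "0 < Im w" "Im w <= pi / 2" for w
proof (rule quadrant_bound[OF hm hol AB grm gr Gm G mono C intm int(2) _ _ that])
show "((%z. \<Phi> (\<i> * z) / \<i>) has_field_derivative h (- z) * h (\<i> * z)) (at z)" for z
 using rot[of \<i> z] by (simp add: mult.commute mult.assoc[symmetric])
qed (simp_all add: \<Phi>0)
have q3: "norm (\<Phi> (- 1 * exp w) / (- 1)) <= ?K * (1 + norm (exp w)) ^ L" if "0 < Im w" "Im w <= pi / 2" for w
proof (rule quadrant_bound[OF hm hm AB grm grm Gm Gm mono C intm intmm _ _ that])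
show "((%z. \<Phi> (- 1 * z) / (- 1)) has_field_derivative h (- z) * h (- (\<i> * z))) (at z)" for z
 using rot[of "- 1" z] by simp
qed (simp_all add: \<Phi>0)
have q4: "norm (\<Phi> (- \<i> * exp w) / (- \<i>)) <= ?K * (1 + norm (exp w)) ^ L" if "0 < Im w" "Im w <= pi / 2" for w
proof (rule quadrant_bound[OF hol hm AB gr grm G Gm mono C int(1) intmm _ _ that])
show "((%z. \<Phi> (- \<i> * z) / (- \<i>)) has_field_derivative h z * h (- (\<i> * z))) (at z)" for z
 using rot[of "- \<i>" z] by (simp add: mult.commute mult.assoc[symmetric])
qed (simp_all add: \<Phi>0)
have bound: "norm (\<Phi> z) <= ?K * (1 + norm z) ^ L" if z: "z ~= 0" for z
proof -
define w where "w = Ln z"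
have ez: "exp w = z" using z by (simp add: w_def)
have im: "- pi < Im w" "Im w <= pi" using z by (auto simp: w_def mpi_less_Im_Ln Im_Ln_le_pi)
have shift: "exp (w + \<i> * cplx t) = z * exp (\<i> * cplx t)" for t by (simp add: exp_add ez)
have e1: "exp (\<i> * cplx (pi / 2)) = \<i>" "exp (\<i> * cplx (- (pi / 2))) = - \<i>" "exp (\<i> * cplx pi) = - 1"
 unfolding cis_conv_exp[symmetric] by simp_all
consider "0 < Im w" "Im w <= pi / 2" | "pi / 2 < Im w" | "Im w <= 0" "- (pi / 2) < Im w" | "Im w <= - (pi / 2)"
 by linarith
thus ?thesis
proof cases
 case 1
 thus ?thesis using q1[of w] ez by simp
next
 case 2
 have "\<i> * exp (w + \<i> * cplx (- (pi / 2))) = z" unfolding shift e1 by (simp add: complex_eq_iff)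
 moreover have "norm (exp (w + \<i> * cplx (- (pi / 2)))) = norm z" unfolding shift e1 by (simp add: norm_mult)
 ultimately show ?thesis using q2[of "w + \<i> * cplx (- (pi / 2))"] 2 im by (simp add: norm_divide norm_mult)
next
 case 3
 have "- \<i> * exp (w + \<i> * cplx (pi / 2)) = z" unfolding shift e1 by (simp add: complex_eq_iff)
 moreover have "norm (exp (w + \<i> * cplx (pi / 2))) = norm z" unfolding shift e1 by (simp add: norm_mult)
 ultimately show ?thesis using q4[of "w + \<i> * cplx (pi / 2)"] 3 by (simp add: norm_divide norm_mult)
next
 case 4
 have "- 1 * exp (w + \<i> * cplx pi) = z" unfolding shift e1 by (simp add: complex_eq_iff)
 moreover have "norm (exp (w + \<i> * cplx pi)) = norm z" unfolding shift e1 by (simp add: norm_mult)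
 ultimately show ?thesis using q3[of "w + \<i> * cplx pi"] 4 im by (simp add: norm_divide norm_mult)
qed
qed
define q where "q = (\<Sum>k\<le>L. monom ((deriv ^^ k) \<Phi> 0 / fact k) k)"
have \<Phi>q: "\<Phi> z = poly q z" for z
proof -
have "\<Phi> z = (\<Sum>k\<le>L. (deriv ^^ k) \<Phi> 0 / fact k * z ^ k)"
proof (rule Liouville_polynomial[where A = 1 and B = "?K * 2 ^ L"])
 show "\<Phi> holomorphic_on UNIV" using \<Phi> by (auto simp: holomorphic_on_open)
 fix z :: complex assume z: "1 <= norm z"
 have "(1 + norm z) ^ L <= (2 * norm z) ^ L" using z by (intro power_mono) auto
 hence "?K * (1 + norm z) ^ L <= ?K * (2 * norm z) ^ L" using C by (intro mult_left_mono) auto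
 moreover have "norm (\<Phi> z) <= ?K * (1 + norm z) ^ L" using z by (intro bound) auto
 ultimately show "norm (\<Phi> z) <= ?K * 2 ^ L * norm z ^ L" by (simp add: power_mult_distrib mult_ac)
qed
thus ?thesis by (simp add: q_def poly_sum poly_monom)
qed
have "degree q <= L" unfolding q_def by (intro degree_sum_le) (auto intro: order_trans[OF degree_monom_le])
hence "degree (pderiv q) <= L" by (simp add: degree_pderiv)
moreover have "h z * h (\<i> * z) = poly (pderiv q) z" for z
proof -
have "(\<Phi> has_field_derivative poly (pderiv q) z) (at z)"
 using poly_DERIV[of q z] \<Phi>q by (metis (no_types, lifting) ext)
thus ?thesis using \<Phi> DERIV_unique by blast
qed
ultimately show ?thesis using that by blast
qed

section \<open>Entire functions of order two: factorization\<close>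

lemma continuous_eq_except_point:
fixes f g :: "complex => complex"
assumes "continuous_on UNIV f" "continuous_on UNIV g" "!!z. z ~= a ==> f z = g z"
shows "f z = g z"
proof (cases "z = a")
case True
have "(f \<longlongrightarrow> f a) (at a)" "(g \<longlongrightarrow> g a) (at a)"
using assms(1,2) by (auto simp: continuous_on_def)
moreover have "\<forall>\<^sub>F z in at a. f z = g z"
using assms(3) by (auto simp: eventually_at_filter)
ultimately have "(g \<longlongrightarrow> f a) (at a)" using tendsto_cong by blast
with \<open>(g \<longlongrightarrow> g a) (at a)\<close> have "f a = g a" by (intro tendsto_unique[of "at a" g]) auto
thus ?thesis using True by simp
qed (use assms in auto)

lemma poly_times_entire_root:
fixes R :: "complex poly"
assumes cont: "continuous_on UNIV k" and R: "!!z. (z - a) * k z = poly R z"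
obtains R' where "R = [:- a, 1:] * R'" "!!z. k z = poly R' z"
proof -
have "poly R a = 0" using R[of a] by simp
then obtain R' where R': "R = [:- a, 1:] * R'" by (auto simp: poly_eq_0_iff_dvd)
have "k z = poly R' z" for z
proof (rule continuous_eq_except_point[OF cont, where a = a])
show "continuous_on UNIV (poly R')" by (intro continuous_intros)
fix z assume "z ~= a"
have "(z - a) * k z = (z - a) * poly R' z" using R[of z] by (simp add: R' algebra_simps)
thus "k z = poly R' z" using \<open>z ~= a\<close> by simp
qed
thus ?thesis using that R' by blast
qed

text \<open>The Schwarz lemma applied to the Cayley transform of the function on discs, i.e. the Borel-Caratheodory inequality, followed by Liouville's theorem.\<close>
lemma entire_real_part_quadratic:
fixes q :: "complex => complex"
assumes hol: "q holomorphic_on UNIV" and B: "B >= 0" and bd: "!!z. Re (q z) <= A + B * (norm z)\<^sup>2"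
obtains a b c where "!!z. q z = a + b * z + c * z\<^sup>2"
proof -
define A' where "A' = \<bar>A\<bar> + \<bar>Re (q 0)\<bar> + 1"
define f where "f z = q z - q 0" for z
have holf: "f holomorphic_on UNIV" unfolding f_def by (intro holomorphic_intros hol)
have f0: "f 0 = 0" by (simp add: f_def)
have Ref: "Re (f z) < A' + B * (norm z)\<^sup>2" for z
using bd[of z] unfolding f_def A'_def by simp
have bound: "norm (f z) <= 2 * (A' + B * (2 * norm z)\<^sup>2)" if z: "z ~= 0" for z
proof -
define R where "R = 2 * norm z"
define m where "m = A' + B * R\<^sup>2"
have m: "m > 0" using B by (simp add: m_def A'_def add_pos_nonneg)
have R: "R > 0" using z by (simp add: R_def)
define \<phi> where "\<phi> u = f (cplx R * u) / (2 * cplx m - f (cplx R * u))" for u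
have lt: "Re (f (cplx R * u)) < m" if "norm u < 1" for u
proof -
 have "(norm (cplx R * u))\<^sup>2 <= R\<^sup>2"
 using that R by (intro power_mono) (auto simp: norm_mult mult_left_le)
 hence "B * (norm (cplx R * u))\<^sup>2 <= B * R\<^sup>2" using B by (rule mult_left_mono)
 thus ?thesis using Ref[of "cplx R * u"] unfolding m_def by linarith
qed
have nz: "2 * cplx m - f (cplx R * u) ~= 0" if "norm u < 1" for u
proof
 assume "2 * cplx m - f (cplx R * u) = 0"
 hence "Re (2 * cplx m - f (cplx R * u)) = 0" by simp
 thus False using lt[OF that] m by simp
qed
have sq: "norm w < norm (2 * cplx m - w)" if "Re w < m" for w
proof -
 have "(norm (2 * cplx m - w))\<^sup>2 - (norm w)\<^sup>2 = 4 * m * (m - Re w)"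
 unfolding cmod_power2 by (simp add: power2_eq_square algebra_simps)
 moreover have "4 * m * (m - Re w) > 0" using that m by simp
 ultimately show ?thesis by (intro power2_less_imp_less[of "norm w"]) auto
qed
have "norm (\<phi> (z / cplx R)) <= norm (z / cplx R)"
proof (rule Schwarz_Lemma(1))
 have "(%u. f (cplx R * u)) holomorphic_on ball 0 1"
 by (rule holomorphic_on_compose_gen[unfolded o_def, OF _ holf]) (auto intro!: holomorphic_intros)
 thus "\<phi> holomorphic_on ball 0 1"
 unfolding \<phi>_def using nz by (intro holomorphic_intros) auto
 show "\<phi> 0 = 0" by (simp add: \<phi>_def f0)
 show "norm (\<phi> u) < 1" if "norm u < 1" for u
 using sq[OF lt[OF that]] nz[OF that] by (simp add: \<phi>_def norm_divide divide_less_eq)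
 show "norm (z / cplx R) < 1" using z by (simp add: R_def norm_divide)
qed
moreover have "norm (z / cplx R) = 1 / 2" using z by (simp add: R_def norm_divide)
moreover have "cplx R * (z / cplx R) = z" using R by simp
ultimately have "norm (f z / (2 * cplx m - f z)) <= 1 / 2" by (simp add: \<phi>_def)
moreover have "norm (2 * cplx m - f z) > 0"
 using nz[of "z / cplx R"] \<open>norm (z / cplx R) = 1 / 2\<close> R by simp
ultimately have "2 * norm (f z) <= norm (2 * cplx m - f z)" by (simp add: norm_divide divide_le_eq)
also have "... <= 2 * m + norm (f z)" using norm_triangle_ineq4[of "2 * cplx m" "f z"] m by simp
finally show ?thesis by (simp add: m_def R_def)
qed
have "f z = (\<Sum>k\<le>2. (deriv ^^ k) f 0 / fact k * z ^ k)" for z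
proof (rule Liouville_polynomial[OF holf, where A = 1 and B = "2 * A' + 8 * B"])
fix z :: complex assume z: "1 <= norm z"
have "1 <= (norm z)\<^sup>2" using z by simp
hence "2 * A' * 1 <= 2 * A' * (norm z)\<^sup>2" by (intro mult_left_mono) (auto simp: A'_def)
moreover have "norm (f z) <= 2 * (A' + B * (2 * norm z)\<^sup>2)" using z by (intro bound) auto
ultimately show "norm (f z) <= (2 * A' + 8 * B) * norm z ^ 2" by (simp add: power_mult_distrib algebra_simps)
qed
hence "q z = (q 0 + (deriv ^^ 0) f 0) + (deriv ^^ 1) f 0 * z + ((deriv ^^ 2) f 0 / 2) * z\<^sup>2" for z
proof -
assume *: "!!z. f z = (\<Sum>k\<le>2. (deriv ^^ k) f 0 / fact k * z ^ k)"
have "q z = q 0 + f z" by (simp add: f_def)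
also have "f z = (deriv ^^ 0) f 0 + (deriv ^^ 1) f 0 * z + (deriv ^^ 2) f 0 / 2 * z\<^sup>2"
 unfolding *[of z] by (simp only: numeral_2_eq_2 sum.atMost_Suc atMost_0 sum.insert fact_Suc) (simp add: fact_Suc)
finally show ?thesis by simp
qed
from this show ?thesis by (rule that)
qed

text \<open>Each zero of \<open>h\<close> is divided out, which lowers the degree of the product by two. A zero-free \<open>h\<close> is the exponential of a polynomial of degree at most two, and its linear term vanishes because it would survive in the product.\<close>
theorem hadamard_factorization:
fixes h :: "complex => complex"
assumes "R ~= 0" "h holomorphic_on UNIV" "B >= 0" "!!z. norm (h z) <= A * exp (B * (norm z)\<^sup>2)"
"!!z. h z * h (\<i> * z) = poly R z"
shows "\<exists>p c. \<forall>z. h z = poly p z * exp (- c * z\<^sup>2)"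
using assms
proof (induction "degree R" arbitrary: R h A rule: less_induct)
case (less R h A)
note R = less.prems(1) and hol = less.prems(2) and B = less.prems(3) and gr = less.prems(4) and prod = less.prems(5)
have cont: "continuous_on S h" for S using hol by (auto intro: holomorphic_on_imp_continuous_on holomorphic_on_subset)
show ?case
proof (cases "\<exists>z0. h z0 = 0")
case True
then obtain z0 where z0: "h z0 = 0" by blast
define h1 where "h1 z = (if z = z0 then deriv h z0 else (h z - h z0) / (z - z0))" for z
have hol1: "h1 holomorphic_on UNIV" unfolding h1_def by (rule pole_lemma_open[OF hol open_UNIV])
have cont1: "continuous_on S h1" for S using hol1 by (auto intro: holomorphic_on_imp_continuous_on holomorphic_on_subset)
have hh1: "h z = (z - z0) * h1 z" for z by (simp add: h1_def z0)
obtain A1 where A1: "!!z. z \<in> cball z0 1 ==> norm (h1 z) <= A1"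
proof -
 have "compact (h1 ` cball z0 1)" by (intro compact_continuous_image cont1 compact_cball)
 hence "bounded (h1 ` cball z0 1)" by (rule compact_imp_bounded)
 thus ?thesis using that unfolding bounded_iff by blast
qed
have A10: "A1 >= 0" using A1[of z0] by (simp add: order_trans[OF norm_ge_zero])
have A0: "A >= 0" using gr[of 0] by (simp add: order_trans[OF norm_ge_zero])
have gr1: "norm (h1 z) <= (A + A1) * exp (B * (norm z)\<^sup>2)" for z
proof (cases "z \<in> cball z0 1")
 case True
 have "norm (h1 z) <= (A + A1) * 1" using A1[OF True] A0 by simp
 also have "... <= (A + A1) * exp (B * (norm z)\<^sup>2)" using A0 A10 B by (intro mult_left_mono) auto
 finally show ?thesis .
next
 case False
 hence d: "norm (z - z0) > 1" by (simp add: dist_norm norm_minus_commute)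
 have "norm (h1 z) * 1 <= norm (h1 z) * norm (z - z0)" using d by (intro mult_left_mono) auto
 also have "... = norm (h z)" unfolding hh1[of z] norm_mult by (rule mult.commute)
 also have "... <= A * exp (B * (norm z)\<^sup>2)" by (rule gr)
 also have "... <= (A + A1) * exp (B * (norm z)\<^sup>2)" using A10 by (intro mult_right_mono) auto
 finally show ?thesis by simp
qed
have ci: "continuous_on UNIV (%z. h1 (\<i> * z))" by (intro continuous_on_compose2[OF cont1[of UNIV]] continuous_intros) auto
have ci': "continuous_on UNIV (%z. h (\<i> * z))" by (intro continuous_on_compose2[OF cont[of UNIV]] continuous_intros) auto
have m1: "continuous_on UNIV (%z. h1 z * h (\<i> * z))" by (intro continuous_on_mult cont1 ci')
have r1: "(z - z0) * (h1 z * h (\<i> * z)) = poly R z" for z using prod[of z] by (simp add: hh1[of z] mult.assoc)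
obtain R1 where R1: "R = [:- z0, 1:] * R1" "!!z. h1 z * h (\<i> * z) = poly R1 z"
 by (rule poly_times_entire_root[OF m1 r1], rule that)
have m2: "continuous_on UNIV (%z. \<i> * (h1 z * h1 (\<i> * z)))" by (intro continuous_on_mult cont1 ci continuous_on_const)
have r2: "(z - (- \<i> * z0)) * (\<i> * (h1 z * h1 (\<i> * z))) = poly R1 z" for z
proof -
 have "\<i> * z - z0 = \<i> * (z - (- \<i> * z0))" by (simp add: complex_eq_iff)
 thus ?thesis using R1(2)[of z] hh1[of "\<i> * z"] by (simp add: mult_ac)
qed
obtain R2 where R2: "R1 = [:- (- \<i> * z0), 1:] * R2" "!!z. \<i> * (h1 z * h1 (\<i> * z)) = poly R2 z"
 by (rule poly_times_entire_root[OF m2 r2], rule that)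
have R2nz: "R2 ~= 0" using R R1 R2 by auto
have R1nz: "R1 ~= 0" using R R1 by auto
have "degree R1 = 1 + degree R2" unfolding R2(1) using R2nz by (subst degree_mult_eq) auto
moreover have "degree R = 1 + degree R1" unfolding R1(1) using R1nz by (subst degree_mult_eq) auto
ultimately have deg: "degree (smult (- \<i>) R2) < degree R" by simp
have prod1: "h1 z * h1 (\<i> * z) = poly (smult (- \<i>) R2) z" for z
 unfolding poly_smult R2(2)[symmetric] by simp
obtain p c where pc: "!!z. h1 z = poly p z * exp (- c * z\<^sup>2)"
 using less.hyps[OF deg _ hol1 B gr1 prod1] R2nz by auto
have "h z = poly ([:- z0, 1:] * p) z * exp (- c * z\<^sup>2)" for z
 unfolding hh1[of z] pc[of z] by (simp add: algebra_simps)
thus ?thesis by blast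
next
case False
hence nz: "h z ~= 0" for z by blast
have "poly R z ~= 0" for z using nz[of z] nz[of "\<i> * z"] unfolding prod[of z, symmetric] by simp
hence "constant (poly R)" using Fundamental_Theorem_Algebra.fundamental_theorem_of_algebra[of R] by blast
hence Rc: "poly R z = poly R 0" for z unfolding constant_def by blast
obtain q where q: "q holomorphic_on UNIV" "!!z. exp (q z) = h z"
 by (rule holomorphic_logarithm_exists[OF convex_UNIV open_UNIV hol nz UNIV_I[of 0]]) (rule that, auto)
have A0: "A > 0"
proof -
 have "0 < norm (h 0)" using nz[of 0] by simp
 also have "... <= A" using gr[of 0] by simp
 finally show ?thesis .
qed
have req: "Re (q z) <= ln A + B * (norm z)\<^sup>2" for z
proof -
 have "exp (Re (q z)) <= exp (ln A + B * (norm z)\<^sup>2)"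
 using gr[of z] A0 unfolding q(2)[symmetric] norm_exp_eq_Re by (simp add: exp_add)
 thus ?thesis by simp
qed
obtain a b c where abc: "!!z. q z = a + b * z + c * z\<^sup>2"
 by (rule entire_real_part_quadratic[OF q(1) B req], rule that)
have E: "exp (2 * a + (1 + \<i>) * b * z) = poly R 0" for z
proof -
 have "exp (q z) * exp (q (\<i> * z)) = poly R 0" unfolding q(2) prod Rc[of z] ..
 moreover have "q z + q (\<i> * z) = 2 * a + (1 + \<i>) * b * z"
 unfolding abc by (simp add: power_mult_distrib algebra_simps)
 ultimately show ?thesis by (simp add: exp_add[symmetric])
qed
have "((%z. exp (2 * a + (1 + \<i>) * b * z)) has_field_derivative exp (2 * a + (1 + \<i>) * b * 0) * ((1 + \<i>) * b)) (at 0)"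
 by (auto intro!: derivative_eq_intros)
moreover have "((%z. exp (2 * a + (1 + \<i>) * b * z)) has_field_derivative 0) (at 0)"
 unfolding E by simp
ultimately have "exp (2 * a + (1 + \<i>) * b * 0) * ((1 + \<i>) * b) = 0" by (rule DERIV_unique)
moreover have "1 + \<i> ~= 0" by (simp add: complex_eq_iff)
ultimately have b: "b = 0" by simp
have "h z = poly [:exp a:] z * exp (- (- c) * z\<^sup>2)" for z
 unfolding q(2)[symmetric] abc b by (simp add: exp_add)
thus ?thesis by blast
qed
qed

lemma exp_quadratic_growth:
fixes \<kappa> :: real
assumes \<delta>: "\<delta> > 0" and A: "A >= 0" and bd: "!!r. r >= rmin ==> \<delta> * exp (\<kappa> * r\<^sup>2) <= A * (1 + r) ^ L * exp (D * (1 + r))"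
shows "\<kappa> <= 0"
proof (rule ccontr)
assume "\<not> \<kappa> <= 0"
hence \<kappa>: "\<kappa> > 0" by simp
define E where "E = \<bar>D\<bar> + 1"
define Q where "Q = A * fact L / \<delta>"
have Q: "Q >= 0" using A \<delta> by (simp add: Q_def)
define r where "r = Max {1, rmin, (2 * E + Q) / \<kappa>}"
have r: "r >= 1" "r >= rmin" "(2 * E + Q) / \<kappa> <= r" by (auto simp: r_def)
have 1: "2 * E + Q <= \<kappa> * r" using r(3) \<kappa> by (simp add: field_simps)
have "(1 + r) ^ L * exp (D * (1 + r)) <= (fact L * exp (1 + r)) * exp (\<bar>D\<bar> * (1 + r))"
using r(1) by (intro mult_mono exp_integral_bounds) (auto intro: mult_right_mono)
also have "... = fact L * exp (E * (1 + r))" by (simp add: E_def exp_add[symmetric] algebra_simps)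
finally have "A * ((1 + r) ^ L * exp (D * (1 + r))) <= A * (fact L * exp (E * (1 + r)))" using A by (rule mult_left_mono)
with bd[OF r(2)] have "\<delta> * exp (\<kappa> * r\<^sup>2) <= \<delta> * (Q * exp (E * (1 + r)))"
using \<delta> by (simp add: Q_def mult.assoc)
hence "exp (\<kappa> * r\<^sup>2) <= Q * exp (E * (1 + r))" using \<delta> by simp
also have "... < exp Q * exp (E * (1 + r))"
using exp_ge_add_one_self[of Q] by (intro mult_strict_right_mono) (linarith, simp)
also have "... = exp (Q + E * (1 + r))" by (simp add: exp_add)
finally have "\<kappa> * r\<^sup>2 < Q + E * (1 + r)" by simp
moreover have "Q + E * (1 + r) <= \<kappa> * r\<^sup>2"
proof -
have "(2 * E + Q) * r <= (\<kappa> * r) * r" using 1 r(1) by (intro mult_right_mono) auto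
moreover have "E * 1 <= E * r" using r(1) by (intro mult_left_mono) (auto simp: E_def)
moreover have "Q * 1 <= Q * r" using r(1) Q by (intro mult_left_mono) auto
ultimately show ?thesis by (simp add: power2_eq_square algebra_simps)
qed
ultimately show False by linarith
qed

lemma poly_lower_bound_at_infinity:
fixes p :: "complex poly"
assumes "p ~= 0"
obtains r0 \<delta> where "r0 >= 1" "\<delta> > 0" "!!z. norm z >= r0 ==> norm (poly p z) >= \<delta>"
proof (cases p)
case (pCons a q)
show ?thesis
proof (cases "q = 0")
case True
thus ?thesis using that[of 1 "norm a"] assms pCons by simp
next
case False
then obtain r where "!!z. r <= norm z ==> 1 <= norm (poly (pCons a q) z)"
 using poly_infinity[of q 1 a] by blast
thus ?thesis using that[of "max 1 r" 1] pCons by simp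
qed
qed

text \<open>Compare both sides in the direction in which \<open>- c z\<^sup>2\<close> is positive.\<close>
lemma gaussian_coefficient_bound:
fixes p :: "complex poly"
assumes p: "p ~= 0" and h: "!!z. h z = poly p z * exp (- c * z\<^sup>2)" and gr: "!!z. norm (h z) <= A * exp (B * (norm z)\<^sup>2)"
shows "norm c <= B"
proof -
obtain r0 \<delta> where \<delta>: "r0 >= 1" "\<delta> > 0" "!!z. norm z >= r0 ==> norm (poly p z) >= \<delta>"
by (rule poly_lower_bound_at_infinity[OF p], rule that)
have A0: "A >= 0" using gr[of 0] by (simp add: order_trans[OF norm_ge_zero])
define w where "w = (if c = 0 then 1 else csqrt (- cnj c / cplx (norm c)))"
have w2: "w\<^sup>2 = (if c = 0 then 1 else - cnj c / cplx (norm c))" by (simp add: w_def)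
have nw: "norm w = 1"
proof -
have "norm (w\<^sup>2) = 1" unfolding w2 by (simp add: norm_divide)
hence "(norm w)\<^sup>2 = 1" by (simp add: norm_power)
thus ?thesis using norm_ge_zero[of w] unfolding power2_eq_1_iff by linarith
qed
have cw: "- c * w\<^sup>2 = cplx (norm c)"
proof (cases "c = 0")
case False
have "c * cnj c = cplx ((norm c)\<^sup>2)" by (rule complex_norm_square[symmetric])
thus ?thesis using False unfolding w2 by (simp add: power2_eq_square field_simps)
qed simp
have "norm c - B <= 0"
proof (rule exp_quadratic_growth[where \<delta> = \<delta> and A = A and rmin = r0 and L = 0 and D = 0])
fix r assume r: "r >= r0"
define z where "z = cplx r * w"
have nz: "norm z = r" using r \<delta>(1) nw by (simp add: z_def norm_mult)
have "- c * z\<^sup>2 = cplx (norm c * r\<^sup>2)"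
proof -
 have "- c * z\<^sup>2 = (- c * w\<^sup>2) * cplx (r\<^sup>2)" by (simp add: z_def power_mult_distrib)
 thus ?thesis unfolding cw by simp
qed
hence "norm (exp (- c * z\<^sup>2)) = exp (norm c * r\<^sup>2)" by (simp only: norm_exp_eq_Re Re_complex_of_real)
hence "norm (poly p z) * exp (norm c * r\<^sup>2) <= A * exp (B * r\<^sup>2)"
 using gr[of z] unfolding h norm_mult nz by simp
moreover have "\<delta> * exp (norm c * r\<^sup>2) <= norm (poly p z) * exp (norm c * r\<^sup>2)"
 using \<delta>(3)[of z] r nz by (intro mult_right_mono) auto
ultimately have "\<delta> * exp (norm c * r\<^sup>2) <= A * exp (B * r\<^sup>2)" by linarith
hence "\<delta> * exp (norm c * r\<^sup>2) * exp (- (B * r\<^sup>2)) <= A * exp (B * r\<^sup>2) * exp (- (B * r\<^sup>2))"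
 by (rule mult_right_mono) simp
moreover have "\<delta> * exp (norm c * r\<^sup>2) * exp (- (B * r\<^sup>2)) = \<delta> * exp ((norm c - B) * r\<^sup>2)"
 unfolding mult.assoc exp_add[symmetric] by (simp add: left_diff_distrib)
moreover have "A * exp (B * r\<^sup>2) * exp (- (B * r\<^sup>2)) = A"
 unfolding mult.assoc exp_add[symmetric] by simp
ultimately show "\<delta> * exp ((norm c - B) * r\<^sup>2) <= A * (1 + r) ^ 0 * exp (0 * (1 + r))" by simp
qed (use \<delta> A0 in auto)
thus ?thesis by simp
qed

text \<open>Along \<open>z = r (x + i)\<close> the majorant at height \<open>r\<close> is at least \<open>exp (- Re (c z\<^sup>2))\<close>, while the integral bound caps it by \<open>exp (Re c r\<^sup>2)\<close> up to subquadratic terms. So \<open>2 x Im c \<le> x\<^sup>2 Re c\<close> for every real \<open>x\<close>, and small \<open>x\<close> of both signs give the claim.\<close>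
lemma gaussian_coefficient_real:
fixes G :: "real => real" and p :: "complex poly"
assumes p: "p ~= 0" and h: "!!z. h z = poly p z * exp (- c * z\<^sup>2)"
and G: "!!z. norm (h z) <= G \<bar>Im z\<bar>"
and mono: "!!s t. 0 <= s ==> s <= t ==> G s <= G t"
and C: "C >= 0"
and int: "!!R. R >= 0 ==> (\<integral>\<^sup>+s. ennreal (norm (h (cplx s)) * G s) * indicator {0..R} s \<partial>lborel) <= ennreal (C * (1 + R) ^ L)"
shows "Im c = 0" "Re c >= 0"
proof -
obtain r0 \<delta> where \<delta>: "r0 >= 1" "\<delta> > 0" "!!z. norm z >= r0 ==> norm (poly p z) >= \<delta>"
by (rule poly_lower_bound_at_infinity[OF p], rule that)
define \<alpha> where "\<alpha> = Re c"
have G0: "G s >= 0" if "s >= 0" for s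
using G[of "\<i> * cplx s"] that by (simp add: order_trans[OF norm_ge_zero])
have upper: "\<delta> * exp (- \<alpha> * r\<^sup>2 - \<bar>\<alpha>\<bar> * (2 * r + 1)) * G r <= C * (2 + r) ^ L" if r: "r >= r0" for r
proof -
let ?m = "\<delta> * exp (- \<alpha> * r\<^sup>2 - \<bar>\<alpha>\<bar> * (2 * r + 1)) * G r"
have r1: "r >= 1" using r \<delta>(1) by simp
have m0: "?m >= 0" using \<delta>(2) G0[of r] r1 by simp
have "ennreal ?m = (\<integral>\<^sup>+s. ennreal ?m * indicator {r..r+1} s \<partial>lborel)"
 by (subst nn_integral_cmult_indicator) auto
also have "... <= (\<integral>\<^sup>+s. ennreal (norm (h (cplx s)) * G s) * indicator {0..r+1} s \<partial>lborel)"
proof (rule nn_integral_mono)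
 fix s :: real
 show "ennreal ?m * indicator {r..r+1} s <= ennreal (norm (h (cplx s)) * G s) * indicator {0..r+1} s"
 proof (cases "s \<in> {r..r+1}")
 case True
 hence s: "r <= s" "s <= r + 1" "0 <= s" using r1 by auto
 have "s\<^sup>2 - r\<^sup>2 <= 2 * r + 1"
 using power_mono[OF s(2) s(3), of 2] by (simp add: power2_eq_square algebra_simps)
 moreover have "0 <= s\<^sup>2 - r\<^sup>2" using power_mono[OF s(1), of 2] r1 by simp
 ultimately have "\<bar>\<alpha> * (s\<^sup>2 - r\<^sup>2)\<bar> <= \<bar>\<alpha>\<bar> * (2 * r + 1)" unfolding abs_mult by (intro mult_left_mono) auto
 hence e: "- \<alpha> * r\<^sup>2 - \<bar>\<alpha>\<bar> * (2 * r + 1) <= - \<alpha> * s\<^sup>2" by (simp add: abs_le_iff algebra_simps)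
 have "norm (h (cplx s)) = norm (poly p (cplx s)) * exp (- \<alpha> * s\<^sup>2)"
 unfolding h norm_mult norm_exp_eq_Re by (simp add: \<alpha>_def flip: of_real_power)
 moreover have "\<delta> * exp (- \<alpha> * r\<^sup>2 - \<bar>\<alpha>\<bar> * (2 * r + 1)) <= norm (poly p (cplx s)) * exp (- \<alpha> * s\<^sup>2)"
 using \<delta>(2,3) s r e by (intro mult_mono \<delta>(3)) auto
 ultimately have "?m <= norm (h (cplx s)) * G s"
 using mono[of r s] s r1 \<delta>(2) G0[of r] by (intro mult_mono) auto
 thus ?thesis using True r1 by (auto intro: ennreal_leI)
 qed simp
qed
also have "... <= ennreal (C * (1 + (r + 1)) ^ L)" using r1 by (intro int) auto
finally have "?m <= C * (1 + (r + 1)) ^ L" using C r1 by (simp add: ennreal_le_iff)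
thus ?thesis by (simp add: add.commute add.left_commute)
qed
have key: "- (\<alpha> * (x\<^sup>2 - 1) - 2 * Im c * x) - \<alpha> <= 0" for x :: real
proof (rule exp_quadratic_growth[where \<delta> = "\<delta> * \<delta>" and A = "C * 2 ^ L" and rmin = r0 and L = L and D = "2 * \<bar>\<alpha>\<bar>"])
fix r assume r: "r >= r0"
have r1: "r >= 1" using r \<delta>(1) by simp
define z where "z = cplx r * (cplx x + \<i>)"
have "Im z = r" by (simp add: z_def)
moreover have "norm z >= r" using abs_Im_le_cmod[of z] \<open>Im z = r\<close> by simp
moreover have "Re (- c * z\<^sup>2) = - r\<^sup>2 * (\<alpha> * (x\<^sup>2 - 1) - 2 * Im c * x)"
 by (simp add: z_def \<alpha>_def power2_eq_square algebra_simps)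
ultimately have "norm (poly p z) * exp (- r\<^sup>2 * (\<alpha> * (x\<^sup>2 - 1) - 2 * Im c * x)) <= G r"
 using G[of z] r1 unfolding h norm_mult norm_exp_eq_Re by simp
moreover have "\<delta> * exp (- r\<^sup>2 * (\<alpha> * (x\<^sup>2 - 1) - 2 * Im c * x)) <= norm (poly p z) * exp (- r\<^sup>2 * (\<alpha> * (x\<^sup>2 - 1) - 2 * Im c * x))"
 using \<delta>(3)[of z] \<open>norm z >= r\<close> r by (intro mult_right_mono) auto
ultimately have lowG: "\<delta> * exp (- r\<^sup>2 * (\<alpha> * (x\<^sup>2 - 1) - 2 * Im c * x)) <= G r" by linarith
have "(\<delta> * exp (- \<alpha> * r\<^sup>2 - \<bar>\<alpha>\<bar> * (2 * r + 1))) * (\<delta> * exp (- r\<^sup>2 * (\<alpha> * (x\<^sup>2 - 1) - 2 * Im c * x))) <= (\<delta> * exp (- \<alpha> * r\<^sup>2 - \<bar>\<alpha>\<bar> * (2 * r + 1))) * G r"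
 using lowG \<delta>(2) by (intro mult_left_mono) auto
also have "... <= C * (2 + r) ^ L" by (rule upper[OF r])
also have "... <= C * (2 * (1 + r)) ^ L" using C r1 by (intro mult_left_mono power_mono) auto
finally have fin: "(\<delta> * exp (- \<alpha> * r\<^sup>2 - \<bar>\<alpha>\<bar> * (2 * r + 1))) * (\<delta> * exp (- r\<^sup>2 * (\<alpha> * (x\<^sup>2 - 1) - 2 * Im c * x))) <= C * (2 * (1 + r)) ^ L" .
have "(\<delta> * exp X) * (\<delta> * exp Y) = (\<delta> * \<delta>) * exp (X + Y)" for X Y :: real by (simp add: exp_add)
moreover have "(- \<alpha> * r\<^sup>2 - \<bar>\<alpha>\<bar> * (2 * r + 1)) + (- r\<^sup>2 * (\<alpha> * (x\<^sup>2 - 1) - 2 * Im c * x)) = (- (\<alpha> * (x\<^sup>2 - 1) - 2 * Im c * x) - \<alpha>) * r\<^sup>2 - \<bar>\<alpha>\<bar> * (2 * r + 1)"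
 by (simp add: algebra_simps)
ultimately have "(\<delta> * \<delta>) * exp ((- (\<alpha> * (x\<^sup>2 - 1) - 2 * Im c * x) - \<alpha>) * r\<^sup>2 - \<bar>\<alpha>\<bar> * (2 * r + 1)) <= C * 2 ^ L * (1 + r) ^ L"
 using fin by (simp only: power_mult_distrib mult.assoc)
hence "(\<delta> * \<delta>) * exp ((- (\<alpha> * (x\<^sup>2 - 1) - 2 * Im c * x) - \<alpha>) * r\<^sup>2 - \<bar>\<alpha>\<bar> * (2 * r + 1)) * exp (\<bar>\<alpha>\<bar> * (2 * r + 1)) <= C * 2 ^ L * (1 + r) ^ L * exp (\<bar>\<alpha>\<bar> * (2 * r + 1))"
 by (rule mult_right_mono) simp
also have "... <= C * 2 ^ L * (1 + r) ^ L * exp (2 * \<bar>\<alpha>\<bar> * (1 + r))"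
 using C r1 by (intro mult_left_mono) (auto simp: algebra_simps)
finally show "\<delta> * \<delta> * exp ((- (\<alpha> * (x\<^sup>2 - 1) - 2 * Im c * x) - \<alpha>) * r\<^sup>2) <= C * 2 ^ L * (1 + r) ^ L * exp (2 * \<bar>\<alpha>\<bar> * (1 + r))"
 by (simp add: mult.assoc exp_add[symmetric])
qed (use \<delta> C in auto)
have key': "2 * Im c * x <= \<alpha> * x\<^sup>2" for x :: real using key[of x] by (simp add: algebra_simps)
have "2 * Im c <= \<alpha> * x" if "x > 0" for x
proof -
have "(2 * Im c) * x <= (\<alpha> * x) * x" using key'[of x] by (simp add: power2_eq_square)
thus ?thesis using that by (rule mult_right_le_imp_le)
qed
hence ev1: "\<forall>\<^sub>F x in at_right 0. 2 * Im c <= \<alpha> * x" by (simp add: eventually_at_right_less[THEN eventually_mono])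
have lim: "((%x. \<alpha> * x) \<longlongrightarrow> \<alpha> * 0) (at_right 0)" by (intro tendsto_intros)
from tendsto_lowerbound[OF lim ev1] have 1: "Im c <= 0" by simp
have "- 2 * Im c <= \<alpha> * x" if "x > 0" for x
proof -
have "(- 2 * Im c) * x <= (\<alpha> * x) * x" using key'[of "- x"] by (simp add: power2_eq_square)
thus ?thesis using that by (rule mult_right_le_imp_le)
qed
hence ev2: "\<forall>\<^sub>F x in at_right 0. - 2 * Im c <= \<alpha> * x" by (simp add: eventually_at_right_less[THEN eventually_mono])
from tendsto_lowerbound[OF lim ev2] have 2: "Im c >= 0" by simp
show 3: "Im c = 0" using 1 2 by simp
show "Re c >= 0" using key'[of 1] 3 by (simp add: \<alpha>_def)
qed

section \<open>Growth on balls and on rays\<close>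

lemma gauss_mass_nn_integral:
"(\<integral>\<^sup>+(w::real^'n::finite). ennreal (exp (- ((norm w)\<^sup>2 / 2))) \<partial>lborel) = ennreal (gauss_mass TYPE('n))"
unfolding gauss_mass_def by (intro nn_integral_eq_integral gauss_integrable) auto

lemma gauss_exp_linear_bound:
fixes y :: "real ^ 'n::finite"
shows "(\<integral>\<^sup>+(w::real^'n). ennreal (exp (\<bar>w \<bullet> y\<bar> - (norm w)\<^sup>2 / 2)) \<partial>lborel) <= ennreal (2 * gauss_mass TYPE('n) * exp ((norm y)\<^sup>2 / 2))"
proof -
let ?\<kappa> = "gauss_mass TYPE('n)"
let ?E = "%w::real^'n. ennreal (exp (- ((norm w)\<^sup>2 / 2)))"
have "(\<integral>\<^sup>+(w::real^'n). ennreal (exp (\<bar>w \<bullet> y\<bar> - (norm w)\<^sup>2 / 2)) \<partial>lborel)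
 <= (\<integral>\<^sup>+(w::real^'n). ennreal (exp ((norm y)\<^sup>2 / 2)) * (?E (w + y) + ?E (w + (- y))) \<partial>lborel)"
proof (rule nn_integral_mono)
fix w :: "real^'n"
have 1: "w \<bullet> y - (norm w)\<^sup>2 / 2 = (norm y)\<^sup>2 / 2 + (- ((norm (w + (- y)))\<^sup>2 / 2))"
 unfolding power2_norm_eq_inner by (simp add: inner_simps inner_commute field_simps)
have 2: "- (w \<bullet> y) - (norm w)\<^sup>2 / 2 = (norm y)\<^sup>2 / 2 + (- ((norm (w + y))\<^sup>2 / 2))"
 unfolding power2_norm_eq_inner by (simp add: inner_simps inner_commute field_simps)
have "exp (\<bar>w \<bullet> y\<bar> - (norm w)\<^sup>2 / 2) <= exp (w \<bullet> y - (norm w)\<^sup>2 / 2) + exp (- (w \<bullet> y) - (norm w)\<^sup>2 / 2)"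
 by (cases "w \<bullet> y >= 0") (simp_all add: less_imp_le)
also have "... = exp ((norm y)\<^sup>2 / 2) * (exp (- ((norm (w + y))\<^sup>2 / 2)) + exp (- ((norm (w + (- y)))\<^sup>2 / 2)))"
 unfolding 1 2 exp_add by (simp add: distrib_left)
finally show "ennreal (exp (\<bar>w \<bullet> y\<bar> - (norm w)\<^sup>2 / 2)) <= ennreal (exp ((norm y)\<^sup>2 / 2)) * (?E (w + y) + ?E (w + (- y)))"
 by (simp add: ennreal_mult[symmetric] ennreal_plus[symmetric] ennreal_leI del: ennreal_plus)
qed
also have "... = ennreal (exp ((norm y)\<^sup>2 / 2)) * ((\<integral>\<^sup>+w. ?E (w + y) \<partial>lborel) + (\<integral>\<^sup>+w. ?E (w + (- y)) \<partial>lborel))"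
by (subst nn_integral_cmult, simp, subst nn_integral_add) auto
also have "(\<integral>\<^sup>+w. ?E (w + y) \<partial>lborel) = ennreal ?\<kappa>"
by (subst lborel_nn_integral_translate) (auto simp: gauss_mass_nn_integral)
also have "(\<integral>\<^sup>+w. ?E (w + (- y)) \<partial>lborel) = ennreal ?\<kappa>"
by (subst lborel_nn_integral_translate) (auto simp: gauss_mass_nn_integral)
also have "ennreal (exp ((norm y)\<^sup>2 / 2)) * (ennreal ?\<kappa> + ennreal ?\<kappa>) = ennreal (2 * ?\<kappa> * exp ((norm y)\<^sup>2 / 2))"
using gauss_mass_pos[where 'n='n]
by (simp add: ennreal_mult[symmetric] ennreal_plus[symmetric] algebra_simps del: ennreal_plus)
finally show ?thesis .
qed

lemma cball_volume_scale:
obtains v :: real where "v >= 0" "!!R. R > 0 ==> emeasure lborel (cball (0::real^'n::finite) R) <= ennreal (v * R ^ CARD('n))"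
proof -
have fin: "emeasure lborel (cball (0::real^'n) 1) < \<infinity>" by (intro emeasure_bounded_finite bounded_cball)
define v where "v = enn2real (emeasure lborel (cball (0::real^'n) 1))"
have v: "emeasure lborel (cball (0::real^'n) 1) = ennreal v" using fin by (simp add: v_def)
have "emeasure lborel (cball (0::real^'n) R) <= ennreal (v * R ^ CARD('n))" if R: "R > 0" for R
proof -
have "emeasure lborel (cball (0::real^'n) R) = (\<integral>\<^sup>+(x::real^'n). indicator (cball 0 R) x \<partial>lborel)" by simp
also have "... = ennreal (\<bar>R\<bar> ^ DIM(real^'n)) * (\<integral>\<^sup>+(x::real^'n). indicator (cball 0 R) (0 + R *\<^sub>R x) \<partial>lborel)"
 using R by (intro lborel_nn_integral_affine borel_measurable_indicator) auto
also have "(\<integral>\<^sup>+(x::real^'n). indicator (cball 0 R) (0 + R *\<^sub>R x) \<partial>lborel) = (\<integral>\<^sup>+(x::real^'n). indicator (cball 0 1) x \<partial>lborel)"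
 using R by (intro nn_integral_cong) (auto simp: indicator_def mult_le_cancel_left1)
finally have "emeasure lborel (cball (0::real^'n) R) = ennreal (R ^ CARD('n)) * ennreal v"
 using R v by simp
thus ?thesis using R by (simp add: ennreal_mult[symmetric] v_def mult.commute)
qed
moreover have "v >= 0" by (simp add: v_def)
ultimately show ?thesis using that by blast
qed

text \<open>The variable \<open>x = t + w\<close> is integrated first; the Gaussian integral in \<open>w\<close> returns exactly the factor by which \<open>F\<close> was damped.\<close>
lemma smoothed_product_bound:
fixes f F :: "real ^ 'n::finite => complex"
assumes [measurable]: "f \<in> borel_measurable borel" "F \<in> borel_measurable borel"
and a: "0 <= a" "a <= 1"
shows "(\<integral>\<^sup>+(x::real^'n). (\<integral>\<^sup>+(y::real^'n). (\<integral>\<^sup>+(t::real^'n).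
 ennreal (norm (f t) * norm (F y) * exp (- ((norm y)\<^sup>2 / 2)) * exp (- ((norm (x - t))\<^sup>2 / 2)) * exp (a * \<bar>x \<bullet> y\<bar>)) \<partial>lborel) \<partial>lborel) \<partial>lborel)
<= ennreal (2 * gauss_mass TYPE('n)) * KK a f F"
proof -
let ?\<kappa> = "gauss_mass TYPE('n)"
let ?H = "%x y t :: real^'n. ennreal (norm (f t) * norm (F y) * exp (- ((norm y)\<^sup>2 / 2)) * exp (- ((norm (x - t))\<^sup>2 / 2)) * exp (a * \<bar>x \<bullet> y\<bar>))"
have inner: "(\<integral>\<^sup>+x. ?H x y t \<partial>lborel) <= ennreal (2 * ?\<kappa>) * ennreal (norm (f t) * norm (F y) * exp (a * \<bar>t \<bullet> y\<bar>))" for y t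
proof -
have "(\<integral>\<^sup>+x. ?H x y t \<partial>lborel) = (\<integral>\<^sup>+x. ?H (x + t) y t \<partial>lborel)"
 by (rule lborel_nn_integral_translate[symmetric]) measurable
also have "... <= (\<integral>\<^sup>+(w::real^'n). ennreal (norm (f t) * norm (F y) * exp (- ((norm y)\<^sup>2 / 2)) * exp (a * \<bar>t \<bullet> y\<bar>)) * ennreal (exp (\<bar>w \<bullet> y\<bar> - (norm w)\<^sup>2 / 2)) \<partial>lborel)"
proof (rule nn_integral_mono)
 fix w :: "real^'n"
 have "\<bar>(w + t) \<bullet> y\<bar> <= \<bar>w \<bullet> y\<bar> + \<bar>t \<bullet> y\<bar>" by (simp add: inner_add_left)
 hence "a * \<bar>(w + t) \<bullet> y\<bar> <= a * \<bar>w \<bullet> y\<bar> + a * \<bar>t \<bullet> y\<bar>" using a(1) by (simp add: mult_left_mono flip: distrib_left)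
 moreover have "a * \<bar>w \<bullet> y\<bar> <= 1 * \<bar>w \<bullet> y\<bar>" using a by (intro mult_right_mono) auto
 ultimately have e: "- ((norm w)\<^sup>2 / 2) + a * \<bar>(w + t) \<bullet> y\<bar> <= a * \<bar>t \<bullet> y\<bar> + (\<bar>w \<bullet> y\<bar> - (norm w)\<^sup>2 / 2)" by linarith
 have "exp (- ((norm w)\<^sup>2 / 2)) * exp (a * \<bar>(w + t) \<bullet> y\<bar>) <= exp (a * \<bar>t \<bullet> y\<bar>) * exp (\<bar>w \<bullet> y\<bar> - (norm w)\<^sup>2 / 2)"
 using e by (simp add: exp_add[symmetric])
 hence "(norm (f t) * norm (F y) * exp (- ((norm y)\<^sup>2 / 2))) * (exp (- ((norm w)\<^sup>2 / 2)) * exp (a * \<bar>(w + t) \<bullet> y\<bar>))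
 <= (norm (f t) * norm (F y) * exp (- ((norm y)\<^sup>2 / 2))) * (exp (a * \<bar>t \<bullet> y\<bar>) * exp (\<bar>w \<bullet> y\<bar> - (norm w)\<^sup>2 / 2))"
 by (intro mult_left_mono) auto
 thus "?H (w + t) y t <= ennreal (norm (f t) * norm (F y) * exp (- ((norm y)\<^sup>2 / 2)) * exp (a * \<bar>t \<bullet> y\<bar>)) * ennreal (exp (\<bar>w \<bullet> y\<bar> - (norm w)\<^sup>2 / 2))"
 by (simp add: ennreal_mult[symmetric] ennreal_leI mult.assoc)
qed
also have "... = ennreal (norm (f t) * norm (F y) * exp (- ((norm y)\<^sup>2 / 2)) * exp (a * \<bar>t \<bullet> y\<bar>)) * (\<integral>\<^sup>+(w::real^'n). ennreal (exp (\<bar>w \<bullet> y\<bar> - (norm w)\<^sup>2 / 2)) \<partial>lborel)"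
 by (rule nn_integral_cmult) measurable
also have "... <= ennreal (norm (f t) * norm (F y) * exp (- ((norm y)\<^sup>2 / 2)) * exp (a * \<bar>t \<bullet> y\<bar>)) * ennreal (2 * ?\<kappa> * exp ((norm y)\<^sup>2 / 2))"
 by (intro mult_left_mono gauss_exp_linear_bound) simp
also have "... = ennreal ((norm (f t) * norm (F y) * exp (- ((norm y)\<^sup>2 / 2)) * exp (a * \<bar>t \<bullet> y\<bar>)) * (2 * ?\<kappa> * exp ((norm y)\<^sup>2 / 2)))"
 using gauss_mass_pos[where 'n='n] by (intro ennreal_mult[symmetric]) auto
also have "(norm (f t) * norm (F y) * exp (- ((norm y)\<^sup>2 / 2)) * exp (a * \<bar>t \<bullet> y\<bar>)) * (2 * ?\<kappa> * exp ((norm y)\<^sup>2 / 2))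
 = 2 * ?\<kappa> * (norm (f t) * norm (F y) * exp (a * \<bar>t \<bullet> y\<bar>)) * (exp (- ((norm y)\<^sup>2 / 2)) * exp ((norm y)\<^sup>2 / 2))" by (simp only: mult_ac)
also have "exp (- ((norm y)\<^sup>2 / 2)) * exp ((norm y)\<^sup>2 / 2) = 1" by (simp flip: exp_add)
finally show ?thesis using gauss_mass_pos[where 'n='n] by (simp add: ennreal_mult[symmetric])
qed
have "(\<integral>\<^sup>+x. (\<integral>\<^sup>+y. (\<integral>\<^sup>+t. ?H x y t \<partial>lborel) \<partial>lborel) \<partial>lborel) = (\<integral>\<^sup>+y. (\<integral>\<^sup>+x. (\<integral>\<^sup>+t. ?H x y t \<partial>lborel) \<partial>lborel) \<partial>lborel)"
by (rule lborel_pair.Fubini') measurable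
also have "... = (\<integral>\<^sup>+y. (\<integral>\<^sup>+t. (\<integral>\<^sup>+x. ?H x y t \<partial>lborel) \<partial>lborel) \<partial>lborel)"
by (intro nn_integral_cong lborel_pair.Fubini') measurable
also have "... <= (\<integral>\<^sup>+y. (\<integral>\<^sup>+t. ennreal (2 * ?\<kappa>) * ennreal (norm (f t) * norm (F y) * exp (a * \<bar>t \<bullet> y\<bar>)) \<partial>lborel) \<partial>lborel)"
by (intro nn_integral_mono inner)
also have "... = ennreal (2 * ?\<kappa>) * (\<integral>\<^sup>+y. (\<integral>\<^sup>+t. ennreal (norm (f t) * norm (F y) * exp (a * \<bar>t \<bullet> y\<bar>)) \<partial>lborel) \<partial>lborel)"
by (subst nn_integral_cmult, simp)+ simp
also have "... = ennreal (2 * ?\<kappa>) * KK a f F" by (subst KK_swap) simp_all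
finally show ?thesis .
qed

text \<open>With \<open>a = 1 - 1 / (2 r\<^sup>2)\<close> the factors \<open>exp \<bar>x \<bullet> y\<bar>\<close> and \<open>exp (a \<bar>x \<bullet> y\<bar>)\<close> differ by at most \<open>exp 2\<close> for \<open>\<bar>y\<bar> \<le> 4 r\<close>; for larger \<open>y\<close> the damping absorbs the exponential.\<close>
lemma local_growth_bound:
fixes f F g :: "real ^ 'n::finite => complex"
assumes [measurable]: "f \<in> borel_measurable borel" "F \<in> borel_measurable borel" "g \<in> borel_measurable borel"
and g: "!!x. ennreal (norm (g x)) <= ennreal \<kappa>' * (\<integral>\<^sup>+t. ennreal (norm (f t) * exp (- ((norm (x - t))\<^sup>2 / 2))) \<partial>lborel)"
and gb: "!!x. norm (g x) <= M0" and \<kappa>': "\<kappa>' >= 0"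
and \<Phi>: "\<Phi> >= 0" "(\<integral>\<^sup>+y. ennreal (norm (F y)) \<partial>lborel) <= ennreal \<Phi>"
and KK: "C >= 0" "!!a. 0 < a ==> a < 1 ==> KK a f F <= ennreal (C * blowup a ^ N)"
obtains C' L where "C' >= 0" "!!R. R >= 0 ==>
(\<integral>\<^sup>+x. ennreal (norm (g x)) * (\<integral>\<^sup>+y. ennreal (norm (F y) * exp (- ((norm y)\<^sup>2 / 2)) * exp \<bar>x \<bullet> y\<bar>) \<partial>lborel) * indicator (cball 0 R) x \<partial>lborel) <= ennreal (C' * (1 + R) ^ L)"
proof -
let ?\<kappa> = "gauss_mass TYPE('n)"
obtain v where v: "v >= 0" "!!R. R > 0 ==> emeasure lborel (cball (0::real^'n) R) <= ennreal (v * R ^ CARD('n))"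
by (rule cball_volume_scale, rule that)
have M0: "M0 >= 0" using gb[of 0] norm_ge_zero order_trans by blast
have kp: "?\<kappa> > 0" by (rule gauss_mass_pos)
define G where "G a x = (\<integral>\<^sup>+y. ennreal (norm (F y) * exp (- ((norm y)\<^sup>2 / 2)) * exp (a * \<bar>x \<bullet> y\<bar>)) \<partial>lborel)" for a :: real and x
have [measurable]: "G a \<in> borel_measurable borel" for a unfolding G_def[abs_def] by measurable
define L where "L = max N CARD('n)"
define C1 where "C1 = exp 2 * (\<kappa>' * (2 * ?\<kappa> * (C * 2 ^ N)))"
define C2 where "C2 = M0 * \<Phi> * v"
have C1: "C1 >= 0" using \<kappa>' kp KK(1) by (simp add: C1_def)
have C2: "C2 >= 0" using M0 \<Phi>(1) v(1) by (simp add: C2_def)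
have "(\<integral>\<^sup>+x. ennreal (norm (g x)) * G 1 x * indicator (cball 0 R) x \<partial>lborel) <= ennreal ((C1 + C2) * (1 + R) ^ L)" if R: "R >= 0" for R
proof -
define r where "r = 1 + R"
have r: "r >= 1" using R by (simp add: r_def)
define a where "a = 1 - 1 / (2 * r\<^sup>2)"
have r2: "r\<^sup>2 >= 1" using r by (simp add: one_le_power)
have rp: "2 * r\<^sup>2 > 1" using r2 by linarith
have "1 / (2 * r\<^sup>2) < 1" using rp by (subst divide_less_eq_1_pos) linarith+
moreover have "1 / (2 * r\<^sup>2) > 0" using rp by (intro divide_pos_pos) linarith+
ultimately have a: "0 < a" "a < 1" by (auto simp: a_def)
have blow: "blowup a <= 2 * r"
proof -
 have "(blowup a)\<^sup>2 = 2 * r\<^sup>2" using blowup_props(2)[OF a] r by (simp add: a_def field_simps)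
 also have "... <= (2 * r)\<^sup>2" by (simp add: power_mult_distrib)
 finally show ?thesis by (rule power2_le_imp_le) (use r in simp)
qed
have Gbound: "G 1 x <= ennreal (exp 2) * G a x + ennreal \<Phi>" if x: "x \<in> cball 0 R" for x
proof -
 have nx: "norm x <= r" using x by (simp add: r_def)
 have "G 1 x <= (\<integral>\<^sup>+y. ennreal (exp 2) * ennreal (norm (F y) * exp (- ((norm y)\<^sup>2 / 2)) * exp (a * \<bar>x \<bullet> y\<bar>)) + ennreal (norm (F y)) \<partial>lborel)"
 unfolding G_def
 proof (rule nn_integral_mono)
 fix y :: "real^'n"
 have xy: "\<bar>x \<bullet> y\<bar> <= r * norm y" using Cauchy_Schwarz_ineq2[of x y] mult_right_mono[OF nx norm_ge_zero[of y]] by linarith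
 have "norm (F y) * exp (- ((norm y)\<^sup>2 / 2)) * exp (1 * \<bar>x \<bullet> y\<bar>)
 <= exp 2 * (norm (F y) * exp (- ((norm y)\<^sup>2 / 2)) * exp (a * \<bar>x \<bullet> y\<bar>)) + norm (F y)"
 proof (cases "norm y <= 4 * r")
 case True
 have "r * norm y <= r * (4 * r)" using True r by (intro mult_left_mono) auto
 hence "\<bar>x \<bullet> y\<bar> <= 4 * r\<^sup>2" using xy by (simp add: power2_eq_square)
 hence "(1 / (2 * r\<^sup>2)) * \<bar>x \<bullet> y\<bar> <= (1 / (2 * r\<^sup>2)) * (4 * r\<^sup>2)" by (intro mult_left_mono) auto
 also have "... = 2" using r by simp
 finally have "1 * \<bar>x \<bullet> y\<bar> <= 2 + a * \<bar>x \<bullet> y\<bar>" by (simp add: a_def left_diff_distrib)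
 hence "exp (1 * \<bar>x \<bullet> y\<bar>) <= exp 2 * exp (a * \<bar>x \<bullet> y\<bar>)" by (simp add: exp_add[symmetric])
 hence "norm (F y) * exp (- ((norm y)\<^sup>2 / 2)) * exp (1 * \<bar>x \<bullet> y\<bar>) <= norm (F y) * exp (- ((norm y)\<^sup>2 / 2)) * (exp 2 * exp (a * \<bar>x \<bullet> y\<bar>))"
  by (intro mult_left_mono) auto
 also have "... = exp 2 * (norm (F y) * exp (- ((norm y)\<^sup>2 / 2)) * exp (a * \<bar>x \<bullet> y\<bar>))" by (simp only: mult_ac)
 finally show ?thesis using norm_ge_zero[of "F y"] by linarith
 next
 case False
 have "r * norm y <= (norm y / 2) * norm y" using False r by (intro mult_right_mono) auto
 hence "- ((norm y)\<^sup>2 / 2) + 1 * \<bar>x \<bullet> y\<bar> <= 0" using xy by (simp add: power2_eq_square)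
 hence "exp (- ((norm y)\<^sup>2 / 2)) * exp (1 * \<bar>x \<bullet> y\<bar>) <= 1" by (simp add: exp_add[symmetric])
 hence "norm (F y) * (exp (- ((norm y)\<^sup>2 / 2)) * exp (1 * \<bar>x \<bullet> y\<bar>)) <= norm (F y) * 1" by (intro mult_left_mono) auto
 moreover have "0 <= exp 2 * (norm (F y) * exp (- ((norm y)\<^sup>2 / 2)) * exp (a * \<bar>x \<bullet> y\<bar>))" by simp
 ultimately show ?thesis by (simp only: mult.assoc)
 qed
 thus "ennreal (norm (F y) * exp (- ((norm y)\<^sup>2 / 2)) * exp (1 * \<bar>x \<bullet> y\<bar>))
 <= ennreal (exp 2) * ennreal (norm (F y) * exp (- ((norm y)\<^sup>2 / 2)) * exp (a * \<bar>x \<bullet> y\<bar>)) + ennreal (norm (F y))"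
 by (simp add: ennreal_mult[symmetric] ennreal_plus[symmetric] ennreal_leI del: ennreal_plus)
 qed
 also have "... = ennreal (exp 2) * G a x + (\<integral>\<^sup>+y. ennreal (norm (F y)) \<partial>lborel)"
 unfolding G_def by (subst nn_integral_add, simp, simp, subst nn_integral_cmult) simp_all
 also have "... <= ennreal (exp 2) * G a x + ennreal \<Phi>" by (intro add_left_mono \<Phi>)
 finally show ?thesis .
qed
have [measurable]: "cball (0::real^'n) r \<in> sets borel" by simp
have m1: "(%x. ennreal (exp 2) * (ennreal (norm (g x)) * G a x)) \<in> borel_measurable lborel" by measurable
have m2: "(%x::real^'n. ennreal (M0 * \<Phi>) * indicator (cball 0 r) x) \<in> borel_measurable lborel" by measurable
have m3: "(%x. ennreal (norm (g x)) * G a x) \<in> borel_measurable lborel" by measurable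
have "(\<integral>\<^sup>+x. ennreal (norm (g x)) * G 1 x * indicator (cball 0 R) x \<partial>lborel)
 <= (\<integral>\<^sup>+x. ennreal (exp 2) * (ennreal (norm (g x)) * G a x) + ennreal (M0 * \<Phi>) * indicator (cball 0 r) x \<partial>lborel)"
proof (rule nn_integral_mono)
 fix x :: "real^'n"
 show "ennreal (norm (g x)) * G 1 x * indicator (cball 0 R) x <= ennreal (exp 2) * (ennreal (norm (g x)) * G a x) + ennreal (M0 * \<Phi>) * indicator (cball 0 r) x"
 proof (cases "x \<in> cball 0 R")
 case True
 have "ennreal (norm (g x)) * G 1 x <= ennreal (norm (g x)) * (ennreal (exp 2) * G a x + ennreal \<Phi>)"
 by (intro mult_left_mono Gbound True) simp
 also have "... = ennreal (exp 2) * (ennreal (norm (g x)) * G a x) + ennreal (norm (g x)) * ennreal \<Phi>"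
 by (simp add: distrib_left mult_ac)
 also have "... <= ennreal (exp 2) * (ennreal (norm (g x)) * G a x) + ennreal M0 * ennreal \<Phi>"
 by (intro add_left_mono mult_right_mono ennreal_leI gb) simp
 finally show ?thesis using True M0 \<Phi>(1) by (simp add: ennreal_mult r_def)
 qed simp
qed
also have "... = ennreal (exp 2) * (\<integral>\<^sup>+x. ennreal (norm (g x)) * G a x \<partial>lborel) + ennreal (M0 * \<Phi>) * emeasure lborel (cball (0::real^'n) r)"
 by (subst nn_integral_add[OF m1 m2], subst nn_integral_cmult[OF m3], subst nn_integral_cmult_indicator) simp_all
also have "... <= ennreal (exp 2) * (ennreal \<kappa>' * (ennreal (2 * ?\<kappa>) * ennreal (C * (2 * r) ^ N))) + ennreal (M0 * \<Phi>) * ennreal (v * r ^ CARD('n))"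
proof (intro add_mono mult_left_mono v)
 have "(\<integral>\<^sup>+x. ennreal (norm (g x)) * G a x \<partial>lborel)
 <= (\<integral>\<^sup>+(x::real^'n). ennreal \<kappa>' * (\<integral>\<^sup>+(y::real^'n). (\<integral>\<^sup>+(t::real^'n).
 ennreal (norm (f t) * norm (F y) * exp (- ((norm y)\<^sup>2 / 2)) * exp (- ((norm (x - t))\<^sup>2 / 2)) * exp (a * \<bar>x \<bullet> y\<bar>)) \<partial>lborel) \<partial>lborel) \<partial>lborel)"
 proof (rule nn_integral_mono)
 fix x :: "real^'n"
 let ?I = "\<integral>\<^sup>+(t::real^'n). ennreal (norm (f t) * exp (- ((norm (x - t))\<^sup>2 / 2))) \<partial>lborel"
 have "ennreal (norm (g x)) * G a x <= (ennreal \<kappa>' * ?I) * G a x" by (intro mult_right_mono g) simp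
 also have "... = ennreal \<kappa>' * (G a x * ?I)" by (simp only: mult_ac)
 also have "G a x * ?I = (\<integral>\<^sup>+y. ennreal (norm (F y) * exp (- ((norm y)\<^sup>2 / 2)) * exp (a * \<bar>x \<bullet> y\<bar>)) * ?I \<partial>lborel)"
 unfolding G_def by (rule nn_integral_multc[symmetric]) measurable
 also have "... = (\<integral>\<^sup>+y. (\<integral>\<^sup>+(t::real^'n). ennreal (norm (F y) * exp (- ((norm y)\<^sup>2 / 2)) * exp (a * \<bar>x \<bullet> y\<bar>)) * ennreal (norm (f t) * exp (- ((norm (x - t))\<^sup>2 / 2))) \<partial>lborel) \<partial>lborel)"
 by (intro nn_integral_cong nn_integral_cmult[symmetric]) measurable
 also have "... = (\<integral>\<^sup>+(y::real^'n). (\<integral>\<^sup>+(t::real^'n).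
 ennreal (norm (f t) * norm (F y) * exp (- ((norm y)\<^sup>2 / 2)) * exp (- ((norm (x - t))\<^sup>2 / 2)) * exp (a * \<bar>x \<bullet> y\<bar>)) \<partial>lborel) \<partial>lborel)"
 by (intro nn_integral_cong) (simp add: ennreal_mult[symmetric] mult_ac)
 finally show "ennreal (norm (g x)) * G a x <= ennreal \<kappa>' * (\<integral>\<^sup>+(y::real^'n). (\<integral>\<^sup>+(t::real^'n).
 ennreal (norm (f t) * norm (F y) * exp (- ((norm y)\<^sup>2 / 2)) * exp (- ((norm (x - t))\<^sup>2 / 2)) * exp (a * \<bar>x \<bullet> y\<bar>)) \<partial>lborel) \<partial>lborel)" .
 qed
 also have "... = ennreal \<kappa>' * (\<integral>\<^sup>+(x::real^'n). (\<integral>\<^sup>+(y::real^'n). (\<integral>\<^sup>+(t::real^'n).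
 ennreal (norm (f t) * norm (F y) * exp (- ((norm y)\<^sup>2 / 2)) * exp (- ((norm (x - t))\<^sup>2 / 2)) * exp (a * \<bar>x \<bullet> y\<bar>)) \<partial>lborel) \<partial>lborel) \<partial>lborel)"
 by (rule nn_integral_cmult) measurable
 also have "... <= ennreal \<kappa>' * (ennreal (2 * ?\<kappa>) * KK a f F)"
 using a by (intro mult_left_mono smoothed_product_bound) simp_all
 also have "... <= ennreal \<kappa>' * (ennreal (2 * ?\<kappa>) * ennreal (C * (2 * r) ^ N))"
 proof (intro mult_left_mono)
 have "KK a f F <= ennreal (C * blowup a ^ N)" by (rule KK(2)[OF a])
 also have "... <= ennreal (C * (2 * r) ^ N)"
 using blow blowup_props(1)[OF a] KK(1) by (intro ennreal_leI mult_left_mono power_mono) auto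
 finally show "KK a f F <= ennreal (C * (2 * r) ^ N)" .
 qed simp_all
 finally show "(\<integral>\<^sup>+x. ennreal (norm (g x)) * G a x \<partial>lborel) <= ennreal \<kappa>' * (ennreal (2 * ?\<kappa>) * ennreal (C * (2 * r) ^ N))" .
qed (use r in auto)
also have "... = ennreal (C1 * r ^ N + C2 * r ^ CARD('n))"
 using \<kappa>' kp KK(1) M0 \<Phi>(1) v(1) r unfolding C1_def C2_def
 by (simp add: ennreal_mult[symmetric] ennreal_plus[symmetric] power_mult_distrib mult_ac del: ennreal_plus)
also have "... <= ennreal ((C1 + C2) * (1 + R) ^ L)"
proof (rule ennreal_leI)
 have "C1 * r ^ N <= C1 * r ^ L" using C1 r by (intro mult_left_mono power_increasing) (auto simp: L_def)
 moreover have "C2 * r ^ CARD('n) <= C2 * r ^ L" using C2 r by (intro mult_left_mono power_increasing) (auto simp: L_def)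
 ultimately show "C1 * r ^ N + C2 * r ^ CARD('n) <= (C1 + C2) * (1 + R) ^ L" by (simp add: r_def distrib_right)
qed
finally show ?thesis .
qed
moreover have "C1 + C2 >= 0" using C1 C2 by simp
ultimately show ?thesis using that[of "C1 + C2" L] unfolding G_def by simp
qed

text \<open>Polar coordinates are avoided by averaging over dilations: the weight \<open>s ^ n / (1 + s) ^ (L + 2)\<close> makes the double integral over \<open>s\<close> and a ball of directions finite, so almost every direction has a finite integral.\<close>
lemma ray_growth_bound:
fixes H :: "real ^ 'n::finite => ennreal"
assumes [measurable]: "H \<in> borel_measurable borel"
and C: "C >= 0" "!!R. R >= 0 ==> (\<integral>\<^sup>+x. H x * indicator (cball 0 R) x \<partial>lborel) <= ennreal (C * (1 + R) ^ L)"
and bd: "!!R. \<exists>M. \<forall>x\<in>cball 0 R. H x <= ennreal M"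
shows "AE \<omega> in lborel. \<exists>C'\<ge>0. \<forall>R\<ge>0. (\<integral>\<^sup>+(s::real). H (s *\<^sub>R \<omega>) * indicator {0..R} s \<partial>lborel) <= ennreal (C' * (1 + R) ^ (L + 2))"
proof -
have [measurable]: "cball (0::real^'n) R \<in> sets borel" for R by simp
define w where "w s = s ^ CARD('n) / (1 + s) ^ (L + 2)" for s :: real
have [measurable]: "w \<in> borel_measurable borel" unfolding w_def[abs_def] by measurable
define J where "J \<omega> = (\<integral>\<^sup>+s. H (s *\<^sub>R \<omega>) * (ennreal (w s) * indicator {0<..} s) \<partial>lborel)" for \<omega>
have [measurable]: "J \<in> borel_measurable borel" unfolding J_def[abs_def] by measurable
have Jfin: "AE \<omega> in lborel. \<omega> \<in> cball 0 \<rho> --> J \<omega> < \<infinity>" if \<rho>: "\<rho> >= 0" for \<rho> :: real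
proof -
have slice: "(\<integral>\<^sup>+\<omega>. H (s *\<^sub>R \<omega>) * (ennreal (w s) * indicator {0<..} s) * indicator (cball 0 \<rho>) \<omega> \<partial>lborel)
 <= ennreal (C * (1 + \<rho>) ^ L) * (ennreal (1 / (1 + s)\<^sup>2) * indicator {0..} s)" for s :: real
proof (cases "s > 0")
 case True
 let ?I = "\<integral>\<^sup>+(\<omega>::real^'n). H (s *\<^sub>R \<omega>) * indicator (cball 0 \<rho>) \<omega> \<partial>lborel"
 have "(\<integral>\<^sup>+x. H x * indicator (cball 0 (s * \<rho>)) x \<partial>lborel) = ennreal (\<bar>s\<bar> ^ DIM(real^'n)) * (\<integral>\<^sup>+(\<omega>::real^'n). H (0 + s *\<^sub>R \<omega>) * indicator (cball 0 (s * \<rho>)) (0 + s *\<^sub>R \<omega>) \<partial>lborel)"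
 using True by (intro lborel_nn_integral_affine borel_measurable_times_ennreal borel_measurable_indicator) auto
 also have "(\<integral>\<^sup>+(\<omega>::real^'n). H (0 + s *\<^sub>R \<omega>) * indicator (cball 0 (s * \<rho>)) (0 + s *\<^sub>R \<omega>) \<partial>lborel) = ?I"
 using True by (intro nn_integral_cong) (auto simp: indicator_def)
 finally have eq: "(\<integral>\<^sup>+x. H x * indicator (cball 0 (s * \<rho>)) x \<partial>lborel) = ennreal (s ^ CARD('n)) * ?I" using True by simp
 have "(\<integral>\<^sup>+\<omega>. H (s *\<^sub>R \<omega>) * (ennreal (w s) * indicator {0<..} s) * indicator (cball 0 \<rho>) \<omega> \<partial>lborel)
 = (\<integral>\<^sup>+\<omega>. ennreal (w s) * (H (s *\<^sub>R \<omega>) * indicator (cball 0 \<rho>) \<omega>) \<partial>lborel)"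
 using True by (intro nn_integral_cong) (simp add: mult_ac)
 also have "... = ennreal (w s) * ?I" by (rule nn_integral_cmult) measurable
 also have "... = ennreal (1 / (1 + s) ^ (L + 2)) * (ennreal (s ^ CARD('n)) * ?I)"
 using True by (simp add: w_def ennreal_mult[symmetric] mult.assoc[symmetric])
 also have "... <= ennreal (1 / (1 + s) ^ (L + 2)) * ennreal (C * (1 + s * \<rho>) ^ L)"
 unfolding eq[symmetric] using True \<rho> by (intro mult_left_mono C) auto
 also have "... = ennreal (1 / (1 + s) ^ (L + 2) * (C * (1 + s * \<rho>) ^ L))"
 using True C(1) \<rho> by (intro ennreal_mult[symmetric]) auto
 also have "... <= ennreal ((C * (1 + \<rho>) ^ L) * (1 / (1 + s)\<^sup>2))"
 proof (rule ennreal_leI)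
 have "1 + s * \<rho> <= (1 + \<rho>) * (1 + s)" using True \<rho> by (simp add: algebra_simps)
 hence "(1 + s * \<rho>) ^ L <= ((1 + \<rho>) * (1 + s)) ^ L" using True \<rho> by (intro power_mono) auto
 hence "1 / (1 + s) ^ (L + 2) * (C * (1 + s * \<rho>) ^ L) <= 1 / (1 + s) ^ (L + 2) * (C * ((1 + \<rho>) * (1 + s)) ^ L)"
 using True C(1) by (intro mult_left_mono) auto
 also have "... = (C * (1 + \<rho>) ^ L) * (1 / (1 + s)\<^sup>2)"
 proof -
 have p: "(1 + s) ^ L > 0" using True by simp
 show ?thesis using p True by (simp add: power_mult_distrib power_add power2_eq_square)
 qed
 finally show "1 / (1 + s) ^ (L + 2) * (C * (1 + s * \<rho>) ^ L) <= (C * (1 + \<rho>) ^ L) * (1 / (1 + s)\<^sup>2)" .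
 qed
 also have "... = ennreal (C * (1 + \<rho>) ^ L) * ennreal (1 / (1 + s)\<^sup>2)"
 using True C(1) \<rho> by (intro ennreal_mult) auto
 finally show ?thesis using True by simp
qed simp
have tail: "(\<integral>\<^sup>+s. ennreal (1 / (1 + s)\<^sup>2) * indicator {0..} s \<partial>lborel) = ennreal (0 - (- 1 / (1 + 0)))"
proof (rule nn_integral_FTC_atLeast)
 show "DERIV (%s. - 1 / (1 + s)) s :> 1 / (1 + s)\<^sup>2" if "0 <= s" for s :: real
 using that by (auto intro!: derivative_eq_intros simp: power2_eq_square field_simps)
 show "((%s::real. - 1 / (1 + s)) \<longlongrightarrow> 0) at_top" by real_asymp
qed auto
have "(\<integral>\<^sup>+\<omega>. J \<omega> * indicator (cball 0 \<rho>) \<omega> \<partial>lborel)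
 = (\<integral>\<^sup>+(\<omega>::real^'n). (\<integral>\<^sup>+s. H (s *\<^sub>R \<omega>) * (ennreal (w s) * indicator {0<..} s) * indicator (cball 0 \<rho>) \<omega> \<partial>lborel) \<partial>lborel)"
 unfolding J_def by (intro nn_integral_cong nn_integral_multc[symmetric]) measurable
also have "... = (\<integral>\<^sup>+s. (\<integral>\<^sup>+(\<omega>::real^'n). H (s *\<^sub>R \<omega>) * (ennreal (w s) * indicator {0<..} s) * indicator (cball 0 \<rho>) \<omega> \<partial>lborel) \<partial>lborel)"
 by (rule lborel_pair.Fubini') measurable
also have "... <= (\<integral>\<^sup>+s. ennreal (C * (1 + \<rho>) ^ L) * (ennreal (1 / (1 + s)\<^sup>2) * indicator {0..} s) \<partial>lborel)"
 by (intro nn_integral_mono slice)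
also have "... = ennreal (C * (1 + \<rho>) ^ L) * ennreal (0 - (- 1 / (1 + 0)))"
 unfolding tail[symmetric] by (rule nn_integral_cmult) measurable
also have "... < \<infinity>" by (simp add: ennreal_mult_less_top)
finally have "(\<integral>\<^sup>+\<omega>. J \<omega> * indicator (cball 0 \<rho>) \<omega> \<partial>lborel) ~= \<infinity>" by simp
hence "AE \<omega> in lborel. J \<omega> * indicator (cball 0 \<rho>) \<omega> ~= \<infinity>" by (intro nn_integral_PInf_AE) auto
thus ?thesis by eventually_elim (auto simp: less_top)
qed
have "AE \<omega> in lborel. \<forall>k. \<omega> \<in> cball 0 (real k) --> J \<omega> < \<infinity>" unfolding AE_all_countable using Jfin by simp
thus ?thesis
proof eventually_elim
case (elim \<omega>)
obtain k :: nat where "norm \<omega> <= real k" using real_arch_simple by blast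
hence Jf: "J \<omega> < \<infinity>" using elim by auto
obtain M where M: "!!x. x \<in> cball 0 (norm \<omega>) ==> H x <= ennreal M" using bd[of "norm \<omega>"] by blast
define C' where "C' = max M 0 + enn2real (J \<omega>)"
have J: "J \<omega> = ennreal (enn2real (J \<omega>))" using Jf by simp
have "(\<integral>\<^sup>+(s::real). H (s *\<^sub>R \<omega>) * indicator {0..R} s \<partial>lborel) <= ennreal (C' * (1 + R) ^ (L + 2))" if R: "R >= 0" for R
proof -
 have "(\<integral>\<^sup>+(s::real). H (s *\<^sub>R \<omega>) * indicator {0..R} s \<partial>lborel)
 <= (\<integral>\<^sup>+(s::real). ennreal (max M 0) * indicator {0..1} s + ennreal ((1 + R) ^ (L + 2)) * (H (s *\<^sub>R \<omega>) * (ennreal (w s) * indicator {0<..} s)) \<partial>lborel)"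
 proof (rule nn_integral_mono)
 fix s :: real
 show "H (s *\<^sub>R \<omega>) * indicator {0..R} s <= ennreal (max M 0) * indicator {0..1} s + ennreal ((1 + R) ^ (L + 2)) * (H (s *\<^sub>R \<omega>) * (ennreal (w s) * indicator {0<..} s))"
 proof (cases "s \<in> {0..R}")
 case True
 show ?thesis
 proof (cases "s <= 1")
  case s1: True
  have "norm (s *\<^sub>R \<omega>) <= norm \<omega>" using s1 True by (simp add: mult_left_le_one_le)
  hence "H (s *\<^sub>R \<omega>) <= ennreal M" by (intro M) simp
  also have "... <= ennreal (max M 0)" by (intro ennreal_leI) simp
  finally have "H (s *\<^sub>R \<omega>) <= ennreal (max M 0)" .
  thus ?thesis using True s1 by (auto intro: add_increasing2)
 next
  case False
  have "1 <= (1 + R) ^ (L + 2) * w s"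
  proof -
  have "(1 + s) ^ (L + 2) * 1 <= (1 + R) ^ (L + 2) * s ^ CARD('n)"
  using True False by (intro mult_mono power_mono one_le_power) auto
  thus ?thesis using True by (simp add: w_def divide_simps add_pos_nonneg)
  qed
  hence "ennreal 1 <= ennreal ((1 + R) ^ (L + 2)) * ennreal (w s)" using R True by (subst ennreal_mult[symmetric]) (auto simp: w_def ennreal_leI)
  hence "H (s *\<^sub>R \<omega>) * 1 <= H (s *\<^sub>R \<omega>) * (ennreal ((1 + R) ^ (L + 2)) * ennreal (w s))" by (intro mult_left_mono) auto
  thus ?thesis using True False by (simp add: mult_ac)
 qed
 qed simp
 qed
 also have "... = ennreal (max M 0) + ennreal ((1 + R) ^ (L + 2)) * J \<omega>"
 unfolding J_def by (subst nn_integral_add, simp, simp, subst nn_integral_cmult_indicator, simp, subst nn_integral_cmult) simp_all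
 also have "... = ennreal (max M 0 + (1 + R) ^ (L + 2) * enn2real (J \<omega>))"
 using R by (subst J) (simp add: ennreal_mult[symmetric] ennreal_plus[symmetric] del: ennreal_plus)
 also have "... <= ennreal (C' * (1 + R) ^ (L + 2))"
 proof (rule ennreal_leI)
 have "max M 0 * 1 <= max M 0 * (1 + R) ^ (L + 2)" using R by (intro mult_left_mono one_le_power) auto
 thus "max M 0 + (1 + R) ^ (L + 2) * enn2real (J \<omega>) <= C' * (1 + R) ^ (L + 2)"
 unfolding C'_def distrib_right by (simp add: mult.commute)
 qed
 finally show ?thesis .
qed
moreover have "C' >= 0" by (simp add: C'_def)
ultimately show ?case by blast
qed
qed

section \<open>Restrictions to complex directions\<close>

text \<open>Finite exponential moments of every order; the class is stable under multiplication by polynomials.\<close>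
definition exp_integrable :: "(real ^ 'n::finite => complex) => bool" where
"exp_integrable \<phi> \<longleftrightarrow> \<phi> \<in> borel_measurable borel \<and> (\<forall>R. integrable lborel (%y. norm (\<phi> y) * exp (R * norm y)))"

lemma exp_integrable_measurable: "exp_integrable \<phi> ==> \<phi> \<in> borel_measurable borel"
by (simp add: exp_integrable_def)

lemma exp_integrable_imp_integrable:
assumes "exp_integrable \<phi>" shows "integrable lborel \<phi>"
proof -
have "integrable lborel (%y. norm (\<phi> y) * exp (0 * norm y))" using assms unfolding exp_integrable_def by blast
hence "integrable lborel (%y. norm (\<phi> y))" by simp
moreover have "\<phi> \<in> borel_measurable lborel" using exp_integrable_measurable[OF assms] by simp
ultimately show ?thesis by (simp add: integrable_norm_iff)
qed

lemma exp_integrable_times_linear: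
assumes "exp_integrable \<phi>"
shows "exp_integrable (%y. \<phi> y * cplx (a \<bullet> y))"
unfolding exp_integrable_def
proof (intro conjI allI)
have [measurable]: "\<phi> \<in> borel_measurable borel" by (rule exp_integrable_measurable[OF assms])
show "(%y. \<phi> y * cplx (a \<bullet> y)) \<in> borel_measurable borel" by measurable
fix R :: real
have i: "integrable lborel (%y. norm a * (norm (\<phi> y) * exp ((R + 1) * norm y)))"
using assms unfolding exp_integrable_def by (intro integrable_mult_right) blast
show "integrable lborel (%y. norm (\<phi> y * cplx (a \<bullet> y)) * exp (R * norm y))"
proof (rule Bochner_Integration.integrable_bound[OF i])
show "AE y in lborel. norm (norm (\<phi> y * cplx (a \<bullet> y)) * exp (R * norm y)) <= norm (norm a * (norm (\<phi> y) * exp ((R + 1) * norm y)))"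
proof (rule AE_I2)
 fix y :: "real^'a"
 have "\<bar>a \<bullet> y\<bar> <= norm a * norm y" by (rule Cauchy_Schwarz_ineq2)
 also have "... <= norm a * exp (norm y)"
 using exp_ge_add_one_self[of "norm y"] by (intro mult_left_mono) (linarith, simp)
 finally have "\<bar>a \<bullet> y\<bar> <= norm a * exp (norm y)" .
 hence "(norm (\<phi> y) * exp (R * norm y)) * \<bar>a \<bullet> y\<bar> <= (norm (\<phi> y) * exp (R * norm y)) * (norm a * exp (norm y))"
 by (intro mult_left_mono) auto
 also have "... = norm a * (norm (\<phi> y) * exp ((R + 1) * norm y))"
 proof -
 have "exp ((R + 1) * norm y) = exp (R * norm y) * exp (norm y)" unfolding distrib_right exp_add by simp
 thus ?thesis by (simp only: mult_ac)
 qed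
 finally show "norm (norm (\<phi> y * cplx (a \<bullet> y)) * exp (R * norm y)) <= norm (norm a * (norm (\<phi> y) * exp ((R + 1) * norm y)))"
 by (simp add: norm_mult mult_ac)
qed
qed measurable
qed

lemma exp_integrable_times_power:
assumes "exp_integrable \<phi>"
shows "exp_integrable (%y. \<phi> y * cplx (a \<bullet> y) ^ k)"
proof (induction k)
case (Suc k)
show ?case using exp_integrable_times_linear[OF Suc.IH, of a] by (simp add: mult_ac)
qed (use assms in simp)

lemma linear_times_integral:
assumes "exp_integrable \<phi>"
shows "linear (%b. LINT y|lborel. \<phi> y * cplx (b \<bullet> y))"
proof (rule linearI)
have i: "integrable lborel (%y. \<phi> y * cplx (b \<bullet> y))" for b
by (intro exp_integrable_imp_integrable exp_integrable_times_linear assms)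
fix b c :: "real^'a" and r :: real
show "(LINT y|lborel. \<phi> y * cplx ((b + c) \<bullet> y)) = (LINT y|lborel. \<phi> y * cplx (b \<bullet> y)) + (LINT y|lborel. \<phi> y * cplx (c \<bullet> y))"
unfolding Bochner_Integration.integral_add[OF i i, symmetric] by (simp add: inner_add_left distrib_left)
show "(LINT y|lborel. \<phi> y * cplx ((r *\<^sub>R b) \<bullet> y)) = r *\<^sub>R (LINT y|lborel. \<phi> y * cplx (b \<bullet> y))"
unfolding integral_scaleR_right[symmetric] by (intro Bochner_Integration.integral_cong) (simp_all add: scaleR_conv_of_real[where 'a = complex] mult_ac)
qed

lemma polyfun_moment:
assumes "exp_integrable \<phi>"
shows "polyfun k (%b. LINT y|lborel. \<phi> y * cplx (b \<bullet> y) ^ k)"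
using assms
proof (induction k arbitrary: \<phi>)
case (Suc k)
have "(LINT y|lborel. \<phi> y * cplx (b \<bullet> y) ^ Suc k)
 = (\<Sum>i\<in>UNIV. cplx (b $ i) * (LINT y|lborel. (\<phi> y * cplx (axis i 1 \<bullet> y)) * cplx (b \<bullet> y) ^ k))" for b
proof -
have e: "\<phi> y * cplx (b \<bullet> y) ^ Suc k = (\<Sum>i\<in>UNIV. cplx (b $ i) * ((\<phi> y * cplx (axis i 1 \<bullet> y)) * cplx (b \<bullet> y) ^ k))" for y
proof -
 have "cplx (b \<bullet> y) = (\<Sum>i\<in>UNIV. cplx (b $ i) * cplx (axis i 1 \<bullet> y))"
 by (simp add: inner_vec_def[of b] inner_axis')
 note b = this
 have "\<phi> y * cplx (b \<bullet> y) ^ Suc k = cplx (b \<bullet> y) * (\<phi> y * cplx (b \<bullet> y) ^ k)"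
 by simp
 also have "... = (\<Sum>i\<in>UNIV. cplx (b $ i) * cplx (axis i 1 \<bullet> y)) * (\<phi> y * cplx (b \<bullet> y) ^ k)"
 by (rule arg_cong[OF b])
 also have "... = (\<Sum>i\<in>UNIV. cplx (b $ i) * ((\<phi> y * cplx (axis i 1 \<bullet> y)) * cplx (b \<bullet> y) ^ k))"
 unfolding sum_distrib_right by (simp only: mult_ac)
 finally show ?thesis .
qed
have i: "integrable lborel (%y. cplx (b $ i) * ((\<phi> y * cplx (axis i 1 \<bullet> y)) * cplx (b \<bullet> y) ^ k))" for i
 by (intro integrable_mult_right exp_integrable_imp_integrable exp_integrable_times_power exp_integrable_times_linear Suc.prems)
show ?thesis unfolding e using i by simp
qed
moreover have "polyfun (1 + k) (%b. \<Sum>i\<in>UNIV. cplx (b $ i) * (LINT y|lborel. (\<phi> y * cplx (axis i 1 \<bullet> y)) * cplx (b \<bullet> y) ^ k))"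
by (intro polyfun_sum polyfun_mult polyfun_coord Suc.IH exp_integrable_times_linear Suc.prems)
ultimately show ?case by simp
qed (simp add: polyfun_const)

text \<open>The linear functional of the complex direction \<open>i (a + t b)\<close>; a complex parameter on a real line of directions is all that is needed of complex directions.\<close>
definition ldir :: "real ^ 'n::finite => real ^ 'n => complex => real ^ 'n => complex" where
"ldir a b t y = \<i> * (t * cplx (b \<bullet> y) + cplx (a \<bullet> y))"

definition tcoef :: "(real ^ 'n::finite => complex) => (real ^ 'n => complex) => nat => complex" where
"tcoef \<phi> l k = (LINT y|lborel. \<phi> y * l y ^ k / fact k)"

text \<open>The smoothed function on the complex line spanned by a direction, with Taylor coefficients \<open>tcoef\<close>.\<close>
definition hdir :: "(real ^ 'n::finite => complex) => (real ^ 'n => complex) => complex => complex" where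
"hdir \<phi> l z = (LINT y|lborel. \<phi> y * exp (z * l y))"

definition hfps :: "(real ^ 'n::finite => complex) => (real ^ 'n => complex) => complex fps" where
"hfps \<phi> l = Abs_fps (tcoef \<phi> l)"

text \<open>The series of \<open>z \<mapsto> F (i z)\<close>.\<close>
definition rotate_fps :: "complex fps => complex fps" where
"rotate_fps F = Abs_fps (%k. fps_nth F k * \<i> ^ k)"

lemma ldir_measurable [measurable]: "ldir a b t \<in> borel_measurable borel"
unfolding ldir_def[abs_def] by measurable

lemma ldir_bound: "norm (ldir a b t y) <= (norm a + norm t * norm b) * norm y"
proof -
have "norm (ldir a b t y) = norm (t * cplx (b \<bullet> y) + cplx (a \<bullet> y))"
unfolding ldir_def norm_mult[of \<i>] by simp
also have "... <= norm (t * cplx (b \<bullet> y)) + norm (cplx (a \<bullet> y))"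
by (rule norm_triangle_ineq)
also have "... <= norm t * (norm b * norm y) + norm a * norm y"
unfolding norm_mult norm_of_real real_norm_def by (intro add_mono mult_left_mono Cauchy_Schwarz_ineq2) auto
finally show ?thesis by (simp add: algebra_simps)
qed

lemma hdir_expansion:
assumes "exp_integrable \<phi>"
shows "(%k. tcoef \<phi> (ldir a b t) k * z ^ k) sums hdir \<phi> (ldir a b t) z"
and "integrable lborel (%y. \<phi> y * ldir a b t y ^ k)"
and "integrable lborel (%y. \<phi> y * exp (z * ldir a b t y))"
proof -
have [measurable]: "\<phi> \<in> borel_measurable borel" by (rule exp_integrable_measurable[OF assms])
let ?\<rho> = "norm a + norm t * norm b"
have int: "integrable lborel (%y. norm (\<phi> y) * exp (R * norm (ldir a b t y)))" for R
proof (rule Bochner_Integration.integrable_bound)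
show "integrable lborel (%y. norm (\<phi> y) * exp ((\<bar>R\<bar> * ?\<rho>) * norm y))"
 using assms unfolding exp_integrable_def by blast
show "AE y in lborel. norm (norm (\<phi> y) * exp (R * norm (ldir a b t y))) <= norm (norm (\<phi> y) * exp ((\<bar>R\<bar> * ?\<rho>) * norm y))"
proof (rule AE_I2)
 fix y :: "real^'a"
 have "R * norm (ldir a b t y) <= \<bar>R\<bar> * norm (ldir a b t y)" by (intro mult_right_mono) auto
 also have "... <= \<bar>R\<bar> * (?\<rho> * norm y)" by (intro mult_left_mono ldir_bound) auto
 finally have "R * norm (ldir a b t y) <= (\<bar>R\<bar> * ?\<rho>) * norm y" by (simp add: mult.assoc)
 hence "norm (\<phi> y) * exp (R * norm (ldir a b t y)) <= norm (\<phi> y) * exp ((\<bar>R\<bar> * ?\<rho>) * norm y)"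
 by (intro mult_left_mono) auto
 thus "norm (norm (\<phi> y) * exp (R * norm (ldir a b t y))) <= norm (norm (\<phi> y) * exp ((\<bar>R\<bar> * ?\<rho>) * norm y))" by simp
qed
qed measurable
note * = exp_integral_sums[OF _ _ int, simplified]
show "(%k. tcoef \<phi> (ldir a b t) k * z ^ k) sums hdir \<phi> (ldir a b t) z"
unfolding tcoef_def hdir_def by (rule exp_integral_sums(1)[OF _ _ int]) simp_all
show "integrable lborel (%y. \<phi> y * ldir a b t y ^ k)" by (rule exp_integral_sums(2)[OF _ _ int]) simp_all
show "integrable lborel (%y. \<phi> y * exp (z * ldir a b t y))" by (rule exp_integral_sums(3)[OF _ _ int]) simp_all
qed

lemma entire_series:
fixes c :: "nat => complex"
assumes "!!z. (%k. c k * z ^ k) sums f z"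
shows "fps_conv_radius (Abs_fps c) = \<infinity>" "eval_fps (Abs_fps c) z = f z" "f has_fps_expansion Abs_fps c" "f holomorphic_on UNIV"
proof -
show 1: "fps_conv_radius (Abs_fps c) = \<infinity>"
unfolding fps_conv_radius_def using assms by (intro conv_radius_inftyI'') (auto simp: sums_iff)
show 2: "eval_fps (Abs_fps c) z = f z" for z unfolding eval_fps_def using assms[of z] by (simp add: sums_iff)
show "f has_fps_expansion Abs_fps c" unfolding has_fps_expansion_def using 1 2 by simp
have "eval_fps (Abs_fps c) holomorphic_on UNIV" by (rule holomorphic_on_eval_fps) (simp add: 1 eball_inf)
moreover have "eval_fps (Abs_fps c) = f" using 2 by auto
ultimately show "f holomorphic_on UNIV" by simp
qed

lemma rotate_series:
assumes "!!z. (%k. c k * z ^ k) sums f z"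
shows "(%k. (c k * \<i> ^ k) * z ^ k) sums f (\<i> * z)"
using assms[of "\<i> * z"] by (simp add: power_mult_distrib mult.assoc)

lemma finite_fps_eval:
fixes F :: "complex fps"
assumes "!!j. j > D ==> fps_nth F j = 0"
shows "eval_fps F z = poly (\<Sum>j\<le>D. monom (fps_nth F j) j) z"
proof -
have "eval_fps F z = (\<Sum>j\<le>D. fps_nth F j * z ^ j)"
unfolding eval_fps_def using assms by (intro suminf_finite) auto
thus ?thesis by (simp add: poly_sum poly_monom)
qed

lemma coeff_top_mult:
fixes p q :: "complex poly"
assumes "degree p <= m" "degree q <= n"
shows "coeff (p * q) (m + n) = coeff p m * coeff q n"
proof (cases "degree p = m \<and> degree q = n")
case True
thus ?thesis using coeff_mult_degree_sum[of p q] by simp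
next
case False
hence "degree p < m \<or> degree q < n" using assms by linarith
hence 0: "coeff p m * coeff q n = 0" by (auto simp: coeff_eq_0)
have "degree (p * q) < m + n" using degree_mult_le[of p q] False assms by linarith
thus ?thesis unfolding 0 by (rule coeff_eq_0)
qed

lemma poly_has_fps_expansion: "(%z. poly p z) has_fps_expansion fps_of_poly (p :: complex poly)"
proof -
have "(%k. coeff p k * z ^ k) sums poly p z" for z
unfolding poly_altdef by (rule sums_finite) (auto simp: coeff_eq_0)
from entire_series(3)[OF this] show ?thesis by (simp add: fps_of_poly_def)
qed

text \<open>Once \<open>h z * h (i z)\<close> is a polynomial, the Gaussian factors of \<open>h z\<close> and \<open>h (i z)\<close> cancel. In \<open>h' z * h (i z)\<close> the term of degree \<open>D + 1\<close> then comes only from the derivative of the Gaussian.\<close>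
lemma direction_form:
fixes \<phi> :: "real ^ 'n::finite => complex"
assumes \<phi>: "exp_integrable \<phi>"
and gr: "!!\<rho>. \<rho> >= 0 ==> (LINT y|lborel. norm (\<phi> y) * exp (\<rho> * norm y)) <= A * exp (\<rho>\<^sup>2 / 2)"
and F: "F = hfps \<phi> (ldir a b t)"
and van: "!!j. j > D ==> fps_nth (F * rotate_fps F) j = 0" and nz: "fps_nth (F * rotate_fps F) D ~= 0"
shows "\<exists>p c. p ~= 0 \<and> degree p <= D \<and> (\<forall>z. hdir \<phi> (ldir a b t) z = poly p z * exp (- c * z\<^sup>2))
\<and> norm c <= (norm a + norm t * norm b)\<^sup>2 / 2
\<and> fps_nth (fps_deriv F * rotate_fps F) (Suc D) = - 2 * c * fps_nth (F * rotate_fps F) D"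
proof -
let ?h = "hdir \<phi> (ldir a b t)"
let ?\<rho> = "norm a + norm t * norm b"
have [measurable]: "\<phi> \<in> borel_measurable borel" by (rule exp_integrable_measurable[OF \<phi>])
note ser = hdir_expansion(1)[OF \<phi>, of a b t]
note E = entire_series[OF ser, folded hfps_def, folded F]
have rF: "rotate_fps F = Abs_fps (%k. tcoef \<phi> (ldir a b t) k * \<i> ^ k)" by (simp add: rotate_fps_def F hfps_def)
note E' = entire_series[OF rotate_series[OF ser], folded rF]
define R where "R = (\<Sum>j\<le>D. monom (fps_nth (F * rotate_fps F) j) j)"
have prod: "?h z * ?h (\<i> * z) = poly R z" for z
proof -
have "eval_fps (F * rotate_fps F) z = eval_fps F z * eval_fps (rotate_fps F) z"
 by (rule eval_fps_mult) (simp_all add: E(1) E'(1))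
thus ?thesis unfolding E(2) E'(2) R_def using finite_fps_eval[OF van] by simp
qed
have "coeff R D = fps_nth (F * rotate_fps F) D" by (simp add: R_def coeff_sum)
hence Rnz: "R ~= 0" using nz by auto
have growth: "norm (?h z) <= A * exp ((?\<rho>\<^sup>2 / 2) * (norm z)\<^sup>2)" for z
proof -
have "norm (?h z) <= (LINT y|lborel. norm (\<phi> y * exp (z * ldir a b t y)))" unfolding hdir_def by (rule integral_norm_bound)
also have "... <= (LINT y|lborel. norm (\<phi> y) * exp ((norm z * ?\<rho>) * norm y))"
proof (rule integral_mono)
 show "integrable lborel (%y. norm (\<phi> y * exp (z * ldir a b t y)))" by (intro integrable_norm hdir_expansion(3) \<phi>)
 show "integrable lborel (%y. norm (\<phi> y) * exp ((norm z * ?\<rho>) * norm y))" using \<phi> unfolding exp_integrable_def by blast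
 fix y :: "real^'n"
 have "Re (z * ldir a b t y) <= norm z * norm (ldir a b t y)" using complex_Re_le_cmod[of "z * ldir a b t y"] by (simp add: norm_mult)
 also have "... <= norm z * (?\<rho> * norm y)" by (intro mult_left_mono ldir_bound) auto
 finally have "Re (z * ldir a b t y) <= (norm z * ?\<rho>) * norm y" by (simp add: mult.assoc)
 thus "norm (\<phi> y * exp (z * ldir a b t y)) <= norm (\<phi> y) * exp ((norm z * ?\<rho>) * norm y)"
 unfolding norm_mult norm_exp_eq_Re by (intro mult_left_mono) auto
qed
also have "... <= A * exp ((norm z * ?\<rho>)\<^sup>2 / 2)" by (rule gr) simp
finally show ?thesis by (simp add: power_mult_distrib mult.commute)
qed
have B: "?\<rho>\<^sup>2 / 2 >= 0" by simp
obtain p c where pc: "!!z. ?h z = poly p z * exp (- c * z\<^sup>2)"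
using hadamard_factorization[OF Rnz E(4) B growth prod] by blast
have pnz: "p ~= 0"
proof
assume "p = 0"
hence "\<forall>z. poly R z = 0" using prod by (simp add: pc)
thus False using Rnz poly_all_0_iff_0 by blast
qed
have cb: "norm c <= ?\<rho>\<^sup>2 / 2" by (rule gaussian_coefficient_bound[OF pnz pc growth])
define pi where "pi = pcompose p [:0, \<i>:]"
have ri: "?h (\<i> * z) = poly pi z * exp (c * z\<^sup>2)" for z
by (simp add: pc pi_def poly_pcompose power_mult_distrib mult.commute)
have ee: "exp (- c * z\<^sup>2) * exp (c * z\<^sup>2) = 1" for z by (simp flip: exp_add)
have "(%z. ?h z * ?h (\<i> * z)) has_fps_expansion F * rotate_fps F" by (intro has_fps_expansion_mult E(3) E'(3))
moreover have "?h z * ?h (\<i> * z) = poly (p * pi) z" for z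
unfolding ri unfolding pc using ee[of z] by (simp add: mult_ac)
ultimately have "(%z. poly (p * pi) z) has_fps_expansion F * rotate_fps F" by (simp only:)
hence eqE: "F * rotate_fps F = fps_of_poly (p * pi)" by (rule fps_expansion_unique_complex) (rule poly_has_fps_expansion)
have dh: "deriv ?h z = poly (pderiv p - smult (2 * c) (pCons 0 p)) z * exp (- c * z\<^sup>2)" for z
proof -
have "(?h has_field_derivative poly (pderiv p - smult (2 * c) (pCons 0 p)) z * exp (- c * z\<^sup>2)) (at z)"
 unfolding pc[abs_def] by (auto intro!: derivative_eq_intros simp: algebra_simps)
thus ?thesis by (rule DERIV_imp_deriv)
qed
have "(%z. deriv ?h z * ?h (\<i> * z)) has_fps_expansion fps_deriv F * rotate_fps F"
by (intro has_fps_expansion_mult has_fps_expansion_deriv E(3) E'(3))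
moreover have "deriv ?h z * ?h (\<i> * z) = poly ((pderiv p - smult (2 * c) (pCons 0 p)) * pi) z" for z
unfolding ri dh poly_mult using ee[of z] by (simp only: mult_ac) simp
ultimately have "(%z. poly ((pderiv p - smult (2 * c) (pCons 0 p)) * pi) z) has_fps_expansion fps_deriv F * rotate_fps F" by (simp only:)
hence eqT: "fps_deriv F * rotate_fps F = fps_of_poly ((pderiv p - smult (2 * c) (pCons 0 p)) * pi)"
by (rule fps_expansion_unique_complex) (rule poly_has_fps_expansion)
have pinz: "pi ~= 0" unfolding pi_def using pnz by (simp add: pcompose_eq_0_iff)
have "degree (p * pi) = D"
proof (rule antisym)
show "degree (p * pi) <= D" using van by (intro degree_le) (auto simp: eqE)
show "D <= degree (p * pi)" using nz by (intro le_degree) (auto simp: eqE)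
qed
hence deg: "degree p + degree pi = D" using pnz pinz by (simp add: degree_mult_eq)
have "degree (pderiv p * pi) < Suc D"
using degree_mult_le[of "pderiv p" pi] deg by (simp add: degree_pderiv)
hence 0: "coeff (pderiv p * pi) (Suc D) = 0" by (rule coeff_eq_0)
have "fps_nth (fps_deriv F * rotate_fps F) (Suc D) = - 2 * c * fps_nth (F * rotate_fps F) D"
unfolding eqT eqE fps_of_poly_nth left_diff_distrib coeff_diff 0 by simp
thus ?thesis using pnz pc cb deg by (intro exI[of _ p] exI[of _ c]) auto
qed

lemma poly_ineq_everywhere:
fixes T E :: "complex poly"
assumes "finite S" "!!t. t \<notin> S ==> norm (poly T t) <= (\<alpha> + norm t * \<beta>)\<^sup>2 * norm (poly E t)"
shows "norm (poly T t) <= (\<alpha> + norm t * \<beta>)\<^sup>2 * norm (poly E t)"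
proof -
have "closed {t. norm (poly T t) <= (\<alpha> + norm t * \<beta>)\<^sup>2 * norm (poly E t)}"
by (intro closed_Collect_le continuous_intros)
moreover have "- S \<subseteq> {t. norm (poly T t) <= (\<alpha> + norm t * \<beta>)\<^sup>2 * norm (poly E t)}" using assms(2) by auto
ultimately have "closure (- S) \<subseteq> {t. norm (poly T t) <= (\<alpha> + norm t * \<beta>)\<^sup>2 * norm (poly E t)}" by (rule closure_minimal[rotated])
moreover have "closure (- S) = UNIV" unfolding closure_complement using empty_interior_finite[OF assms(1)] by simp
ultimately show ?thesis by blast
qed

text \<open>A root of \<open>E\<close> is a root of \<open>T\<close> and both can be divided by it; for constant \<open>E\<close> the estimate is that of Liouville's theorem.\<close>
lemma poly_quadratic_quotient:
fixes T E :: "complex poly"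
assumes "E ~= 0" "!!t. norm (poly T t) <= (\<alpha> + norm t * \<beta>)\<^sup>2 * norm (poly E t)" "\<alpha> >= 0" "\<beta> >= 0"
shows "\<exists>s. T = s * E \<and> degree s <= 2"
using assms(1,2)
proof (induction "degree E" arbitrary: T E rule: less_induct)
case (less E T)
show ?case
proof (cases "\<exists>r. poly E r = 0")
case True
then obtain r where r: "poly E r = 0" by blast
have "poly T r = 0" using less.prems(2)[of r] r by simp
then obtain T' where T': "T = [:- r, 1:] * T'" by (auto simp: poly_eq_0_iff_dvd)
obtain E' where E': "E = [:- r, 1:] * E'" using r by (auto simp: poly_eq_0_iff_dvd)
have E'nz: "E' ~= 0" using less.prems(1) E' by auto
have "degree E = 1 + degree E'" unfolding E' using E'nz by (subst degree_mult_eq) auto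
hence d: "degree E' < degree E" by simp
have "norm (poly T' t) <= (\<alpha> + norm t * \<beta>)\<^sup>2 * norm (poly E' t)" for t
proof (rule poly_ineq_everywhere[of "{r}"])
 fix t assume "t \<notin> {r}"
 hence pos: "norm (t - r) > 0" by simp
 have "norm (t - r) * norm (poly T' t) <= norm (t - r) * ((\<alpha> + norm t * \<beta>)\<^sup>2 * norm (poly E' t))"
 using less.prems(2)[of t] unfolding T' E' poly_mult norm_mult by (simp add: mult_ac)
 thus "norm (poly T' t) <= (\<alpha> + norm t * \<beta>)\<^sup>2 * norm (poly E' t)" using pos by (rule mult_left_le_imp_le)
qed simp
from less.hyps[OF d E'nz this] obtain s where s: "T' = s * E'" "degree s <= 2" by blast
have "T = s * E" by (subst T', subst s(1), subst E') (rule mult.left_commute)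
thus ?thesis using s(2) by blast
next
case False
hence "constant (poly E)" using Fundamental_Theorem_Algebra.fundamental_theorem_of_algebra[of E] by blast
hence "degree E = 0" by (simp add: constant_degree)
then obtain e where e: "E = [:e:]" by (rule degree_eq_zeroE)
have enz: "e ~= 0" using less.prems(1) e by auto
have bd: "norm (poly T t) <= ((\<alpha> + \<beta>)\<^sup>2 * norm e) * norm t ^ 2" if "1 <= norm t" for t
proof -
 have "\<alpha> + norm t * \<beta> <= (\<alpha> + \<beta>) * norm t" using mult_left_mono[OF that assms(3)] by (simp add: algebra_simps)
 hence "(\<alpha> + norm t * \<beta>)\<^sup>2 <= ((\<alpha> + \<beta>) * norm t)\<^sup>2" using assms(3,4) by (intro power_mono) auto
 hence "(\<alpha> + norm t * \<beta>)\<^sup>2 * norm e <= ((\<alpha> + \<beta>) * norm t)\<^sup>2 * norm e" by (intro mult_right_mono) auto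
 thus ?thesis using less.prems(2)[of t] by (simp add: e power_mult_distrib mult_ac)
qed
have hT: "poly T holomorphic_on UNIV"
 unfolding holomorphic_on_def field_differentiable_def using poly_DERIV has_field_derivative_at_within by blast
have "poly T t = poly (\<Sum>k\<le>2. monom ((deriv ^^ k) (poly T) 0 / fact k) k) t" for t
proof -
 have "poly T t = (\<Sum>k\<le>2. (deriv ^^ k) (poly T) 0 / fact k * t ^ k)" by (rule Liouville_polynomial[OF hT bd])
 thus ?thesis by (simp add: poly_sum poly_monom)
qed
hence "T = (\<Sum>k\<le>2. monom ((deriv ^^ k) (poly T) 0 / fact k) k)" by (simp add: poly_eq_poly_eq_iff[symmetric] fun_eq_iff)
moreover have "degree (\<Sum>k\<le>2. monom ((deriv ^^ k) (poly T) 0 / fact k) k) <= 2"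
 by (intro degree_sum_le) (auto intro: order_trans[OF degree_monom_le])
ultimately have "degree T <= 2" by simp
thus ?thesis using enz e by (intro exI[of _ "smult (1 / e) T"]) (auto intro: order_trans[OF degree_smult_le])
qed
qed

section \<open>Dependence on the direction\<close>

lemma linear_cmult: "linear f ==> linear (%b. c * f b :: complex)"
by (intro linearI) (simp_all add: linear_add linear_scale distrib_left)

lemma bilinear_cmult: "bilinear B ==> bilinear (%x y. c * B x y :: complex)"
unfolding bilinear_def by (auto intro: linear_cmult)

lemma bilinear_add: "bilinear B ==> bilinear B' ==> bilinear (%x y. B x y + B' x y :: complex)"
unfolding bilinear_def by (auto intro: linear_compose_add)

lemma bilinear_linear_mult:
fixes f g :: "real ^ 'n::finite => complex"
assumes "linear f" "linear g"
shows "bilinear (%x y. f x * g y)"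
proof -
have "linear (%x. f x * g y)" for y using linear_cmult[OF assms(1), of "g y"] by (simp add: mult.commute)
thus ?thesis unfolding bilinear_def using linear_cmult[OF assms(2)] by auto
qed

lemma linear_zero_fun: "linear (%b :: real ^ 'n::finite. 0 :: complex)"
by (intro linearI) auto

lemma bilinear_zero_fun: "bilinear (%(b :: real ^ 'n::finite) (b' :: real ^ 'n). 0 :: complex)"
unfolding bilinear_def by (auto intro: linear_zero_fun)

text \<open>Dependence on \<open>b\<close> of the coefficients of degrees 0, 1 and 2: constant, linear, quadratic. This is what homogeneity in \<open>t b\<close> gives, and it survives sums and products.\<close>
definition jet :: "(real ^ 'n::finite => complex poly) => bool" where
"jet P \<longleftrightarrow> (\<exists>c. \<forall>b. coeff (P b) 0 = c) \<and> linear (%b. coeff (P b) 1) \<and> (\<exists>B. bilinear B \<and> (\<forall>b. coeff (P b) 2 = B b b))"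

lemma jet_zero: "jet (%b. 0)"
unfolding jet_def by (auto intro: linear_zero_fun bilinear_zero_fun)

lemma jet_smult:
assumes "jet P" shows "jet (%b. smult r (P b))"
proof -
obtain c B where *: "!!b. coeff (P b) 0 = c" "linear (%b. coeff (P b) 1)" "bilinear B" "!!b. coeff (P b) 2 = B b b"
using assms unfolding jet_def by auto
show ?thesis unfolding jet_def coeff_smult
by (intro conjI linear_cmult *(2) exI[of _ "r * c"] exI[of _ "%x y. r * B x y"] bilinear_cmult *(3)) (simp_all add: *(1,4))
qed

lemma jet_add:
assumes "jet P" "jet Q" shows "jet (%b. P b + Q b)"
proof -
obtain c B where P: "!!b. coeff (P b) 0 = c" "linear (%b. coeff (P b) 1)" "bilinear B" "!!b. coeff (P b) 2 = B b b"
using assms(1) unfolding jet_def by auto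
obtain c' B' where Q: "!!b. coeff (Q b) 0 = c'" "linear (%b. coeff (Q b) 1)" "bilinear B'" "!!b. coeff (Q b) 2 = B' b b"
using assms(2) unfolding jet_def by auto
show ?thesis unfolding jet_def coeff_add
by (intro conjI linear_compose_add P(2) Q(2) exI[of _ "c + c'"] exI[of _ "%x y. B x y + B' x y"] bilinear_add P(3) Q(3))
 (simp_all add: P(1,4) Q(1,4))
qed

lemma jet_mult:
assumes "jet P" "jet Q" shows "jet (%b. P b * Q b)"
proof -
obtain c B where P: "!!b. coeff (P b) 0 = c" "linear (%b. coeff (P b) 1)" "bilinear B" "!!b. coeff (P b) 2 = B b b"
using assms(1) unfolding jet_def by auto
obtain c' B' where Q: "!!b. coeff (Q b) 0 = c'" "linear (%b. coeff (Q b) 1)" "bilinear B'" "!!b. coeff (Q b) 2 = B' b b"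
using assms(2) unfolding jet_def by auto
have 0: "coeff (P b * Q b) 0 = c * c'" for b by (simp add: coeff_mult P(1) Q(1))
have 1: "coeff (P b * Q b) 1 = c * coeff (Q b) 1 + c' * coeff (P b) 1" for b
by (simp add: coeff_mult P(1) Q(1))
have 2: "coeff (P b * Q b) 2 = (c * B' b b + coeff (P b) 1 * coeff (Q b) 1) + c' * B b b" for b
proof -
have "coeff (P b * Q b) 2 = coeff (P b) 0 * coeff (Q b) 2 + coeff (P b) 1 * coeff (Q b) 1 + coeff (P b) 2 * coeff (Q b) 0"
 unfolding coeff_mult by (simp add: numeral_2_eq_2)
thus ?thesis by (simp add: P(1,4) Q(1,4))
qed
show ?thesis unfolding jet_def
proof (intro conjI)
show "\<exists>d. \<forall>b. coeff (P b * Q b) 0 = d" using 0 by blast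
show "linear (%b. coeff (P b * Q b) 1)" unfolding 1 by (intro linear_compose_add linear_cmult P(2) Q(2))
show "\<exists>D. bilinear D \<and> (\<forall>b. coeff (P b * Q b) 2 = D b b)"
 by (rule exI[of _ "%x y. (c * B' x y + coeff (P x) 1 * coeff (Q y) 1) + c' * B x y"])
 (intro conjI allI 2 bilinear_add bilinear_cmult bilinear_linear_mult P(2,3) Q(2,3))
qed
qed

lemma jet_sum: "(!!i. i \<in> I ==> jet (P i)) ==> jet (%b. \<Sum>i\<in>I. P i b)"
by (induction I rule: infinite_finite_induct) (auto intro: jet_zero jet_add)

definition line_coef :: "(real ^ 'n::finite => complex) => real ^ 'n => nat => real ^ 'n => complex poly" where
"line_coef \<phi> a k b = (\<Sum>m\<le>k. monom (\<i> ^ k / fact k * of_nat (k choose m) *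
(LINT y|lborel. \<phi> y * cplx (a \<bullet> y) ^ (k - m) * cplx (b \<bullet> y) ^ m)) m)"

lemma line_coef_poly:
assumes "exp_integrable \<phi>"
shows "poly (line_coef \<phi> a k b) t = tcoef \<phi> (ldir a b t) k"
proof -
have i: "integrable lborel (%y. (\<i> ^ k / fact k * of_nat (k choose m) * t ^ m) * (\<phi> y * cplx (a \<bullet> y) ^ (k - m) * cplx (b \<bullet> y) ^ m))" for m
by (intro integrable_mult_right exp_integrable_imp_integrable exp_integrable_times_power assms)
have e: "\<phi> y * ldir a b t y ^ k / fact k = (\<Sum>m\<le>k. (\<i> ^ k / fact k * of_nat (k choose m) * t ^ m) * (\<phi> y * cplx (a \<bullet> y) ^ (k - m) * cplx (b \<bullet> y) ^ m))" for y
proof -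
have "ldir a b t y ^ k = \<i> ^ k * (\<Sum>m\<le>k. of_nat (k choose m) * (t * cplx (b \<bullet> y)) ^ m * cplx (a \<bullet> y) ^ (k - m))"
 unfolding ldir_def power_mult_distrib[of \<i>] binomial_ring ..
hence "\<phi> y * ldir a b t y ^ k / fact k = (\<phi> y * \<i> ^ k / fact k) * (\<Sum>m\<le>k. of_nat (k choose m) * (t * cplx (b \<bullet> y)) ^ m * cplx (a \<bullet> y) ^ (k - m))"
 by simp
thus ?thesis by (simp add: sum_distrib_left power_mult_distrib mult_ac)
qed
have "tcoef \<phi> (ldir a b t) k = (\<Sum>m\<le>k. LINT y|lborel. (\<i> ^ k / fact k * of_nat (k choose m) * t ^ m) * (\<phi> y * cplx (a \<bullet> y) ^ (k - m) * cplx (b \<bullet> y) ^ m))"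
unfolding tcoef_def e by (rule Bochner_Integration.integral_sum[OF i])
also have "... = (\<Sum>m\<le>k. (\<i> ^ k / fact k * of_nat (k choose m) * t ^ m) * (LINT y|lborel. \<phi> y * cplx (a \<bullet> y) ^ (k - m) * cplx (b \<bullet> y) ^ m))"
by (simp only: integral_mult_right_zero)
finally show ?thesis unfolding line_coef_def poly_sum poly_monom by (simp only: mult_ac)
qed

lemma line_coef_coeff:
"coeff (line_coef \<phi> a k b) m = (if m <= k then \<i> ^ k / fact k * of_nat (k choose m) *
(LINT y|lborel. \<phi> y * cplx (a \<bullet> y) ^ (k - m) * cplx (b \<bullet> y) ^ m) else 0)"
unfolding line_coef_def by (auto simp: coeff_sum)

lemma line_coef_degree: "degree (line_coef \<phi> a k b) <= k"
by (intro degree_le) (auto simp: line_coef_coeff)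

lemma tcoef_real: "tcoef \<phi> (ldir b 0 0) k = \<i> ^ k / fact k * (LINT y|lborel. \<phi> y * cplx (b \<bullet> y) ^ k)"
proof -
have "tcoef \<phi> (ldir b 0 0) k = (LINT y|lborel. (\<i> ^ k / fact k) * (\<phi> y * cplx (b \<bullet> y) ^ k))"
unfolding tcoef_def ldir_def by (intro Bochner_Integration.integral_cong) (simp_all add: power_mult_distrib mult_ac)
thus ?thesis by simp
qed

lemma line_coef_top: "coeff (line_coef \<phi> a k b) k = tcoef \<phi> (ldir b 0 0) k"
unfolding line_coef_coeff tcoef_real by simp

lemma jet_line_coef:
assumes \<phi>: "exp_integrable \<phi>"
shows "jet (line_coef \<phi> a k)"
proof -
have 1: "linear (%b. coeff (line_coef \<phi> a k b) 1)"
proof (cases "1 <= k")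
case True
have "linear (%b. \<i> ^ k / fact k * of_nat (k choose 1) * (LINT y|lborel. (\<phi> y * cplx (a \<bullet> y) ^ (k - 1)) * cplx (b \<bullet> y)))"
 by (intro linear_cmult linear_times_integral exp_integrable_times_power \<phi>)
thus ?thesis unfolding line_coef_coeff using True by simp
next
case False
thus ?thesis unfolding line_coef_coeff by (simp add: linear_zero_fun)
qed
have 2: "\<exists>B. bilinear B \<and> (\<forall>b. coeff (line_coef \<phi> a k b) 2 = B b b)"
proof (cases "2 <= k")
case True
define \<psi> where "\<psi> y = \<phi> y * cplx (a \<bullet> y) ^ (k - 2)" for y
have \<psi>: "exp_integrable \<psi>" unfolding \<psi>_def[abs_def] by (intro exp_integrable_times_power \<phi>)
define B where "B x z = \<i> ^ k / fact k * of_nat (k choose 2) * (LINT y|lborel. \<psi> y * cplx (x \<bullet> y) * cplx (z \<bullet> y))" for x z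
have l1: "linear (B x)" for x unfolding B_def[abs_def] by (intro linear_cmult linear_times_integral exp_integrable_times_linear \<psi>)
have sym: "B x z = B z x" for x z unfolding B_def by (simp add: mult_ac)
have "linear (%x. B x z)" for z unfolding sym[of _ z] by (rule l1)
hence "bilinear B" unfolding bilinear_def using l1 by auto
moreover have "coeff (line_coef \<phi> a k b) 2 = B b b" for b
 unfolding line_coef_coeff B_def \<psi>_def using True by (simp add: power2_eq_square mult_ac)
ultimately show ?thesis by blast
next
case False
thus ?thesis unfolding line_coef_coeff by (intro exI[of _ "%_ _. 0"]) (simp add: bilinear_zero_fun)
qed
show ?thesis unfolding jet_def using 1 2 by (simp add: line_coef_coeff)
qed

text \<open>Taylor coefficient of \<open>h z * h (i z)\<close>.\<close>
definition ecoef :: "(real ^ 'n::finite => complex) => (real ^ 'n => complex) => nat => complex" where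
"ecoef \<phi> l j = fps_nth (hfps \<phi> l * rotate_fps (hfps \<phi> l)) j"

text \<open>Taylor coefficient of \<open>h' z * h (i z)\<close>.\<close>
definition dcoef :: "(real ^ 'n::finite => complex) => (real ^ 'n => complex) => nat => complex" where
"dcoef \<phi> l j = fps_nth (fps_deriv (hfps \<phi> l) * rotate_fps (hfps \<phi> l)) j"

lemma ecoef_sum: "ecoef \<phi> l j = (\<Sum>i\<le>j. \<i> ^ (j - i) * (tcoef \<phi> l i * tcoef \<phi> l (j - i)))"
unfolding ecoef_def fps_mult_nth atMost_atLeast0 by (simp add: hfps_def rotate_fps_def mult_ac)

lemma dcoef_sum: "dcoef \<phi> l j = (\<Sum>i\<le>j. (of_nat (Suc i) * \<i> ^ (j - i)) * (tcoef \<phi> l (Suc i) * tcoef \<phi> l (j - i)))"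
unfolding dcoef_def fps_mult_nth atMost_atLeast0 by (simp add: hfps_def rotate_fps_def mult_ac)

definition line_E :: "(real ^ 'n::finite => complex) => real ^ 'n => nat => real ^ 'n => complex poly" where
"line_E \<phi> a j b = (\<Sum>i\<le>j. smult (\<i> ^ (j - i)) (line_coef \<phi> a i b * line_coef \<phi> a (j - i) b))"

definition line_T :: "(real ^ 'n::finite => complex) => real ^ 'n => nat => real ^ 'n => complex poly" where
"line_T \<phi> a j b = (\<Sum>i\<le>j. smult (of_nat (Suc i) * \<i> ^ (j - i)) (line_coef \<phi> a (Suc i) b * line_coef \<phi> a (j - i) b))"

lemma line_E_poly: "exp_integrable \<phi> ==> poly (line_E \<phi> a j b) t = ecoef \<phi> (ldir a b t) j"
unfolding line_E_def ecoef_sum by (simp add: poly_sum line_coef_poly)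

lemma line_T_poly: "exp_integrable \<phi> ==> poly (line_T \<phi> a j b) t = dcoef \<phi> (ldir a b t) j"
unfolding line_T_def dcoef_sum by (simp add: poly_sum line_coef_poly)

lemma line_E_degree: "degree (line_E \<phi> a j b) <= j"
unfolding line_E_def
proof (intro degree_sum_le)
fix i assume "i \<in> {..j}"
thus "degree (smult (\<i> ^ (j - i)) (line_coef \<phi> a i b * line_coef \<phi> a (j - i) b)) <= j"
using degree_smult_le[of "\<i> ^ (j - i)" "line_coef \<phi> a i b * line_coef \<phi> a (j - i) b"]
 degree_mult_le[of "line_coef \<phi> a i b" "line_coef \<phi> a (j - i) b"] line_coef_degree[of \<phi> a i b] line_coef_degree[of \<phi> a "j - i" b]
by simp
qed simp

text \<open>The leading coefficient in \<open>t\<close> is the value at the direction \<open>b\<close>: only the direction at infinity of the line remains.\<close>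
lemma line_E_top: "coeff (line_E \<phi> a j b) j = ecoef \<phi> (ldir b 0 0) j"
unfolding line_E_def ecoef_sum coeff_sum coeff_smult
proof (intro sum.cong refl)
fix i assume "i \<in> {..j}"
hence "coeff (line_coef \<phi> a i b * line_coef \<phi> a (j - i) b) (i + (j - i)) = tcoef \<phi> (ldir b 0 0) i * tcoef \<phi> (ldir b 0 0) (j - i)"
unfolding line_coef_top[symmetric, where a = a] by (intro coeff_top_mult line_coef_degree)
thus "\<i> ^ (j - i) * coeff (line_coef \<phi> a i b * line_coef \<phi> a (j - i) b) j = \<i> ^ (j - i) * (tcoef \<phi> (ldir b 0 0) i * tcoef \<phi> (ldir b 0 0) (j - i))"
using \<open>i \<in> {..j}\<close> by simp
qed

lemma line_T_top: "coeff (line_T \<phi> a j b) (Suc j) = dcoef \<phi> (ldir b 0 0) j"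
unfolding line_T_def dcoef_sum coeff_sum coeff_smult
proof (intro sum.cong refl)
fix i assume "i \<in> {..j}"
hence "coeff (line_coef \<phi> a (Suc i) b * line_coef \<phi> a (j - i) b) (Suc i + (j - i)) = tcoef \<phi> (ldir b 0 0) (Suc i) * tcoef \<phi> (ldir b 0 0) (j - i)"
unfolding line_coef_top[symmetric, where a = a] by (intro coeff_top_mult line_coef_degree)
thus "(of_nat (Suc i) * \<i> ^ (j - i)) * coeff (line_coef \<phi> a (Suc i) b * line_coef \<phi> a (j - i) b) (Suc j) = (of_nat (Suc i) * \<i> ^ (j - i)) * (tcoef \<phi> (ldir b 0 0) (Suc i) * tcoef \<phi> (ldir b 0 0) (j - i))"
using \<open>i \<in> {..j}\<close> by simp
qed

lemma jet_line_E: "exp_integrable \<phi> ==> jet (line_E \<phi> a j)"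
unfolding line_E_def[abs_def] by (intro jet_sum jet_smult jet_mult jet_line_coef)

lemma jet_line_T: "exp_integrable \<phi> ==> jet (line_T \<phi> a j)"
unfolding line_T_def[abs_def] by (intro jet_sum jet_smult jet_mult jet_line_coef)

lemma polyfun_tcoef: "exp_integrable \<phi> ==> polyfun k (%b. tcoef \<phi> (ldir b 0 0) k)"
unfolding tcoef_real by (intro polyfun_cmult polyfun_moment)

lemma polyfun_ecoef:
assumes "exp_integrable \<phi>" shows "polyfun j (%b. ecoef \<phi> (ldir b 0 0) j)"
unfolding ecoef_sum
proof (intro polyfun_sum polyfun_cmult)
fix i assume "i \<in> {..j}"
thus "polyfun j (%b. tcoef \<phi> (ldir b 0 0) i * tcoef \<phi> (ldir b 0 0) (j - i))"
using polyfun_mult[OF polyfun_tcoef polyfun_tcoef, OF assms assms, of i "j - i"] by simp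
qed

lemma polyfun_continuous: "polyfun d F ==> continuous_on UNIV F"
unfolding polyfun_def using cpoly_eval_continuous by (metis ext)

lemma bilinear_diagonal_matrix:
fixes S :: "real ^ 'n::finite => real ^ 'n => complex"
assumes "bilinear S"
shows "\<exists>M :: complex ^ 'n ^ 'n. \<forall>b. S b b = (\<Sum>i\<in>UNIV. \<Sum>j\<in>UNIV. M $ i $ j * cplx (b $ i) * cplx (b $ j))"
proof (intro exI allI)
fix b :: "real^'n"
have l: "linear (S x)" "linear (%x. S x y)" for x y using assms unfolding bilinear_def by auto
have lin: "f b = (\<Sum>i\<in>UNIV. (b $ i) *\<^sub>R f (axis i 1))" if "linear f" for f :: "real^'n => complex"
proof -
have "f b = f (\<Sum>i\<in>UNIV. (b $ i) *\<^sub>R axis i 1)" using basis_expansion[of b] by (simp add: scalar_mult_eq_scaleR)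
thus ?thesis using that by (simp add: linear_sum linear_scale)
qed
have "S b b = (\<Sum>i\<in>UNIV. (b $ i) *\<^sub>R S (axis i 1) b)" by (rule lin[OF l(2)])
also have "... = (\<Sum>i\<in>UNIV. (b $ i) *\<^sub>R (\<Sum>j\<in>UNIV. (b $ j) *\<^sub>R S (axis i 1) (axis j 1)))"
by (intro sum.cong refl arg_cong2[where f = scaleR] lin l(1))
finally show "S b b = (\<Sum>i\<in>UNIV. \<Sum>j\<in>UNIV. (\<chi> i j. S (axis i 1) (axis j 1)) $ i $ j * cplx (b $ i) * cplx (b $ j))"
by (simp add: scaleR_conv_of_real sum_distrib_left mult_ac)
qed

lemma symmetric_matrix_of_form:
fixes M :: "complex ^ 'n ^ 'n::finite"
obtains A :: "real ^ 'n ^ 'n" where "transpose A = A"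
"!!b. quad A b = Re (\<Sum>i\<in>UNIV. \<Sum>j\<in>UNIV. M $ i $ j * cplx (b $ i) * cplx (b $ j))"
proof -
define A :: "real^'n^'n" where "A = (\<chi> i j. (Re (M $ i $ j) + Re (M $ j $ i)) / 2)"
have "transpose A = A" by (simp add: A_def transpose_def vec_eq_iff add.commute)
moreover have "quad A b = Re (\<Sum>i\<in>UNIV. \<Sum>j\<in>UNIV. M $ i $ j * cplx (b $ i) * cplx (b $ j))" for b
proof -
let ?S = "\<Sum>i\<in>UNIV. \<Sum>j\<in>UNIV. Re (M $ i $ j) * (b $ i) * (b $ j)"
have "quad A b = (\<Sum>i\<in>UNIV. \<Sum>j\<in>UNIV. Re (M $ i $ j) * (b $ i) * (b $ j) / 2 + Re (M $ j $ i) * (b $ i) * (b $ j) / 2)"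
 by (simp add: quad_def inner_vec_def matrix_vector_mult_def A_def sum_distrib_left sum_distrib_right add_divide_distrib algebra_simps)
also have "... = ?S / 2 + (\<Sum>i\<in>UNIV. \<Sum>j\<in>UNIV. Re (M $ j $ i) * (b $ i) * (b $ j)) / 2"
 by (simp add: sum.distrib sum_divide_distrib)
also have "(\<Sum>i\<in>UNIV. \<Sum>j\<in>UNIV. Re (M $ j $ i) * (b $ i) * (b $ j)) = ?S"
 by (subst sum.swap) (simp add: mult_ac)
finally show ?thesis by simp
qed
ultimately show ?thesis by (rule that)
qed

lemma AE_meets_open:
fixes U :: "'a::euclidean_space set"
assumes "AE x in lborel. P x" "open U" "U ~= {}"
shows "\<exists>x\<in>U. P x"
proof (rule ccontr)
assume "\<not> (\<exists>x\<in>U. P x)"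
hence sub: "U \<subseteq> {x. \<not> P x}" by blast
obtain N where N: "{x\<in>space lborel. \<not> P x} \<subseteq> N" "N \<in> null_sets lborel"
using assms(1) unfolding eventually_ae_filter by blast
have "U \<subseteq> N" using sub N(1) by auto
hence "U \<in> null_sets lborel" using N(2) assms(2) by (intro null_sets_subset[OF N(2)]) auto
hence "negligible U" by (simp add: negligible_iff_null_sets null_sets_completionI)
thus False using open_not_negligible[OF assms(2,3)] by blast
qed

section \<open>Rigidity of the smoothed function\<close>

lemma exp_integrable_abs_linear:
assumes "exp_integrable \<phi>"
shows "integrable lborel (%y. norm (\<phi> y) * exp (s * \<bar>\<omega> \<bullet> y\<bar>))"
and "(LINT y|lborel. norm (\<phi> y) * exp (s * \<bar>\<omega> \<bullet> y\<bar>)) <= (LINT y|lborel. norm (\<phi> y) * exp ((\<bar>s\<bar> * norm \<omega>) * norm y))"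
proof -
have [measurable]: "\<phi> \<in> borel_measurable borel" by (rule exp_integrable_measurable[OF assms])
have i: "integrable lborel (%y. norm (\<phi> y) * exp ((\<bar>s\<bar> * norm \<omega>) * norm y))" using assms unfolding exp_integrable_def by blast
have b: "norm (\<phi> y) * exp (s * \<bar>\<omega> \<bullet> y\<bar>) <= norm (\<phi> y) * exp ((\<bar>s\<bar> * norm \<omega>) * norm y)" for y
proof -
have "s * \<bar>\<omega> \<bullet> y\<bar> <= \<bar>s\<bar> * \<bar>\<omega> \<bullet> y\<bar>" by (intro mult_right_mono) auto
also have "... <= \<bar>s\<bar> * (norm \<omega> * norm y)" by (intro mult_left_mono Cauchy_Schwarz_ineq2) auto
finally show ?thesis by (intro mult_left_mono) (auto simp: mult.assoc)
qed
show 1: "integrable lborel (%y. norm (\<phi> y) * exp (s * \<bar>\<omega> \<bullet> y\<bar>))"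
by (rule Bochner_Integration.integrable_bound[OF i]) (measurable, use b in \<open>auto intro!: AE_I2\<close>)
show "(LINT y|lborel. norm (\<phi> y) * exp (s * \<bar>\<omega> \<bullet> y\<bar>)) <= (LINT y|lborel. norm (\<phi> y) * exp ((\<bar>s\<bar> * norm \<omega>) * norm y))"
by (rule integral_mono[OF 1 i b])
qed

text \<open>The restriction to the line satisfies the hypotheses of the one-dimensional theorems.\<close>
lemma good_direction:
fixes \<phi> :: "real ^ 'n::finite => complex"
assumes \<phi>: "exp_integrable \<phi>"
and gr: "!!\<rho>. \<rho> >= 0 ==> (LINT y|lborel. norm (\<phi> y) * exp (\<rho> * norm y)) <= A * exp (\<rho>\<^sup>2 / 2)"
and g: "!!x. g x = (LINT y|lborel. \<phi> y * exp (\<i> * cplx (x \<bullet> y)))"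
and Gf: "!!x. Gf x = (LINT y|lborel. norm (\<phi> y) * exp \<bar>x \<bullet> y\<bar>)"
and ray: "\<exists>C\<ge>0. \<forall>R\<ge>0. (\<integral>\<^sup>+(s::real). ennreal ((norm (g (s *\<^sub>R \<omega>)) + norm (g (- (s *\<^sub>R \<omega>)))) * Gf (s *\<^sub>R \<omega>)) * indicator {0..R} s \<partial>lborel) <= ennreal (C * (1 + R) ^ L)"
shows "!!j. j > L ==> ecoef \<phi> (ldir \<omega> 0 0) j = 0"
and "!!p c. p ~= 0 ==> (!!z. hdir \<phi> (ldir \<omega> 0 0) z = poly p z * exp (- c * z\<^sup>2)) ==> Im c = 0"
proof -
let ?h = "hdir \<phi> (ldir \<omega> 0 0)"
have [measurable]: "\<phi> \<in> borel_measurable borel" by (rule exp_integrable_measurable[OF \<phi>])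
define G where "G s = (LINT y|lborel. norm (\<phi> y) * exp (s * \<bar>\<omega> \<bullet> y\<bar>))" for s
have G0: "G s >= 0" for s unfolding G_def by (intro Bochner_Integration.integral_nonneg) auto
note ser = hdir_expansion(1)[OF \<phi>, of \<omega> 0 0]
note E = entire_series[OF ser, folded hfps_def]
note E' = entire_series[OF rotate_series[OF ser]]
have hg: "?h (cplx s) = g (s *\<^sub>R \<omega>)" for s
unfolding hdir_def g ldir_def by (intro Bochner_Integration.integral_cong refl) (simp add: mult_ac)
have hg': "?h (cplx (- s)) = g (- (s *\<^sub>R \<omega>))" for s using hg[of "- s"] by simp
have Gs: "G s = Gf (s *\<^sub>R \<omega>)" if "s >= 0" for s
unfolding G_def Gf using that by (simp add: abs_mult)
have hG: "norm (?h z) <= G \<bar>Im z\<bar>" for z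
proof -
have "norm (?h z) <= (LINT y|lborel. norm (\<phi> y * exp (z * ldir \<omega> 0 0 y)))" unfolding hdir_def by (rule integral_norm_bound)
also have "... <= G \<bar>Im z\<bar>" unfolding G_def
proof (rule integral_mono)
 show "integrable lborel (%y. norm (\<phi> y * exp (z * ldir \<omega> 0 0 y)))" by (intro integrable_norm hdir_expansion(3) \<phi>)
 show "integrable lborel (%y. norm (\<phi> y) * exp (\<bar>Im z\<bar> * \<bar>\<omega> \<bullet> y\<bar>))" by (rule exp_integrable_abs_linear[OF \<phi>])
 fix y :: "real^'n"
 have "Re (z * ldir \<omega> 0 0 y) = - (Im z * (\<omega> \<bullet> y))" by (simp add: ldir_def)
 also have "... <= \<bar>Im z * (\<omega> \<bullet> y)\<bar>" by linarith
 finally have "Re (z * ldir \<omega> 0 0 y) <= \<bar>Im z\<bar> * \<bar>\<omega> \<bullet> y\<bar>" by (simp only: abs_mult)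
 thus "norm (\<phi> y * exp (z * ldir \<omega> 0 0 y)) <= norm (\<phi> y) * exp (\<bar>Im z\<bar> * \<bar>\<omega> \<bullet> y\<bar>)"
 unfolding norm_mult norm_exp_eq_Re by (intro mult_left_mono) auto
qed
finally show ?thesis .
qed
have mono: "G s <= G t" if "0 <= s" "s <= t" for s t
unfolding G_def using that
by (intro integral_mono exp_integrable_abs_linear(1)[OF \<phi>] mult_left_mono) (auto intro: mult_right_mono)
have A: "A >= 0"
proof -
have "0 <= (LINT y|lborel. norm (\<phi> y) * exp (0 * norm y))" by (intro Bochner_Integration.integral_nonneg) auto
also have "... <= A" using gr[of 0] by simp
finally show ?thesis .
qed
have growth: "norm (?h z) <= A * exp (((norm \<omega>)\<^sup>2 / 2) * (norm z)\<^sup>2)" for z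
proof -
have "norm (?h z) <= G \<bar>Im z\<bar>" by (rule hG)
also have "... <= G (norm z)" by (intro mono abs_Im_le_cmod) auto
also have "... <= (LINT y|lborel. norm (\<phi> y) * exp ((\<bar>norm z\<bar> * norm \<omega>) * norm y))"
 unfolding G_def by (rule exp_integrable_abs_linear(2)[OF \<phi>])
also have "... <= A * exp ((\<bar>norm z\<bar> * norm \<omega>)\<^sup>2 / 2)" by (rule gr) simp
finally show ?thesis by (simp add: power_mult_distrib mult.commute)
qed
obtain C where C: "C >= 0" and bd: "!!R. R >= 0 ==> (\<integral>\<^sup>+(s::real). ennreal ((norm (g (s *\<^sub>R \<omega>)) + norm (g (- (s *\<^sub>R \<omega>)))) * Gf (s *\<^sub>R \<omega>)) * indicator {0..R} s \<partial>lborel) <= ennreal (C * (1 + R) ^ L)"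
using ray by blast
have int1: "(\<integral>\<^sup>+s. ennreal (norm (?h (cplx s)) * G s) * indicator {0..R} s \<partial>lborel) <= ennreal (C * (1 + R) ^ L)" if "R >= 0" for R
proof (rule order_trans[OF nn_integral_mono bd[OF that]])
fix s :: real
show "ennreal (norm (?h (cplx s)) * G s) * indicator {0..R} s <= ennreal ((norm (g (s *\<^sub>R \<omega>)) + norm (g (- (s *\<^sub>R \<omega>)))) * Gf (s *\<^sub>R \<omega>)) * indicator {0..R} s"
 using G0[of s] Gs[of s] unfolding hg by (auto simp: indicator_def intro!: ennreal_leI mult_right_mono)
qed
have int2: "(\<integral>\<^sup>+s. ennreal (norm (?h (cplx (- s))) * G s) * indicator {0..R} s \<partial>lborel) <= ennreal (C * (1 + R) ^ L)" if "R >= 0" for R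
proof (rule order_trans[OF nn_integral_mono bd[OF that]])
fix s :: real
show "ennreal (norm (?h (cplx (- s))) * G s) * indicator {0..R} s <= ennreal ((norm (g (s *\<^sub>R \<omega>)) + norm (g (- (s *\<^sub>R \<omega>)))) * Gf (s *\<^sub>R \<omega>)) * indicator {0..R} s"
 using G0[of s] Gs[of s] unfolding hg' by (auto simp: indicator_def intro!: ennreal_leI mult_right_mono)
qed
have B0: "(norm \<omega>)\<^sup>2 / 2 >= 0" by simp
obtain p where p: "degree p <= L" "!!z. ?h z * ?h (\<i> * z) = poly p z"
by (rule product_polynomial[OF E(4) A B0 growth hG mono C int1 int2], assumption, assumption, assumption, assumption, rule that)
have "(%z. ?h z * ?h (\<i> * z)) has_fps_expansion hfps \<phi> (ldir \<omega> 0 0) * Abs_fps (%k. tcoef \<phi> (ldir \<omega> 0 0) k * \<i> ^ k)"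
by (intro has_fps_expansion_mult E(3) E'(3))
moreover have "Abs_fps (%k. tcoef \<phi> (ldir \<omega> 0 0) k * \<i> ^ k) = rotate_fps (hfps \<phi> (ldir \<omega> 0 0))"
by (simp add: rotate_fps_def hfps_def)
ultimately have "(%z. poly p z) has_fps_expansion hfps \<phi> (ldir \<omega> 0 0) * rotate_fps (hfps \<phi> (ldir \<omega> 0 0))"
by (simp only: p(2))
hence eq: "hfps \<phi> (ldir \<omega> 0 0) * rotate_fps (hfps \<phi> (ldir \<omega> 0 0)) = fps_of_poly p"
by (rule fps_expansion_unique_complex) (rule poly_has_fps_expansion)
show "ecoef \<phi> (ldir \<omega> 0 0) j = 0" if "j > L" for j
unfolding ecoef_def eq using that p(1) by (simp add: coeff_eq_0)
show "Im c = 0" if "q ~= 0" "!!z. ?h z = poly q z * exp (- c * z\<^sup>2)" for q c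
by (rule gaussian_coefficient_real(1)[OF that hG mono C int1])
qed

definition gauss_fps :: "complex => complex fps" where
"gauss_fps q = Abs_fps (%k. if even k then q ^ (k div 2) / fact (k div 2) else 0)"

lemma gauss_series: "(%k. (if even k then q ^ (k div 2) / fact (k div 2) else 0) * z ^ k) sums exp (q * z\<^sup>2)" for q z :: complex
proof -
have sm: "strict_mono (%m::nat. 2 * m)" by (intro strict_monoI) simp
have "(%m. (q * z\<^sup>2) ^ m /\<^sub>R fact m) sums exp (q * z\<^sup>2)" by (rule exp_converges)
hence "(%m. (if even (2 * m) then q ^ ((2 * m) div 2) / fact ((2 * m) div 2) else 0) * z ^ (2 * m)) sums exp (q * z\<^sup>2)"
by (simp add: power_mult_distrib power_mult power2_eq_square scaleR_conv_of_real field_simps)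
thus ?thesis by (subst (asm) sums_mono_reindex[OF sm]) (auto elim!: evenE)
qed

lemma polyfun_quad: "polyfun 2 (%b. cplx (quad A b))"
proof -
have "cplx (quad A b) = (\<Sum>i\<in>UNIV. cplx ((A *v b) $ i) * cplx (b $ i))" for b
by (simp add: quad_def inner_vec_def)
moreover have "polyfun (1 + 1) (%b. \<Sum>i\<in>UNIV. cplx ((A *v b) $ i) * cplx (b $ i))"
by (intro polyfun_sum polyfun_mult polyfun_linear polyfun_coord)
ultimately show ?thesis by (simp add: numeral_2_eq_2)
qed

lemma polyfun_gauss_fps: "polyfun k (%b. fps_nth (gauss_fps (cplx (quad A b))) k)"
proof (cases "even k")
case True
have "polyfun ((k div 2) * 2) (%b. cplx (quad A b) ^ (k div 2))" by (intro polyfun_power polyfun_quad)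
hence "polyfun k (%b. (1 / fact (k div 2)) * cplx (quad A b) ^ (k div 2))" using True by (intro polyfun_cmult) simp
thus ?thesis using True by (simp add: gauss_fps_def)
qed (simp add: gauss_fps_def polyfun_const)

lemma rotate_fps_eq_0: "rotate_fps F = 0 ==> F = 0"
by (simp add: rotate_fps_def fps_eq_iff)

text \<open>Let \<open>D\<close> be the largest degree occurring in \<open>h z * h (i z)\<close> over all directions. On the line \<open>a + t b\<close> the quotient \<open>s = T / E\<close> is a polynomial of degree two in \<open>t\<close>. Its coefficients follow from the lowest three coefficients of \<open>T\<close> and \<open>E\<close>, where \<open>E 0\<close> does not depend on \<open>b\<close>; so the top one is a quadratic form \<open>S\<close> in \<open>b\<close>, and comparing top coefficients yields \<open>T = S E\<close> at \<open>b\<close>. The power series of \<open>g\<close> times the inverse Gaussian then terminates in a dense set of directions, hence in all of them.\<close>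
theorem gaussian_rigidity:
fixes \<phi> :: "real ^ 'n::finite => complex"
assumes \<phi>: "exp_integrable \<phi>"
and gr: "!!\<rho>. \<rho> >= 0 ==> (LINT y|lborel. norm (\<phi> y) * exp (\<rho> * norm y)) <= B * exp (\<rho>\<^sup>2 / 2)"
and g: "!!x. g x = (LINT y|lborel. \<phi> y * exp (\<i> * cplx (x \<bullet> y)))"
and Gf: "!!x. Gf x = (LINT y|lborel. norm (\<phi> y) * exp \<bar>x \<bullet> y\<bar>)"
and ray: "AE \<omega> in lborel. \<exists>C\<ge>0. \<forall>R\<ge>0. (\<integral>\<^sup>+(s::real). ennreal ((norm (g (s *\<^sub>R \<omega>)) + norm (g (- (s *\<^sub>R \<omega>)))) * Gf (s *\<^sub>R \<omega>)) * indicator {0..R} s \<partial>lborel) <= ennreal (C * (1 + R) ^ L)"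
and nz: "g x0 ~= 0"
obtains A P where "transpose A = A" "!!x. g x = pgauss P A x"
proof -
define good where "good \<omega> \<longleftrightarrow> (\<exists>C\<ge>0. \<forall>R\<ge>0. (\<integral>\<^sup>+(s::real). ennreal ((norm (g (s *\<^sub>R \<omega>)) + norm (g (- (s *\<^sub>R \<omega>)))) * Gf (s *\<^sub>R \<omega>)) * indicator {0..R} s \<partial>lborel) <= ennreal (C * (1 + R) ^ L))" for \<omega>
have AEg: "AE \<omega> in lborel. good \<omega>" using ray unfolding good_def .
have good1: "ecoef \<phi> (ldir \<omega> 0 0) j = 0" if "good \<omega>" "j > L" for \<omega> j
by (rule good_direction(1)[OF \<phi> gr g Gf that(1)[unfolded good_def] that(2)])
have good2: "Im c = 0" if "good \<omega>" "p ~= 0" "!!z. hdir \<phi> (ldir \<omega> 0 0) z = poly p z * exp (- c * z\<^sup>2)" for \<omega> p c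
by (rule good_direction(2)[OF \<phi> gr g Gf that(1)[unfolded good_def] that(2,3)])
let ?e = "%b j. ecoef \<phi> (ldir b 0 0) j"
have econt: "continuous_on UNIV (%b. ?e b j)" for j by (rule polyfun_continuous[OF polyfun_ecoef[OF \<phi>]])
have eopen: "open {b. ?e b j ~= 0}" for j
using econt[of j] by (intro open_Collect_neq continuous_on_const)
have evan: "?e b j = 0" if "j > L" for b j
proof (rule ccontr)
assume "?e b j ~= 0"
hence "{b. ?e b j ~= 0} ~= {}" by blast
from AE_meets_open[OF AEg eopen this] obtain \<omega> where "?e \<omega> j ~= 0" "good \<omega>" by blast
thus False using good1[of \<omega> j] that by blast
qed
have gh: "g x = hdir \<phi> (ldir x 0 0) 1" for x
unfolding g hdir_def ldir_def by simp
\<comment> \<open>the largest degree occurring in some direction\<close>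
define J where "J = {j. \<exists>b. ?e b j ~= 0}"
have "J \<subseteq> {..L}" unfolding J_def using evan by (auto simp: not_less[symmetric])
hence Jfin: "finite J" by (rule finite_subset) simp
have Jne: "J ~= {}"
proof
assume "J = {}"
hence "hfps \<phi> (ldir x0 0 0) * rotate_fps (hfps \<phi> (ldir x0 0 0)) = 0"
 unfolding J_def ecoef_def fps_eq_iff by auto
hence "hfps \<phi> (ldir x0 0 0) = 0" using rotate_fps_eq_0 by auto
hence "hdir \<phi> (ldir x0 0 0) 1 = eval_fps 0 1"
 using entire_series(2)[OF hdir_expansion(1)[OF \<phi>, of x0 0 0], of 1] by (simp add: hfps_def)
thus False using nz gh by simp
qed
define D where "D = Max J"
have DJ: "D \<in> J" unfolding D_def by (rule Max_in[OF Jfin Jne])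
then obtain a where a: "?e a D ~= 0" unfolding J_def by blast
have van: "?e b j = 0" if "j > D" for b j
proof (rule ccontr)
assume "?e b j ~= 0"
hence "j \<in> J" unfolding J_def by blast
hence "j <= D" unfolding D_def by (rule Max_ge[OF Jfin])
thus False using that by simp
qed
have van_line: "ecoef \<phi> (ldir x b t) j = 0" if "j > D" for x b t j
proof -
have "poly (line_E \<phi> x j b) t = 0"
proof (rule entire_zero_on_reals[where f = "poly (line_E \<phi> x j b)"])
 show "poly (line_E \<phi> x j b) holomorphic_on UNIV"
 unfolding holomorphic_on_def field_differentiable_def using poly_DERIV has_field_derivative_at_within by blast
 fix s :: real
 have "ldir x b (cplx s) = ldir (x + s *\<^sub>R b) 0 0"
 by (auto simp: ldir_def fun_eq_iff inner_add_left add.commute)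
 thus "poly (line_E \<phi> x j b) (cplx s) = 0" using van[OF that] by (simp add: line_E_poly[OF \<phi>])
qed
thus ?thesis by (simp add: line_E_poly[OF \<phi>])
qed
have form: "\<exists>p c. p ~= 0 \<and> degree p <= D \<and> (\<forall>z. hdir \<phi> (ldir x b t) z = poly p z * exp (- c * z\<^sup>2))
\<and> norm c <= (norm x + norm t * norm b)\<^sup>2 / 2 \<and> dcoef \<phi> (ldir x b t) (Suc D) = - 2 * c * ecoef \<phi> (ldir x b t) D"
if "ecoef \<phi> (ldir x b t) D ~= 0" for x b t
unfolding dcoef_def ecoef_def
by (rule direction_form[OF \<phi> gr refl]) (use van_line that in \<open>simp_all add: ecoef_def\<close>)
\<comment> \<open>on every complex line through the direction \<open>a\<close> the exponent is a quadratic polynomial\<close>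
have l0: "ldir a b 0 = ldir a 0 0" for b by (simp add: ldir_def fun_eq_iff)
have quotient: "\<exists>s. line_T \<phi> a (Suc D) b = s * line_E \<phi> a D b \<and> degree s <= 2" for b
proof (rule poly_quadratic_quotient)
have p0: "poly (line_E \<phi> a D b) 0 ~= 0"
 using a by (simp add: line_E_poly[OF \<phi>] l0[of b])
thus Enz: "line_E \<phi> a D b ~= 0" by auto
fix t
show "norm (poly (line_T \<phi> a (Suc D) b) t) <= (norm a + norm t * norm b)\<^sup>2 * norm (poly (line_E \<phi> a D b) t)"
proof (rule poly_ineq_everywhere[of "{t. poly (line_E \<phi> a D b) t = 0}"])
 show "finite {t. poly (line_E \<phi> a D b) t = 0}" by (rule poly_roots_finite[OF Enz])
 fix t assume "t \<notin> {t. poly (line_E \<phi> a D b) t = 0}"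
 hence "ecoef \<phi> (ldir a b t) D ~= 0" by (simp add: line_E_poly[OF \<phi>])
 from form[OF this] obtain c where c: "norm c <= (norm a + norm t * norm b)\<^sup>2 / 2"
 "dcoef \<phi> (ldir a b t) (Suc D) = - 2 * c * ecoef \<phi> (ldir a b t) D" by blast
 have "norm (poly (line_T \<phi> a (Suc D) b) t) = (2 * norm c) * norm (poly (line_E \<phi> a D b) t)"
 unfolding line_T_poly[OF \<phi>] line_E_poly[OF \<phi>] c(2) by (simp add: norm_mult)
 also have "... <= (norm a + norm t * norm b)\<^sup>2 * norm (poly (line_E \<phi> a D b) t)"
 using c(1) by (intro mult_right_mono) auto
 finally show "norm (poly (line_T \<phi> a (Suc D) b) t) <= (norm a + norm t * norm b)\<^sup>2 * norm (poly (line_E \<phi> a D b) t)" .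
qed
qed auto
obtain E0 EB where E0: "!!b. coeff (line_E \<phi> a D b) 0 = E0" and E1: "linear (%b. coeff (line_E \<phi> a D b) 1)"
and EB: "bilinear EB" "!!b. coeff (line_E \<phi> a D b) 2 = EB b b"
using jet_line_E[OF \<phi>, of a D] unfolding jet_def by auto
obtain T0 TB where T0: "!!b. coeff (line_T \<phi> a (Suc D) b) 0 = T0" and T1: "linear (%b. coeff (line_T \<phi> a (Suc D) b) 1)"
and TB: "bilinear TB" "!!b. coeff (line_T \<phi> a (Suc D) b) 2 = TB b b"
using jet_line_T[OF \<phi>, of a "Suc D"] unfolding jet_def by auto
have E0nz: "E0 ~= 0"
using a unfolding E0[of a, symmetric] poly_0_coeff_0[symmetric] line_E_poly[OF \<phi>] l0[of a] .
define s1 where "s1 b = (1 / E0) * (coeff (line_T \<phi> a (Suc D) b) 1 + (- (T0 / E0)) * coeff (line_E \<phi> a D b) 1)" for b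
define S where "S x y = (1 / E0) * ((TB x y + (- (T0 / E0)) * EB x y) + (- 1) * (s1 x * coeff (line_E \<phi> a D y) 1))" for x y
have s1lin: "linear s1" unfolding s1_def[abs_def] by (intro linear_cmult linear_compose_add T1 E1)
have Sbil: "bilinear S" unfolding S_def[abs_def]
by (intro bilinear_cmult bilinear_add bilinear_linear_mult s1lin E1 EB(1) TB(1))
have TS: "dcoef \<phi> (ldir b 0 0) (Suc D) = S b b * ?e b D" for b
proof -
obtain s where s: "line_T \<phi> a (Suc D) b = s * line_E \<phi> a D b" "degree s <= 2" using quotient by blast
have 0: "coeff s 0 = T0 / E0" using arg_cong[OF s(1), of "%p. coeff p 0"] E0nz by (simp add: T0 E0 coeff_mult)
have 1: "coeff s 1 = s1 b"
proof -
 have "coeff (line_T \<phi> a (Suc D) b) 1 = coeff s 0 * coeff (line_E \<phi> a D b) 1 + coeff s 1 * E0"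
 unfolding s(1) coeff_mult by (simp add: E0)
 thus ?thesis unfolding s1_def 0 using E0nz by (simp add: field_simps)
qed
have 2: "coeff s 2 = S b b"
proof -
 have "coeff (line_T \<phi> a (Suc D) b) 2 = coeff s 0 * coeff (line_E \<phi> a D b) 2 + coeff s 1 * coeff (line_E \<phi> a D b) 1 + coeff s 2 * E0"
 unfolding s(1) coeff_mult by (simp add: E0 numeral_2_eq_2)
 hence "TB b b = T0 / E0 * EB b b + s1 b * coeff (line_E \<phi> a D b) 1 + coeff s 2 * E0" unfolding 0 1 TB(2) EB(2) .
 thus ?thesis unfolding S_def using E0nz by (simp add: field_simps)
qed
have "coeff (line_T \<phi> a (Suc D) b) (Suc (Suc D)) = coeff (s * line_E \<phi> a D b) (2 + D)" unfolding s(1) by simp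
also have "... = coeff s 2 * coeff (line_E \<phi> a D b) D" by (rule coeff_top_mult[OF s(2) line_E_degree])
finally show ?thesis unfolding line_T_top line_E_top 2 .
qed
obtain M :: "complex^'n^'n" where M: "!!b. S b b = (\<Sum>i\<in>UNIV. \<Sum>j\<in>UNIV. M $ i $ j * cplx (b $ i) * cplx (b $ j))"
using bilinear_diagonal_matrix[OF Sbil] by blast
have Scont: "continuous_on UNIV (%b. S b b)" unfolding M by (intro continuous_intros)
\<comment> \<open>generic directions, in which the previous results apply, are dense\<close>
have generic: "\<exists>b\<in>U. good b \<and> ?e b D ~= 0" if U: "open U" "U ~= {}" for U
proof -
obtain x where xU: "x \<in> U" using U(2) by blast
obtain \<epsilon> where x: "\<epsilon> > 0" "ball x \<epsilon> \<subseteq> U" by (rule openE[OF U(1) xU])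
have "coeff (line_E \<phi> x D a) D ~= 0" unfolding line_E_top by (rule a)
hence Enz: "line_E \<phi> x D a ~= 0" by auto
define \<delta> where "\<delta> = \<epsilon> / (norm a + 1)"
have np: "norm a + 1 > 0" using norm_ge_zero[of a] by linarith
have \<delta>: "\<delta> > 0" using x(1) np by (simp add: \<delta>_def)
have inf: "infinite (cplx ` {0<..<\<delta>})" using \<delta> by (subst finite_image_iff) (auto simp: inj_on_def infinite_Ioo)
hence "\<not> cplx ` {0<..<\<delta>} \<subseteq> {t. poly (line_E \<phi> x D a) t = 0}"
 using finite_subset[OF _ poly_roots_finite[OF Enz]] inf by blast
then obtain s where s0: "s \<in> {0<..<\<delta>}" "poly (line_E \<phi> x D a) (cplx s) ~= 0"
 unfolding image_subset_iff mem_Collect_eq by blast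
hence s: "0 < s" "s < \<delta>" "poly (line_E \<phi> x D a) (cplx s) ~= 0" by auto
have "ldir x a (cplx s) = ldir (x + s *\<^sub>R a) 0 0"
 by (auto simp: ldir_def fun_eq_iff inner_add_left add.commute)
hence ne: "?e (x + s *\<^sub>R a) D ~= 0" using s(3) by (simp add: line_E_poly[OF \<phi>])
have "s * norm a < \<epsilon>"
proof -
 have "s * norm a <= s * (norm a + 1)" using s(1) by (intro mult_left_mono) auto
 also have "... < \<delta> * (norm a + 1)" using s(2) np by (intro mult_strict_right_mono)
 also have "... = \<epsilon>" using np by (simp add: \<delta>_def)
 finally show ?thesis .
qed
hence "x + s *\<^sub>R a \<in> U" using s(1) by (intro subsetD[OF x(2)]) (simp add: dist_norm)
hence "U \<inter> {b. ?e b D ~= 0} ~= {}" using ne by blast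
from AE_meets_open[OF AEg open_Int[OF U(1) eopen] this] show ?thesis by blast
qed
have dense: "\<forall>b. F b = 0" if "continuous_on UNIV F" "!!b. good b ==> ?e b D ~= 0 ==> F b = 0" for F :: "real^'n => complex"
proof (rule ccontr)
assume "\<not> (\<forall>b. F b = 0)"
hence "{b. F b ~= 0} ~= {}" by blast
moreover have "open {b. F b ~= 0}" by (intro open_Collect_neq continuous_on_const that)
ultimately obtain b where "F b ~= 0" "good b" "?e b D ~= 0" using generic[of "{b. F b ~= 0}"] by blast
thus False using that(2) by blast
qed
have real_form: "cplx (Im (S b b)) = 0" for b
proof (rule dense[where F = "%b. cplx (Im (S b b))", THEN spec])
show "continuous_on UNIV (%b. cplx (Im (S b b)))" by (intro continuous_intros Scont)
fix b assume b: "good b" "?e b D ~= 0"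
from form[OF b(2)] obtain p c where pc: "p ~= 0" "!!z. hdir \<phi> (ldir b 0 0) z = poly p z * exp (- c * z\<^sup>2)"
 "dcoef \<phi> (ldir b 0 0) (Suc D) = - 2 * c * ?e b D" by blast
have c: "Im c = 0" using good2[OF b(1) pc(1,2)] .
have "S b b * ?e b D = - 2 * c * ?e b D" using pc(3) unfolding TS .
hence "S b b = - 2 * c" unfolding mult_right_cancel[OF b(2)] .
with c show "cplx (Im (S b b)) = 0" by simp
qed
obtain A' :: "real^'n^'n" where tA': "transpose A' = A'"
and qA': "!!b. quad A' b = Re (\<Sum>i\<in>UNIV. \<Sum>j\<in>UNIV. M $ i $ j * cplx (b $ i) * cplx (b $ j))"
by (rule symmetric_matrix_of_form[of M], rule that)
have "quad A' b = Re (S b b)" for b unfolding M by (rule qA')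
note A' = tA' this
define A where "A = (- (1/2)) *\<^sub>R A'"
have tA: "transpose A = A" unfolding A_def using A'(1) by (simp add: vec_eq_iff transpose_def)
have qA: "cplx (quad A b) = - S b b / 2" for b
proof -
have "A *v b = (- (1/2)) *\<^sub>R (A' *v b)" unfolding A_def by (rule scaleR_matrix_vector_assoc[symmetric])
hence "quad A b = - (1/2) * Re (S b b)" unfolding A'(2)[symmetric] quad_def by simp
moreover have "S b b = cplx (Re (S b b))" using real_form[of b] by (simp add: complex_eq_iff)
ultimately show ?thesis by (subst \<open>S b b = cplx (Re (S b b))\<close>) simp
qed
\<comment> \<open>the power series of \<open>g\<close> along a ray, multiplied by the inverse Gaussian\<close>
define W where "W b = hfps \<phi> (ldir b 0 0) * gauss_fps (cplx (quad A b))" for b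
have Wpoly: "polyfun k (%b. fps_nth (W b) k)" for k
unfolding W_def fps_mult_nth
proof (intro polyfun_sum)
fix i assume "i \<in> {0..k}"
thus "polyfun k (%b. fps_nth (hfps \<phi> (ldir b 0 0)) i * fps_nth (gauss_fps (cplx (quad A b))) (k - i))"
 using polyfun_mult[OF polyfun_tcoef[OF \<phi>, of i] polyfun_gauss_fps[of "k - i" A]] by (simp add: hfps_def)
qed
have Wzero: "fps_nth (W b) k = 0" if "k > D" for b k
proof (rule dense[where F = "%b. fps_nth (W b) k", THEN spec])
show "continuous_on UNIV (%b. fps_nth (W b) k)" by (rule polyfun_continuous[OF Wpoly])
fix b assume b: "good b" "?e b D ~= 0"
from form[OF b(2)] obtain p c where pc: "degree p <= D" "!!z. hdir \<phi> (ldir b 0 0) z = poly p z * exp (- c * z\<^sup>2)"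
 "dcoef \<phi> (ldir b 0 0) (Suc D) = - 2 * c * ?e b D" by blast
have "S b b * ?e b D = - 2 * c * ?e b D" using pc(3) unfolding TS .
hence "S b b = - 2 * c" unfolding mult_right_cancel[OF b(2)] .
hence c: "cplx (quad A b) = c" unfolding qA by simp
have "(%z. hdir \<phi> (ldir b 0 0) z * exp (c * z\<^sup>2)) has_fps_expansion W b"
 unfolding W_def c hfps_def gauss_fps_def
 by (intro has_fps_expansion_mult entire_series(3)[OF hdir_expansion(1)[OF \<phi>]] entire_series(3)[OF gauss_series])
moreover have "hdir \<phi> (ldir b 0 0) z * exp (c * z\<^sup>2) = poly p z" for z
proof -
 have "exp (- c * z\<^sup>2) * exp (c * z\<^sup>2) = 1" by (simp flip: exp_add)
 thus ?thesis unfolding pc(2) by (simp only: mult.assoc mult_1_right)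
qed
ultimately have "(%z. poly p z) has_fps_expansion W b" by (simp only:)
hence "W b = fps_of_poly p" by (rule fps_expansion_unique_complex) (rule poly_has_fps_expansion)
thus "fps_nth (W b) k = 0" using that pc(1) by (simp add: coeff_eq_0)
qed
have gW: "g b * exp (cplx (quad A b)) = (\<Sum>k\<le>D. fps_nth (W b) k)" for b
proof -
note E = entire_series[OF hdir_expansion(1)[OF \<phi>, of b 0 0], folded hfps_def]
note X = entire_series[OF gauss_series[of "cplx (quad A b)"], folded gauss_fps_def]
have "eval_fps (W b) 1 = eval_fps (hfps \<phi> (ldir b 0 0)) 1 * eval_fps (gauss_fps (cplx (quad A b))) 1"
 unfolding W_def by (rule eval_fps_mult) (simp_all add: E(1) X(1))
also have "... = g b * exp (cplx (quad A b))" unfolding E(2) X(2) gh by simp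
finally show ?thesis using finite_fps_eval[of D "W b" 1, OF Wzero] by (simp add: poly_sum poly_monom)
qed
have "polyfun D (%b. \<Sum>k\<le>D. fps_nth (W b) k)"
by (intro polyfun_sum polyfun_mono[OF Wpoly]) auto
then obtain P where P: "!!b. (\<Sum>k\<le>D. fps_nth (W b) k) = cpoly_eval P b" unfolding polyfun_def by blast
have "g x = pgauss P A x" for x
proof -
have "exp (cplx (quad A x)) * exp (- cplx (quad A x)) = 1" by (simp flip: exp_add)
hence "g x = (g x * exp (cplx (quad A x))) * exp (- cplx (quad A x))" by (simp only: mult.assoc mult_1_right)
moreover have "exp (- cplx (quad A x)) = cplx (exp (- quad A x))"
 using exp_of_real[of "- quad A x", where 'a = complex] by simp
ultimately show ?thesis unfolding gW P pgauss_def by simp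
qed
with tA show ?thesis by (rule that)
qed

section \<open>Back to the original function\<close>

lemma bounded_polynomial_constant:
fixes p :: "complex poly"
assumes "!!t::real. norm (poly p (cplx t)) <= M"
shows "poly p z = poly p 0"
proof (cases p)
case (pCons a q)
have "q = 0"
proof (rule ccontr)
assume "q ~= 0"
then obtain r where r: "!!z. r <= norm z ==> M + 1 <= norm (poly (pCons a q) z)"
 using poly_infinity[of q "M + 1" a] by blast
have "M + 1 <= norm (poly p (cplx \<bar>r\<bar>))" using r[of "cplx \<bar>r\<bar>"] pCons by simp
thus False using assms[of "\<bar>r\<bar>"] by linarith
qed
thus ?thesis using pCons by simp
qed

lemma cpoly_on_line: "\<exists>p. \<forall>t::real. cpoly_eval P (x + t *\<^sub>R w) = poly p (cplx t)"
proof (intro exI allI)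
fix t :: real
show "cpoly_eval P (x + t *\<^sub>R w) = poly (\<Sum>m\<in>Poly_Mapping.keys P. smult (Poly_Mapping.lookup P m)
 (\<Prod>i\<in>UNIV. [:cplx (x $ i), cplx (w $ i):] ^ Poly_Mapping.lookup m i)) (cplx t)"
by (simp add: cpoly_eval_def poly_sum poly_prod poly_power)
qed

lemma pgauss_continuous: "continuous_on UNIV (pgauss P A)"
proof -
have "continuous_on UNIV (%x. quad A x)"
unfolding quad_def by (intro continuous_intros linear_continuous_on_compose[OF continuous_on_id]) auto
thus ?thesis unfolding pgauss_def[abs_def] by (intro continuous_intros cpoly_eval_continuous)
qed

lemma continuous_AE_closed:
fixes u :: "real ^ 'n::finite => complex"
assumes "AE x in lborel. u x \<in> S" "closed S" "continuous_on UNIV u"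
shows "u x \<in> S"
proof (rule ccontr)
assume "u x \<notin> S"
have "open (u -` (- S))" using assms(2,3) by (intro open_vimage) auto
moreover have "u -` (- S) ~= {}" using \<open>u x \<notin> S\<close> by auto
ultimately obtain y where "y \<in> u -` (- S)" "u y \<in> S" using AE_meets_open[OF assms(1)] by blast
thus False by simp
qed

text \<open>Along a direction in which the form is negative the function would grow like a Gaussian.\<close>
lemma pgauss_nonneg_form:
assumes A: "transpose A = A" and bd: "!!x. norm (pgauss P A x) <= M" and nz: "pgauss P A x0 ~= 0"
shows "quad A w >= 0"
proof -
obtain p where p: "!!t::real. cpoly_eval P (x0 + t *\<^sub>R w) = poly p (cplx t)"
using cpoly_on_line[of P x0 w] by blast
have "poly p 0 ~= 0" using p[of 0] nz by (simp add: pgauss_def)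
hence "p ~= 0" by auto
obtain rmin \<delta> where \<delta>: "rmin >= 1" "\<delta> > 0" "!!z. norm z >= rmin ==> norm (poly p z) >= \<delta>"
by (rule poly_lower_bound_at_infinity[OF \<open>p ~= 0\<close>], rule that)
have M: "M >= 0" using bd[of x0] norm_ge_zero order_trans by blast
define \<beta> where "\<beta> = (A *v x0) \<bullet> w"
have "- quad A w <= 0"
proof (rule exp_quadratic_growth[where \<delta> = \<delta> and rmin = rmin and A = "M * exp (quad A x0)" and L = 0 and D = "2 * \<bar>\<beta>\<bar>"])
fix r assume r: "r >= rmin"
have r0: "r >= 0" using r \<delta>(1) by linarith
have q: "quad A (x0 + r *\<^sub>R w) = quad A x0 + 2 * r * \<beta> + r\<^sup>2 * quad A w"
 unfolding quad_def \<beta>_def by (rule quad_add[OF A])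
have "norm (poly p (cplx r)) * exp (- quad A (x0 + r *\<^sub>R w)) <= M"
 using bd[of "x0 + r *\<^sub>R w"] unfolding pgauss_def p norm_mult by simp
moreover have "\<delta> * exp (- quad A (x0 + r *\<^sub>R w)) <= norm (poly p (cplx r)) * exp (- quad A (x0 + r *\<^sub>R w))"
 using \<delta>(3)[of "cplx r"] r r0 by (intro mult_right_mono) auto
ultimately have 1: "\<delta> * exp (- quad A (x0 + r *\<^sub>R w)) <= M" by linarith
have "2 * r * \<beta> <= 2 * \<bar>\<beta>\<bar> * (1 + r)"
proof -
 have "r * \<beta> <= r * \<bar>\<beta>\<bar>" using r0 by (intro mult_left_mono) auto
 thus ?thesis by (simp add: algebra_simps)
qed
hence "- quad A w * r\<^sup>2 <= - quad A (x0 + r *\<^sub>R w) + (quad A x0 + 2 * \<bar>\<beta>\<bar> * (1 + r))" unfolding q by (simp add: mult.commute)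
hence "exp (- quad A w * r\<^sup>2) <= exp (- quad A (x0 + r *\<^sub>R w)) * exp (quad A x0 + 2 * \<bar>\<beta>\<bar> * (1 + r))"
 by (simp only: exp_add[symmetric] exp_le_cancel_iff)
hence "\<delta> * exp (- quad A w * r\<^sup>2) <= \<delta> * (exp (- quad A (x0 + r *\<^sub>R w)) * exp (quad A x0 + 2 * \<bar>\<beta>\<bar> * (1 + r)))"
 using \<delta>(2) by (intro mult_left_mono) auto
also have "... <= M * exp (quad A x0 + 2 * \<bar>\<beta>\<bar> * (1 + r))"
 using mult_right_mono[OF 1, of "exp (quad A x0 + 2 * \<bar>\<beta>\<bar> * (1 + r))"] by (simp add: mult.assoc)
finally show "\<delta> * exp (- quad A w * r\<^sup>2) <= M * exp (quad A x0) * (1 + r) ^ 0 * exp (2 * \<bar>\<beta>\<bar> * (1 + r))"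
 by (simp add: exp_add mult.assoc)
qed (use \<delta> M in auto)
thus ?thesis by simp
qed

lemma semidefinite_kernel:
assumes A: "transpose A = (A :: real ^ 'n ^ 'n::finite)" and psd: "!!w. quad A w >= 0" and z: "quad A w = 0"
shows "A *v w = 0"
proof (rule ccontr)
assume ne: "A *v w ~= 0"
define v where "v = A *v w"
define \<beta> where "\<beta> = v \<bullet> v"
have \<beta>: "\<beta> > 0" using ne by (simp add: \<beta>_def v_def)
define t where "t = - \<beta> / (quad A v + 1)"
have q1: "quad A v + 1 > 0" using psd[of v] by linarith
have "quad A (w + t *\<^sub>R v) = 2 * t * \<beta> + t\<^sup>2 * quad A v"
unfolding quad_def \<beta>_def using quad_add[OF A, of w t v] z by (simp add: quad_def v_def)
also have "... <= 2 * t * \<beta> + t\<^sup>2 * (quad A v + 1)" by (simp add: distrib_left)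
also have "t\<^sup>2 * (quad A v + 1) = - t * \<beta>"
using q1 by (simp add: t_def power2_eq_square)
also have "2 * t * \<beta> + - t * \<beta> = t * \<beta>" by (simp add: algebra_simps)
also have "t * \<beta> < 0" using \<beta> q1 by (simp add: t_def mult_neg_pos)
finally show False using psd[of "w + t *\<^sub>R v"] by linarith
qed

text \<open>Translation multiplies the transform by a character, so the transform lives on the hyperplane orthogonal to \<open>w\<close>, a null set.\<close>
lemma translation_invariant_zero:
fixes u :: "real ^ 'n::finite => complex"
assumes u: "integrable lborel u" and w: "w ~= 0" and inv: "!!x t. u (x + t *\<^sub>R w) = u x"
shows "AE x in lborel. u x = 0"
proof -
have [measurable]: "u \<in> borel_measurable borel" using u by auto
have FT0: "FT u y = 0" if y: "w \<bullet> y ~= 0" for y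
proof -
define s where "s = pi / (w \<bullet> y)"
have "FT u y = (LINT x|lborel. u (x + s *\<^sub>R w) * exp (- (\<i> * cplx ((x + s *\<^sub>R w) \<bullet> y))))"
 unfolding FT_def by (rule lborel_integral_translate[symmetric]) measurable
also have "... = (LINT x|lborel. - (u x * exp (- (\<i> * cplx (x \<bullet> y)))))"
proof (intro Bochner_Integration.integral_cong refl)
 fix x
 have "(x + s *\<^sub>R w) \<bullet> y = x \<bullet> y + pi" using y by (simp add: inner_add_left s_def)
 hence "exp (- (\<i> * cplx ((x + s *\<^sub>R w) \<bullet> y))) = exp (- (\<i> * cplx (x \<bullet> y))) * exp (- (\<i> * cplx pi))"
 by (simp add: distrib_left exp_add[symmetric])
 also have "exp (- (\<i> * cplx pi)) = - 1" using exp_pi_i by (simp add: exp_minus mult.commute)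
 finally show "u (x + s *\<^sub>R w) * exp (- (\<i> * cplx ((x + s *\<^sub>R w) \<bullet> y))) = - (u x * exp (- (\<i> * cplx (x \<bullet> y))))"
 unfolding inv by simp
qed
also have "... = - FT u y" unfolding FT_def by simp
finally show ?thesis by simp
qed
have "negligible {y. w \<bullet> y = 0}" using w by (intro negligible_hyperplane) auto
hence "{y. w \<bullet> y = 0} \<in> null_sets lebesgue" by (simp add: negligible_iff_null_sets)
hence "AE y in lebesgue. y \<notin> {y. w \<bullet> y = 0}" by (rule AE_not_in)
hence "AE y in lborel. w \<bullet> y ~= 0" unfolding AE_lebesgue_iff by simp
hence ae: "AE y in lborel. FT u y = 0" by eventually_elim (rule FT0)
have iF: "integrable lborel (FT u)" using ae by (subst integrable_cong_AE[of _ _ "%_. 0"]) auto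
have FF: "FT (FT u) x = 0" for x
proof -
have "FT (FT u) x = FT (%_. 0) x" using ae by (intro FT_cong_AE) auto
thus ?thesis by (simp add: FT_def)
qed
from fourier_inversion[OF u iF] show ?thesis
proof eventually_elim
case (elim x)
thus ?case using FF gauss_mass_pos[where 'n='n] by simp
qed
qed

text \<open>In a kernel direction of the form the function is a bounded polynomial, hence constant, which contradicts integrability.\<close>
lemma pgauss_positive_definite:
fixes A :: "real ^ 'n ^ 'n::finite"
assumes A: "transpose A = A" and bd: "!!x. norm (pgauss P A x) <= M" and int: "integrable lborel (pgauss P A)" and nz: "pgauss P A x0 ~= 0"
shows "sym_pos_def A"
proof -
have psd: "quad A w >= 0" for w by (rule pgauss_nonneg_form[OF A bd nz])
have "quad A w ~= 0" if w: "w ~= 0" for w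
proof
assume q0: "quad A w = 0"
have Aw: "A *v w = 0" by (rule semidefinite_kernel[OF A psd q0])
have qinv: "quad A (x + t *\<^sub>R w) = quad A x" for x t
proof -
 have "(A *v x) \<bullet> w = 0" unfolding sym_inner[OF A] Aw by simp
 thus ?thesis unfolding quad_def quad_add[OF A] using q0 by (simp add: quad_def)
qed
have inv: "pgauss P A (x + t *\<^sub>R w) = pgauss P A x" for x t
proof -
 obtain p where p: "!!t::real. cpoly_eval P (x + t *\<^sub>R w) = poly p (cplx t)"
 using cpoly_on_line[of P x w] by blast
 have "norm (poly p (cplx t)) <= M * exp (quad A x)" for t
 proof -
 have "norm (poly p (cplx t)) * exp (- quad A x) <= M"
 using bd[of "x + t *\<^sub>R w"] unfolding pgauss_def p norm_mult qinv by simp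
 thus ?thesis by (simp add: exp_minus divide_inverse[symmetric] divide_le_eq)
 qed
 hence "poly p (cplx t) = poly p 0" by (rule bounded_polynomial_constant)
 thus ?thesis unfolding pgauss_def qinv using p[of t] p[of 0] by simp
qed
have "AE x in lborel. pgauss P A x \<in> {0}" using translation_invariant_zero[OF int w inv] by simp
hence "pgauss P A x0 \<in> {0}" by (rule continuous_AE_closed) (auto intro: pgauss_continuous)
thus False using nz by simp
qed
hence "quad A w > 0" if "w ~= 0" for w using psd[of w] that by (simp add: less_le)
thus ?thesis using A unfolding sym_pos_def_def quad_def by blast
qed

lemma pgauss_reflect_scale:
fixes P :: "'n::finite cpoly"
shows "\<exists>P'. \<forall>x. c * pgauss P A (- x) = pgauss P' A x"
proof -
obtain M where "deg_le P M" using deg_le_exists by blast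
hence "polyfun M (cpoly_eval P)" unfolding polyfun_def by blast
hence "polyfun M (%x. c * cpoly_eval P ((- mat 1) *v x))" by (intro polyfun_cmult polyfun_compose_linear)
moreover have "(- mat 1) *v x = - (x :: real^'n)" for x
using scaleR_matrix_vector_assoc[of "-1" "mat 1" x] by simp
ultimately obtain P' where P': "!!x. c * cpoly_eval P (- x) = cpoly_eval P' x" unfolding polyfun_def by auto
have "quad A (- x) = quad A x" for x using quad_scaleR[of A "-1" x] by simp
hence "c * pgauss P A (- x) = pgauss P' A x" for x unfolding pgauss_def P'[symmetric] by simp
thus ?thesis by blast
qed

lemma fourier_pgauss_imp_pgauss:
fixes u :: "real ^ 'n::finite => complex"
assumes u: "integrable lborel u" and A: "sym_pos_def A" and F: "!!x. FT u x = pgauss P A x"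
obtains P' B where "sym_pos_def B" "AE x in lborel. u x = pgauss P' B x"
proof -
let ?k = "cplx ((gauss_mass TYPE('n))\<^sup>2)"
have k: "?k ~= 0" using gauss_mass_pos[where 'n='n] by simp
have Fe: "FT u = pgauss P A" using F by (rule ext)
obtain M where M: "deg_le P M" using deg_le_exists by blast
obtain P1 B where B: "sym_pos_def B" "!!y. FT (pgauss P A) y = pgauss P1 B y"
by (rule FT_pgauss_is_pgauss[OF A M], rule that)
obtain P' where P': "!!x. (1 / ?k) * pgauss P1 B (- x) = pgauss P' B x"
using pgauss_reflect_scale[of "1 / ?k" P1 B] by blast
have "AE x in lborel. ?k * u x = FT (FT u) (- x)"
by (rule fourier_inversion[OF u]) (use pgauss_integrable(1)[OF A] Fe in simp)
hence "AE x in lborel. u x = pgauss P' B x"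
unfolding Fe B(2) P'[symmetric]
proof eventually_elim
case (elim x)
show ?case using k by (simp flip: elim)
qed
with B(1) show ?thesis by (rule that)
qed

text \<open>Growth on rays gives the shape of the smoothed function by rigidity; removing the damping changes the form by half the identity, and boundedness and integrability of the transform restore positivity.\<close>
theorem KK_bound_imp_pgauss:
fixes f :: "real ^ 'n::finite => complex"
assumes f: "integrable lborel f" and F: "integrable lborel (FT f)" and nz: "\<not> (AE x in lborel. f x = 0)"
and C: "C >= 0" and KK: "!!a. 0 < a ==> a < 1 ==> KK a f (FT f) <= ennreal (C * blowup a ^ N)"
obtains P A where "sym_pos_def A" "AE x in lborel. f x = pgauss P A x"
proof -
let ?\<kappa> = "gauss_mass TYPE('n)"
have kp: "?\<kappa> > 0" by (rule gauss_mass_pos)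
have fm [measurable]: "f \<in> borel_measurable borel" using f by auto
define \<phi> where "\<phi> y = FT f y * cplx (exp (- ((norm y)\<^sup>2 / 2)))" for y
have [measurable]: "\<phi> \<in> borel_measurable borel" unfolding \<phi>_def[abs_def] by measurable
have n\<phi>: "norm (\<phi> y) = norm (FT f y) * exp (- ((norm y)\<^sup>2 / 2))" for y by (simp add: \<phi>_def norm_mult)
have pw: "norm (\<phi> y) * exp (R * norm y) <= exp (R\<^sup>2 / 2) * norm (FT f y)" for y R
proof -
have "R * norm y <= R\<^sup>2 / 2 + (norm y)\<^sup>2 / 2" using sum_squares_bound[of R "norm y"] by simp
hence "exp (- ((norm y)\<^sup>2 / 2)) * exp (R * norm y) <= exp (R\<^sup>2 / 2)" by (simp add: exp_add[symmetric])
hence "norm (FT f y) * (exp (- ((norm y)\<^sup>2 / 2)) * exp (R * norm y)) <= norm (FT f y) * exp (R\<^sup>2 / 2)" by (intro mult_left_mono) auto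
thus ?thesis unfolding n\<phi> by (simp add: mult_ac)
qed
have Fi: "integrable lborel (%y. exp (R\<^sup>2 / 2) * norm (FT f y))" for R by (intro integrable_mult_right integrable_norm F)
have ei: "integrable lborel (%y. norm (\<phi> y) * exp (R * norm y))" for R
by (rule Bochner_Integration.integrable_bound[OF Fi[of R]]) (measurable, use pw in \<open>auto intro!: AE_I2\<close>)
have \<phi>: "exp_integrable \<phi>" unfolding exp_integrable_def using ei by simp
define \<Phi> where "\<Phi> = (LINT y|lborel. norm (FT f y))"
have \<Phi>0: "\<Phi> >= 0" unfolding \<Phi>_def by (intro Bochner_Integration.integral_nonneg) auto
have gr: "(LINT y|lborel. norm (\<phi> y) * exp (\<rho> * norm y)) <= \<Phi> * exp (\<rho>\<^sup>2 / 2)" for \<rho>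
proof -
have "(LINT y|lborel. norm (\<phi> y) * exp (\<rho> * norm y)) <= (LINT y|lborel. exp (\<rho>\<^sup>2 / 2) * norm (FT f y))"
 by (rule integral_mono[OF ei Fi pw])
thus ?thesis by (simp add: \<Phi>_def mult.commute)
qed
define g where "g x = (LINT y|lborel. \<phi> y * exp (\<i> * cplx (x \<bullet> y)))" for x
define Gf where "Gf x = (LINT y|lborel. norm (\<phi> y) * exp \<bar>x \<bullet> y\<bar>)" for x
have [measurable]: "g \<in> borel_measurable borel" unfolding g_def[abs_def] by measurable
have conv: "g x = (LINT t|lborel. f t * cplx (?\<kappa> * exp (- ((norm (x - t))\<^sup>2 / 2))))" for x
proof -
have "g x = (LINT y|lborel. FT f y * exp (\<i> * cplx (x \<bullet> y)) * exp (- (1\<^sup>2 * (norm y)\<^sup>2 / 2)))"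
 unfolding g_def \<phi>_def by (intro Bochner_Integration.integral_cong refl) (simp add: mult_ac)
also have "... = (LINT t|lborel. f t * cplx (?\<kappa> / 1 ^ CARD('n) * exp (- ((norm (x - t))\<^sup>2 / (2 * 1\<^sup>2)))))"
 by (rule fourier_gaussian_weighted[OF f]) simp
finally show ?thesis by simp
qed
have ci: "integrable lborel (%t. f t * cplx (?\<kappa> * exp (- ((norm (x - t))\<^sup>2 / 2))))" for x
proof (rule Bochner_Integration.integrable_bound)
show "integrable lborel (%t. cplx ?\<kappa> * f t)" by (intro integrable_mult_right f)
have "norm (f t * cplx (?\<kappa> * exp (- ((norm (x - t))\<^sup>2 / 2)))) <= norm (cplx ?\<kappa> * f t)" for t
proof -
 have "norm (f t) * (?\<kappa> * exp (- ((norm (x - t))\<^sup>2 / 2))) <= norm (f t) * (?\<kappa> * 1)"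
 using kp by (intro mult_left_mono) auto
 thus ?thesis using kp by (simp add: norm_mult mult.commute)
qed
thus "AE t in lborel. norm (f t * cplx (?\<kappa> * exp (- ((norm (x - t))\<^sup>2 / 2)))) <= norm (cplx ?\<kappa> * f t)" by (intro AE_I2)
qed measurable
have gnn: "ennreal (norm (g x)) <= ennreal ?\<kappa> * (\<integral>\<^sup>+t. ennreal (norm (f t) * exp (- ((norm (x - t))\<^sup>2 / 2))) \<partial>lborel)" for x
proof -
have "ennreal (norm (g x)) <= (\<integral>\<^sup>+t. ennreal (norm (f t * cplx (?\<kappa> * exp (- ((norm (x - t))\<^sup>2 / 2))))) \<partial>lborel)"
 unfolding conv by (rule integral_norm_bound_ennreal[OF ci])
also have "... = (\<integral>\<^sup>+t. ennreal ?\<kappa> * ennreal (norm (f t) * exp (- ((norm (x - t))\<^sup>2 / 2))) \<partial>lborel)"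
 using kp by (intro nn_integral_cong) (simp add: norm_mult ennreal_mult[symmetric] mult_ac)
also have "... = ennreal ?\<kappa> * (\<integral>\<^sup>+t. ennreal (norm (f t) * exp (- ((norm (x - t))\<^sup>2 / 2))) \<partial>lborel)"
 by (rule nn_integral_cmult) measurable
finally show ?thesis .
qed
have \<phi>i: "integrable lborel \<phi>" by (rule exp_integrable_imp_integrable[OF \<phi>])
have gb: "norm (g x) <= \<Phi>" for x
proof -
have "norm (g x) <= (LINT y|lborel. norm (\<phi> y * exp (\<i> * cplx (x \<bullet> y))))" unfolding g_def by (rule integral_norm_bound)
also have "... = (LINT y|lborel. norm (\<phi> y) * exp (0 * norm y))" by (simp add: norm_mult)
also have "... <= \<Phi>" using gr[of 0] by simp
finally show ?thesis .
qed
have Fnn: "(\<integral>\<^sup>+y. ennreal (norm (FT f y)) \<partial>lborel) <= ennreal \<Phi>"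
unfolding \<Phi>_def using F by (subst nn_integral_eq_integral) auto
have Gi: "integrable lborel (%y. norm (\<phi> y) * exp \<bar>x \<bullet> y\<bar>)" for x
using exp_integrable_abs_linear(1)[OF \<phi>, of 1 x] by simp
have Gnn: "ennreal (Gf x) = (\<integral>\<^sup>+y. ennreal (norm (FT f y) * exp (- ((norm y)\<^sup>2 / 2)) * exp \<bar>x \<bullet> y\<bar>) \<partial>lborel)" for x
unfolding Gf_def n\<phi>[symmetric] by (rule nn_integral_eq_integral[OF Gi, symmetric]) auto
have G0: "Gf x >= 0" for x unfolding Gf_def by (intro Bochner_Integration.integral_nonneg) auto
have [measurable]: "Gf \<in> borel_measurable borel" unfolding Gf_def[abs_def] by measurable
have Gsym: "Gf (- x) = Gf x" for x unfolding Gf_def by simp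
have FTm: "FT f \<in> borel_measurable borel" by measurable
have gm: "g \<in> borel_measurable borel" by measurable
obtain C' L where C': "C' >= 0" and loc: "!!R. R >= 0 ==>
(\<integral>\<^sup>+x. ennreal (norm (g x)) * (\<integral>\<^sup>+y. ennreal (norm (FT f y) * exp (- ((norm y)\<^sup>2 / 2)) * exp \<bar>x \<bullet> y\<bar>) \<partial>lborel) * indicator (cball 0 R) x \<partial>lborel) <= ennreal (C' * (1 + R) ^ L)"
by (rule local_growth_bound[OF fm FTm gm gnn gb less_imp_le[OF kp] \<Phi>0 Fnn C KK], assumption, assumption, rule that)
define H where "H x = ennreal ((norm (g x) + norm (g (- x))) * Gf x)" for x
have [measurable]: "H \<in> borel_measurable borel" unfolding H_def[abs_def] by measurable
have Hint: "(\<integral>\<^sup>+x. H x * indicator (cball 0 R) x \<partial>lborel) <= ennreal ((2 * C') * (1 + R) ^ L)" if R: "R >= 0" for R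
proof -
have [measurable]: "cball (0::real^'n) R \<in> sets borel" by simp
define I where "I x = ennreal (norm (g x)) * ennreal (Gf x) * indicator (cball 0 R) x" for x
have Im [measurable]: "I \<in> borel_measurable borel" unfolding I_def[abs_def] by measurable
have Ib: "(\<integral>\<^sup>+x. I x \<partial>lborel) <= ennreal (C' * (1 + R) ^ L)" unfolding I_def Gnn by (rule loc[OF R])
have "H x * indicator (cball 0 R) x = I x + I (0 + (- 1) *\<^sub>R x)" for x
 unfolding H_def I_def using G0[of x]
 by (auto simp: Gsym indicator_def ennreal_mult[symmetric] ennreal_plus[symmetric] distrib_right simp del: ennreal_plus)
hence "(\<integral>\<^sup>+x. H x * indicator (cball 0 R) x \<partial>lborel) = (\<integral>\<^sup>+x. I x \<partial>lborel) + (\<integral>\<^sup>+x. I (0 + (- 1) *\<^sub>R x) \<partial>lborel)"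
 by (simp add: nn_integral_add)
also have "(\<integral>\<^sup>+x. I (0 + (- 1) *\<^sub>R x) \<partial>lborel) = (\<integral>\<^sup>+x. I x \<partial>lborel)"
 using lborel_nn_integral_affine[OF Im, of "-1" 0] by simp
also have "(\<integral>\<^sup>+x. I x \<partial>lborel) + (\<integral>\<^sup>+x. I x \<partial>lborel) <= ennreal (C' * (1 + R) ^ L) + ennreal (C' * (1 + R) ^ L)"
 by (intro add_mono Ib)
also have "... = ennreal ((2 * C') * (1 + R) ^ L)"
 using C' R by (simp add: ennreal_plus[symmetric] del: ennreal_plus)
finally show ?thesis .
qed
have Hbd: "\<exists>M. \<forall>x\<in>cball 0 R. H x <= ennreal M" for R
proof (intro exI ballI)
fix x :: "real^'n" assume x: "x \<in> cball 0 R"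
have "Gf x <= (LINT y|lborel. norm (\<phi> y) * exp (norm x * norm y))"
 using exp_integrable_abs_linear(2)[OF \<phi>, of 1 x] by (simp add: Gf_def)
also have "... <= (LINT y|lborel. norm (\<phi> y) * exp (R * norm y))"
 using x by (intro integral_mono ei mult_left_mono) (auto intro: mult_right_mono)
finally have "Gf x <= (LINT y|lborel. norm (\<phi> y) * exp (R * norm y))" .
thus "H x <= ennreal ((\<Phi> + \<Phi>) * (LINT y|lborel. norm (\<phi> y) * exp (R * norm y)))"
 unfolding H_def using gb[of x] gb[of "- x"] G0[of x] \<Phi>0 by (intro ennreal_leI mult_mono add_mono) auto
qed
have C2: "2 * C' >= 0" using C' by simp
have Hm: "H \<in> borel_measurable borel" by measurable
have ray: "AE \<omega> in lborel. \<exists>C\<ge>0. \<forall>R\<ge>0. (\<integral>\<^sup>+(s::real). ennreal ((norm (g (s *\<^sub>R \<omega>)) + norm (g (- (s *\<^sub>R \<omega>)))) * Gf (s *\<^sub>R \<omega>)) * indicator {0..R} s \<partial>lborel) <= ennreal (C * (1 + R) ^ (L + 2))"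
by (rule ray_growth_bound[OF Hm C2 Hint Hbd, unfolded H_def])
have "\<exists>x0. g x0 ~= 0"
proof (rule ccontr)
assume "\<not> (\<exists>x0. g x0 ~= 0)"
hence g0: "g x = 0" for x by blast
have "AE t in lborel. f t = 0"
proof (rule gaussian_convolution_zero[OF fm])
 fix x
 have "g x = (LINT t|lborel. cplx ?\<kappa> * (f t * exp (- ((norm (x - t))\<^sup>2 / 2))))"
 unfolding conv by (intro Bochner_Integration.integral_cong refl) (simp add: mult_ac)
 also have "... = cplx ?\<kappa> * (LINT t|lborel. f t * exp (- ((norm (x - t))\<^sup>2 / 2)))" by (rule integral_mult_right_zero)
 finally show "(LINT t|lborel. f t * exp (- ((norm (x - t))\<^sup>2 / 2))) = 0" using kp g0[of x] by simp
next
 fix b :: real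
 have i: "integrable lborel (%t. exp (b\<^sup>2 / 2) * norm (f t))" by (intro integrable_mult_right integrable_norm f)
 show "integrable lborel (%t. norm (f t) * exp (b * norm t - (norm t)\<^sup>2 / 2))"
 proof (rule Bochner_Integration.integrable_bound[OF i])
 have "norm (norm (f t) * exp (b * norm t - (norm t)\<^sup>2 / 2)) <= norm (exp (b\<^sup>2 / 2) * norm (f t))" for t
 proof -
 have "b * norm t - (norm t)\<^sup>2 / 2 <= b\<^sup>2 / 2" using sum_squares_bound[of b "norm t"] by simp
 hence "norm (f t) * exp (b * norm t - (norm t)\<^sup>2 / 2) <= norm (f t) * exp (b\<^sup>2 / 2)" by (intro mult_left_mono) auto
 thus ?thesis by (simp add: mult.commute)
 qed
 thus "AE t in lborel. norm (norm (f t) * exp (b * norm t - (norm t)\<^sup>2 / 2)) <= norm (exp (b\<^sup>2 / 2) * norm (f t))" by (intro AE_I2)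
 qed measurable
qed
thus False using nz by blast
qed
then obtain x0 where x0: "g x0 ~= 0" by blast
obtain A P where A: "transpose A = A" and gP: "!!x. g x = pgauss P A x"
by (rule gaussian_rigidity[OF \<phi> gr g_def Gf_def ray x0], rule that)
have gi: "integrable lborel g"
proof -
have "(\<integral>\<^sup>+x. ennreal (norm (g x)) \<partial>lborel) <= (\<integral>\<^sup>+x. ennreal ?\<kappa> * (\<integral>\<^sup>+t. ennreal (norm (f t) * exp (- ((norm (x - t))\<^sup>2 / 2))) \<partial>lborel) \<partial>lborel)"
 by (intro nn_integral_mono gnn)
also have "... = ennreal ?\<kappa> * (\<integral>\<^sup>+x. (\<integral>\<^sup>+t. ennreal (norm (f t) * exp (- ((norm (x - t))\<^sup>2 / 2))) \<partial>lborel) \<partial>lborel)"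
 by (rule nn_integral_cmult) measurable
also have "(\<integral>\<^sup>+x. (\<integral>\<^sup>+t. ennreal (norm (f t) * exp (- ((norm (x - t))\<^sup>2 / 2))) \<partial>lborel) \<partial>lborel)
 = (\<integral>\<^sup>+t. (\<integral>\<^sup>+x. ennreal (norm (f t) * exp (- ((norm (x - t))\<^sup>2 / 2))) \<partial>lborel) \<partial>lborel)"
 by (rule lborel_pair.Fubini') measurable
also have "... = (\<integral>\<^sup>+t. ennreal (norm (f t)) * ennreal ?\<kappa> \<partial>lborel)"
proof (rule nn_integral_cong)
 fix t :: "real^'n"
 have "(\<integral>\<^sup>+x. ennreal (norm (f t) * exp (- ((norm (x - t))\<^sup>2 / 2))) \<partial>lborel) = (\<integral>\<^sup>+(x::real^'n). ennreal (norm (f t) * exp (- ((norm ((x + t) - t))\<^sup>2 / 2))) \<partial>lborel)"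
 by (rule lborel_nn_integral_translate[symmetric]) measurable
 also have "... = (\<integral>\<^sup>+(x::real^'n). ennreal (norm (f t)) * ennreal (exp (- ((norm x)\<^sup>2 / 2))) \<partial>lborel)"
 by (simp add: ennreal_mult)
 also have "... = ennreal (norm (f t)) * (\<integral>\<^sup>+(x::real^'n). ennreal (exp (- ((norm x)\<^sup>2 / 2))) \<partial>lborel)" by (rule nn_integral_cmult) measurable
 finally show "(\<integral>\<^sup>+x. ennreal (norm (f t) * exp (- ((norm (x - t))\<^sup>2 / 2))) \<partial>lborel) = ennreal (norm (f t)) * ennreal ?\<kappa>"
 unfolding gauss_mass_nn_integral .
qed
also have "... = (\<integral>\<^sup>+t. ennreal (norm (f t)) \<partial>lborel) * ennreal ?\<kappa>" by (rule nn_integral_multc) measurable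
also have "ennreal ?\<kappa> * ((\<integral>\<^sup>+t. ennreal (norm (f t)) \<partial>lborel) * ennreal ?\<kappa>) < \<infinity>"
 using f unfolding integrable_iff_bounded by (auto simp: ennreal_mult_less_top)
finally show ?thesis unfolding integrable_iff_bounded by simp
qed
have ge: "g = pgauss P A" using gP by (rule ext)
have Apd: "sym_pos_def A"
by (rule pgauss_positive_definite[OF A, of P \<Phi> x0]) (use gb gi x0 in \<open>simp_all add: ge\<close>)
\<comment> \<open>undo the Gaussian regularisation on the Fourier side\<close>
obtain P1 where P1: "!!x. 1 * pgauss P A (- x) = pgauss P1 A x" using pgauss_reflect_scale[of 1 P A] by blast
have "FT \<phi> x = g (- x)" for x unfolding FT_def g_def by (simp add: inner_commute)
hence FT\<phi>: "FT \<phi> x = pgauss P1 A x" for x using P1[of x] gP[of "- x"] by simp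
obtain P2 B where B: "sym_pos_def B" and \<phi>B: "AE x in lborel. \<phi> x = pgauss P2 B x"
by (rule fourier_pgauss_imp_pgauss[OF \<phi>i Apd FT\<phi>], rule that)
define B1 where "B1 = B - (1/2) *\<^sub>R mat 1"
have tB1: "transpose B1 = B1"
using B unfolding sym_pos_def_def B1_def by (simp add: vec_eq_iff transpose_def mat_def)
have qB1: "quad B1 y = quad B y - (norm y)\<^sup>2 / 2" for y
unfolding quad_def B1_def power2_norm_eq_inner
by (simp add: matrix_vector_mult_diff_rdistrib scaleR_matrix_vector_assoc[symmetric] inner_diff_left)
have FB: "AE y in lborel. FT f y = pgauss P2 B1 y"
using \<phi>B
proof eventually_elim
case (elim y)
have e: "exp (- ((norm y)\<^sup>2 / 2)) * exp ((norm y)\<^sup>2 / 2) = 1" by (simp flip: exp_add)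
have "FT f y = \<phi> y * cplx (exp ((norm y)\<^sup>2 / 2))"
 unfolding \<phi>_def mult.assoc of_real_mult[symmetric] e by simp
also have "... = cpoly_eval P2 y * cplx (exp (- quad B y) * exp ((norm y)\<^sup>2 / 2))"
 unfolding elim pgauss_def of_real_mult by (simp only: mult.assoc)
also have "exp (- quad B y) * exp ((norm y)\<^sup>2 / 2) = exp (- quad B1 y)" unfolding qB1 exp_add[symmetric] by simp
finally show ?case by (simp add: pgauss_def)
qed
have ui: "integrable lborel (pgauss P2 B1)" by (rule integrable_cong_AE_imp[OF F _ FB]) simp
have ub: "norm (pgauss P2 B1 x) <= (LINT x|lborel. norm (f x))" for x
proof -
have "AE y in lborel. pgauss P2 B1 y \<in> cball 0 (LINT x|lborel. norm (f x))"
 using FB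
proof eventually_elim
 case (elim y)
 show ?case using FT_bound[of f y] unfolding elim by simp
qed
hence "pgauss P2 B1 x \<in> cball 0 (LINT x|lborel. norm (f x))" by (rule continuous_AE_closed) (auto intro: pgauss_continuous)
thus ?thesis by simp
qed
have "\<exists>x1. pgauss P2 B1 x1 ~= 0"
proof (rule ccontr)
assume "\<not> (\<exists>x1. pgauss P2 B1 x1 ~= 0)"
hence z: "pgauss P2 B1 y = 0" for y by blast
have "AE y in lborel. \<phi> y * exp (\<i> * cplx (x0 \<bullet> y)) = 0"
 using FB
proof eventually_elim
 case (elim y)
 show ?case unfolding \<phi>_def elim z by simp
qed
hence "g x0 = 0" unfolding g_def by (rule integral_eq_zero_AE)
thus False using x0 by simp
qed
then obtain x1 where x1: "pgauss P2 B1 x1 ~= 0" by blast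
have B1pd: "sym_pos_def B1" by (rule pgauss_positive_definite[OF tB1 ub ui x1])
have FTF: "FT (FT f) x = FT (pgauss P2 B1) x" for x by (rule FT_cong_AE[OF FB]) measurable
obtain M where M: "deg_le P2 M" using deg_le_exists by blast
obtain P3 A3 where A3: "sym_pos_def A3" "!!y. FT (pgauss P2 B1) y = pgauss P3 A3 y"
by (rule FT_pgauss_is_pgauss[OF B1pd M], rule that)
let ?k = "cplx ((gauss_mass TYPE('n))\<^sup>2)"
have k: "?k ~= 0" using kp by simp
obtain P4 where P4: "!!x. (1 / ?k) * pgauss P3 A3 (- x) = pgauss P4 A3 x"
using pgauss_reflect_scale[of "1 / ?k" P3 A3] by blast
have "AE x in lborel. f x = pgauss P4 A3 x"
using fourier_inversion[OF f F] unfolding FTF A3(2) P4[symmetric]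

proof eventually_elim
case (elim x)
show ?case using k by (simp flip: elim)
qed
with A3(1) show ?thesis by (rule that)
qed

lemma cpoly_degree_le_iff: "cpoly_degree P <= ereal (real d) \<longleftrightarrow> deg_le P d"
unfolding cpoly_degree_def deg_le_def expo_degree_def SUP_le_iff ereal_less_eq of_nat_le_iff by (rule refl)

lemma cpoly_degree_zero: "cpoly_degree 0 = - \<infinity>"
by (simp add: cpoly_degree_def bot_ereal_def)

lemma cpoly_degree_attained:
assumes "P ~= 0"
obtains m where "m \<in> Poly_Mapping.keys P" "deg_le P (expo_degree m)" "cpoly_degree P = ereal (real (expo_degree m))"
proof -
have ne: "Poly_Mapping.keys P ~= {}" using assms by simp
have "Max (expo_degree ` Poly_Mapping.keys P) \<in> expo_degree ` Poly_Mapping.keys P" using ne by (intro Max_in) auto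
then obtain m where m: "m \<in> Poly_Mapping.keys P" "expo_degree m = Max (expo_degree ` Poly_Mapping.keys P)" by force
have d: "deg_le P (expo_degree m)" unfolding deg_le_def m(2) by (intro ballI Max_ge) auto
have "ereal (real (expo_degree m)) <= cpoly_degree P"
unfolding cpoly_degree_def expo_degree_def by (rule SUP_upper[OF m(1)])
moreover have "cpoly_degree P <= ereal (real (expo_degree m))" using d by (simp only: cpoly_degree_le_iff)
ultimately have "cpoly_degree P = ereal (real (expo_degree m))" by (intro antisym)
with m(1) d show ?thesis by (rule that)
qed

definition gauss_matrix :: "real ^ 'n ^ 'n::finite" where
"gauss_matrix = (1/2) *\<^sub>R mat 1"

lemma quad_gauss_matrix: "quad gauss_matrix x = (1/2) * (norm x)\<^sup>2"
unfolding quad_def gauss_matrix_def power2_norm_eq_inner by (simp add: scaleR_matrix_vector_assoc[symmetric])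

lemma scaled_identity_sym: "transpose (c *\<^sub>R mat 1 :: real ^ 'n ^ 'n::finite) = c *\<^sub>R mat 1"
unfolding vec_eq_iff transpose_def mat_def by auto

lemma sym_pos_def_gauss_matrix: "sym_pos_def gauss_matrix"
proof -
have "(gauss_matrix *v x) \<bullet> x > 0" if "x ~= 0" for x :: "real^'n"
proof -
have "(norm x)\<^sup>2 > 0" using that by simp
hence "quad gauss_matrix x > 0" unfolding quad_gauss_matrix by linarith
thus ?thesis unfolding quad_def .
qed
moreover have "transpose gauss_matrix = gauss_matrix" unfolding gauss_matrix_def by (rule scaled_identity_sym)
ultimately show ?thesis unfolding sym_pos_def_def by blast
qed

lemma pgauss_gauss_matrix: "(%x. cpoly_eval Q x * gaussian x) = pgauss Q gauss_matrix"
by (rule ext) (simp add: pgauss_def gaussian_def quad_gauss_matrix)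

lemma K_pgauss:
assumes "sym_pos_def A" "AE x in lborel. f x = pgauss P A x"
shows "K a f = KK a (pgauss P A) (%y. fourier_const TYPE('n) * FT (pgauss P A) (y :: real ^ 'n::finite))"
by (rule K_eq_KK_FT(1)[OF pgauss_measurable pgauss_integrable[OF assms(1)] assms(2)])

lemma KK_zero_left: "KK a (pgauss 0 A) g = 0"
by (simp add: KK_def pgauss_def cpoly_eval_def)

lemma KK_scale:
fixes f g :: "real ^ 'n::finite => complex"
assumes [measurable]: "f \<in> borel_measurable borel" "g \<in> borel_measurable borel"
shows "KK a f (%y. c * g y) = ennreal (norm c) * KK a f g"
proof -
have "KK a f (%y. c * g y) = (\<integral>\<^sup>+(x::real^'n). (\<integral>\<^sup>+(y::real^'n). ennreal (norm c) * ennreal (norm (f x) * norm (g y) * exp (a * \<bar>x \<bullet> y\<bar>)) \<partial>lborel) \<partial>lborel)"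
unfolding KK_def by (intro nn_integral_cong) (simp add: norm_mult ennreal_mult[symmetric] mult_ac)
also have "... = (\<integral>\<^sup>+(x::real^'n). ennreal (norm c) * (\<integral>\<^sup>+(y::real^'n). ennreal (norm (f x) * norm (g y) * exp (a * \<bar>x \<bullet> y\<bar>)) \<partial>lborel) \<partial>lborel)"
by (intro nn_integral_cong nn_integral_cmult) measurable
also have "... = ennreal (norm c) * KK a f g"
unfolding KK_def by (rule nn_integral_cmult) measurable
finally show ?thesis .
qed

lemma KK_ge_product:
fixes f g :: "real ^ 'n::finite => complex"
assumes [measurable]: "f \<in> borel_measurable borel" "g \<in> borel_measurable borel" and a: "a >= 0"
shows "(\<integral>\<^sup>+x. ennreal (norm (f x)) \<partial>lborel) * (\<integral>\<^sup>+y. ennreal (norm (g y)) \<partial>lborel) <= KK a f g"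
proof -
have "(\<integral>\<^sup>+x. ennreal (norm (f x)) \<partial>lborel) * (\<integral>\<^sup>+y. ennreal (norm (g y)) \<partial>lborel)
= (\<integral>\<^sup>+(x::real^'n). ennreal (norm (f x)) * (\<integral>\<^sup>+(y::real^'n). ennreal (norm (g y)) \<partial>lborel) \<partial>lborel)"
by (rule nn_integral_multc[symmetric]) measurable
also have "... = (\<integral>\<^sup>+(x::real^'n). (\<integral>\<^sup>+(y::real^'n). ennreal (norm (f x)) * ennreal (norm (g y)) \<partial>lborel) \<partial>lborel)"
by (intro nn_integral_cong nn_integral_cmult[symmetric]) measurable
also have "... <= KK a f g"
unfolding KK_def
proof (intro nn_integral_mono)
fix x y :: "real^'n"
have "norm (f x) * norm (g y) * 1 <= norm (f x) * norm (g y) * exp (a * \<bar>x \<bullet> y\<bar>)"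
 using a by (intro mult_left_mono) auto
thus "ennreal (norm (f x)) * ennreal (norm (g y)) <= ennreal (norm (f x) * norm (g y) * exp (a * \<bar>x \<bullet> y\<bar>))"
 by (simp add: ennreal_mult[symmetric] ennreal_leI)
qed
finally show ?thesis .
qed

lemma blowup_surj:
assumes "s > 1" shows "0 < 1 - 1 / s\<^sup>2" "1 - 1 / s\<^sup>2 < 1" "blowup (1 - 1 / s\<^sup>2) = s"
proof -
have "s\<^sup>2 > 1" using assms by (simp add: one_less_power)
hence "1 / s\<^sup>2 < 1" by (subst divide_less_eq_1_pos) linarith+
thus "0 < 1 - 1 / s\<^sup>2" by simp
show "1 - 1 / s\<^sup>2 < 1" using assms by simp
show "blowup (1 - 1 / s\<^sup>2) = s" using assms by (simp add: blowup_def real_sqrt_divide)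
qed

text \<open>The scale is unbounded as \<open>a\<close> tends to 1.\<close>
lemma blowup_exponent_comparison:
assumes c: "c > 0" and le: "!!a. 0 < a ==> a < 1 ==> c * blowup a ^ p <= C * blowup a ^ q"
shows "p <= q"
proof (rule ccontr)
assume "\<not> p <= q"
then obtain k where k: "p = q + Suc k" using less_imp_Suc_add[of q p] by auto
define s where "s = max 2 (C / c + 1)"
have s: "s >= 2" "s >= C / c + 1" by (simp_all add: s_def)
have s1: "s > 1" using s(1) by linarith
have "c * s ^ p <= C * s ^ q" using le[OF blowup_surj(1,2)[OF s1]] unfolding blowup_surj(3)[OF s1] .
hence "(c * s ^ Suc k) * s ^ q <= C * s ^ q" by (simp only: k power_add mult_ac)
hence 1: "c * s ^ Suc k <= C" by (rule mult_right_le_imp_le) (use s1 in simp)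
have "c * (s * 1) <= c * (s * s ^ k)" using c s1 by (intro mult_left_mono one_le_power) auto
hence "c * s <= C" using 1 by simp
moreover have "c * (C / c + 1) <= c * s" using c s(2) by (intro mult_left_mono) auto
moreover have "c * (C / c + 1) = C + c" using c by (simp add: distrib_left)
ultimately show False using c by linarith
qed

lemma K_zero_imp_zero:
fixes f f0 g0 :: "real ^ 'n::finite => complex"
assumes f: "in_L2 f" and f0: "f0 \<in> borel_measurable borel" "AE x in lborel. f x = f0 x"
and g0: "g0 \<in> borel_measurable borel" "AE y in lborel. fourier_L2 f y = g0 y"
and z: "(\<integral>\<^sup>+x. ennreal (norm (f0 x)) \<partial>lborel) = 0 \<or> (\<integral>\<^sup>+y. ennreal (norm (g0 y)) \<partial>lborel) = 0"
shows "AE x in lborel. f x = 0"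
using z
proof
assume "(\<integral>\<^sup>+x. ennreal (norm (f0 x)) \<partial>lborel) = 0"
hence "AE x in lborel. f0 x = 0" using f0(1) by (subst (asm) nn_integral_0_iff_AE) auto
with f0(2) show ?thesis by eventually_elim simp
next
assume "(\<integral>\<^sup>+y. ennreal (norm (g0 y)) \<partial>lborel) = 0"
hence "AE y in lborel. g0 y = 0" using g0(1) by (subst (asm) nn_integral_0_iff_AE) auto
with g0(2) have "AE y in lborel. fourier_L2 f y = 0" by eventually_elim simp
thus ?thesis by (rule fourier_L2_zero_imp_zero[OF f])
qed

text \<open>Finiteness at a single \<open>a\<close> already forces the function and its transform to be integrable, because the exponential factor is at least 1.\<close>
lemma K_bound_imp_pgauss:
fixes f :: "real ^ 'n::finite => complex"
assumes f: "in_L2 f" and nz: "\<not> (AE x in lborel. f x = 0)"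
and C: "C >= 0" and bd: "!!a. 0 < a ==> a < 1 ==> K a f <= ennreal (C * blowup a ^ N)"
obtains P A where "sym_pos_def A" "AE x in lborel. f x = pgauss P A x"
proof -
have fl: "f \<in> borel_measurable lebesgue" using f by (simp add: in_L2_def)
obtain f0 where f0: "f0 \<in> borel_measurable borel" "AE x in lborel. f x = f0 x"
by (rule lebesgue_borel_representative[OF fl], rule that)
have gl: "fourier_L2 f \<in> borel_measurable lebesgue"
using is_fourier_fourier_L2[OF f] by (simp add: is_fourier_L2_def in_L2_def)
obtain g0 where g0: "g0 \<in> borel_measurable borel" "AE y in lborel. fourier_L2 f y = g0 y"
by (rule lebesgue_borel_representative[OF gl], rule that)
let ?I = "\<integral>\<^sup>+x. ennreal (norm (f0 x)) \<partial>lborel" and ?J = "\<integral>\<^sup>+y. ennreal (norm (g0 y)) \<partial>lborel"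
have IJ: "?I ~= 0" "?J ~= 0" using K_zero_imp_zero[OF f f0 g0] nz by blast+
have "?I * ?J <= KK (1/2) f0 g0" by (rule KK_ge_product[OF f0(1) g0(1)]) simp
also have "... = K (1/2) f" by (rule K_eq_KK[OF f0(2) g0(2), symmetric])
also have "... <= ennreal (C * blowup (1/2) ^ N)" by (rule bd) simp_all
also have "... < \<infinity>" by simp
finally have "?I * ?J < \<infinity>" .
hence fin: "?I < \<infinity>" "?J < \<infinity>" using IJ by (auto simp: ennreal_mult_less_top)
have fi: "integrable lborel f0" unfolding integrable_iff_bounded using f0(1) fin(1) by simp
have gi: "integrable lborel g0" unfolding integrable_iff_bounded using g0(1) fin(2) by simp
have f2: "(\<integral>\<^sup>+x. ennreal ((norm (f0 x))\<^sup>2) \<partial>lborel) < \<infinity>" using f unfolding in_L2_iff[OF f0] .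
let ?c = "fourier_const TYPE('n)"
note KF = K_eq_KK_FT[OF f0(1) fi f2 f0(2)]
have FTm: "FT f0 \<in> borel_measurable borel" by (rule FT_measurable[OF f0(1)])
have "AE y in lborel. (1 / ?c) * g0 y = FT f0 y"
using KF(2) g0(2) by eventually_elim simp
note ae = this
have "integrable lborel (%y. (1 / ?c) * g0 y)" by (rule integrable_mult_right[OF gi])
hence Fi: "integrable lborel (FT f0)" by (rule integrable_cong_AE_imp[OF _ _ ae]) (use FTm in simp)
have nz0: "\<not> (AE x in lborel. f0 x = 0)"
proof
assume "AE x in lborel. f0 x = 0"
with f0(2) have "AE x in lborel. f x = 0" by eventually_elim simp
thus False using nz by blast
qed
define C1 where "C1 = C / norm ?c"
have cp: "norm ?c > 0" by simp
have C1: "C1 >= 0" using C by (simp add: C1_def)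
have KKb: "KK a f0 (FT f0) <= ennreal (C1 * blowup a ^ N)" if a: "0 < a" "a < 1" for a
proof -
have "ennreal (1 / norm ?c) * K a f = (ennreal (1 / norm ?c) * ennreal (norm ?c)) * KK a f0 (FT f0)"
 unfolding KF(1) KK_scale[OF f0(1) FTm] by (simp only: mult.assoc)
also have "ennreal (1 / norm ?c) * ennreal (norm ?c) = 1"
 using cp by (subst ennreal_mult[symmetric]) auto
finally have "KK a f0 (FT f0) = ennreal (1 / norm ?c) * K a f" by simp
also have "... <= ennreal (1 / norm ?c) * ennreal (C * blowup a ^ N)" by (intro mult_left_mono bd a) simp
also have "... = ennreal (C1 * blowup a ^ N)"
 using blowup_props(1)[OF a] C by (subst ennreal_mult[symmetric]) (auto simp: C1_def)
finally show ?thesis .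
qed
obtain P A where A: "sym_pos_def A" and P: "AE x in lborel. f0 x = pgauss P A x"
by (rule KK_bound_imp_pgauss[OF fi Fi nz0 C1 KKb], assumption, assumption, rule that)
from f0(2) P have "AE x in lborel. f x = pgauss P A x" by eventually_elim simp
with A show ?thesis by (rule that)
qed

theorem theorem2p1:
  fixes f :: "real ^ 'n::finite \<Rightarrow> complex"
    and Q :: "'n cpoly"
  assumes "in_L2 f"
  shows "(\<exists>C::real. C > 0 \<and>
            (\<forall>a::real. 0 < a \<and> a < 1 \<longrightarrow>
               K a f \<le> ennreal C * K a (\<lambda>x. cpoly_eval Q x * gaussian x)))
     \<longleftrightarrow> (\<exists>(A :: real ^ 'n ^ 'n) (P :: 'n cpoly).
            sym_pos_def A \<and> cpoly_degree P \<le> cpoly_degree Q \<and>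
            (AE x in lebesgue.
               f x = cpoly_eval P x * complex_of_real (exp (- ((A *v x) \<bullet> x)))))"
proof -
let ?c = "fourier_const TYPE('n)"
let ?R = "%(A :: real^'n^'n) P. sym_pos_def A \<and> cpoly_degree P <= cpoly_degree Q \<and> (AE x in lborel. f x = pgauss P A x)"
have KQ: "K a (%x. cpoly_eval Q x * gaussian x) = KK a (pgauss Q gauss_matrix) (%y. ?c * FT (pgauss Q gauss_matrix) y)" for a
unfolding pgauss_gauss_matrix by (rule K_pgauss[OF sym_pos_def_gauss_matrix]) simp
have zero_form: "?R gauss_matrix 0" if "AE x in lborel. f x = 0"
using that sym_pos_def_gauss_matrix by (simp add: cpoly_degree_zero pgauss_def cpoly_eval_def)
have "(\<exists>C::real. C > 0 \<and> (\<forall>a::real. 0 < a \<and> a < 1 --> K a f <= ennreal C * K a (%x. cpoly_eval Q x * gaussian x))) \<longleftrightarrow> (\<exists>A P. ?R A P)"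
proof
assume "\<exists>C::real. C > 0 \<and> (\<forall>a::real. 0 < a \<and> a < 1 --> K a f <= ennreal C * K a (%x. cpoly_eval Q x * gaussian x))"
then obtain C where C: "C > 0" and le: "\<And>a. 0 < a ==> a < 1 ==> K a f <= ennreal C * K a (%x. cpoly_eval Q x * gaussian x)" by blast
show "\<exists>A P. ?R A P"
proof (cases "AE x in lborel. f x = 0")
 case True
 thus ?thesis using zero_form by blast
next
 case nz: False
 obtain M where M: "deg_le Q M" "Q ~= 0 ==> cpoly_degree Q = ereal (real M)"
 proof (cases "Q = 0")
 case True
 thus ?thesis using that[of 0] by (simp add: deg_le_def)
 next
 case False
 obtain m where "m \<in> Poly_Mapping.keys Q" "deg_le Q (expo_degree m)" "cpoly_degree Q = ereal (real (expo_degree m))"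
 by (rule cpoly_degree_attained[OF False], rule that)
 thus ?thesis using that by blast
 qed
 obtain C1 where C1: "C1 > 0" "\<And>a. 0 < a ==> a < 1 ==>
 KK a (pgauss Q gauss_matrix) (%y. ?c * FT (pgauss Q gauss_matrix) y) <= ennreal (C1 * blowup a ^ (CARD('n) + 2 * M))"
 by (rule KK_pgauss_upper[OF sym_pos_def_gauss_matrix M(1)], rule that)
 have up: "K a f <= ennreal ((C * C1) * blowup a ^ (CARD('n) + 2 * M))" if a: "0 < a" "a < 1" for a
 proof -
 have "K a f <= ennreal C * KK a (pgauss Q gauss_matrix) (%y. ?c * FT (pgauss Q gauss_matrix) y)"
 using le[OF a] unfolding KQ .
 also have "\<dots> <= ennreal C * ennreal (C1 * blowup a ^ (CARD('n) + 2 * M))"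
 by (rule mult_left_mono[OF C1(2)[OF a]]) simp
 also have "\<dots> = ennreal ((C * C1) * blowup a ^ (CARD('n) + 2 * M))"
 using C C1(1) blowup_props(1)[OF a] by (subst ennreal_mult[symmetric]) (auto simp: mult.assoc)
 finally show ?thesis .
 qed
 have CC: "C * C1 >= 0" using C C1(1) by simp
 obtain P A where A: "sym_pos_def A" and P: "AE x in lborel. f x = pgauss P A x"
 by (rule K_bound_imp_pgauss[OF assms nz CC up], assumption, assumption, rule that)
 have Pnz: "P ~= 0"
 proof
 assume "P = 0"
 hence "AE x in lborel. f x = 0" using P by (simp add: pgauss_def cpoly_eval_def)
 thus False using nz by blast
 qed
 have Qnz: "Q ~= 0"
 proof
 assume "Q = 0"
 hence "K (1/2) f = 0" using le[of "1/2"] unfolding KQ by (simp add: KK_zero_left)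
 obtain m where m: "m \<in> Poly_Mapping.keys P" "deg_le P (expo_degree m)" by (rule cpoly_degree_attained[OF Pnz], rule that)
 obtain c where c: "c > 0" "\<And>a. 0 < a ==> a < 1 ==>
  ennreal (c * blowup a ^ (CARD('n) + 2 * expo_degree m)) <= KK a (pgauss P A) (%y. ?c * FT (pgauss P A) y)"
 by (rule KK_pgauss_lower[OF A m(2,1) refl, of ?c], simp, rule that)
 have "ennreal (c * blowup (1/2) ^ (CARD('n) + 2 * expo_degree m)) <= 0"
 using c(2)[of "1/2"] \<open>K (1/2) f = 0\<close> unfolding K_pgauss[OF A P] by simp
 hence "c * blowup (1/2) ^ (CARD('n) + 2 * expo_degree m) <= 0" by (simp add: ennreal_eq_0_iff)
 moreover have "blowup (1/2) >= 1" by (rule blowup_props) simp_all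
 hence "c * blowup (1/2) ^ (CARD('n) + 2 * expo_degree m) > 0" using c(1) by (intro mult_pos_pos zero_less_power) auto
 ultimately show False by linarith
 qed
 obtain m where m: "m \<in> Poly_Mapping.keys P" "deg_le P (expo_degree m)" "cpoly_degree P = ereal (real (expo_degree m))"
 by (rule cpoly_degree_attained[OF Pnz], rule that)
 obtain c where c: "c > 0" "\<And>a. 0 < a ==> a < 1 ==>
 ennreal (c * blowup a ^ (CARD('n) + 2 * expo_degree m)) <= KK a (pgauss P A) (%y. ?c * FT (pgauss P A) y)"
 by (rule KK_pgauss_lower[OF A m(2,1) refl, of ?c], simp, rule that)
 have "CARD('n) + 2 * expo_degree m <= CARD('n) + 2 * M"
 proof (rule blowup_exponent_comparison[OF c(1)])
 fix a :: real assume a: "0 < a" "a < 1"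
 have "ennreal (c * blowup a ^ (CARD('n) + 2 * expo_degree m)) <= ennreal ((C * C1) * blowup a ^ (CARD('n) + 2 * M))"
 by (rule order_trans[OF c(2)[OF a] up[OF a, unfolded K_pgauss[OF A P]]])
 thus "c * blowup a ^ (CARD('n) + 2 * expo_degree m) <= (C * C1) * blowup a ^ (CARD('n) + 2 * M)"
 using blowup_props(1)[OF a] CC by (subst (asm) ennreal_le_iff) auto
 qed
 hence "cpoly_degree P <= cpoly_degree Q" unfolding m(3) M(2)[OF Qnz] by simp
 thus ?thesis using A P by blast
qed
next
assume "\<exists>A P. ?R A P"
then obtain A P where A: "sym_pos_def A" and deg: "cpoly_degree P <= cpoly_degree Q" and P: "AE x in lborel. f x = pgauss P A x" by blast
show "\<exists>C::real. C > 0 \<and> (\<forall>a::real. 0 < a \<and> a < 1 --> K a f <= ennreal C * K a (%x. cpoly_eval Q x * gaussian x))"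
proof (cases "P = 0")
 case True
 hence "K a f = 0" for a unfolding K_pgauss[OF A P] by (simp add: KK_zero_left)
 thus ?thesis by (intro exI[of _ 1]) simp
next
 case False
 have Qnz: "Q ~= 0"
 proof
 assume "Q = 0"
 obtain m where "m \<in> Poly_Mapping.keys P" "deg_le P (expo_degree m)" "cpoly_degree P = ereal (real (expo_degree m))"
 by (rule cpoly_degree_attained[OF False], rule that)
 thus False using deg \<open>Q = 0\<close> by (simp add: cpoly_degree_zero)
 qed
 obtain m where m: "m \<in> Poly_Mapping.keys Q" "deg_le Q (expo_degree m)" "cpoly_degree Q = ereal (real (expo_degree m))"
 by (rule cpoly_degree_attained[OF Qnz], rule that)
 let ?N = "CARD('n) + 2 * expo_degree m"
 have dP: "deg_le P (expo_degree m)" using deg unfolding m(3) cpoly_degree_le_iff .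
 obtain C1 where C1: "C1 > 0" "\<And>a. 0 < a ==> a < 1 ==> KK a (pgauss P A) (%y. ?c * FT (pgauss P A) y) <= ennreal (C1 * blowup a ^ ?N)"
 by (rule KK_pgauss_upper[OF A dP], rule that)
 obtain c where c: "c > 0" "\<And>a. 0 < a ==> a < 1 ==>
 ennreal (c * blowup a ^ ?N) <= KK a (pgauss Q gauss_matrix) (%y. ?c * FT (pgauss Q gauss_matrix) y)"
 by (rule KK_pgauss_lower[OF sym_pos_def_gauss_matrix m(2,1) refl, of ?c], simp, rule that)
 have "K a f <= ennreal (C1 / c) * K a (%x. cpoly_eval Q x * gaussian x)" if a: "0 < a" "a < 1" for a
 proof -
 have "K a f <= ennreal (C1 * blowup a ^ ?N)" unfolding K_pgauss[OF A P] by (rule C1(2)[OF a])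
 also have "C1 * blowup a ^ ?N = (C1 / c) * (c * blowup a ^ ?N)" using c(1) by simp
 also have "ennreal \<dots> = ennreal (C1 / c) * ennreal (c * blowup a ^ ?N)"
 using c(1) C1(1) blowup_props(1)[OF a] by (intro ennreal_mult) auto
 also have "\<dots> <= ennreal (C1 / c) * K a (%x. cpoly_eval Q x * gaussian x)"
 unfolding KQ by (intro mult_left_mono c(2) a) simp
 finally show ?thesis .
 qed
 moreover have "C1 / c > 0" using C1(1) c(1) by simp
 ultimately show ?thesis by blast
qed
qed
thus ?thesis unfolding AE_lebesgue_iff pgauss_def quad_def .
qed

end
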